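(* Let $F$ be a field of characteristic $0$, let $H$ be an associative algebra with $1$ over $F$, and let $A$ be a finite dimensional $H$-simple (not necessarily associative) algebra over $F$ with a generalized $H$-action, $\dim A = s$. Let $$d(A) := \limsup_{n\to\infty}\ \max_{\substack{\lambda \vdash n,\\ m(A,H,\lambda)\ne 0}} \Phi\left(\frac{\lambda_1}{n},\dots,\frac{\lambda_s}{n}\right).$$ Then the limit $\mathrm{PIexp}^{H}(A) := \lim_{n\to\infty}\sqrt[n]{c_n^H(A)}$ exists and equals $d(A)$.
   Context: Algebras are not necessarily associative unless stated otherwise. Let $F$ be a field and $H$ an associative $F$-algebra with $1$. An algebra $A$ over $F$ is an algebra with a generalized $H$-action if $A$ is a left $H$-module and for every $h\in H$ there exist $k\in\mathbb N$ and $h'_i,h''_i,h'''_i,h''''_i\in H$ ($1\le i\le k$) such that $h(ab)=\sum_{i=1}^k\bigl((h'_i a)(h''_i b)+(h'''_i b)(h''''_i a)\bigr)$ for all $a,b\in A$. Such an $A$ is $H$-simple if $A^2\neq 0$ and $A$ has no two-sided ideals that are $H$-submodules other than $0$ and $A$. $H$-polynomials: let $X=\{x_1,x_2,\dots\}$ and let $F\{X\}=\bigoplus_{n\ge1}F\{X\}^{(n)}$ be the absolutely free non-associative $F$-algebra on $X$, graded by total degree. Put $F\{X|H\}:=\bigoplus_{n\ge 1}H^{\otimes n}\otimes F\{X\}^{(n)}$ with multiplication $(u_1\otimes w_1)(u_2\otimes w_2):=(u_1\otimes u_2)\otimes w_1w_2$. Write $x_{i_1}^{h_1}\cdots x_{i_n}^{h_n}:=(h_1\otimes\cdots\otimes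 h_n)\otimes x_{i_1}\cdots x_{i_n}$ (same bracket arrangement) and identify $x_i$ with $x_i^{1_H}$. Every map $\psi\colon X\to A$ extends uniquely to an algebra homomorphism $\bar\psi\colon F\{X|H\}\to A$ with $\bar\psi(x_i^h)=h\psi(x_i)$; $f\in F\{X|H\}$ is a polynomial $H$-identity of $A$ if $\bar\psi(f)=0$ for all $\psi$. The ideal of polynomial $H$-identities is $\mathrm{Id}^H(A)$. Let $W_n^H$ be the span of all $x_{\sigma(1)}^{h_1}\cdots x_{\sigma(n)}^{h_n}$ with $h_i\in H$, $\sigma\in S_n$ and all arrangements of brackets. The $n$th $H$-codimension is $c_n^H(A):=\dim\frac{W_n^H}{W_n^H\cap \mathrm{Id}^H(A)}$. The group $S_n$ acts on this quotient by permuting the variables $x_1,\dots,x_n$, and (in characteristic $0$) $m(A,H,\lambda)$ denotes the multiplicity in it of the irreducible $FS_n$-module $M(\lambda)$ corresponding to the partition $\lambda\vdash n$. For a partition $\lambda=(\lambda_1,\lambda_2,\dots)$ put $\lambda_i=0$ for $i$ greater than the number of rows. $\Phi(x_1,\dots,x_s):=\dfrac{1}{x_1^{x_1}\cdots x_s^{x_s}}$ for $x_1,\dots,x_s\ge 0$, with the convention $0^0=1$. *)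

theory Defs
  imports
    Complex_Main
    "HOL-Library.Extended_Real"
    "HOL-Library.Poly_Mapping"
    "HOL-Combinatorics.Permutations"
    "HOL-Algebra.QuotRing"
    "Jordan_Normal_Form.VS_Connect"
begin

section \<open>Algebras with a generalized action\<close>

text \<open>
  The field \<open>F\<close>, the algebra \<open>H\<close> and the algebra \<open>A\<close> are types; the scalar multiplications, the
  multiplication of \<open>A\<close> and the action of \<open>H\<close> are explicit operations. The spaces built from them
  (\<open>H\<close>-polynomials, their subspaces and quotients, group algebras) have carrier sets and are
  records of type \<^type>\<open>module\<close> over the field \<^term>\<open>class_ring\<close> of all elements of \<open>F\<close>.
\<close>

locale unital_algebra = vector_space scaleH
  for scaleH :: "'f::field \<Rightarrow> 'h::ring_1 \<Rightarrow> 'h" +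
  assumes scale_mult_left: "scaleH c x * y = scaleH c (x * y)"
    and scale_mult_right: "x * scaleH c y = scaleH c (x * y)"

locale nonassoc_algebra = vector_space scaleA
  for scaleA :: "'f::field \<Rightarrow> 'a::ab_group_add \<Rightarrow> 'a" +
  fixes mulA :: "'a \<Rightarrow> 'a \<Rightarrow> 'a"
  assumes mulA_add_left: "mulA (a + b) c = mulA a c + mulA b c"
    and mulA_add_right: "mulA a (b + c) = mulA a b + mulA a c"
    and mulA_scale_left: "mulA (scaleA r a) b = scaleA r (mulA a b)"
    and mulA_scale_right: "mulA a (scaleA r b) = scaleA r (mulA a b)"

locale generalized_H_action =
  H: unital_algebra scaleH + A: nonassoc_algebra scaleA mulA
  for scaleH :: "'f::field \<Rightarrow> 'h::ring_1 \<Rightarrow> 'h"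
    and scaleA :: "'f \<Rightarrow> 'a::ab_group_add \<Rightarrow> 'a"
    and mulA :: "'a \<Rightarrow> 'a \<Rightarrow> 'a" +
  fixes act :: "'h \<Rightarrow> 'a \<Rightarrow> 'a"
  assumes act_one: "act 1 a = a"
    and act_mult: "act (g * h) a = act g (act h a)"
    and act_add_left: "act (g + h) a = act g a + act h a"
    and act_add_right: "act h (a + b) = act h a + act h b"
    and act_scale_left: "act (scaleH r h) a = scaleA r (act h a)"
    and act_scale_right: "act h (scaleA r a) = scaleA r (act h a)"
    and act_mulA: "\<exists>(k::nat) h1 h2 h3 h4. \<forall>a b. act h (mulA a b) =
      (\<Sum>i=1..k. mulA (act (h1 i) a) (act (h2 i) b) + mulA (act (h3 i) b) (act (h4 i) a))"

definition H_ideal ::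
    "('f::field \<Rightarrow> 'a::ab_group_add \<Rightarrow> 'a) \<Rightarrow> ('a \<Rightarrow> 'a \<Rightarrow> 'a) \<Rightarrow> ('h \<Rightarrow> 'a \<Rightarrow> 'a) \<Rightarrow> 'a set \<Rightarrow> bool"
  where "H_ideal scaleA mulA act I \<longleftrightarrow>
    Modules.module.subspace scaleA I \<and>
    (\<forall>a. \<forall>b\<in>I. mulA a b \<in> I \<and> mulA b a \<in> I) \<and>
    (\<forall>h. \<forall>b\<in>I. act h b \<in> I)"

definition H_simple ::
    "('f::field \<Rightarrow> 'a::ab_group_add \<Rightarrow> 'a) \<Rightarrow> ('a \<Rightarrow> 'a \<Rightarrow> 'a) \<Rightarrow> ('h \<Rightarrow> 'a \<Rightarrow> 'a) \<Rightarrow> bool"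
  where "H_simple scaleA mulA act \<longleftrightarrow>
    Modules.module.span scaleA {mulA a b |a b. True} \<noteq> {0} \<and>
    (\<forall>I. H_ideal scaleA mulA act I \<longrightarrow> I = {0} \<or> I = UNIV)"


section \<open>Free vector spaces and quotient spaces\<close>

abbreviation fspan :: "('f::field, 'v, 'm) module_scheme \<Rightarrow> 'v set \<Rightarrow> 'v set"
  where "fspan V S \<equiv> LinearCombinations.module.span class_ring V S"

definition lin_ext :: "('k \<Rightarrow> 'l) \<Rightarrow> ('k \<Rightarrow>\<^sub>0 'f) \<Rightarrow> ('l \<Rightarrow>\<^sub>0 'f::field)"
  where "lin_ext g p = (\<Sum>k\<in>Poly_Mapping.keys p. Poly_Mapping.single (g k) (Poly_Mapping.lookup p k))"

definition bilin_ext :: "('k \<Rightarrow> 'l \<Rightarrow> 'm) \<Rightarrow> ('k \<Rightarrow>\<^sub>0 'f) \<Rightarrow> ('l \<Rightarrow>\<^sub>0 'f) \<Rightarrow> ('m \<Rightarrow>\<^sub>0 'f::field)"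
  where "bilin_ext g p q =
    (\<Sum>k\<in>Poly_Mapping.keys p. \<Sum>l\<in>Poly_Mapping.keys q.
      Poly_Mapping.single (g k l) (Poly_Mapping.lookup p k * Poly_Mapping.lookup q l))"

text \<open>
  The algebra with basis \<open>S\<close> whose product extends the operation \<open>g\<close> on \<open>S\<close> bilinearly. The records
  of type \<^type>\<open>module\<close> have a field \<open>one\<close>; for algebras without unit it is left unspecified
  and is never used.
\<close>

definition free_alg :: "'k set \<Rightarrow> ('k \<Rightarrow> 'k \<Rightarrow> 'k) \<Rightarrow> ('f::field, 'k \<Rightarrow>\<^sub>0 'f) module"
  where "free_alg S g =
    \<lparr>carrier = {p. Poly_Mapping.keys p \<subseteq> S}, mult = bilin_ext g, one = undefined, zero = 0, add = (+),
     smult = (\<lambda>c. Poly_Mapping.map ((*) c))\<rparr>"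

text \<open>The set of cosets as in \<^const>\<open>FactRing\<close>, with the induced scalar multiplication.\<close>

definition quot_space :: "('f, 'v, 'm) module_scheme \<Rightarrow> 'v set \<Rightarrow> ('f, 'v set) module"
  where "quot_space V N =
    \<lparr>carrier = a_rcosets\<^bsub>V\<^esub> N, mult = rcoset_mult V N, one = N +>\<^bsub>V\<^esub> \<one>\<^bsub>V\<^esub>,
     zero = N, add = set_add V, smult = (\<lambda>c C. \<Union>v\<in>C. N +>\<^bsub>V\<^esub> (c \<odot>\<^bsub>V\<^esub> v))\<rparr>"


section \<open>\<open>H\<close>-polynomials\<close>

text \<open>
  Non-associative monomials in the variables \<open>X = {x\<^sub>0, x\<^sub>1, \<dots>}\<close> form the basis of \<open>F{X}\<close>; the variables
  are numbered from \<open>0\<close>.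
\<close>

datatype monom = Var nat | Prod monom monom

primrec vars :: "monom \<Rightarrow> nat list"
  where
    "vars (Var i) = [i]"
  | "vars (Prod u v) = vars u @ vars v"

abbreviation deg :: "monom \<Rightarrow> nat"
  where "deg w \<equiv> length (vars w)"

primrec rename :: "(nat \<Rightarrow> nat) \<Rightarrow> monom \<Rightarrow> monom"
  where
    "rename \<sigma> (Var i) = Var (\<sigma> i)"
  | "rename \<sigma> (Prod u v) = Prod (rename \<sigma> u) (rename \<sigma> v)"

text \<open>
  \<open>F{X|H}\<close> is the direct sum of the \<open>H\<^sup>\<otimes>\<^sup>n \<otimes> F{X}\<^sup>(\<^sup>n\<^sup>)\<close>. The pair \<open>([h\<^sub>1, \<dots>, h\<^sub>n], w)\<close> with \<open>deg w = n\<close>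
  stands for \<open>(h\<^sub>1 \<otimes> \<dots> \<otimes> h\<^sub>n) \<otimes> w\<close>. As usual, the tensor product is the space of formal linear
  combinations of these symbols modulo the relations that make them multilinear in \<open>h\<^sub>1, \<dots>, h\<^sub>n\<close>;
  linearity in \<open>F{X}\<^sup>(\<^sup>n\<^sup>)\<close> is built in because \<open>w\<close> runs through a basis only.
\<close>

definition Hmonoms :: "('h list \<times> monom) set"
  where "Hmonoms = {(hs, w). length hs = deg w}"

fun Hmult :: "'h list \<times> monom \<Rightarrow> 'h list \<times> monom \<Rightarrow> 'h list \<times> monom"
  where "Hmult (hs, u) (ks, v) = (hs @ ks, Prod u v)"

abbreviation pre_Hpolys :: "('f::field, ('h list \<times> monom) \<Rightarrow>\<^sub>0 'f) module"
  where "pre_Hpolys \<equiv> free_alg Hmonoms Hmult"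

definition tensor_relations ::
    "('f::field \<Rightarrow> 'h::ring_1 \<Rightarrow> 'h) \<Rightarrow> (('h list \<times> monom) \<Rightarrow>\<^sub>0 'f) set"
  where "tensor_relations scaleH =
    {Poly_Mapping.single (hs[k := g + h], w) 1 - Poly_Mapping.single (hs[k := g], w) 1
       - Poly_Mapping.single (hs[k := h], w) 1 |hs w k g h. (hs, w) \<in> Hmonoms \<and> k < length hs} \<union>
    {Poly_Mapping.single (hs[k := scaleH c h], w) 1 - Poly_Mapping.single (hs[k := h], w) c
       |hs w k c h. (hs, w) \<in> Hmonoms \<and> k < length hs}"

definition tensor_zero ::
    "('f::field \<Rightarrow> 'h::ring_1 \<Rightarrow> 'h) \<Rightarrow> (('h list \<times> monom) \<Rightarrow>\<^sub>0 'f) set"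
  where "tensor_zero scaleH = fspan pre_Hpolys (tensor_relations scaleH)"

definition Hpolys ::
    "('f::field \<Rightarrow> 'h::ring_1 \<Rightarrow> 'h) \<Rightarrow> ('f, (('h list \<times> monom) \<Rightarrow>\<^sub>0 'f) set) module"
  where "Hpolys scaleH = quot_space pre_Hpolys (tensor_zero scaleH)"

text \<open>
  The image of \<open>(h\<^sub>1 \<otimes> \<dots> \<otimes> h\<^sub>n) \<otimes> w\<close> in \<open>F{X|H}\<close>: for \<open>w = x\<^sub>i x\<^sub>j \<dots>\<close> it is the product of \<open>x\<^sub>i\<close> with
  exponent \<open>h\<^sub>1\<close>, \<open>x\<^sub>j\<close> with exponent \<open>h\<^sub>2\<close>, and so on, bracketed as in \<open>w\<close>.
\<close>

definition Hmonom ::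
    "('f::field \<Rightarrow> 'h::ring_1 \<Rightarrow> 'h) \<Rightarrow> 'h list \<Rightarrow> monom \<Rightarrow> (('h list \<times> monom) \<Rightarrow>\<^sub>0 'f) set"
  where "Hmonom scaleH hs w =
    tensor_zero scaleH +>\<^bsub>pre_Hpolys\<^esub> Poly_Mapping.single (hs, w) 1"

text \<open>
  The homomorphism \<open>F{X|H} \<rightarrow> A\<close> that extends \<open>\<psi>\<close>: it is defined on symbols, extended linearly, and
  passes to cosets because it is constant on each of them.
\<close>

primrec eval_monom ::
    "('a \<Rightarrow> 'a \<Rightarrow> 'a) \<Rightarrow> ('h \<Rightarrow> 'a \<Rightarrow> 'a) \<Rightarrow> (nat \<Rightarrow> 'a) \<Rightarrow> monom \<Rightarrow> 'h list \<Rightarrow> 'a"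
  where
    "eval_monom mulA act \<psi> (Var i) hs = act (hd hs) (\<psi> i)"
  | "eval_monom mulA act \<psi> (Prod u v) hs =
      mulA (eval_monom mulA act \<psi> u (take (deg u) hs)) (eval_monom mulA act \<psi> v (drop (deg u) hs))"

definition eval_pre ::
    "('f::field \<Rightarrow> 'a::ab_group_add \<Rightarrow> 'a) \<Rightarrow> ('a \<Rightarrow> 'a \<Rightarrow> 'a) \<Rightarrow> ('h \<Rightarrow> 'a \<Rightarrow> 'a) \<Rightarrow> (nat \<Rightarrow> 'a) \<Rightarrow>
     (('h list \<times> monom) \<Rightarrow>\<^sub>0 'f) \<Rightarrow> 'a"
  where "eval_pre scaleA mulA act \<psi> p =
    (\<Sum>(hs, w)\<in>Poly_Mapping.keys p.
      scaleA (Poly_Mapping.lookup p (hs, w)) (eval_monom mulA act \<psi> w hs))"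

definition eval_Hpoly ::
    "('f::field \<Rightarrow> 'a::ab_group_add \<Rightarrow> 'a) \<Rightarrow> ('a \<Rightarrow> 'a \<Rightarrow> 'a) \<Rightarrow> ('h \<Rightarrow> 'a \<Rightarrow> 'a) \<Rightarrow> (nat \<Rightarrow> 'a) \<Rightarrow>
     (('h list \<times> monom) \<Rightarrow>\<^sub>0 'f) set \<Rightarrow> 'a"
  where "eval_Hpoly scaleA mulA act \<psi> f = the_elem (eval_pre scaleA mulA act \<psi> ` f)"

definition H_identities ::
    "('f::field \<Rightarrow> 'h::ring_1 \<Rightarrow> 'h) \<Rightarrow> ('f \<Rightarrow> 'a::ab_group_add \<Rightarrow> 'a) \<Rightarrow> ('a \<Rightarrow> 'a \<Rightarrow> 'a) \<Rightarrow>
     ('h \<Rightarrow> 'a \<Rightarrow> 'a) \<Rightarrow> (('h list \<times> monom) \<Rightarrow>\<^sub>0 'f) set set"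
  where "H_identities scaleH scaleA mulA act =
    {f \<in> carrier (Hpolys scaleH). \<forall>\<psi>. eval_Hpoly scaleA mulA act \<psi> f = 0}"


section \<open>Codimensions\<close>

definition multilinear_Hpolys ::
    "('f::field \<Rightarrow> 'h::ring_1 \<Rightarrow> 'h) \<Rightarrow> nat \<Rightarrow> (('h list \<times> monom) \<Rightarrow>\<^sub>0 'f) set set"
  where "multilinear_Hpolys scaleH n = fspan (Hpolys scaleH)
    {Hmonom scaleH hs w |hs w \<sigma>. length hs = n \<and> \<sigma> permutes {..<n} \<and> vars w = map \<sigma> [0..<n]}"

definition multilinear_quot ::
    "('f::field \<Rightarrow> 'h::ring_1 \<Rightarrow> 'h) \<Rightarrow> ('f \<Rightarrow> 'a::ab_group_add \<Rightarrow> 'a) \<Rightarrow> ('a \<Rightarrow> 'a \<Rightarrow> 'a) \<Rightarrow>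
     ('h \<Rightarrow> 'a \<Rightarrow> 'a) \<Rightarrow> nat \<Rightarrow> ('f, (('h list \<times> monom) \<Rightarrow>\<^sub>0 'f) set set) module"
  where "multilinear_quot scaleH scaleA mulA act n =
    quot_space (Hpolys scaleH\<lparr>carrier := multilinear_Hpolys scaleH n\<rparr>)
      (multilinear_Hpolys scaleH n \<inter> H_identities scaleH scaleA mulA act)"

definition H_codim ::
    "('f::field \<Rightarrow> 'h::ring_1 \<Rightarrow> 'h) \<Rightarrow> ('f \<Rightarrow> 'a::ab_group_add \<Rightarrow> 'a) \<Rightarrow> ('a \<Rightarrow> 'a \<Rightarrow> 'a) \<Rightarrow>
     ('h \<Rightarrow> 'a \<Rightarrow> 'a) \<Rightarrow> nat \<Rightarrow> nat"
  where "H_codim scaleH scaleA mulA act n =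
    vectorspace.dim class_ring (multilinear_quot scaleH scaleA mulA act n)"

text \<open>
  A permutation \<open>\<sigma>\<close> acts by replacing the variable number \<open>i\<close> by the variable number \<open>\<sigma> i\<close>. On a
  quotient space it maps a coset to its image; an element of \<^const>\<open>multilinear_quot\<close> is a coset of
  cosets.
\<close>

definition perm_pre ::
    "(nat \<Rightarrow> nat) \<Rightarrow> (('h list \<times> monom) \<Rightarrow>\<^sub>0 'f) \<Rightarrow> (('h list \<times> monom) \<Rightarrow>\<^sub>0 'f::field)"
  where "perm_pre \<sigma> = lin_ext (\<lambda>(hs, w). (hs, rename \<sigma> w))"

definition perm_quot ::
    "(nat \<Rightarrow> nat) \<Rightarrow> (('h list \<times> monom) \<Rightarrow>\<^sub>0 'f::field) set set \<Rightarrow> (('h list \<times> monom) \<Rightarrow>\<^sub>0 'f) set set"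
  where "perm_quot \<sigma> C = (\<lambda>f. perm_pre \<sigma> ` f) ` C"


section \<open>Representations of symmetric groups\<close>

text \<open>
  An \<open>FS\<^sub>n\<close>-module is given by a vector space \<open>V\<close> and by the map \<open>\<rho>\<close> that takes a permutation of
  \<open>{..<n}\<close> to a linear operator on \<open>V\<close>.
\<close>

definition Sn_submodule ::
    "nat \<Rightarrow> ('f::field, 'v) module \<Rightarrow> ((nat \<Rightarrow> nat) \<Rightarrow> 'v \<Rightarrow> 'v) \<Rightarrow> 'v set \<Rightarrow> bool"
  where "Sn_submodule n V \<rho> N \<longleftrightarrow>
    submodule class_ring N V \<and> (\<forall>\<sigma>. \<sigma> permutes {..<n} \<longrightarrow> \<rho> \<sigma> ` N \<subseteq> N)"

definition Sn_irreducible ::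
    "nat \<Rightarrow> ('f::field, 'v) module \<Rightarrow> ((nat \<Rightarrow> nat) \<Rightarrow> 'v \<Rightarrow> 'v) \<Rightarrow> 'v set \<Rightarrow> bool"
  where "Sn_irreducible n V \<rho> N \<longleftrightarrow>
    Sn_submodule n V \<rho> N \<and> N \<noteq> {\<zero>\<^bsub>V\<^esub>} \<and>
    (\<forall>M. Sn_submodule n V \<rho> M \<and> M \<subseteq> N \<longrightarrow> M = {\<zero>\<^bsub>V\<^esub>} \<or> M = N)"

definition Sn_isomorphic ::
    "nat \<Rightarrow> ('f::field, 'v) module \<Rightarrow> ((nat \<Rightarrow> nat) \<Rightarrow> 'v \<Rightarrow> 'v) \<Rightarrow>
     ('f, 'w) module \<Rightarrow> ((nat \<Rightarrow> nat) \<Rightarrow> 'w \<Rightarrow> 'w) \<Rightarrow> bool"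
  where "Sn_isomorphic n V \<rho> W \<tau> \<longleftrightarrow>
    (\<exists>f \<in> module_hom class_ring V W. bij_betw f (carrier V) (carrier W) \<and>
      (\<forall>\<sigma>. \<sigma> permutes {..<n} \<longrightarrow> (\<forall>v\<in>carrier V. f (\<rho> \<sigma> v) = \<tau> \<sigma> (f v))))"

text \<open>\<open>V\<close> is the direct sum of the irreducible submodules \<open>N 0, \<dots>, N (r - 1)\<close>.\<close>

definition Sn_decomposition ::
    "nat \<Rightarrow> ('f::field, 'v) module \<Rightarrow> ((nat \<Rightarrow> nat) \<Rightarrow> 'v \<Rightarrow> 'v) \<Rightarrow> nat \<Rightarrow> (nat \<Rightarrow> 'v set) \<Rightarrow> bool"
  where "Sn_decomposition n V \<rho> r N \<longleftrightarrow>
    (\<forall>i<r. Sn_irreducible n V \<rho> (N i)) \<and>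
    (\<forall>v\<in>carrier V. \<exists>!f. f \<in> (\<Pi>\<^sub>E i\<in>{..<r}. N i) \<and> v = (\<Oplus>\<^bsub>V\<^esub>i\<in>{..<r}. f i))"

text \<open>
  The number of summands isomorphic to \<open>M\<close> in a decomposition of \<open>V\<close> into irreducible submodules.
  It does not depend on the decomposition by the Jordan-Hoelder theorem, which justifies \<open>SOME\<close>.
\<close>

definition Sn_multiplicity ::
    "nat \<Rightarrow> ('f::field, 'v) module \<Rightarrow> ((nat \<Rightarrow> nat) \<Rightarrow> 'v \<Rightarrow> 'v) \<Rightarrow>
     ('f, 'w) module \<Rightarrow> ((nat \<Rightarrow> nat) \<Rightarrow> 'w \<Rightarrow> 'w) \<Rightarrow> nat"
  where "Sn_multiplicity n V \<rho> M \<tau> =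
    (SOME m. \<exists>r N. Sn_decomposition n V \<rho> r N \<and>
      m = card {i. i < r \<and> Sn_isomorphic n (V\<lparr>carrier := N i\<rparr>) \<rho> M \<tau>})"


subsection \<open>The irreducible modules \<open>M(lam)\<close>\<close>

text \<open>A partition is the list of its nonzero parts in weakly decreasing order.\<close>

definition partition_of :: "nat list \<Rightarrow> nat \<Rightarrow> bool"
  where "partition_of lam n \<longleftrightarrow> sorted_wrt (\<ge>) lam \<and> 0 \<notin> set lam \<and> sum_list lam = n"

definition part :: "nat list \<Rightarrow> nat \<Rightarrow> nat"
  where "part lam i = (if i < length lam then lam ! i else 0)"

text \<open>
  Rows and columns of the Young tableau of shape \<open>lam\<close> in which the numbers \<open>0, \<dots>, n - 1\<close> are written
  row by row.
\<close>

definition tableau_row :: "nat list \<Rightarrow> nat \<Rightarrow> nat set"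
  where "tableau_row lam i = {sum_list (take i lam) + j |j. j < part lam i}"

definition tableau_col :: "nat list \<Rightarrow> nat \<Rightarrow> nat set"
  where "tableau_col lam j = {sum_list (take i lam) + j |i. j < part lam i}"

abbreviation Sn_algebra :: "nat \<Rightarrow> ('f::field, (nat \<Rightarrow> nat) \<Rightarrow>\<^sub>0 'f) module"
  where "Sn_algebra n \<equiv> free_alg {\<sigma>. \<sigma> permutes {..<n}} (\<circ>)"

definition row_symmetrizer :: "nat list \<Rightarrow> (nat \<Rightarrow> nat) \<Rightarrow>\<^sub>0 'f::field"
  where "row_symmetrizer lam =
    (\<Sum>\<sigma> | \<sigma> permutes {..<sum_list lam} \<and> (\<forall>i. \<sigma> ` tableau_row lam i = tableau_row lam i).
      Poly_Mapping.single \<sigma> 1)"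

definition col_antisymmetrizer :: "nat list \<Rightarrow> (nat \<Rightarrow> nat) \<Rightarrow>\<^sub>0 'f::field"
  where "col_antisymmetrizer lam =
    (\<Sum>\<sigma> | \<sigma> permutes {..<sum_list lam} \<and> (\<forall>j. \<sigma> ` tableau_col lam j = tableau_col lam j).
      Poly_Mapping.single \<sigma> (of_int (sign \<sigma>)))"

text \<open>\<open>M(lam)\<close> is the left ideal of \<open>FS\<^sub>n\<close> generated by the Young symmetrizer.\<close>

definition young_symmetrizer :: "nat list \<Rightarrow> (nat \<Rightarrow> nat) \<Rightarrow>\<^sub>0 'f::field"
  where "young_symmetrizer lam =
    row_symmetrizer lam \<otimes>\<^bsub>Sn_algebra (sum_list lam)\<^esub> col_antisymmetrizer lam"

definition young_module :: "nat list \<Rightarrow> ('f::field, (nat \<Rightarrow> nat) \<Rightarrow>\<^sub>0 'f) module"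
  where "young_module lam = (let R = Sn_algebra (sum_list lam) in
    R\<lparr>carrier := {a \<otimes>\<^bsub>R\<^esub> young_symmetrizer lam |a. a \<in> carrier R}\<rparr>)"

definition young_action :: "(nat \<Rightarrow> nat) \<Rightarrow> ((nat \<Rightarrow> nat) \<Rightarrow>\<^sub>0 'f) \<Rightarrow> ((nat \<Rightarrow> nat) \<Rightarrow>\<^sub>0 'f::field)"
  where "young_action \<sigma> = lin_ext (\<lambda>\<tau>. \<sigma> \<circ> \<tau>)"


section \<open>The exponent\<close>

definition H_multiplicity ::
    "('f::field \<Rightarrow> 'h::ring_1 \<Rightarrow> 'h) \<Rightarrow> ('f \<Rightarrow> 'a::ab_group_add \<Rightarrow> 'a) \<Rightarrow> ('a \<Rightarrow> 'a \<Rightarrow> 'a) \<Rightarrow>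
     ('h \<Rightarrow> 'a \<Rightarrow> 'a) \<Rightarrow> nat list \<Rightarrow> nat"
  where "H_multiplicity scaleH scaleA mulA act lam =
    Sn_multiplicity (sum_list lam) (multilinear_quot scaleH scaleA mulA act (sum_list lam)) perm_quot
      (young_module lam) young_action"

text \<open>The case distinction implements \<open>0\<^sup>0 = 1\<close>; in the library \<^term>\<open>0 powr 0 = (0::real)\<close>.\<close>

definition Phi :: "nat \<Rightarrow> (nat \<Rightarrow> real) \<Rightarrow> real"
  where "Phi s x = 1 / (\<Prod>i<s. if x i = 0 then 1 else x i powr x i)"

definition d_exponent ::
    "('f::field \<Rightarrow> 'h::ring_1 \<Rightarrow> 'h) \<Rightarrow> ('f \<Rightarrow> 'a::ab_group_add \<Rightarrow> 'a) \<Rightarrow> ('a \<Rightarrow> 'a \<Rightarrow> 'a) \<Rightarrow>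
     ('h \<Rightarrow> 'a \<Rightarrow> 'a) \<Rightarrow> nat \<Rightarrow> ereal"
  where "d_exponent scaleH scaleA mulA act s =
    limsup (\<lambda>n. ereal (Max
      {Phi s (\<lambda>i. real (part lam i) / real n) |lam.
        partition_of lam n \<and> H_multiplicity scaleH scaleA mulA act lam \<noteq> 0}))"

definition PIexp ::
    "('f::field \<Rightarrow> 'h::ring_1 \<Rightarrow> 'h) \<Rightarrow> ('f \<Rightarrow> 'a::ab_group_add \<Rightarrow> 'a) \<Rightarrow> ('a \<Rightarrow> 'a \<Rightarrow> 'a) \<Rightarrow>
     ('h \<Rightarrow> 'a \<Rightarrow> 'a) \<Rightarrow> real"
  where "PIexp scaleH scaleA mulA act = lim (\<lambda>n. root n (real (H_codim scaleH scaleA mulA act n)))"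

end

theory Submission
  imports
    Defs
    "HOL-Library.Function_Algebras"
    "HOL-Combinatorics.Cycles"
begin

text \<open>
  A multilinear \<open>H\<close>-polynomial modulo the identities is the multilinear function on \<open>A\<close> which it defines,
  and \<open>M(lam)\<close> occurs in the space of these functions iff some Young symmetrizer of shape \<open>lam\<close> does
  not kill it. An alternating function of more than \<open>dim A\<close> arguments vanishes, hence \<open>lam\<close> has at most
  \<open>dim A\<close> rows. A function that is symmetric in the arguments of each row is determined by polynomially
  many values, so \<open>c\<^sub>n\<close> is at most a polynomial in \<open>n\<close> times the maximum over the occurring \<open>lam\<close> of the
  number \<open>w(lam)\<close> of words of content \<open>lam\<close>. By Stirling's estimate \<open>w(lam)\<close> is \<open>\<Phi>(lam/n)\<^sup>n\<close> up to a
  polynomial factor.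

  For the lower bound, \<open>H\<close>-simplicity allows one to multiply \<open>q\<close> copies of a column-antisymmetrized
  function of shape \<open>lam\<close> into one nonzero function of \<open>N\<close> arguments whenever
  \<open>N \<ge> q (n + 2 dim A)\<close>. Row \<open>i\<close> of copy \<open>b\<close> is put on diagonal \<open>i + b\<close>. Permuting the arguments
  within the diagonals gives functions indexed by tuples of words of content \<open>lam\<close>, and a triangularity
  argument along the diagonals shows their independence. Thus \<open>c\<^sub>N \<ge> w(lam)\<^sup>q\<^sup>-\<^sup>r\<close>, where \<open>r\<close> is the number of
  rows of \<open>lam\<close>. For \<open>q \<longrightarrow> \<infinity>\<close> this bounds the lower limit of \<open>ln c\<^sub>N / N\<close> by the terms of a sequence with
  the same upper limit as the upper bound, so both limits exist and agree.
\<close>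

section \<open>Cycle types\<close>

text \<open>\<open>F\<close> is an arbitrary field of characteristic 0, so representations are
  handled without characters or splitting fields. A Young symmetrizer e satisfies e x e = k e with a
  scalar k for every x in the group algebra. The sums of its conjugates have integer coefficients
  and are independent class functions; there are as many of them as cycle types, so the identity is
  a combination of them. Complete reducibility, irreducibility of \<open>M(lam)\<close> and the test
  for its occurrence follow from this. The lower bound has to live with the alternation: a value
  repeated in a column of one copy gives 0, so arguments cannot be permuted freely across its rows.
  Rows of different copies are free of this constraint, and the shift by the row index lets a
  diagonal contain every row once; the number of incomplete diagonals does not grow with
  \<open>q\<close>. The constant 2 dim A arises because a nonzero element generates \<open>A\<close>
  in at most dim A multiplications, and two elements have to be moved before their product is
  nonzero. Single arguments can be added afterwards, so every large \<open>N\<close> is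
  reached.\<close>

lemma cycle_decomp_permutes: "cycle_decomp I p \<Longrightarrow> p permutes I"
proof (induction rule: cycle_decomp.induct)
  case empty
  show ?case by (simp add: permutes_def)
next
  case (comp I p cs)
  show ?case
    by (rule permutes_compose)
      (rule permutes_subset[OF comp.IH], simp, rule permutes_subset[OF cycle_permutes], simp)
qed

text \<open>Lists on which \<open>p\<close> acts by rotation make conjugation a matter of matching
  entries. Fixed points occur as lists of length one, so the lengths add up to the size of
  \<open>I\<close>.\<close>

lemma cycle_decomp_lists:
  "cycle_decomp I p \<Longrightarrow> \<exists>css. distinct (concat css) \<and> set (concat css) = I \<and> [] \<notin> set css \<and>
     (\<forall>cs\<in>set css. map p cs = rotate1 cs)"
proof (induction rule: cycle_decomp.induct)
  case empty
  show ?case by (intro exI[of _ "[]"]) simp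
next
  case (comp I p cs)
  then obtain css where css: "distinct (concat css)" "set (concat css) = I" "[] \<notin> set css"
    "\<forall>cs\<in>set css. map p cs = rotate1 cs" by blast
  have pI: "p permutes I" using comp.hyps(1) by (rule cycle_decomp_permutes)
  have 1: "map (cycle_of_list cs \<circ> p) cs = rotate1 cs"
  proof -
    have "map (cycle_of_list cs \<circ> p) cs = map (cycle_of_list cs) cs"
      using comp.hyps(3) permutes_not_in[OF pI] by (auto simp: disjoint_iff)
    also have "\<dots> = rotate1 cs" using cyclic_rotation[OF comp.hyps(2), of 1] by simp
    finally show ?thesis .
  qed
  have 2: "map (cycle_of_list cs \<circ> p) ds = rotate1 ds" if ds: "ds \<in> set css" for ds
  proof -
    have "map (cycle_of_list cs \<circ> p) ds = map (cycle_of_list cs) (rotate1 ds)"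
      using css(4) ds by (metis map_map)
    also have "\<dots> = map id (rotate1 ds)"
    proof (rule map_cong[OF refl])
      fix x assume "x \<in> set (rotate1 ds)"
      then have "x \<in> I" using css(2) ds by auto
      then have "x \<notin> set cs" using comp.hyps(3) by auto
      then show "cycle_of_list cs x = id x" by (simp add: id_outside_supp)
    qed
    finally show ?thesis by simp
  qed
  \<comment> \<open>The inductive rule admits an empty cycle; it is dropped so that no part of the
    cycle type is 0.\<close>
  show ?case
  proof (cases "cs = []")
    case True
    then show ?thesis using css by auto
  next
    case False
    have "distinct (concat (cs # css))" using css(1,2) comp.hyps(2,3) by simp
    moreover have "set (concat (cs # css)) = set cs \<union> I" using css(2) by simp
    moreover have "[] \<notin> set (cs # css)" using css(3) False by simp
    moreover have "\<forall>ds\<in>set (cs # css). map (cycle_of_list cs \<circ> p) ds = rotate1 ds"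
      using 1 2 by (simp del: map_map o_apply)
    ultimately show ?thesis by blast
  qed
qed

definition has_cycle_type :: "'a set \<Rightarrow> ('a \<Rightarrow> 'a) \<Rightarrow> nat list \<Rightarrow> bool" where
  "has_cycle_type S p lam \<longleftrightarrow> (\<exists>css. distinct (concat css) \<and> set (concat css) = S \<and>
     (\<forall>cs\<in>set css. map p cs = rotate1 cs) \<and> map length css = lam)"

lemma has_cycle_type_ex:
  assumes "p permutes S" "finite S"
  shows "\<exists>lam. partition_of lam (card S) \<and> has_cycle_type S p lam"
proof -
  from cycle_decomp_lists[OF cycle_decomposition[OF assms]]
  obtain css where css: "distinct (concat css)" "set (concat css) = S" "[] \<notin> set css"
    "\<forall>cs\<in>set css. map p cs = rotate1 cs" by blast
  define dss where "dss = rev (sort_key length css)"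
  have m: "mset dss = mset css" by (simp add: dss_def)
  have s: "set dss = set css" by (simp add: dss_def)
  have lc: "length (concat xs) = sum_mset (image_mset length (mset xs))" for xs :: "'a list list"
    by (simp add: length_concat sum_mset_sum_list[symmetric])
  have "length (concat dss) = length (concat css)" unfolding lc m ..
  then have 1: "distinct (concat dss)"
    using css(1) s by (intro card_distinct) (simp add: distinct_card[OF css(1), symmetric])
  have 2: "set (concat dss) = S" using css(2) s by simp
  have "sorted (map length (sort_key length css))" by (rule sorted_sort_key)
  then have 3: "sorted_wrt (\<ge>) (map length dss)"
    by (simp add: dss_def rev_map[symmetric] sorted_wrt_rev)
  have 4: "sum_list (map length dss) = card S"
    using distinct_card[OF 1] unfolding 2 length_concat by (rule sym)
  have 5: "0 \<notin> set (map length dss)" unfolding set_map s using css(3) by auto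
  show ?thesis
    unfolding has_cycle_type_def partition_of_def
    using 1 2 3 4 5 css(4) s by blast
qed

text \<open>The cycles have the same lengths in the same order, so sending the concatenation for
  \<open>p\<close> entry by entry to that for \<open>q\<close> carries cycles to cycles. Both
  permutations rotate their cycles, hence this map intertwines them.\<close>

lemma has_cycle_type_conj:
  assumes "has_cycle_type S p lam" "has_cycle_type S q lam"
    and "p permutes S" "q permutes S"
  shows "\<exists>t. t permutes S \<and> t \<circ> p = q \<circ> t"
proof -
  from assms(1) obtain css where css: "distinct (concat css)" "set (concat css) = S"
    "\<forall>cs\<in>set css. map p cs = rotate1 cs" "map length css = lam" unfolding has_cycle_type_def by blast
  from assms(2) obtain dss where dss: "distinct (concat dss)" "set (concat dss) = S"
    "\<forall>cs\<in>set dss. map q cs = rotate1 cs" "map length dss = lam" unfolding has_cycle_type_def by blast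
  let ?xs = "concat css" and ?ys = "concat dss"
  have len: "length ?xs = length ?ys" by (metis css(4) dss(4) length_concat)
  have "\<exists>t. t permutes S \<and> map t ?xs = ?ys"
  proof -
    define t where "t x = (if x \<in> S then the (map_of (zip ?xs ?ys) x) else x)" for x
    have m: "map t ?xs = ?ys"
    proof (rule nth_equalityI)
      fix i assume i: "i < length (map t ?xs)"
      then have "?xs ! i \<in> S" using css(2) by (metis length_map nth_mem)
      then show "map t ?xs ! i = ?ys ! i" using i len css(1)
        by (simp add: t_def map_of_zip_nth)
    qed (use len in simp)
    have "bij_betw t S S"
    proof -
      have "t ` S = S" using m css(2) dss(2) by (metis set_map)
      moreover have "inj_on t S"
        using m css(1,2) dss(1) by (metis distinct_map)
      ultimately show ?thesis by (simp add: bij_betw_def)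
    qed
    then have "t permutes S" by (rule bij_imp_permutes) (simp add: t_def)
    then show ?thesis using m by blast
  qed
  then obtain t where t: "t permutes S" "map t ?xs = ?ys" by blast
  have mm: "map (map t) css = dss"
  proof (rule concat_injective)
    show "concat (map (map t) css) = concat dss" using t(2) by (simp add: map_concat)
    show l: "length (map (map t) css) = length dss" using css(4) dss(4) by (metis length_map)
    show "\<forall>(x, y)\<in>set (zip (map (map t) css) dss). length x = length y"
    proof safe
      fix x y assume "(x, y) \<in> set (zip (map (map t) css) dss)"
      then obtain i where i: "i < length css" "i < length dss" "x = map t (css ! i)" "y = dss ! i"
        by (force simp: set_zip)
      have "length (css ! i) = lam ! i" using css(4) i(1) by auto
      moreover have "length (dss ! i) = lam ! i" using dss(4) i(2) by auto
      ultimately show "length x = length y" using i by simp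
    qed
  qed
  have "(t \<circ> p) x = (q \<circ> t) x" for x
  proof (cases "x \<in> S")
    case True
    then obtain cs where cs: "cs \<in> set css" "x \<in> set cs" using css(2) by auto
    have "map t cs \<in> set dss" using mm cs(1) by auto
    then have "map q (map t cs) = rotate1 (map t cs)" using dss(3) by blast
    also have "\<dots> = map t (map p cs)" using css(3) cs(1) by (simp add: rotate1_map)
    finally show ?thesis using cs(2) by simp
  next
    case False
    then show ?thesis using assms(3,4) t(1) by (simp add: permutes_not_in)
  qed
  then show ?thesis using t(1) by blast
qed

abbreviation pinv :: "('a \<Rightarrow> 'a) \<Rightarrow> 'a \<Rightarrow> 'a" where
  "pinv f \<equiv> inv_into UNIV f"

section \<open>Tableaux\<close>

text \<open>Row of the cell containing the number \<open>p\<close> when the tableau is filled row by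
  row. For \<open>p\<close> beyond the tableau the value is unspecified, which is why the coordinate
  facts assume \<open>p < sum_list lam\<close>.\<close>

definition rowf :: "nat list \<Rightarrow> nat \<Rightarrow> nat" where
  "rowf lam p = (LEAST i. p < sum_list (take (Suc i) lam))"

definition colf :: "nat list \<Rightarrow> nat \<Rightarrow> nat" where
  "colf lam p = p - sum_list (take (rowf lam p) lam)"

definition cell :: "nat list \<Rightarrow> nat \<Rightarrow> nat \<Rightarrow> nat" where
  "cell lam i j = sum_list (take i lam) + j"

lemma sum_list_take_Suc: "sum_list (take (Suc i) lam) = sum_list (take i lam) + part lam i"
  by (cases "i < length lam") (auto simp: part_def take_Suc_conv_app_nth)

lemma sum_list_take_mono: "i \<le> j \<Longrightarrow> sum_list (take i lam) \<le> sum_list (take j (lam :: nat list))"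
  by (induction j) (auto simp: le_Suc_eq sum_list_take_Suc)

lemma sum_list_take_eq: "sum_list (take k lam) = (\<Sum>i<k. part lam i)"
  by (induction k) (auto simp: sum_list_take_Suc)

lemma sum_list_take_le: "sum_list (take i lam) \<le> sum_list (lam :: nat list)"
  by (metis le_add1 append_take_drop_id sum_list_append)

lemma cell_less: assumes "j < part lam i" shows "cell lam i j < sum_list lam"
proof -
  have "cell lam i j < sum_list (take (Suc i) lam)" using assms by (simp add: cell_def sum_list_take_Suc)
  also have "\<dots> \<le> sum_list lam" by (rule sum_list_take_le)
  finally show ?thesis .
qed

lemma rowf_cell: assumes "j < part lam i" shows "rowf lam (cell lam i j) = i"
  unfolding rowf_def
proof (rule Least_equality)
  show "cell lam i j < sum_list (take (Suc i) lam)" using assms by (simp add: cell_def sum_list_take_Suc)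
  fix k assume k: "cell lam i j < sum_list (take (Suc k) lam)"
  show "i \<le> k"
  proof (rule ccontr)
    assume "\<not> i \<le> k"
    then have "sum_list (take (Suc k) lam) \<le> sum_list (take i lam)" by (intro sum_list_take_mono) auto
    with k show False by (simp add: cell_def)
  qed
qed

lemma colf_cell: "j < part lam i \<Longrightarrow> colf lam (cell lam i j) = j"
  by (simp add: colf_def rowf_cell) (simp add: cell_def)

lemma cell_rowf_colf:
  assumes "p < sum_list lam"
  shows "colf lam p < part lam (rowf lam p)" "cell lam (rowf lam p) (colf lam p) = p"
proof -
  let ?i = "rowf lam p"
  have "p < sum_list (take (Suc (length lam)) lam)" using assms by simp
  then have 1: "p < sum_list (take (Suc ?i) lam)" unfolding rowf_def by (rule LeastI)
  have 2: "sum_list (take ?i lam) \<le> p"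
  proof (cases ?i)
    case (Suc k)
    then have "\<not> p < sum_list (take (Suc k) lam)" unfolding rowf_def by (intro not_less_Least) simp
    then show ?thesis using Suc by simp
  qed simp
  show "colf lam p < part lam ?i" using 1 2 by (simp add: colf_def sum_list_take_Suc)
  show "cell lam ?i (colf lam p) = p" using 2 by (simp add: colf_def cell_def)
qed

lemma rowf_less_length: "p < sum_list lam \<Longrightarrow> rowf lam p < length lam"
  using cell_rowf_colf(1)[of p lam] by (auto simp: part_def split: if_splits)

lemma tableau_row_eq: "tableau_row lam i = {p. p < sum_list lam \<and> rowf lam p = i}"
proof -
  have "tableau_row lam i = {cell lam i j |j. j < part lam i}" by (simp add: tableau_row_def cell_def)
  also have "\<dots> = {p. p < sum_list lam \<and> rowf lam p = i}"
    by (auto simp: cell_less rowf_cell) (metis cell_rowf_colf)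
  finally show ?thesis .
qed

lemma tableau_col_eq: "tableau_col lam j = {p. p < sum_list lam \<and> colf lam p = j}"
proof -
  have "tableau_col lam j = {cell lam i j |i. j < part lam i}" by (simp add: tableau_col_def cell_def)
  also have "\<dots> = {p. p < sum_list lam \<and> colf lam p = j}"
    by (auto simp: cell_less colf_cell) (metis cell_rowf_colf)
  finally show ?thesis .
qed

text \<open>Preservation of the row index is easier to compose and invert than preservation of the
  row sets; \<open>row_stab_eq\<close> identifies the result with the group summed over in
  \<open>row_symmetrizer\<close>.\<close>

definition row_stab :: "nat list \<Rightarrow> (nat \<Rightarrow> nat) set" where
  "row_stab lam = {\<sigma>. \<sigma> permutes {..<sum_list lam} \<and> (\<forall>p<sum_list lam. rowf lam (\<sigma> p) = rowf lam p)}"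

definition col_stab :: "nat list \<Rightarrow> (nat \<Rightarrow> nat) set" where
  "col_stab lam = {\<sigma>. \<sigma> permutes {..<sum_list lam} \<and> (\<forall>p<sum_list lam. colf lam (\<sigma> p) = colf lam p)}"

text \<open>Pointwise preservation gives equality of sets because an injective map of a finite fiber
  into itself is onto.\<close>

lemma permutes_fibers_iff:
  assumes "\<sigma> permutes {..<n::nat}"
  shows "(\<forall>i. \<sigma> ` {p. p < n \<and> f p = i} = {p. p < n \<and> f p = i}) \<longleftrightarrow> (\<forall>p<n. f (\<sigma> p) = f p)" (is "?L = ?R")
proof
  assume ?L then show ?R by blast
next
  have lt: "\<sigma> p < n \<longleftrightarrow> p < n" for p using permutes_in_image[OF assms, of p] by simp
  assume R: ?R
  have "\<sigma> ` {p. p < n \<and> f p = i} \<subseteq> {p. p < n \<and> f p = i}" for i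
    using R lt by auto
  moreover have "inj_on \<sigma> {p. p < n \<and> f p = i}" for i
    by (rule permutes_inj_on[OF assms])
  ultimately show ?L by (simp add: endo_inj_surj)
qed

lemma row_stab_eq: "row_stab lam = {\<sigma>. \<sigma> permutes {..<sum_list lam} \<and> (\<forall>i. \<sigma> ` tableau_row lam i = tableau_row lam i)}"
  unfolding row_stab_def tableau_row_eq
  by (rule Collect_cong, rule conj_cong[OF refl]) (simp only: permutes_fibers_iff[where f = "rowf lam"])

lemma col_stab_eq: "col_stab lam = {\<sigma>. \<sigma> permutes {..<sum_list lam} \<and> (\<forall>i. \<sigma> ` tableau_col lam i = tableau_col lam i)}"
  unfolding col_stab_def tableau_col_eq
  by (rule Collect_cong, rule conj_cong[OF refl]) (simp only: permutes_fibers_iff[where f = "colf lam"])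

lemma partition_of_antimono: "partition_of lam n \<Longrightarrow> i \<le> j \<Longrightarrow> part lam j \<le> part lam i"
  unfolding partition_of_def part_def
  by (cases "i = j") (auto simp: sorted_wrt_iff_nth_less)

lemma partition_of_eqI:
  assumes "partition_of lam n" "partition_of mu m" "\<And>i. part lam i = part mu i"
  shows "lam = mu"
proof -
  have *: "part nu i = 0 \<longleftrightarrow> length nu \<le> i" if "partition_of nu k" for nu k i
  proof -
    show ?thesis
    proof (cases "i < length nu")
      case True
      then have "nu ! i \<in> set nu" by simp
      then have "nu ! i \<noteq> 0" using that unfolding partition_of_def by metis
      then show ?thesis using True by (simp add: part_def)
    qed (simp add: part_def)
  qed
  have **: "length lam \<le> i \<longleftrightarrow> length mu \<le> i" for i
    using *[OF assms(1), of i] *[OF assms(2), of i] assms(3)[of i] by simp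
  have len: "length lam = length mu" using **[of "length lam"] **[of "length mu"] by simp
  show ?thesis
  proof (rule nth_equalityI[OF len])
    fix i assume "i < length lam"
    then show "lam ! i = mu ! i" using assms(3)[of i] len by (simp add: part_def)
  qed
qed

lemma part_le_sum_list: "part lam i \<le> sum_list lam"
  by (auto simp: part_def intro: member_le_sum_list)

lemma colf_less: "p < sum_list lam \<Longrightarrow> colf lam p < sum_list lam"
  using cell_rowf_colf(1) part_le_sum_list by (metis order_less_le_trans)

lemma rowf_less_iff: "p < sum_list lam \<and> rowf lam p < k \<longleftrightarrow> p < sum_list (take k lam)"
proof
  assume *: "p < sum_list lam \<and> rowf lam p < k"
  then have "p = cell lam (rowf lam p) (colf lam p)" "colf lam p < part lam (rowf lam p)"
    using cell_rowf_colf by metis+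
  then have "p < sum_list (take (Suc (rowf lam p)) lam)" by (simp add: cell_def sum_list_take_Suc)
  also have "\<dots> \<le> sum_list (take k lam)" using * by (intro sum_list_take_mono) auto
  finally show "p < sum_list (take k lam)" .
next
  assume *: "p < sum_list (take k lam)"
  then have pn: "p < sum_list lam" using sum_list_take_le order_less_le_trans by blast
  have "\<not> k \<le> rowf lam p"
  proof
    assume "k \<le> rowf lam p"
    then have "sum_list (take k lam) \<le> sum_list (take (rowf lam p) lam)" by (rule sum_list_take_mono)
    also have "\<dots> \<le> p" using cell_rowf_colf(2)[OF pn] by (metis cell_def le_add1)
    finally show False using * by simp
  qed
  with pn show "p < sum_list lam \<and> rowf lam p < k" by simp
qed

lemma card_rowf_less: "card {p. p < sum_list lam \<and> rowf lam p < k} = sum_list (take k lam)"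
  unfolding rowf_less_iff by simp

lemma card_rowf: "card {p. p < sum_list lam \<and> rowf lam p = i} = part lam i"
proof -
  have "{p. p < sum_list lam \<and> rowf lam p = i} = cell lam i ` {..<part lam i}"
    by (auto simp: cell_less rowf_cell image_iff) (metis cell_rowf_colf lessThan_iff)
  moreover have "inj_on (cell lam i) {..<part lam i}" by (auto simp: inj_on_def cell_def)
  ultimately show ?thesis by (simp add: card_image)
qed

lemma card_colf:
  "card {p. p < sum_list lam \<and> colf lam p = j} = card {i. j < part lam i}"
proof -
  have "{p. p < sum_list lam \<and> colf lam p = j} = (\<lambda>i. cell lam i j) ` {i. j < part lam i}"
    by (auto simp: cell_less colf_cell image_iff) (metis cell_rowf_colf)
  moreover have "inj_on (\<lambda>i. cell lam i j) {i. j < part lam i}"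
    by (rule inj_onI) (metis mem_Collect_eq rowf_cell)
  ultimately show ?thesis by (simp add: card_image)
qed

section \<open>Dominance order and pairs of tableaux in general position\<close>

definition dominated :: "nat list \<Rightarrow> nat list \<Rightarrow> bool" where
  "dominated lam mu \<longleftrightarrow> (\<forall>k. sum_list (take k lam) \<le> sum_list (take k mu))"

lemma dominated_antisym:
  assumes "partition_of lam n" "partition_of mu m" "dominated lam mu" "dominated mu lam"
  shows "lam = mu"
proof (rule partition_of_eqI[OF assms(1,2)])
  fix i
  have "sum_list (take k lam) = sum_list (take k mu)" for k
    using assms(3,4) by (simp add: dominated_def le_antisym)
  from this[of i] this[of "Suc i"] show "part lam i = part mu i" by (simp add: sum_list_take_Suc)
qed

text \<open>Here \<open>t\<close> carries positions of a tableau of shape \<open>lam\<close> to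
  positions of one of shape \<open>mu\<close>, and two numbers of one row never land in one column.
  Only in this configuration can a row symmetrizer times a translated column antisymmetrizer be
  nonzero.\<close>

definition transversal :: "nat list \<Rightarrow> nat list \<Rightarrow> (nat \<Rightarrow> nat) \<Rightarrow> bool" where
  "transversal lam mu t \<longleftrightarrow> (\<forall>p<sum_list lam. \<forall>q<sum_list lam.
     rowf lam p = rowf lam q \<longrightarrow> colf mu (t p) = colf mu (t q) \<longrightarrow> p = q)"

context
  fixes lam mu :: "nat list" and n :: nat and t :: "nat \<Rightarrow> nat"
  assumes lam: "sum_list lam = n" and mu: "partition_of mu n" and t: "t permutes {..<n}"
    and tr: "transversal lam mu t"
begin

lemma transversal_mu: "sum_list mu = n"
  using mu by (simp add: partition_of_def)

text \<open>If column \<open>j\<close> has at least \<open>k\<close> cells, the positions lie in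
  different rows among the first \<open>k\<close>. Otherwise their number is at most the length of
  the whole column, all of whose cells are in rows before \<open>k\<close> because the parts
  decrease.\<close>

lemma transversal_count:
  "card {p. p < n \<and> rowf lam p < k \<and> colf mu (t p) = j} \<le> card {i. i < k \<and> j < part mu i}"
proof (cases "\<forall>i<k. j < part mu i")
  case True
  have "inj_on (rowf lam) {p. p < n \<and> rowf lam p < k \<and> colf mu (t p) = j}"
    using tr by (auto simp: inj_on_def transversal_def lam)
  then have "card {p. p < n \<and> rowf lam p < k \<and> colf mu (t p) = j} \<le> card {..<k}"
    by (rule card_inj_on_le) auto
  also have "{..<k} = {i. i < k \<and> j < part mu i}" using True by auto
  finally show ?thesis .
next
  case False
  then obtain i0 where i0: "i0 < k" "part mu i0 \<le> j" by force
  have "i < k" if "j < part mu i" for i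
    using partition_of_antimono[OF mu, of i0 i] i0 that by (meson leD le_trans not_le_imp_less order_less_trans)
  then have e: "{i. i < k \<and> j < part mu i} = {i. j < part mu i}" by auto
  have lt: "t p < n \<longleftrightarrow> p < n" for p using permutes_in_image[OF t, of p] by simp
  have "card {p. p < n \<and> rowf lam p < k \<and> colf mu (t p) = j} \<le> card {p. p < n \<and> colf mu p = j}"
    by (rule card_inj_on_le[of t]) (use t lt in \<open>auto intro: permutes_inj_on\<close>)
  also have "\<dots> = card {i. j < part mu i}" using card_colf[of mu j] by (simp add: transversal_mu)
  finally show ?thesis by (simp add: e)
qed

lemma transversal_sum_left:
  "(\<Sum>j<n. card {p. p < n \<and> rowf lam p < k \<and> colf mu (t p) = j}) = sum_list (take k lam)"
proof -
  have lt: "t p < n \<longleftrightarrow> p < n" for p using permutes_in_image[OF t, of p] by simp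
  have c: "colf mu (t p) < n" if "p < n" for p using that lt colf_less[of "t p" mu] by (simp add: transversal_mu)
  have "{p. p < n \<and> rowf lam p < k} = (\<Union>j<n. {p. p < n \<and> rowf lam p < k \<and> colf mu (t p) = j})"
    using c by auto
  then have "card {p. p < n \<and> rowf lam p < k} = (\<Sum>j<n. card {p. p < n \<and> rowf lam p < k \<and> colf mu (t p) = j})"
    by (simp only:) (rule card_UN_disjoint, auto)
  then show ?thesis using card_rowf_less[of lam k] by (simp add: lam)
qed

lemma transversal_sum_right:
  "(\<Sum>j<n. card {i. i < k \<and> j < part mu i}) = sum_list (take k mu)"
proof -
  have "(\<Sum>j<n. card {i. i < k \<and> j < part mu i}) = (\<Sum>j<n. \<Sum>i<k. of_bool (j < part mu i))"
    by (intro sum.cong refl) (auto intro!: arg_cong[where f = card])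
  also have "\<dots> = (\<Sum>i<k. \<Sum>j<n. of_bool (j < part mu i))" by (rule sum.swap)
  also have "\<dots> = (\<Sum>i<k. part mu i)"
  proof (rule sum.cong[OF refl])
    fix i
    have "{..<n} \<inter> {j. j < part mu i} = {..<part mu i}"
      using part_le_sum_list[of mu i] by (auto simp: transversal_mu)
    then show "(\<Sum>j<n. of_bool (j < part mu i)) = part mu i" by simp
  qed
  finally show ?thesis by (simp add: sum_list_take_eq)
qed

text \<open>Summing the counts over all columns yields the partial sums of the two shapes.\<close>

lemma transversal_dominated: "dominated lam mu"
  unfolding dominated_def
proof
  fix k
  show "sum_list (take k lam) \<le> sum_list (take k mu)"
    unfolding transversal_sum_left[symmetric] transversal_sum_right[symmetric]
    by (rule sum_mono) (rule transversal_count)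
qed

text \<open>For equal shapes the counts have equal sums, hence are equal: the row of \<open>p\<close> in one tableau
  and the column in the other one are the coordinates of a cell.\<close>

lemma transversal_cell:
  assumes "lam = mu" "p < n"
  shows "colf mu (t p) < part mu (rowf lam p)"
proof (rule ccontr)
  let ?i = "rowf lam p" and ?j = "colf mu (t p)"
  let ?N = "\<lambda>k j. {p. p < n \<and> rowf lam p < k \<and> colf mu (t p) = j}"
  assume no: "\<not> ?j < part mu ?i"
  have "t p < n" using permutes_in_image[OF t, of p] assms(2) by simp
  then have j: "?j \<in> {..<n}" using colf_less[of "t p" mu] by (simp add: transversal_mu)
  have eq: "card (?N k j) = card {i. i < k \<and> j < part mu i}" if "j \<in> {..<n}" for k j
  proof (rule ccontr)
    assume "card (?N k j) \<noteq> card {i. i < k \<and> j < part mu i}"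
    then have "card (?N k j) < card {i. i < k \<and> j < part mu i}"
      using transversal_count[of k j] by simp
    then have "(\<Sum>j<n. card (?N k j)) < (\<Sum>j<n. card {i. i < k \<and> j < part mu i})"
      using that by (intro sum_strict_mono_ex1) (auto intro: transversal_count)
    then show False unfolding transversal_sum_left transversal_sum_right using assms(1) by simp
  qed
  \<comment> \<open>If the cell were missing, row \<open>?i\<close> would add nothing to the count
    of cells, although it adds \<open>p\<close> to the count of positions.\<close>
  have "{i. i < Suc ?i \<and> ?j < part mu i} = {i. i < ?i \<and> ?j < part mu i}"
    using no less_Suc_eq by auto
  then have "card (?N (Suc ?i) ?j) = card (?N ?i ?j)" using eq[OF j] by simp
  moreover have "?N ?i ?j \<subset> ?N (Suc ?i) ?j" using assms(2) by auto
  then have "card (?N ?i ?j) < card (?N (Suc ?i) ?j)" by (intro psubset_card_mono) auto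
  ultimately show False by simp
qed

end

lemma finite_row_stab [simp]: "finite (row_stab lam)"
  by (rule finite_subset[OF _ finite_permutations[of "{..<sum_list lam}"]]) (auto simp: row_stab_def)

lemma finite_col_stab [simp]: "finite (col_stab lam)"
  by (rule finite_subset[OF _ finite_permutations[of "{..<sum_list lam}"]]) (auto simp: col_stab_def)

text \<open>Stated for the level sets of an arbitrary function, so that one proof serves the row
  group and the column group.\<close>

lemma stab_group:
  fixes f :: "nat \<Rightarrow> nat" and n :: nat
  defines "G \<equiv> {\<sigma>. \<sigma> permutes {..<n} \<and> (\<forall>p<n. f (\<sigma> p) = f p)}"
  shows "id \<in> G" and "\<sigma> \<in> G \<Longrightarrow> \<tau> \<in> G \<Longrightarrow> \<sigma> \<circ> \<tau> \<in> G" and "\<sigma> \<in> G \<Longrightarrow> pinv \<sigma> \<in> G"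
proof -
  show "id \<in> G" by (simp add: G_def permutes_id)
  have lt: "\<sigma> p < n \<longleftrightarrow> p < n" if "\<sigma> permutes {..<n}" for \<sigma> p
    using permutes_in_image[OF that, of p] by simp
  show "\<sigma> \<in> G \<Longrightarrow> \<tau> \<in> G \<Longrightarrow> \<sigma> \<circ> \<tau> \<in> G"
    using lt by (auto simp: G_def intro: permutes_compose)
  show "pinv \<sigma> \<in> G" if "\<sigma> \<in> G"
  proof -
    have s: "\<sigma> permutes {..<n}" "\<forall>p<n. f (\<sigma> p) = f p" using that by (auto simp: G_def)
    have "f (pinv \<sigma> p) = f p" if "p < n" for p
      using s(2) lt[OF permutes_inv[OF s(1)]] that permutes_inverses(1)[OF s(1), of p] by metis
    then show ?thesis using s(1) by (auto simp: G_def permutes_inv)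
  qed
qed

lemmas row_stab_id = stab_group(1)[of "sum_list lam" "rowf lam" for lam, folded row_stab_def]
lemmas row_stab_comp = stab_group(2)[of _ "sum_list lam" "rowf lam" _ for lam, folded row_stab_def]
lemmas row_stab_inv = stab_group(3)[of _ "sum_list lam" "rowf lam" for lam, folded row_stab_def]
lemmas col_stab_id = stab_group(1)[of "sum_list lam" "colf lam" for lam, folded col_stab_def]
lemmas col_stab_comp = stab_group(2)[of _ "sum_list lam" "colf lam" _ for lam, folded col_stab_def]
lemmas col_stab_inv = stab_group(3)[of _ "sum_list lam" "colf lam" for lam, folded col_stab_def]

lemma row_stab_permutes: "r \<in> row_stab lam \<Longrightarrow> r permutes {..<sum_list lam}"
  by (simp add: row_stab_def)

lemma col_stab_permutes: "r \<in> col_stab lam \<Longrightarrow> r permutes {..<sum_list lam}"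
  by (simp add: col_stab_def)

lemma row_col_stab_inter:
  assumes "r \<in> row_stab lam" "r \<in> col_stab lam" shows "r = id"
proof
  fix p
  show "r p = id p"
  proof (cases "p < sum_list lam")
    case True
    have rp: "r p < sum_list lam"
      using permutes_in_image[OF row_stab_permutes[OF assms(1)], of p] True by simp
    have "r p = cell lam (rowf lam (r p)) (colf lam (r p))" using cell_rowf_colf[OF rp] by simp
    also have "\<dots> = p" using assms True cell_rowf_colf[OF True] by (simp add: row_stab_def col_stab_def)
    finally show ?thesis by simp
  next
    case False
    then show ?thesis using row_stab_permutes[OF assms(1)] by (simp add: permutes_not_in)
  qed
qed

text \<open>Move each \<open>p\<close> inside its row to the column of \<open>pinv s p\<close>:
  \<open>transversal_cell\<close> says that this cell exists, transversality that no cell is hit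
  twice. The resulting \<open>u\<close> is a row permutation, and \<open>u \<circ> s\<close>
  preserves columns.\<close>

lemma transversal_factor:
  assumes lam: "partition_of lam n" and s: "s permutes {..<n}" and tr: "transversal lam lam (pinv s)"
  obtains r c where "r \<in> row_stab lam" "c \<in> col_stab lam" "s = r \<circ> c"
proof -
  have n: "sum_list lam = n" using lam by (simp add: partition_of_def)
  note isp = permutes_inv[OF s]
  define u where "u p = (if p < n then cell lam (rowf lam p) (colf lam (pinv s p)) else p)" for p
  have cl: "colf lam (pinv s p) < part lam (rowf lam p)" if "p < n" for p
    using transversal_cell[OF n lam isp tr refl that] .
  have ru: "rowf lam (u p) = rowf lam p" "colf lam (u p) = colf lam (pinv s p)" "u p < n" if "p < n" for p
    using that cl[OF that] rowf_cell colf_cell cell_less n by (auto simp: u_def)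
  have "inj_on u {..<n}"
    using tr ru by (auto simp: inj_on_def transversal_def n) metis
  moreover have "u ` {..<n} \<subseteq> {..<n}" using ru by auto
  ultimately have "bij_betw u {..<n} {..<n}" by (simp add: bij_betw_def endo_inj_surj)
  then have up: "u permutes {..<n}" by (rule bij_imp_permutes) (simp add: u_def)
  have ur: "u \<in> row_stab lam" using up ru by (simp add: row_stab_def n)
  have lt: "s p < n \<longleftrightarrow> p < n" for p using permutes_in_image[OF s, of p] by simp
  have uc: "u \<circ> s \<in> col_stab lam"
    using permutes_compose[OF s up] ru lt permutes_inverses(2)[OF s] by (simp add: col_stab_def n)
  have "s = pinv u \<circ> (u \<circ> s)" using permutes_inv_o(2)[OF up] by (simp add: o_assoc)
  then show ?thesis using that row_stab_inv[OF ur] uc by blast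
qed

text \<open>A pair \<open>p\<close>, \<open>q\<close> that violates transversality lies in one row
  while its preimages under \<open>s\<close> lie in one column; the two transpositions are conjugate
  by \<open>s\<close>.\<close>

lemma not_transversal_swap:
  assumes "sum_list lam = n" "sum_list mu = n" "s permutes {..<n}" "\<not> transversal lam mu (pinv s)"
  obtains t t' where "t \<in> row_stab lam" "t' \<in> col_stab mu" "t \<circ> s = s \<circ> t'" "sign t' = -1"
proof -
  from assms(4) obtain p q where pq: "p < n" "q < n" "rowf lam p = rowf lam q"
    "colf mu (pinv s p) = colf mu (pinv s q)" "p \<noteq> q" unfolding transversal_def assms(1) by blast
  let ?t = "Transposition.transpose p q" and ?t' = "Transposition.transpose (pinv s p) (pinv s q)"
  have bs: "bij s" using assms(3) by (rule permutes_bij)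
  have lt: "pinv s p < n \<longleftrightarrow> p < n" for p using permutes_in_image[OF permutes_inv[OF assms(3)], of p] by simp
  have ne: "pinv s p \<noteq> pinv s q" using pq(5) permutes_inverses(1)[OF assms(3)] by metis
  have "?t \<in> row_stab lam" using pq
    by (auto simp: row_stab_def assms(1) Transposition.transpose_def intro!: permutes_swap_id)
  moreover have "?t' \<in> col_stab mu" using pq lt
    by (auto simp: col_stab_def assms(2) Transposition.transpose_def intro!: permutes_swap_id)
  moreover have "?t \<circ> s = s \<circ> ?t'"
    using permutes_inverses[OF assms(3)] by (auto simp: fun_eq_iff Transposition.transpose_def)
  moreover have "sign ?t' = -1" using ne by (simp add: sign_swap_id)
  ultimately show ?thesis using that by blast
qed

section \<open>Representations of symmetric groups and the operators of Young\<close>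

abbreviation Sym :: "nat \<Rightarrow> (nat \<Rightarrow> nat) set" where
  "Sym n \<equiv> {\<sigma>. \<sigma> permutes {..<n}}"

lemma finite_Sym [simp]: "finite (Sym n)" by (rule finite_permutations) simp

lemma sum_perm_comp_left:
  "t permutes {..<n} \<Longrightarrow> (\<Sum>\<sigma>\<in>Sym n. f (t \<circ> \<sigma>)) = sum f (Sym n)"
  by (rule sum.reindex_bij_witness[of _ "\<lambda>\<sigma>. pinv t \<circ> \<sigma>" "\<lambda>\<sigma>. t \<circ> \<sigma>"])
    (auto simp: o_assoc permutes_inv_o intro: permutes_compose permutes_inv)

text \<open>The representation lives on a whole type, so that the theory of
  \<open>vector_space\<close> applies; submodules are invariant subspaces. Nothing is asked of
  \<open>rho\<close> outside the permutations of \<open>{..<n}\<close>.\<close>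

locale Sn_rep = vector_space scale
  for scale :: "'f::field_char_0 \<Rightarrow> 'v::ab_group_add \<Rightarrow> 'v" (infixr "*s" 75) +
  fixes n :: nat and rho :: "(nat \<Rightarrow> nat) \<Rightarrow> 'v \<Rightarrow> 'v"
  assumes rho_add: "\<sigma> permutes {..<n} \<Longrightarrow> rho \<sigma> (u + v) = rho \<sigma> u + rho \<sigma> v"
    and rho_scale: "\<sigma> permutes {..<n} \<Longrightarrow> rho \<sigma> (c *s v) = c *s rho \<sigma> v"
    and rho_comp: "\<sigma> permutes {..<n} \<Longrightarrow> \<tau> permutes {..<n} \<Longrightarrow> rho (\<sigma> \<circ> \<tau>) v = rho \<sigma> (rho \<tau> v)"
    and rho_id: "rho id v = v"
begin

lemma rho_zero: "\<sigma> permutes {..<n} \<Longrightarrow> rho \<sigma> 0 = 0"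
  using rho_add[of \<sigma> 0 0] by simp

lemma rho_sum: "\<sigma> permutes {..<n} \<Longrightarrow> rho \<sigma> (sum f I) = (\<Sum>i\<in>I. rho \<sigma> (f i))"
  by (induction I rule: infinite_finite_induct) (auto simp: rho_add rho_zero)

lemma rho_inv: "\<sigma> permutes {..<n} \<Longrightarrow> rho \<sigma> (rho (pinv \<sigma>) v) = v" "\<sigma> permutes {..<n} \<Longrightarrow> rho (pinv \<sigma>) (rho \<sigma> v) = v"
  by (simp_all add: rho_comp[symmetric] permutes_inv permutes_inv_o rho_id)

definition invariant :: "'v set \<Rightarrow> bool" where
  "invariant U \<longleftrightarrow> subspace U \<and> (\<forall>\<sigma>\<in>Sym n. \<forall>u\<in>U. rho \<sigma> u \<in> U)"

lemma invariantD:
  assumes "invariant U"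
  shows "subspace U" "\<sigma> permutes {..<n} \<Longrightarrow> u \<in> U \<Longrightarrow> rho \<sigma> u \<in> U"
  using assms by (auto simp: invariant_def)

text \<open>The action of the group algebra element with coefficients \<open>x\<close>.\<close>

definition grp :: "((nat \<Rightarrow> nat) \<Rightarrow> 'f) \<Rightarrow> 'v \<Rightarrow> 'v" where
  "grp x v = (\<Sum>\<sigma>\<in>Sym n. x \<sigma> *s rho \<sigma> v)"

lemma grp_zero: "grp x 0 = 0" by (simp add: grp_def rho_zero)

lemma grp_in: "invariant U \<Longrightarrow> u \<in> U \<Longrightarrow> grp x u \<in> U"
  unfolding grp_def by (intro subspace_sum subspace_scale) (auto dest: invariantD)

text \<open>The submodule generated by \<open>v\<close>, written as an image of the group algebra so
  that its elements come with coefficients.\<close>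

definition orbit_span :: "'v \<Rightarrow> 'v set" where
  "orbit_span v = range (\<lambda>x. grp x v)"

lemma grp_add_left: "grp x v + grp y v = grp (\<lambda>\<sigma>. x \<sigma> + y \<sigma>) v"
  by (simp add: grp_def scale_left_distrib sum.distrib)

lemma grp_scale_left: "c *s grp x v = grp (\<lambda>\<sigma>. c * x \<sigma>) v"
  by (simp add: grp_def scale_sum_right)

lemma rho_grp: "\<tau> permutes {..<n} \<Longrightarrow> rho \<tau> (grp x v) = grp (\<lambda>\<sigma>. x (pinv \<tau> \<circ> \<sigma>)) v"
proof -
  assume t: "\<tau> permutes {..<n}"
  have "grp (\<lambda>\<sigma>. x (pinv \<tau> \<circ> \<sigma>)) v = (\<Sum>\<sigma>\<in>Sym n. x (pinv \<tau> \<circ> (\<tau> \<circ> \<sigma>)) *s rho (\<tau> \<circ> \<sigma>) v)"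
    unfolding grp_def by (rule sum_perm_comp_left[OF t, symmetric])
  also have "\<dots> = (\<Sum>\<sigma>\<in>Sym n. x \<sigma> *s rho \<tau> (rho \<sigma> v))"
    by (intro sum.cong refl) (simp add: o_assoc permutes_inv_o[OF t] rho_comp t)
  also have "\<dots> = rho \<tau> (grp x v)" by (simp add: grp_def rho_sum rho_scale t)
  finally show ?thesis ..
qed

lemma grp_delta: "grp (\<lambda>\<sigma>. of_bool (\<sigma> = id)) v = v"
proof -
  have "grp (\<lambda>\<sigma>. of_bool (\<sigma> = id)) v = (\<Sum>\<sigma>\<in>Sym n. if \<sigma> = id then v else 0)"
    unfolding grp_def by (intro sum.cong refl) (auto simp: rho_id)
  then show ?thesis by (simp add: permutes_id)
qed

lemma orbit_span_self: "v \<in> orbit_span v"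
  unfolding orbit_span_def using grp_delta by (metis rangeI)

lemma orbit_span_invariant: "invariant (orbit_span v)"
proof -
  have "subspace (orbit_span v)"
  proof (rule subspaceI)
    have "grp (\<lambda>\<sigma>. 0) v = 0" by (simp add: grp_def)
    then show "0 \<in> orbit_span v" unfolding orbit_span_def by (metis rangeI)
  qed (auto simp: orbit_span_def grp_add_left grp_scale_left)
  then show ?thesis by (auto simp: invariant_def orbit_span_def rho_grp)
qed

lemma orbit_span_le: "invariant U \<Longrightarrow> v \<in> U \<Longrightarrow> orbit_span v \<subseteq> U"
  by (auto simp: orbit_span_def grp_in)

definition rowop :: "nat list \<Rightarrow> 'v \<Rightarrow> 'v" where
  "rowop lam v = (\<Sum>r\<in>row_stab lam. rho r v)"

definition colop :: "nat list \<Rightarrow> 'v \<Rightarrow> 'v" where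
  "colop lam v = (\<Sum>c\<in>col_stab lam. of_int (sign c) *s rho c v)"

definition young :: "nat list \<Rightarrow> 'v \<Rightarrow> 'v" where
  "young lam v = rowop lam (colop lam v)"

text \<open>The action of the sum of all conjugates of the Young symmetrizer, a central element of
  the group algebra. It stands in for the central idempotent of \<open>lam\<close> and, unlike that,
  is written down without characters or division.\<close>

definition central :: "nat list \<Rightarrow> 'v \<Rightarrow> 'v" where
  "central lam v = (\<Sum>\<sigma>\<in>Sym n. rho \<sigma> (young lam (rho (pinv \<sigma>) v)))"

context
  fixes lam assumes lam: "sum_list lam = n"
begin

lemma stab_perm: "r \<in> row_stab lam \<Longrightarrow> r permutes {..<n}" "r \<in> col_stab lam \<Longrightarrow> r permutes {..<n}"
  using lam by (auto simp: row_stab_def col_stab_def)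

lemma rowop_add: "rowop lam (u + v) = rowop lam u + rowop lam v"
  by (simp add: rowop_def rho_add stab_perm sum.distrib)

lemma rowop_scale: "rowop lam (c *s v) = c *s rowop lam v"
  by (simp add: rowop_def rho_scale stab_perm scale_sum_right)

lemma colop_add: "colop lam (u + v) = colop lam u + colop lam v"
  by (simp add: colop_def rho_add stab_perm sum.distrib scale_right_distrib)

lemma colop_scale: "colop lam (c *s v) = c *s colop lam v"
  by (simp add: colop_def rho_scale stab_perm scale_sum_right mult.commute)

lemma young_add: "young lam (u + v) = young lam u + young lam v"
  by (simp add: young_def rowop_add colop_add)

lemma young_scale: "young lam (c *s v) = c *s young lam v"
  by (simp add: young_def rowop_scale colop_scale)

lemma young_zero: "young lam 0 = 0" using young_add[of 0 0] by simp

lemma young_sum: "young lam (sum f I) = (\<Sum>i\<in>I. young lam (f i))"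
  by (induction I rule: infinite_finite_induct) (auto simp: young_add young_zero)

lemma rowop_in: "invariant U \<Longrightarrow> u \<in> U \<Longrightarrow> rowop lam u \<in> U"
  unfolding rowop_def by (rule subspace_sum) (auto dest: invariantD stab_perm)

lemma colop_in: "invariant U \<Longrightarrow> u \<in> U \<Longrightarrow> colop lam u \<in> U"
  unfolding colop_def by (intro subspace_sum subspace_scale) (auto dest: invariantD stab_perm)

lemma young_in: "invariant U \<Longrightarrow> u \<in> U \<Longrightarrow> young lam u \<in> U"
  by (simp add: young_def rowop_in colop_in)

lemma rowop_rho: assumes "r \<in> row_stab lam" shows "rowop lam (rho r v) = rowop lam v"
proof -
  have "rowop lam (rho r v) = (\<Sum>q\<in>row_stab lam. rho (q \<circ> r) v)"
    unfolding rowop_def using assms by (intro sum.cong refl) (simp add: rho_comp stab_perm)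
  also have "\<dots> = (\<Sum>q\<in>row_stab lam. rho q v)"
    by (rule sum.reindex_bij_witness[of _ "\<lambda>q. q \<circ> pinv r" "\<lambda>q. q \<circ> r"])
      (use assms stab_perm(1)[OF assms] in \<open>auto simp: o_assoc[symmetric] permutes_inv_o intro: row_stab_comp row_stab_inv\<close>)
  finally show ?thesis by (simp add: rowop_def)
qed

lemma rho_rowop: assumes "r \<in> row_stab lam" shows "rho r (rowop lam v) = rowop lam v"
proof -
  have "rho r (rowop lam v) = (\<Sum>q\<in>row_stab lam. rho (r \<circ> q) v)"
    unfolding rowop_def using assms by (simp add: rho_sum rho_comp stab_perm)
  also have "\<dots> = (\<Sum>q\<in>row_stab lam. rho q v)"
    by (rule sum.reindex_bij_witness[of _ "\<lambda>q. pinv r \<circ> q" "\<lambda>q. r \<circ> q"])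
      (use assms stab_perm(1)[OF assms] in \<open>auto simp: o_assoc permutes_inv_o intro: row_stab_comp row_stab_inv\<close>)
  finally show ?thesis by (simp add: rowop_def)
qed

lemma rho_colop: assumes "t \<in> col_stab lam" shows "rho t (colop lam v) = of_int (sign t) *s colop lam v"
proof -
  note tp = stab_perm(2)[OF assms]
  have sg: "sign (t \<circ> q) = sign t * sign q" if "q \<in> col_stab lam" for q
    by (rule sign_compose) (use tp stab_perm(2)[OF that] in \<open>auto intro: permutes_imp_permutation\<close>)
  have "of_int (sign t) *s colop lam v = (\<Sum>q\<in>col_stab lam. of_int (sign t * sign q) *s rho q v)"
    by (simp add: colop_def scale_sum_right)
  also have "\<dots> = (\<Sum>q\<in>col_stab lam. of_int (sign t * sign (t \<circ> q)) *s rho (t \<circ> q) v)"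
    by (rule sum.reindex_bij_witness[of _ "\<lambda>q. t \<circ> q" "\<lambda>q. pinv t \<circ> q"])
      (use assms tp in \<open>auto simp: o_assoc permutes_inv_o intro: col_stab_comp col_stab_inv\<close>)
  also have "\<dots> = (\<Sum>q\<in>col_stab lam. of_int (sign q) *s rho t (rho q v))"
    using tp by (intro sum.cong refl)
      (simp add: sg rho_comp stab_perm mult.assoc[symmetric] sign_idempotent flip: of_int_mult)
  also have "\<dots> = rho t (colop lam v)"
    using tp by (simp add: colop_def rho_sum rho_scale)
  finally show ?thesis ..
qed

end

text \<open>The row transposition \<open>t\<close> is absorbed by \<open>rowop\<close>, while on the
  other side of \<open>s\<close> it becomes the column transposition \<open>t'\<close> and yields
  the sign -1. So the value equals its negative, and 2 is invertible.\<close>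

lemma row_rho_col_zero:
  assumes lam: "sum_list lam = n" and mu: "sum_list mu = n" and s: "s permutes {..<n}"
    and tr: "\<not> transversal lam mu (pinv s)"
  shows "rowop lam (rho s (colop mu v)) = 0"
proof -
  obtain t t' where t: "t \<in> row_stab lam" "t' \<in> col_stab mu" "t \<circ> s = s \<circ> t'" "sign t' = -1"
    using not_transversal_swap[OF lam mu s tr] by blast
  note tp = stab_perm(1)[OF lam t(1)] and tp' = stab_perm(2)[OF mu t(2)]
  let ?w = "rowop lam (rho s (colop mu v))"
  have "?w = rowop lam (rho t (rho s (colop mu v)))" using rowop_rho[OF lam t(1)] by simp
  also have "rho t (rho s (colop mu v)) = rho s (rho t' (colop mu v))"
    unfolding rho_comp[OF tp s, symmetric] rho_comp[OF s tp', symmetric] t(3) ..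
  also have "\<dots> = (-1) *s rho s (colop mu v)"
    unfolding rho_colop[OF mu t(2)] rho_scale[OF s] t(4) by simp
  also have "rowop lam ((-1) *s rho s (colop mu v)) = (-1) *s ?w" by (rule rowop_scale[OF lam])
  finally have "?w = (-1) *s ?w" .
  moreover have "(2::'f) *s ?w = ?w - (-1) *s ?w" using scale_left_distrib[of 1 1 ?w] by simp
  ultimately have "(2::'f) *s ?w = 0" by simp
  then show ?thesis by simp
qed

text \<open>If \<open>s\<close> is a row permutation times a column permutation, the first is
  absorbed and the second yields its sign; otherwise the value is 0.\<close>

lemma row_rho_col_same:
  assumes lam: "partition_of lam n" and s: "s permutes {..<n}"
  shows "\<exists>c. \<forall>v. rowop lam (rho s (colop lam v)) = c *s young lam v"
proof (cases "transversal lam lam (pinv s)")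
  case False
  have "rowop lam (rho s (colop lam v)) = 0 *s young lam v" for v
    using row_rho_col_zero[OF _ _ s False] lam by (simp add: partition_of_def)
  then show ?thesis by blast
next
  case True
  have n: "sum_list lam = n" using lam by (simp add: partition_of_def)
  obtain r c where rc: "r \<in> row_stab lam" "c \<in> col_stab lam" "s = r \<circ> c"
    using transversal_factor[OF lam s True] by blast
  have "rowop lam (rho s (colop lam v)) = of_int (sign c) *s young lam v" for v
  proof -
    have "rho s (colop lam v) = rho r (of_int (sign c) *s colop lam v)"
      unfolding rc(3) rho_comp[OF stab_perm(1)[OF n rc(1)] stab_perm(2)[OF n rc(2)]] rho_colop[OF n rc(2)] ..
    then show ?thesis using rowop_rho[OF n rc(1)] rowop_scale[OF n] by (simp add: young_def)
  qed
  then show ?thesis by blast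
qed

lemma rho_central: assumes "t permutes {..<n}" shows "rho t (central lam v) = central lam (rho t v)"
proof -
  have "rho t (central lam v) = (\<Sum>\<sigma>\<in>Sym n. rho (t \<circ> \<sigma>) (young lam (rho (pinv (t \<circ> \<sigma>)) (rho t v))))"
    unfolding central_def rho_sum[OF assms]
  proof (intro sum.cong refl)
    fix \<sigma> assume "\<sigma> \<in> Sym n"
    then have s: "\<sigma> permutes {..<n}" by simp
    have "pinv (t \<circ> \<sigma>) = pinv \<sigma> \<circ> pinv t" using s assms by (intro o_inv_distrib permutes_bij)
    then show "rho t (rho \<sigma> (young lam (rho (pinv \<sigma>) v))) = rho (t \<circ> \<sigma>) (young lam (rho (pinv (t \<circ> \<sigma>)) (rho t v)))"
      using s assms by (simp add: rho_comp permutes_inv rho_inv)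
  qed
  also have "\<dots> = central lam (rho t v)" unfolding central_def by (rule sum_perm_comp_left[OF assms])
  finally show ?thesis .
qed

context
  fixes lam assumes lam: "sum_list lam = n"
begin

lemma central_add: "central lam (u + v) = central lam u + central lam v"
  by (simp add: central_def rho_add permutes_inv young_add[OF lam] sum.distrib)

lemma central_scale: "central lam (c *s v) = c *s central lam v"
  by (simp add: central_def rho_scale permutes_inv young_scale[OF lam] scale_sum_right)

lemma central_zero: "central lam 0 = 0" using central_add[of 0 0] by simp

lemma central_sum: "central lam (sum f I) = (\<Sum>i\<in>I. central lam (f i))"
  by (induction I rule: infinite_finite_induct) (auto simp: central_add central_zero)

lemma central_rowop: "sum_list mu = n \<Longrightarrow> central lam (rowop mu v) = rowop mu (central lam v)"
  by (simp add: rowop_def central_sum rho_central stab_perm)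

lemma central_colop: "sum_list mu = n \<Longrightarrow> central lam (colop mu v) = colop mu (central lam v)"
  by (simp add: colop_def central_sum central_scale rho_central stab_perm)

lemma central_young: "sum_list mu = n \<Longrightarrow> central lam (young mu v) = young mu (central lam v)"
  by (simp add: young_def central_rowop central_colop)

lemma central_grp: "central lam (grp x v) = grp x (central lam v)"
  by (simp add: grp_def central_sum central_scale rho_central)

end

text \<open>Expanding the column sum of \<open>lam\<close> and the row sum of \<open>mu\<close>
  leaves terms of the form \<open>rowop lam (rho t (colop mu v))\<close>. A nonzero one would need a
  transversal, and a transversal forces dominance.\<close>

lemma young_young_zero:
  assumes "partition_of lam n" "partition_of mu n" "\<not> dominated lam mu" "s permutes {..<n}"
  shows "young lam (rho s (young mu v)) = 0"
proof -
  have l: "sum_list lam = n" "sum_list mu = n" using assms by (auto simp: partition_of_def)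
  have z: "rowop lam (rho t (colop mu v)) = 0" if "t permutes {..<n}" for t v
    using row_rho_col_zero[OF l that] transversal_dominated[OF l(1) assms(2) permutes_inv[OF that]] assms(3) by blast
  have zero: "rowop lam (0) = 0" using rowop_scale[OF l(1), of 0 0] by simp
  have rs: "rowop lam (sum f I) = (\<Sum>i\<in>I. rowop lam (f i))" for f I
    by (induction I rule: infinite_finite_induct) (auto simp: zero rowop_add l(1))
  have "young lam (rho s (young mu v)) = (\<Sum>c\<in>col_stab lam. \<Sum>r\<in>row_stab mu.
      of_int (sign c) *s rowop lam (rho (c \<circ> s \<circ> r) (colop mu v)))"
    unfolding young_def colop_def[of lam] rs
  proof (intro sum.cong refl)
    fix c assume c: "c \<in> col_stab lam"
    have cp: "c permutes {..<n}" using stab_perm(2)[OF l(1) c] .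
    have "rho c (rho s (rowop mu (colop mu v))) = (\<Sum>r\<in>row_stab mu. rho (c \<circ> s \<circ> r) (colop mu v))"
      unfolding rowop_def using cp assms(4) stab_perm(1)[OF l(2)]
      by (simp add: rho_sum rho_comp permutes_compose)
    then show "rowop lam (of_int (sign c) *s rho c (rho s (rowop mu (colop mu v)))) =
        (\<Sum>r\<in>row_stab mu. of_int (sign c) *s rowop lam (rho (c \<circ> s \<circ> r) (colop mu v)))"
      by (simp add: rowop_scale[OF l(1)] rs scale_sum_right)
  qed
  also have "\<dots> = 0"
  proof (intro sum.neutral ballI)
    fix c r assume "c \<in> col_stab lam" "r \<in> row_stab mu"
    then have "c \<circ> s \<circ> r permutes {..<n}"
      using assms(4) stab_perm(2)[OF l(1)] stab_perm(1)[OF l(2)] by (intro permutes_compose) auto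
    then show "of_int (sign c) *s rowop lam (rho (c \<circ> s \<circ> r) (colop mu v)) = 0" using z by simp
  qed
  finally show ?thesis .
qed

text \<open>The same expansion for a single shape: every term is a multiple of
  \<open>young lam v\<close> with a factor that does not depend on \<open>v\<close>. Irreducibility
  rests on this relation.\<close>

lemma young_young_same:
  assumes "partition_of lam n" "s permutes {..<n}"
  shows "\<exists>k. \<forall>v. young lam (rho s (young lam v)) = k *s young lam v"
proof -
  have l: "sum_list lam = n" using assms by (auto simp: partition_of_def)
  have "\<forall>t\<in>Sym n. \<exists>k. \<forall>v. rowop lam (rho t (colop lam v)) = k *s young lam v"
    using row_rho_col_same[OF assms(1)] by blast
  then obtain k where k: "\<And>t v. t permutes {..<n} \<Longrightarrow> rowop lam (rho t (colop lam v)) = k t *s young lam v"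
    by (metis mem_Collect_eq)
  have zero: "rowop lam (0) = 0" using rowop_scale[OF l(1), of 0 0] by simp
  have rs: "rowop lam (sum f I) = (\<Sum>i\<in>I. rowop lam (f i))" for f I
    by (induction I rule: infinite_finite_induct) (auto simp: zero rowop_add l(1))
  have "young lam (rho s (young lam v)) = (\<Sum>c\<in>col_stab lam. \<Sum>r\<in>row_stab lam.
      of_int (sign c) *s (k (c \<circ> s \<circ> r) *s young lam v))" for v
    unfolding young_def[of lam "rho s _"] colop_def[of lam "rho s _"] rs
  proof (intro sum.cong refl)
    fix c assume c: "c \<in> col_stab lam"
    have cp: "c permutes {..<n}" using stab_perm(2)[OF l(1) c] .
    have "rho c (rho s (rowop lam (colop lam v))) = (\<Sum>r\<in>row_stab lam. rho (c \<circ> s \<circ> r) (colop lam v))"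
      unfolding rowop_def using cp assms(2) stab_perm(1)[OF l(1)]
      by (simp add: rho_sum rho_comp permutes_compose)
    then have "rowop lam (of_int (sign c) *s rho c (rho s (young lam v))) =
        (\<Sum>r\<in>row_stab lam. of_int (sign c) *s rowop lam (rho (c \<circ> s \<circ> r) (colop lam v)))"
      by (simp add: rowop_scale[OF l(1)] rs scale_sum_right young_def)
    also have "\<dots> = (\<Sum>r\<in>row_stab lam. of_int (sign c) *s (k (c \<circ> s \<circ> r) *s young lam v))"
      using assms(2) stab_perm[OF l(1)] cp by (intro sum.cong refl) (simp add: k permutes_compose)
    finally show "rowop lam (of_int (sign c) *s rho c (rho s (young lam v))) =
      (\<Sum>r\<in>row_stab lam. of_int (sign c) *s (k (c \<circ> s \<circ> r) *s young lam v))" .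
  qed
  then have "young lam (rho s (young lam v)) = (\<Sum>c\<in>col_stab lam. \<Sum>r\<in>row_stab lam.
      of_int (sign c) * k (c \<circ> s \<circ> r)) *s young lam v" for v
    by (simp add: scale_sum_left)
  then show ?thesis by blast
qed

text \<open>Different shapes cannot dominate each other, so one of the two products of symmetrizers
  vanishes. If it is the product with \<open>mu\<close> on the left, centrality first moves
  \<open>central lam\<close> to the inside.\<close>

lemma central_young_zero:
  assumes "partition_of lam n" "partition_of mu n" "lam \<noteq> mu"
  shows "central lam (young mu v) = 0"
proof -
  have l: "sum_list lam = n" "sum_list mu = n" using assms by (auto simp: partition_of_def)
  consider "\<not> dominated lam mu" | "\<not> dominated mu lam"
    using dominated_antisym assms by blast
  then show ?thesis
  proof cases
    case 1
    then show ?thesis unfolding central_def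
      by (intro sum.neutral) (auto simp: young_young_zero[OF assms(1,2)] permutes_inv rho_zero)
  next
    case 2
    have "young mu (central lam v) = (\<Sum>\<sigma>\<in>Sym n. young mu (rho \<sigma> (young lam (rho (pinv \<sigma>) v))))"
      by (simp add: central_def young_sum[OF l(2)])
    also have "\<dots> = 0" by (intro sum.neutral) (auto simp: young_young_zero[OF assms(2,1) 2])
    finally show ?thesis by (simp add: central_young[OF l])
  qed
qed

lemma central_central_zero:
  assumes "partition_of lam n" "partition_of mu n" "lam \<noteq> mu"
  shows "central lam (central mu v) = 0"
proof -
  have l: "sum_list lam = n" "sum_list mu = n" using assms by (auto simp: partition_of_def)
  have "central lam (central mu v) = (\<Sum>\<sigma>\<in>Sym n. rho \<sigma> (central lam (young mu (rho (pinv \<sigma>) v))))"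
    unfolding central_def[of mu] by (simp add: central_sum[OF l(1)] rho_central)
  then show ?thesis by (simp add: central_young_zero[OF assms] rho_zero)
qed

end

section \<open>Linear algebra\<close>

context vector_space
begin

lemma independent_family:
  assumes "finite I" and ind: "\<And>k. (\<Sum>i\<in>I. scale (k i) (f i)) = 0 \<Longrightarrow> \<forall>i\<in>I. k i = 0"
  shows "inj_on f I" "independent (f ` I)"
proof -
  show inj: "inj_on f I"
  proof (rule inj_onI, rule ccontr)
    fix i j assume ij: "i \<in> I" "j \<in> I" "f i = f j" "i \<noteq> j"
    let ?k = "\<lambda>l. if l = i then 1 else if l = j then -1 else (0::'a)"
    have "(\<Sum>l\<in>I. scale (?k l) (f l)) = (\<Sum>l\<in>I. (if l = i then f i else 0) + (if l = j then - f i else 0))"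
      using ij by (intro sum.cong refl) auto
    also have "\<dots> = 0" using assms(1) ij by (simp add: sum.distrib)
    finally have "?k i = 0" using ind[of ?k] ij(1) by blast
    then show False by simp
  qed
  show "independent (f ` I)"
  proof
    assume "dependent (f ` I)"
    then obtain u where u: "\<exists>v\<in>f ` I. u v \<noteq> 0" "(\<Sum>v\<in>f ` I. scale (u v) v) = 0"
      using dependent_finite[of "f ` I"] assms(1) by auto
    then have "(\<Sum>i\<in>I. scale (u (f i)) (f i)) = 0" by (simp add: sum.reindex[OF inj])
    from ind[OF this] u(1) show False by auto
  qed
qed

text \<open>The dimension is at most the number of separating functionals, by induction: the kernel
  of one functional in \<open>U\<close> is separated by the others, and one vector outside the
  kernel completes a spanning set.\<close>

lemma separated_span:
  assumes "finite Z" "subspace U"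
    and add: "\<And>z u v. z \<in> Z \<Longrightarrow> \<phi> z (u + v) = \<phi> z u + \<phi> z v"
    and scl: "\<And>z c v. z \<in> Z \<Longrightarrow> \<phi> z (scale c v) = c * \<phi> z v"
    and sep: "\<And>u. u \<in> U \<Longrightarrow> (\<And>z. z \<in> Z \<Longrightarrow> \<phi> z u = 0) \<Longrightarrow> u = 0"
  shows "\<exists>B\<subseteq>U. finite B \<and> card B \<le> card Z \<and> U \<subseteq> span B"
  using assms
proof (induction Z arbitrary: U rule: finite_induct)
  case empty
  then have "U \<subseteq> {0}" by auto
  then show ?case by (intro exI[of _ "{}"]) (auto simp: span_empty)
next
  case (insert z Z)
  let ?U = "{u\<in>U. \<phi> z u = 0}"
  have z0: "\<phi> z 0 = 0" using insert.prems(3)[of z 0 0] by simp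
  have "subspace ?U"
    using insert.prems(1) z0 insert.prems(2,3)[of z]
    by (auto simp: subspace_def)
  then have "\<exists>B\<subseteq>?U. finite B \<and> card B \<le> card Z \<and> ?U \<subseteq> span B"
  proof (rule insert.IH)
    fix u assume u: "u \<in> ?U" "\<And>z. z \<in> Z \<Longrightarrow> \<phi> z u = 0"
    show "u = 0" by (rule insert.prems(4)) (use u in auto)
  qed (use insert.prems(2,3) in auto)
  then obtain B where B: "B \<subseteq> ?U" "finite B" "card B \<le> card Z" "?U \<subseteq> span B" by blast
  show ?case
  proof (cases "\<exists>u\<in>U. \<phi> z u \<noteq> 0")
    case False
    then have "U \<subseteq> span B" using B(4) by blast
    then show ?thesis using B insert.hyps by (intro exI[of _ B]) auto
  next
    case True
    then obtain u where u: "u \<in> U" "\<phi> z u \<noteq> 0" by blast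
    have "v \<in> span (insert u B)" if v: "v \<in> U" for v
    proof -
      let ?c = "\<phi> z v / \<phi> z u"
      let ?w = "v + scale (- ?c) u"
      have "?w \<in> U" using insert.prems(1) u(1) v by (intro subspace_add subspace_scale)
      moreover have "\<phi> z ?w = 0"
        unfolding insert.prems(2)[OF insertI1] insert.prems(3)[OF insertI1] using u(2) by simp
      ultimately have "?w \<in> span B" using B(4) by blast
      then have "?w \<in> span (insert u B)" by (meson span_mono subset_insertI subsetD)
      moreover have "scale ?c u \<in> span (insert u B)" by (intro span_scale span_base) simp
      ultimately have "?w + scale ?c u \<in> span (insert u B)" by (rule span_add)
      then show ?thesis by simp
    qed
    then show ?thesis using B u insert.hyps
      by (intro exI[of _ "insert u B"]) (auto simp: card_insert_if)
  qed
qed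

end

lemma vector_space_fun: "vector_space (\<lambda>(c::'f::field) (f::'b \<Rightarrow> 'f) x. c * f x)"
  by unfold_locales (auto simp: algebra_simps fun_eq_iff)

section \<open>The regular representation\<close>

lemma lookup_lin_ext:
  fixes p :: "'k \<Rightarrow>\<^sub>0 'f::field"
  assumes "inj g" shows "Poly_Mapping.lookup (lin_ext g p) (g k) = Poly_Mapping.lookup p k"
proof -
  have "Poly_Mapping.lookup (lin_ext g p) (g k) = (\<Sum>l\<in>Poly_Mapping.keys p. Poly_Mapping.lookup (Poly_Mapping.single (g l) (Poly_Mapping.lookup p l)) (g k))"
    by (simp add: lin_ext_def Poly_Mapping.lookup_sum)
  also have "\<dots> = (\<Sum>l\<in>Poly_Mapping.keys p. if l = k then Poly_Mapping.lookup p k else 0)"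
    using assms by (intro sum.cong refl) (auto simp: Poly_Mapping.lookup_single when_def inj_eq)
  also have "\<dots> = Poly_Mapping.lookup p k" by (auto simp: in_keys_iff)
  finally show ?thesis .
qed

lemma lookup_young_action:
  assumes "\<sigma> permutes {..<n}"
  shows "Poly_Mapping.lookup (young_action \<sigma> p) \<pi> = Poly_Mapping.lookup p (pinv \<sigma> \<circ> \<pi>)"
proof -
  have "inj (\<lambda>\<tau>. \<sigma> \<circ> \<tau>)" using permutes_inj[OF assms] by (auto simp: inj_on_def fun_eq_iff)
  from lookup_lin_ext[OF this, of p "pinv \<sigma> \<circ> \<pi>"] show ?thesis
    by (simp add: young_action_def o_assoc permutes_inv_o[OF assms])
qed

abbreviation pm_scale :: "'f::field \<Rightarrow> ('k \<Rightarrow>\<^sub>0 'f) \<Rightarrow> ('k \<Rightarrow>\<^sub>0 'f)" where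
  "pm_scale c \<equiv> Poly_Mapping.map ((*) c)"

lemma lookup_pm_scale [simp]: "Poly_Mapping.lookup (pm_scale c p) k = c * Poly_Mapping.lookup p k"
  by (simp add: Poly_Mapping.map.rep_eq when_def)

lemma vector_space_pm: "vector_space (pm_scale :: 'f::field \<Rightarrow> ('k \<Rightarrow>\<^sub>0 'f) \<Rightarrow> _)"
  by unfold_locales (auto simp: poly_mapping_eq_iff fun_eq_iff Poly_Mapping.lookup_add algebra_simps)

text \<open>The underlying type consists of the combinations of all functions on the naturals; the
  group algebra is its submodule generated by the identity.\<close>

lemma regular_rep: "Sn_rep (pm_scale :: 'f::field_char_0 \<Rightarrow> _) n young_action"
proof -
  interpret vector_space "pm_scale :: 'f \<Rightarrow> ((nat \<Rightarrow> nat) \<Rightarrow>\<^sub>0 'f) \<Rightarrow> _" by (rule vector_space_pm)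
  show ?thesis
  proof
    fix \<sigma> \<tau> :: "nat \<Rightarrow> nat" and u v :: "(nat \<Rightarrow> nat) \<Rightarrow>\<^sub>0 'f" and c
    assume s: "\<sigma> permutes {..<n}"
    show "young_action \<sigma> (u + v) = young_action \<sigma> u + young_action \<sigma> v"
      by (rule poly_mapping_eqI) (simp add: lookup_young_action[OF s] Poly_Mapping.lookup_add)
    show "young_action \<sigma> (pm_scale c v) = pm_scale c (young_action \<sigma> v)"
      by (rule poly_mapping_eqI) (simp add: lookup_young_action[OF s])
    assume t: "\<tau> permutes {..<n}"
    show "young_action (\<sigma> \<circ> \<tau>) v = young_action \<sigma> (young_action \<tau> v)"
      by (rule poly_mapping_eqI)
        (simp add: lookup_young_action[OF s] lookup_young_action[OF t] o_assoc
          lookup_young_action[OF permutes_compose[OF t s]] o_inv_distrib permutes_bij[OF s] permutes_bij[OF t])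
  next
    fix v :: "(nat \<Rightarrow> nat) \<Rightarrow>\<^sub>0 'f"
    show "young_action id v = v"
      by (rule poly_mapping_eqI) (simp add: lookup_young_action[OF permutes_id[of "{..<n}"]])
  qed
qed

section \<open>The central elements\<close>

text \<open>The coefficient of \<open>\<pi>\<close> in the central element: a signed count of the
  ways to write it as a conjugate of a row permutation times a column permutation. It is kept as an
  integer so that a sum of squares can be seen to be positive before passing to the field.\<close>

definition zeta :: "nat list \<Rightarrow> (nat \<Rightarrow> nat) \<Rightarrow> int" where
  "zeta lam \<pi> = (\<Sum>(\<sigma>, r, c)\<in>Sym (sum_list lam) \<times> row_stab lam \<times> col_stab lam.
     if \<sigma> \<circ> r \<circ> c \<circ> pinv \<sigma> = \<pi> then sign c else 0)"

lemma zeta_conj: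
  assumes t: "t permutes {..<sum_list lam}"
  shows "zeta lam (t \<circ> \<pi> \<circ> pinv t) = zeta lam \<pi>"
  unfolding zeta_def
proof (rule sum.reindex_bij_witness[of _ "\<lambda>(\<sigma>, r, c). (t \<circ> \<sigma>, r, c)" "\<lambda>(\<sigma>, r, c). (pinv t \<circ> \<sigma>, r, c)"], goal_cases)
  case (1 a) then show ?case using t by (auto simp: o_assoc permutes_inv_o)
next
  case (2 a) then show ?case using t by (auto intro: permutes_compose permutes_inv)
next
  case (3 a) then show ?case using t by (auto simp: o_assoc permutes_inv_o)
next
  case (4 a) then show ?case using t by (auto intro: permutes_compose permutes_inv)
next
  case (5 a)
  obtain \<sigma> r c where a: "a = (\<sigma>, r, c)" by (cases a)
  then have s: "\<sigma> permutes {..<sum_list lam}" using 5 by simp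
  let ?x = "\<sigma> \<circ> r \<circ> c \<circ> pinv \<sigma>"
  have "pinv (pinv t \<circ> \<sigma>) = pinv \<sigma> \<circ> t"
    using o_inv_distrib[of "pinv t" \<sigma>] permutes_bij[OF permutes_inv[OF t]] permutes_bij[OF s]
    by (simp add: permutes_inv_inv[OF t])
  then have e: "pinv t \<circ> \<sigma> \<circ> r \<circ> c \<circ> pinv (pinv t \<circ> \<sigma>) = pinv t \<circ> ?x \<circ> t" by (simp add: o_assoc)
  have "pinv t \<circ> ?x \<circ> t = \<pi> \<longleftrightarrow> ?x = t \<circ> \<pi> \<circ> pinv t"
  proof
    assume "pinv t \<circ> ?x \<circ> t = \<pi>"
    then have "t \<circ> \<pi> \<circ> pinv t = (t \<circ> pinv t) \<circ> ?x \<circ> (t \<circ> pinv t)" by (auto simp: o_assoc)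
    then show "?x = t \<circ> \<pi> \<circ> pinv t" by (simp add: permutes_inv_o[OF t])
  next
    assume "?x = t \<circ> \<pi> \<circ> pinv t"
    then have "pinv t \<circ> ?x \<circ> t = (pinv t \<circ> t) \<circ> \<pi> \<circ> (pinv t \<circ> t)" by (simp only: o_assoc)
    then show "pinv t \<circ> ?x \<circ> t = \<pi>" by (simp add: permutes_inv_o[OF t])
  qed
  then show ?case unfolding a by (simp add: e)
qed

text \<open>The inverse of \<open>\<sigma> r c \<sigma>^-1\<close> is the conjugate of
  \<open>r^-1 c^-1\<close> by \<open>\<sigma> c^-1\<close>, and \<open>c^-1\<close> has the sign of
  \<open>c\<close>. This is an involution on the index triples.\<close>

lemma zeta_inv:
  assumes p: "\<pi> permutes {..<sum_list lam}"
  shows "zeta lam (pinv \<pi>) = zeta lam \<pi>"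
  unfolding zeta_def
proof (rule sum.reindex_bij_witness[of _ "\<lambda>(\<sigma>, r, c). (\<sigma> \<circ> pinv c, pinv r, pinv c)" "\<lambda>(\<sigma>, r, c). (\<sigma> \<circ> pinv c, pinv r, pinv c)"], goal_cases)
  case (1 a) then show ?case
    by (auto simp: o_assoc[symmetric] permutes_inv_o permutes_inv_inv dest!: row_stab_permutes col_stab_permutes)
next
  case (2 a) then show ?case
    by (auto intro: row_stab_inv col_stab_inv intro!: permutes_compose[OF permutes_inv[OF col_stab_permutes]])
next
  case (3 a) then show ?case
    by (auto simp: o_assoc[symmetric] permutes_inv_o permutes_inv_inv dest!: row_stab_permutes col_stab_permutes)
next
  case (4 a) then show ?case
    by (auto intro: row_stab_inv col_stab_inv intro!: permutes_compose[OF permutes_inv[OF col_stab_permutes]])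
next
  case (5 a)
  obtain \<sigma> r c where a: "a = (\<sigma>, r, c)" by (cases a)
  then have s: "\<sigma> permutes {..<sum_list lam}" and r: "r permutes {..<sum_list lam}"
    and c: "c permutes {..<sum_list lam}"
    using 5 by (auto dest: row_stab_permutes col_stab_permutes)
  let ?x = "\<sigma> \<circ> r \<circ> c \<circ> pinv \<sigma>"
  have b: "bij \<sigma>" "bij r" "bij c" using s r c by (auto intro: permutes_bij)
  have bi: "bij (pinv c)" "bij (pinv r)" "bij (pinv \<sigma>)" using b by (auto intro: bij_imp_bij_inv)
  have "pinv (\<sigma> \<circ> pinv c) = c \<circ> pinv \<sigma>"
    using o_inv_distrib[OF b(1) bi(1)] by (simp add: permutes_inv_inv[OF c])
  then have "(\<sigma> \<circ> pinv c) \<circ> pinv r \<circ> pinv c \<circ> pinv (\<sigma> \<circ> pinv c) = \<sigma> \<circ> pinv c \<circ> pinv r \<circ> (pinv c \<circ> c) \<circ> pinv \<sigma>"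
    by (simp add: o_assoc)
  also have "\<dots> = \<sigma> \<circ> pinv c \<circ> pinv r \<circ> pinv \<sigma>" by (simp add: permutes_inv_o[OF c])
  also have "\<dots> = pinv ?x"
  proof -
    have "pinv ?x = pinv (pinv \<sigma>) \<circ> (pinv c \<circ> (pinv r \<circ> pinv \<sigma>))"
      using b bi by (simp add: o_inv_distrib bij_comp)
    then show ?thesis by (simp add: o_assoc permutes_inv_inv[OF s])
  qed
  finally have e: "(\<sigma> \<circ> pinv c) \<circ> pinv r \<circ> pinv c \<circ> pinv (\<sigma> \<circ> pinv c) = pinv ?x" .
  have xp: "?x permutes {..<sum_list lam}" using s r c by (intro permutes_compose permutes_inv)
  have "pinv ?x = \<pi> \<longleftrightarrow> ?x = pinv \<pi>" using permutes_inv_inv[OF xp] permutes_inv_inv[OF p] by auto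
  moreover have "sign (pinv c) = sign c" using c by (intro sign_inverse permutes_imp_permutation) auto
  ultimately show ?case unfolding a by (simp add: e)
qed

lemma row_col_stab_comp_id:
  assumes "r \<in> row_stab lam" "c \<in> col_stab lam"
  shows "r \<circ> c = id \<longleftrightarrow> r = id \<and> c = id"
proof
  assume rc: "r \<circ> c = id"
  then have "r = pinv c" using col_stab_permutes[OF assms(2)]
    by (metis comp_id o_assoc id_comp permutes_inv_o(1))
  then have "r \<in> col_stab lam" using col_stab_inv[OF assms(2)] by simp
  then have "r = id" using row_col_stab_inter assms(1) by blast
  then show "r = id \<and> c = id" using rc by simp
qed simp

text \<open>A row permutation that is also a column permutation is trivial, so only
  \<open>r = c = id\<close> contributes, once for every \<open>\<sigma>\<close>.\<close>

lemma zeta_id: "zeta lam id = fact (sum_list lam)"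
proof -
  have "zeta lam id = (\<Sum>\<sigma>\<in>Sym (sum_list lam). \<Sum>r\<in>row_stab lam. \<Sum>c\<in>col_stab lam.
      if \<sigma> \<circ> r \<circ> c \<circ> pinv \<sigma> = id then sign c else 0)"
    unfolding zeta_def by (simp add: sum.cartesian_product)
  also have "\<dots> = (\<Sum>\<sigma>\<in>Sym (sum_list lam). \<Sum>r\<in>row_stab lam. if r = id then 1 else 0)"
  proof (intro sum.cong refl)
    fix \<sigma> r assume "\<sigma> \<in> Sym (sum_list lam)" and r: "r \<in> row_stab lam"
    then have s: "\<sigma> permutes {..<sum_list lam}" by simp
    have "\<sigma> \<circ> r \<circ> c \<circ> pinv \<sigma> = id \<longleftrightarrow> r = id \<and> c = id" if c: "c \<in> col_stab lam" for c
    proof -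
      have "\<sigma> \<circ> r \<circ> c \<circ> pinv \<sigma> = id \<longleftrightarrow> r \<circ> c = id"
      proof
        assume "\<sigma> \<circ> r \<circ> c \<circ> pinv \<sigma> = id"
        then have "pinv \<sigma> \<circ> (\<sigma> \<circ> r \<circ> c \<circ> pinv \<sigma>) \<circ> \<sigma> = id" by (simp add: permutes_inv_o[OF s])
        then have "(pinv \<sigma> \<circ> \<sigma>) \<circ> r \<circ> c \<circ> (pinv \<sigma> \<circ> \<sigma>) = id" by (simp only: o_assoc)
        then show "r \<circ> c = id" by (simp add: permutes_inv_o[OF s])
      next
        assume rc: "r \<circ> c = id"
        have "\<sigma> \<circ> r \<circ> c \<circ> pinv \<sigma> = \<sigma> \<circ> (r \<circ> c) \<circ> pinv \<sigma>" by (simp only: o_assoc)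
        then show "\<sigma> \<circ> r \<circ> c \<circ> pinv \<sigma> = id" by (simp add: rc permutes_inv_o[OF s])
      qed
      then show ?thesis using row_col_stab_comp_id[OF r c] by simp
    qed
    then have "(\<Sum>c\<in>col_stab lam. if \<sigma> \<circ> r \<circ> c \<circ> pinv \<sigma> = id then sign c else 0) =
        (\<Sum>c\<in>col_stab lam. if c = id then (if r = id then 1 else 0) else (0::int))"
      by (intro sum.cong refl) (auto simp: sign_id)
    then show "(\<Sum>c\<in>col_stab lam. if \<sigma> \<circ> r \<circ> c \<circ> pinv \<sigma> = id then sign c else 0) = (if r = id then 1 else 0)"
      by (simp add: col_stab_id)
  qed
  also have "\<dots> = of_nat (card (Sym (sum_list lam)))" by (simp add: row_stab_id)
  finally show ?thesis by (simp add: card_permutations[of "{..<sum_list lam}", OF refl])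
qed

lemma (in Sn_rep) central_eq_grp:
  assumes lam: "sum_list lam = n"
  shows "central lam v = grp (\<lambda>\<pi>. of_int (zeta lam \<pi>)) v"
proof -
  let ?I = "Sym n \<times> row_stab lam \<times> col_stab lam"
  let ?g = "\<lambda>(\<sigma>, r, c). \<sigma> \<circ> r \<circ> c \<circ> pinv \<sigma>" and ?w = "\<lambda>(\<sigma>, r, c). of_int (sign c) :: 'f"
  have "central lam v = (\<Sum>\<sigma>\<in>Sym n. \<Sum>r\<in>row_stab lam. \<Sum>c\<in>col_stab lam. ?w (\<sigma>, r, c) *s rho (?g (\<sigma>, r, c)) v)"
    unfolding central_def young_def rowop_def colop_def
  proof (intro sum.cong refl)
    fix \<sigma> assume "\<sigma> \<in> Sym n"
    then have s: "\<sigma> permutes {..<n}" by simp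
    show "rho \<sigma> (\<Sum>r\<in>row_stab lam. rho r (\<Sum>c\<in>col_stab lam. of_int (sign c) *s rho c (rho (pinv \<sigma>) v))) =
      (\<Sum>r\<in>row_stab lam. \<Sum>c\<in>col_stab lam. ?w (\<sigma>, r, c) *s rho (?g (\<sigma>, r, c)) v)"
      using s stab_perm[OF lam]
      by (simp add: rho_sum rho_scale rho_comp permutes_compose permutes_inv)
  qed
  also have "\<dots> = (\<Sum>x\<in>?I. ?w x *s rho (?g x) v)"
    by (simp add: sum.cartesian_product case_prod_unfold)
  also have "\<dots> = (\<Sum>x\<in>?I. \<Sum>\<pi>\<in>Sym n. (if ?g x = \<pi> then ?w x else 0) *s rho \<pi> v)"
  proof (intro sum.cong refl)
    fix x assume "x \<in> ?I"
    then obtain \<sigma> r c where x: "x = (\<sigma>, r, c)" "\<sigma> permutes {..<n}" "r \<in> row_stab lam" "c \<in> col_stab lam" by auto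
    then have "?g x permutes {..<n}" using stab_perm[OF lam] by (auto intro!: permutes_compose permutes_inv)
    moreover have "(\<Sum>\<pi>\<in>Sym n. (if ?g x = \<pi> then ?w x else 0) *s rho \<pi> v) =
      (\<Sum>\<pi>\<in>Sym n. if ?g x = \<pi> then ?w x *s rho (?g x) v else 0)"
      by (intro sum.cong refl) auto
    ultimately show "?w x *s rho (?g x) v = (\<Sum>\<pi>\<in>Sym n. (if ?g x = \<pi> then ?w x else 0) *s rho \<pi> v)"
      by simp
  qed
  also have "\<dots> = (\<Sum>\<pi>\<in>Sym n. (\<Sum>x\<in>?I. if ?g x = \<pi> then ?w x else 0) *s rho \<pi> v)"
    by (subst sum.swap) (simp add: scale_sum_left)
  also have "\<dots> = grp (\<lambda>\<pi>. of_int (zeta lam \<pi>)) v"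
    unfolding grp_def zeta_def of_int_sum lam
    by (intro sum.cong refl arg_cong2[where f = scale]) auto
  finally show ?thesis .
qed

lemma lookup_grp:
  assumes "\<pi> permutes {..<n}"
  shows "Poly_Mapping.lookup (Sn_rep.grp pm_scale n young_action x v) \<pi> =
    (\<Sum>\<sigma>\<in>Sym n. x \<sigma> * Poly_Mapping.lookup v (pinv \<sigma> \<circ> \<pi>) :: 'f::field_char_0)"
proof -
  interpret Sn_rep "pm_scale :: 'f \<Rightarrow> _" n young_action by (rule regular_rep)
  show ?thesis unfolding grp_def Poly_Mapping.lookup_sum
    by (intro sum.cong refl) (simp add: lookup_young_action)
qed

lemma lookup_grp_one:
  assumes "\<pi> permutes {..<n}"
  shows "Poly_Mapping.lookup (Sn_rep.grp pm_scale n young_action x (Poly_Mapping.single id (1::'f::field_char_0))) \<pi> = x \<pi>"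
proof -
  have "Poly_Mapping.lookup (Sn_rep.grp pm_scale n young_action x (Poly_Mapping.single id (1::'f))) \<pi> =
    (\<Sum>\<sigma>\<in>Sym n. if \<sigma> = \<pi> then x \<pi> else 0)"
    unfolding lookup_grp[OF assms]
  proof (intro sum.cong refl)
    fix \<sigma> assume "\<sigma> \<in> Sym n"
    then have s: "\<sigma> permutes {..<n}" by simp
    have "pinv \<sigma> \<circ> \<pi> = id \<longleftrightarrow> \<sigma> = \<pi>"
    proof
      assume "pinv \<sigma> \<circ> \<pi> = id"
      then have "\<sigma> \<circ> pinv \<sigma> \<circ> \<pi> = \<sigma>" by (simp only: o_assoc[symmetric]) simp
      then show "\<sigma> = \<pi>" by (simp add: permutes_inv_o[OF s])
    qed (use s in \<open>auto simp: permutes_inv_o\<close>)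
    then show "x \<sigma> * Poly_Mapping.lookup (Poly_Mapping.single id (1::'f)) (pinv \<sigma> \<circ> \<pi>) = (if \<sigma> = \<pi> then x \<pi> else 0)"
      by (auto simp: Poly_Mapping.lookup_single when_def)
  qed
  also have "\<dots> = x \<pi>" using assms by simp
  finally show ?thesis .
qed

text \<open>Since \<open>zeta lam\<close> is invariant under inversion, the coefficient of the identity in the square of
  the central element is a sum of squares of integers.\<close>

lemma central_central_one_nonzero:
  assumes lam: "sum_list lam = n"
  shows "Sn_rep.central pm_scale n young_action lam (Sn_rep.central pm_scale n young_action lam
    (Poly_Mapping.single id (1::'f::field_char_0))) \<noteq> 0"
proof
  interpret Sn_rep "pm_scale :: 'f \<Rightarrow> _" n young_action by (rule regular_rep)
  assume "central lam (central lam (Poly_Mapping.single id (1::'f))) = 0"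
  then have "Poly_Mapping.lookup (grp (\<lambda>\<pi>. of_int (zeta lam \<pi>)) (grp (\<lambda>\<pi>. of_int (zeta lam \<pi>)) (Poly_Mapping.single id (1::'f)))) id = 0"
    by (simp add: central_eq_grp[OF lam])
  also have "Poly_Mapping.lookup (grp (\<lambda>\<pi>. of_int (zeta lam \<pi>)) (grp (\<lambda>\<pi>. of_int (zeta lam \<pi>)) (Poly_Mapping.single id (1::'f)))) id
    = (\<Sum>\<sigma>\<in>Sym n. of_int (zeta lam \<sigma>) * of_int (zeta lam (pinv \<sigma>)))"
    unfolding lookup_grp[OF permutes_id]
    by (intro sum.cong refl) (simp add: lookup_grp_one permutes_inv)
  also have "\<dots> = of_int (\<Sum>\<sigma>\<in>Sym n. (zeta lam \<sigma>)\<^sup>2)"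
    using zeta_inv[of _ lam] by (simp add: lam power2_eq_square)
  finally have "(of_int (\<Sum>\<sigma>\<in>Sym n. (zeta lam \<sigma>)\<^sup>2) :: 'f) = 0" .
  then have "(\<Sum>\<sigma>\<in>Sym n. (zeta lam \<sigma>)\<^sup>2) = 0" by (simp only: of_int_eq_0_iff)
  then have "\<forall>\<sigma>\<in>Sym n. (zeta lam \<sigma>)\<^sup>2 = 0" by (subst (asm) sum_nonneg_eq_0_iff) auto
  then have "zeta lam id = 0" by (simp add: permutes_id)
  then show False by (simp add: zeta_id)
qed

abbreviation Par :: "nat \<Rightarrow> nat list set" where
  "Par n \<equiv> {lam. partition_of lam n}"

lemma length_partition_le: "partition_of lam n \<Longrightarrow> length lam \<le> n"
proof -
  assume lam: "partition_of lam n"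
  have "length lam = (\<Sum>x\<leftarrow>lam. 1)" by (simp add: sum_list_triv)
  also have "\<dots> \<le> (\<Sum>x\<leftarrow>lam. x)"
    using lam by (intro sum_list_mono) (auto simp: partition_of_def Suc_le_eq intro: gr0I)
  finally show "length lam \<le> n" using lam by (simp add: partition_of_def)
qed

lemma finite_Par [simp]: "finite (Par n)"
proof (rule finite_subset)
  show "Par n \<subseteq> {xs. set xs \<subseteq> {..n} \<and> length xs \<le> n}"
    using length_partition_le by (auto simp: partition_of_def intro: member_le_sum_list)
  show "finite {xs. set xs \<subseteq> {..n} \<and> length xs \<le> n}" by (rule finite_lists_length_le) simp
qed

text \<open>Apply the relation to \<open>central mu\<close> of the identity: the terms of other
  shapes vanish by orthogonality, and the remaining product is nonzero.\<close>

lemma zeta_independent: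
  fixes k :: "nat list \<Rightarrow> 'f::field_char_0"
  assumes "\<And>\<pi>. \<pi> permutes {..<n} \<Longrightarrow> (\<Sum>lam\<in>Par n. k lam * of_int (zeta lam \<pi>)) = 0"
    and mu: "partition_of mu n"
  shows "k mu = 0"
proof -
  interpret Sn_rep "pm_scale :: 'f \<Rightarrow> _" n young_action by (rule regular_rep)
  have m: "sum_list mu = n" using mu by (simp add: partition_of_def)
  let ?w = "central mu (Poly_Mapping.single id (1::'f))"
  have "(\<Sum>lam\<in>Par n. pm_scale (k lam) (central lam ?w)) = grp (\<lambda>\<pi>. \<Sum>lam\<in>Par n. k lam * of_int (zeta lam \<pi>)) ?w"
  proof -
    have "(\<Sum>lam\<in>Par n. pm_scale (k lam) (central lam ?w)) =
      (\<Sum>lam\<in>Par n. \<Sum>\<pi>\<in>Sym n. pm_scale (k lam * of_int (zeta lam \<pi>)) (young_action \<pi> ?w))"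
    proof (intro sum.cong refl)
      fix lam assume "lam \<in> Par n"
      then have "central lam ?w = grp (\<lambda>\<pi>. of_int (zeta lam \<pi>)) ?w"
        by (intro central_eq_grp) (simp add: partition_of_def)
      then show "pm_scale (k lam) (central lam ?w) =
        (\<Sum>\<pi>\<in>Sym n. pm_scale (k lam * of_int (zeta lam \<pi>)) (young_action \<pi> ?w))"
        by (simp only: grp_scale_left) (simp only: grp_def)
    qed
    then show ?thesis unfolding grp_def scale_sum_left by (simp only: sum.swap[of _ "Par n"])
  qed
  also have "\<dots> = 0" unfolding grp_def by (intro sum.neutral) (use assms(1) in \<open>simp\<close>)
  finally have "(\<Sum>lam\<in>Par n. pm_scale (k lam) (central lam ?w)) = 0" .
  moreover have "(\<Sum>lam\<in>Par n. pm_scale (k lam) (central lam ?w)) =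
    (\<Sum>lam\<in>Par n. if lam = mu then pm_scale (k mu) (central mu ?w) else 0)"
    using mu by (intro sum.cong refl) (auto simp: central_central_zero)
  ultimately have "pm_scale (k mu) (central mu ?w) = 0" using mu by simp
  then show ?thesis using central_central_one_nonzero[OF m, where 'f = 'f] by simp
qed

text \<open>Class functions are determined by their values on the cycle types, so there are enough
  functions \<open>zeta lam\<close> to span them.\<close>

lemma zeta_spans:
  "\<exists>k :: nat list \<Rightarrow> 'f::field_char_0. \<forall>\<pi>. \<pi> permutes {..<n} \<longrightarrow>
     of_bool (\<pi> = id) = (\<Sum>lam\<in>Par n. k lam * of_int (zeta lam \<pi>))"
proof -
  interpret F: vector_space "\<lambda>(c::'f) (f::(nat \<Rightarrow> nat) \<Rightarrow> 'f) x. c * f x" by (rule vector_space_fun)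
  \<comment> \<open>The class functions, extended by 0 outside the permutations.\<close>
  define U where "U = {f :: (nat \<Rightarrow> nat) \<Rightarrow> 'f. (\<forall>\<pi>. \<not> \<pi> permutes {..<n} \<longrightarrow> f \<pi> = 0) \<and>
    (\<forall>\<pi> t. \<pi> permutes {..<n} \<longrightarrow> t permutes {..<n} \<longrightarrow> f (t \<circ> \<pi> \<circ> pinv t) = f \<pi>)}"
  define rep where "rep lam = (SOME \<pi>. \<pi> permutes {..<n} \<and> has_cycle_type {..<n} \<pi> lam)" for lam
  \<comment> \<open>Evaluation at one representative per cycle type separates class functions, so
    their space has dimension at most the number of partitions.\<close>
  have "\<exists>B\<subseteq>U. finite B \<and> card B \<le> card (Par n) \<and> U \<subseteq> F.span B"
  proof (rule F.separated_span[where \<phi> = "\<lambda>lam f. f (rep lam)"])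
    show "F.subspace U"
    proof (rule F.subspaceI)
      show "0 \<in> U" unfolding U_def by simp
      show "f + g \<in> U" if "f \<in> U" "g \<in> U" for f g
        using that unfolding U_def by simp
      show "(\<lambda>x. c * f x) \<in> U" if "f \<in> U" for c f
        using that unfolding U_def by simp
    qed
    fix f assume f: "f \<in> U" and z: "\<And>lam. lam \<in> Par n \<Longrightarrow> f (rep lam) = 0"
    have "f \<pi> = 0" for \<pi>
    proof (cases "\<pi> permutes {..<n}")
      case True
      obtain lam where lam: "partition_of lam n" "has_cycle_type {..<n} \<pi> lam"
        using has_cycle_type_ex[OF True] by auto
      have r: "rep lam permutes {..<n}" "has_cycle_type {..<n} (rep lam) lam"
        using someI[of "\<lambda>\<pi>. \<pi> permutes {..<n} \<and> has_cycle_type {..<n} \<pi> lam" \<pi>] True lam by (auto simp: rep_def)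
      obtain t where t: "t permutes {..<n}" "t \<circ> rep lam = \<pi> \<circ> t"
        using has_cycle_type_conj[OF r(2) lam(2) r(1) True] by blast
      have "t \<circ> rep lam \<circ> pinv t = \<pi>" unfolding t(2) by (simp add: o_assoc[symmetric] permutes_inv_o[OF t(1)])
      moreover have "f (t \<circ> rep lam \<circ> pinv t) = f (rep lam)"
        using f r(1) t(1) unfolding U_def by blast
      ultimately have "f \<pi> = f (rep lam)" by simp
      then show ?thesis using z lam by simp
    qed (use f in \<open>simp add: U_def\<close>)
    then show "f = 0" by (simp add: fun_eq_iff)
  qed simp_all
  then obtain B where B: "B \<subseteq> U" "finite B" "card B \<le> card (Par n)" "U \<subseteq> F.span B" by blast
  define g where "g lam \<pi> = (if \<pi> permutes {..<n} then of_int (zeta lam \<pi>) else 0 :: 'f)" for lam \<pi>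
  have sum_app: "(\<Sum>i\<in>I. h i) x = (\<Sum>i\<in>I. h i x)" for h :: "nat list \<Rightarrow> (nat \<Rightarrow> nat) \<Rightarrow> 'f" and I x
    by (induction I rule: infinite_finite_induct) auto
  have ind: "inj_on g (Par n)" "F.independent (g ` Par n)"
  proof -
    have fam: "\<forall>lam\<in>Par n. k lam = 0" if "(\<Sum>lam\<in>Par n. (\<lambda>x. k lam * g lam x)) = 0" for k
    proof
      fix mu assume "mu \<in> Par n"
      show "k mu = 0"
      proof (rule zeta_independent)
        fix \<pi> assume "\<pi> permutes {..<n}"
        then show "(\<Sum>lam\<in>Par n. k lam * of_int (zeta lam \<pi>)) = 0"
          using fun_cong[OF that, of \<pi>] by (simp add: sum_app g_def)
      qed (use \<open>mu \<in> Par n\<close> in simp)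
    qed
    show "inj_on g (Par n)" by (rule F.independent_family(1)[OF finite_Par fam])
    show "F.independent (g ` Par n)" by (rule F.independent_family(2)[OF finite_Par fam])
  qed
  have conj_perm: "t \<circ> \<pi> \<circ> pinv t permutes {..<n}" if "\<pi> permutes {..<n}" "t permutes {..<n}" for \<pi> t
    using that by (intro permutes_compose permutes_inv)
  have gU: "g ` Par n \<subseteq> U"
  proof safe
    fix lam assume "partition_of lam n"
    then have l: "sum_list lam = n" by (simp add: partition_of_def)
    show "g lam \<in> U" unfolding U_def
      using zeta_conj[of _ lam, unfolded l] conj_perm by (simp add: g_def)
  qed
  let ?d = "\<lambda>\<pi>. of_bool (\<pi> = id) :: 'f"
  have dU: "?d \<in> U"
  proof -
    have "t \<circ> \<pi> \<circ> pinv t = id \<longleftrightarrow> \<pi> = id" if t: "t permutes {..<n}" for t \<pi> :: "nat \<Rightarrow> nat"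
    proof
      assume "t \<circ> \<pi> \<circ> pinv t = id"
      then have "pinv t \<circ> (t \<circ> \<pi> \<circ> pinv t) \<circ> t = id" by (simp add: permutes_inv_o[OF t])
      then have "(pinv t \<circ> t) \<circ> \<pi> \<circ> (pinv t \<circ> t) = id" by (simp only: o_assoc)
      then show "\<pi> = id" by (simp add: permutes_inv_o[OF t])
    qed (simp add: permutes_inv_o[OF t])
    moreover have "\<pi> \<noteq> id" if "\<not> \<pi> permutes {..<n}" for \<pi> using that permutes_id by metis
    ultimately show ?thesis unfolding U_def by simp
  qed
  \<comment> \<open>Otherwise the delta function together with the functions \<open>g lam\<close>
    would be independent, one vector more than the dimension allows.\<close>
  have "?d \<in> F.span (g ` Par n)"
  proof (rule ccontr)
    assume no: "?d \<notin> F.span (g ` Par n)"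
    then have "F.independent (insert ?d (g ` Par n))" using F.independent_insertI[OF _ ind(2)] by blast
    moreover have "insert ?d (g ` Par n) \<subseteq> F.span B"
      by (rule subset_trans[OF _ B(4)], rule insert_subset[THEN iffD2], rule conjI[OF dU gU])
    ultimately have "card (insert ?d (g ` Par n)) \<le> card B"
      using F.independent_span_bound[OF B(2)] by blast
    moreover have "?d \<notin> g ` Par n" using no F.span_base[of ?d "g ` Par n"] by argo
    ultimately show False using B(3) ind(1) by (simp add: card_image)
  qed
  then have "?d \<in> range (\<lambda>u. \<Sum>f\<in>g ` Par n. (\<lambda>x. u f * f x))"
    unfolding F.span_finite[OF finite_imageI[OF finite_Par]] .
  then obtain u where u: "?d = (\<Sum>f\<in>g ` Par n. (\<lambda>x. u f * f x))" by (rule rangeE)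
  have d: "?d = (\<Sum>lam\<in>Par n. (\<lambda>x. u (g lam) * g lam x))"
    by (rule trans[OF u]) (simp only: sum.reindex[OF ind(1)] o_def)
  have "?d \<pi> = (\<Sum>lam\<in>Par n. u (g lam) * g lam \<pi>)" for \<pi>
    using fun_cong[OF d, of \<pi>] by (simp only: sum_app)
  then show ?thesis by (intro exI[of _ "\<lambda>lam. u (g lam)"]) (auto simp: g_def)
qed

section \<open>Complete reducibility and irreducible submodules\<close>

context Sn_rep
begin

text \<open>The delta function at the identity is a class function, hence a combination of the
  functions \<open>zeta lam\<close>. Read as an identity of operators, this splits every vector into
  one component for each shape.\<close>

lemma sum_central: "\<exists>k. \<forall>v. v = (\<Sum>lam\<in>Par n. k lam *s central lam v)"
proof -
  obtain k :: "nat list \<Rightarrow> 'f" where k: "\<And>\<pi>. \<pi> permutes {..<n} \<Longrightarrow>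
     of_bool (\<pi> = id) = (\<Sum>lam\<in>Par n. k lam * of_int (zeta lam \<pi>))" using zeta_spans by blast
  have "v = (\<Sum>lam\<in>Par n. k lam *s central lam v)" for v
  proof -
    have "(\<Sum>lam\<in>Par n. k lam *s central lam v) = (\<Sum>lam\<in>Par n. \<Sum>\<pi>\<in>Sym n. (k lam * of_int (zeta lam \<pi>)) *s rho \<pi> v)"
    proof (intro sum.cong refl)
      fix lam assume "lam \<in> Par n"
      then have "central lam v = grp (\<lambda>\<pi>. of_int (zeta lam \<pi>)) v"
        by (intro central_eq_grp) (simp add: partition_of_def)
      then show "k lam *s central lam v = (\<Sum>\<pi>\<in>Sym n. (k lam * of_int (zeta lam \<pi>)) *s rho \<pi> v)"
        by (simp only: grp_scale_left) (simp only: grp_def)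
    qed
    also have "\<dots> = grp (\<lambda>\<pi>. \<Sum>lam\<in>Par n. k lam * of_int (zeta lam \<pi>)) v"
      unfolding grp_def scale_sum_left by (rule sum.swap)
    also have "\<dots> = grp (\<lambda>\<pi>. of_bool (\<pi> = id)) v"
      unfolding grp_def by (intro sum.cong refl) (simp add: k)
    also have "\<dots> = v" by (rule grp_delta)
    finally show ?thesis by (rule sym)
  qed
  then show ?thesis by blast
qed

lemma central_orbit_zero:
  assumes "partition_of lam n" "partition_of mu n" "lam \<noteq> mu" "u \<in> orbit_span (young mu v)"
  shows "central lam u = 0"
proof -
  have l: "sum_list lam = n" using assms by (auto simp: partition_of_def)
  obtain x where "u = grp x (young mu v)" using assms(4) by (auto simp: orbit_span_def)
  then show ?thesis using central_young_zero[OF assms(1-3)] by (simp add: central_grp[OF l] grp_zero)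
qed

text \<open>If \<open>young lam\<close> annihilated \<open>U\<close>, so would
  \<open>central lam\<close>; for another shape \<open>central mu\<close> vanishes on everything
  generated by \<open>young lam v\<close>. Then \<open>sum_central\<close> would give
  \<open>U = {0}\<close>.\<close>

lemma young_orbit_nonzero:
  assumes lam: "partition_of lam n" and U: "invariant U" "U \<subseteq> orbit_span (young lam v)" "U \<noteq> {0}"
  shows "\<exists>u\<in>U. young lam u \<noteq> 0"
proof (rule ccontr)
  assume no: "\<not> ?thesis"
  obtain k where k: "\<And>v. v = (\<Sum>lam\<in>Par n. k lam *s central lam v)" using sum_central by blast
  have "u = 0" if u: "u \<in> U" for u
  proof -
    have "central mu u = 0" if mu: "mu \<in> Par n" for mu
    proof (cases "mu = lam")
      case True
      show ?thesis unfolding True central_def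
        using no u U(1) by (intro sum.neutral) (auto simp: invariantD permutes_inv rho_zero)
    next
      case False
      then show ?thesis using central_orbit_zero[OF _ lam False] mu u U(2) by blast
    qed
    then have "(\<Sum>lam\<in>Par n. k lam *s central lam u) = 0" by simp
    then show ?thesis using k[of u] by simp
  qed
  then have "U \<subseteq> {0}" by auto
  moreover have "0 \<in> U" using U(1) by (simp add: invariantD subspace_0)
  ultimately show False using U(3) by auto
qed

text \<open>Some \<open>young lam u\<close> with \<open>u\<close> in \<open>U\<close> is nonzero.
  Since \<open>u\<close> is a combination of translates of \<open>young lam v\<close>, this vector
  is a scalar multiple of the generator, which therefore lies in \<open>U\<close>.\<close>

lemma young_orbit_irreducible:
  assumes lam: "partition_of lam n" and U: "invariant U" "U \<subseteq> orbit_span (young lam v)" "U \<noteq> {0}"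
  shows "U = orbit_span (young lam v)"
proof -
  have l: "sum_list lam = n" using lam by (auto simp: partition_of_def)
  obtain u where u: "u \<in> U" "young lam u \<noteq> 0" using young_orbit_nonzero[OF assms] by blast
  obtain x where x: "u = grp x (young lam v)" using u U(2) by (auto simp: orbit_span_def)
  have "\<forall>\<sigma>\<in>Sym n. \<exists>k. young lam (rho \<sigma> (young lam v)) = k *s young lam v"
    using young_young_same[OF lam] by blast
  then obtain k where k: "\<And>\<sigma>. \<sigma> \<in> Sym n \<Longrightarrow> young lam (rho \<sigma> (young lam v)) = k \<sigma> *s young lam v" by metis
  have "young lam u = (\<Sum>\<sigma>\<in>Sym n. x \<sigma> *s young lam (rho \<sigma> (young lam v)))"
    unfolding x grp_def young_sum[OF l] young_scale[OF l] ..
  also have "\<dots> = (\<Sum>\<sigma>\<in>Sym n. x \<sigma> * k \<sigma>) *s young lam v"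
    unfolding scale_sum_left by (intro sum.cong refl) (simp add: k)
  finally have e: "young lam u = (\<Sum>\<sigma>\<in>Sym n. x \<sigma> * k \<sigma>) *s young lam v" (is "_ = ?K *s _") .
  then have "?K \<noteq> 0" using u(2) by auto
  then have "young lam v = inverse ?K *s young lam u" unfolding e by simp
  moreover have "inverse ?K *s young lam u \<in> U"
    using young_in[OF l U(1) u(1)] U(1) by (intro subspace_scale) (auto simp: invariantD)
  ultimately show ?thesis using orbit_span_le[OF U(1)] U(2) by auto
qed

end

text \<open>The coefficient at the identity is 1, because \<open>r \<circ> c = id\<close> holds only
  for the trivial pair.\<close>

lemma young_one_nonzero:
  assumes lam: "sum_list lam = n"
  shows "Sn_rep.young pm_scale young_action lam (Poly_Mapping.single id (1::'f::field_char_0)) \<noteq> 0"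
proof
  interpret Sn_rep "pm_scale :: 'f \<Rightarrow> _" n young_action by (rule regular_rep)
  let ?e = "Poly_Mapping.single id (1::'f) :: (nat \<Rightarrow> nat) \<Rightarrow>\<^sub>0 'f"
  assume "young lam ?e = 0"
  have lk: "Poly_Mapping.lookup (young_action (r \<circ> c) ?e) id = of_bool (r = id \<and> c = id)"
    if "r \<in> row_stab lam" "c \<in> col_stab lam" for r c
  proof -
    have p: "r \<circ> c permutes {..<n}" using stab_perm[OF lam] that by (intro permutes_compose) auto
    have "pinv (r \<circ> c) = id \<longleftrightarrow> r \<circ> c = id" using permutes_inv_inv[OF p] by (metis inv_id)
    then show ?thesis using row_col_stab_comp_id[OF that]
      by (simp add: lookup_young_action[OF p] Poly_Mapping.lookup_single when_def eq_commute[of id])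
  qed
  have "young lam ?e = (\<Sum>r\<in>row_stab lam. \<Sum>c\<in>col_stab lam. pm_scale (of_int (sign c)) (young_action (r \<circ> c) ?e))"
    unfolding young_def rowop_def colop_def
    by (intro sum.cong refl) (simp add: rho_sum rho_scale stab_perm[OF lam] rho_comp)
  then have "Poly_Mapping.lookup (young lam ?e) id = (\<Sum>r\<in>row_stab lam. \<Sum>c\<in>col_stab lam. of_int (sign c) * of_bool (r = id \<and> c = id))"
    by (simp add: Poly_Mapping.lookup_sum lk)
  also have "\<dots> = (\<Sum>r\<in>row_stab lam. \<Sum>c\<in>col_stab lam. if c = id then of_bool (r = id) else 0)"
    by (intro sum.cong refl) (auto simp: sign_id)
  also have "\<dots> = (\<Sum>r\<in>row_stab lam. if r = id then 1 else 0)"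
    by (intro sum.cong refl) (simp add: col_stab_id)
  also have "\<dots> = 1" by (simp add: row_stab_id)
  finally show False using \<open>young lam ?e = 0\<close> by simp
qed

context Sn_rep
begin

definition irreducible :: "'v set \<Rightarrow> bool" where
  "irreducible U \<longleftrightarrow> invariant U \<and> U \<noteq> {0} \<and> (\<forall>W. invariant W \<longrightarrow> W \<subseteq> U \<longrightarrow> W = {0} \<or> W = U)"

lemma young_orbit_irreducible':
  "partition_of lam n \<Longrightarrow> young lam v \<noteq> 0 \<Longrightarrow> irreducible (orbit_span (young lam v))"
  unfolding irreducible_def
  using orbit_span_invariant orbit_span_self young_orbit_irreducible by blast

lemma invariant_span_Union:
  assumes "\<And>U. U \<in> \<G> \<Longrightarrow> invariant U"
  shows "invariant (span (\<Union>\<G>))"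
  unfolding invariant_def
proof (intro conjI ballI)
  show "subspace (span (\<Union>\<G>))" by (rule subspace_span)
  fix \<sigma> u assume s: "\<sigma> \<in> Sym n" and u: "u \<in> span (\<Union>\<G>)"
  from u show "rho \<sigma> u \<in> span (\<Union>\<G>)"
  proof (induction rule: span_induct_alt)
    case base
    show ?case using s by (simp add: rho_zero span_zero)
  next
    case (step c x y)
    then have "rho \<sigma> x \<in> \<Union>\<G>" using assms s by (auto dest: invariantD)
    then have "c *s rho \<sigma> x + rho \<sigma> y \<in> span (\<Union>\<G>)"
      using step.IH by (intro span_add span_scale) (auto intro: span_base)
    then show ?case using s by (simp add: rho_add rho_scale)
  qed
qed

lemma span_Union_sum:
  assumes "finite \<G>" "\<And>U. U \<in> \<G> \<Longrightarrow> subspace U" "v \<in> span (\<Union>\<G>)"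
  shows "\<exists>f. (\<forall>U\<in>\<G>. f U \<in> U) \<and> v = (\<Sum>U\<in>\<G>. f U)"
  using assms
proof (induction \<G> arbitrary: v rule: finite_induct)
  case empty
  then show ?case by simp
next
  case (insert W \<G>)
  have "v \<in> span (W \<union> \<Union>\<G>)" using insert.prems(2) by simp
  then obtain x y where xy: "v = x + y" "x \<in> span W" "y \<in> span (\<Union>\<G>)"
    unfolding span_Un by blast
  have xW: "x \<in> W" using xy(2) insert.prems(1)[of W] by (simp add: span_eq_iff[THEN iffD2])
  obtain f where f: "\<forall>U\<in>\<G>. f U \<in> U" "y = (\<Sum>U\<in>\<G>. f U)"
    using insert.IH[OF _ xy(3)] insert.prems(1) by auto
  have "(\<Sum>U\<in>\<G>. (f(W := x)) U) = y"
    unfolding f(2) using insert.hyps(2) by (intro sum.cong refl) auto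
  then show ?case using f xW xy(1) insert.hyps by (intro exI[of _ "f(W := x)"]) auto
qed

text \<open>By \<open>sum_central\<close> each spanning vector \<open>b\<close> is a combination of
  translates of the vectors \<open>young lam (rho (pinv \<sigma>) b)\<close>. There are finitely
  many of these, and each nonzero one generates an irreducible submodule.\<close>

lemma spanned_by_young_orbits:
  assumes P: "invariant P" and B: "finite B" "B \<subseteq> P" "P \<subseteq> span B"
  shows "\<exists>\<G>. finite \<G> \<and> (\<forall>U\<in>\<G>. irreducible U \<and> U \<subseteq> P) \<and> P \<subseteq> span (\<Union>\<G>)"
proof -
  define g where "g = (\<lambda>(lam, \<sigma>, b). young lam (rho \<sigma> b))"
  define \<G> where "\<G> = {orbit_span (g x) |x. x \<in> Par n \<times> Sym n \<times> B \<and> g x \<noteq> 0}"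
  have fin: "finite \<G>"
  proof (rule finite_subset)
    show "\<G> \<subseteq> (\<lambda>x. orbit_span (g x)) ` (Par n \<times> Sym n \<times> B)" by (auto simp: \<G>_def)
    show "finite ((\<lambda>x. orbit_span (g x)) ` (Par n \<times> Sym n \<times> B))" using B(1) by simp
  qed
  have ir: "irreducible U \<and> U \<subseteq> P" if "U \<in> \<G>" for U
  proof -
    from that obtain lam \<sigma> b where U: "U = orbit_span (young lam (rho \<sigma> b))" "partition_of lam n"
      "\<sigma> permutes {..<n}" "b \<in> B" "young lam (rho \<sigma> b) \<noteq> 0" by (auto simp: \<G>_def g_def)
    have "young lam (rho \<sigma> b) \<in> P"
      using U B(2) P by (intro young_in invariantD) (auto simp: partition_of_def)
    then show ?thesis using young_orbit_irreducible'[OF U(2,5)] orbit_span_le[OF P] U(1) by auto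
  qed
  have inv: "invariant (span (\<Union>\<G>))"
    using ir by (intro invariant_span_Union) (auto simp: irreducible_def)
  obtain k where k: "\<And>v. v = (\<Sum>lam\<in>Par n. k lam *s central lam v)" using sum_central by blast
  have g: "g x \<in> span (\<Union>\<G>)" if "x \<in> Par n \<times> Sym n \<times> B" for x
  proof (cases "g x = 0")
    case True
    then show ?thesis by (simp add: span_zero)
  next
    case False
    then have "orbit_span (g x) \<in> \<G>" using that by (auto simp: \<G>_def)
    then show ?thesis using orbit_span_self[of "g x"] by (intro span_base) auto
  qed
  have "b \<in> span (\<Union>\<G>)" if b: "b \<in> B" for b
  proof -
    have "k lam *s central lam b \<in> span (\<Union>\<G>)" if lam: "lam \<in> Par n" for lam
      unfolding central_def
    proof (intro span_scale span_sum)
      fix \<sigma> assume s: "\<sigma> \<in> Sym n"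
      have "young lam (rho (pinv \<sigma>) b) \<in> span (\<Union>\<G>)"
        using g[of "(lam, pinv \<sigma>, b)"] lam s b by (simp add: g_def permutes_inv)
      then show "rho \<sigma> (young lam (rho (pinv \<sigma>) b)) \<in> span (\<Union>\<G>)" using invariantD(2)[OF inv] s by simp
    qed
    then have "(\<Sum>lam\<in>Par n. k lam *s central lam b) \<in> span (\<Union>\<G>)" by (rule span_sum)
    then show ?thesis using k[of b] by simp
  qed
  then have "span B \<subseteq> span (\<Union>\<G>)" by (intro span_minimal subspace_span) auto
  then have "P \<subseteq> span (\<Union>\<G>)" using B(3) by blast
  with fin ir show ?thesis by blast
qed

text \<open>A minimal family of irreducible submodules whose sum is \<open>P\<close> has a direct sum.\<close>

lemma irreducible_decomposition:
  assumes P: "invariant P" and B: "finite B" "B \<subseteq> P" "P \<subseteq> span B"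
  shows "\<exists>r N. (\<forall>i<r. irreducible (N i) \<and> N i \<subseteq> P) \<and>
    (\<forall>v\<in>P. \<exists>!f. f \<in> (\<Pi>\<^sub>E i\<in>{..<r::nat}. N i) \<and> v = (\<Sum>i<r. f i))"
proof -
  define Q where "Q = (\<lambda>\<G>. finite \<G> \<and> (\<forall>U\<in>\<G>. irreducible U \<and> U \<subseteq> P) \<and> P \<subseteq> span (\<Union>\<G>))"
  obtain \<G> where \<G>: "Q \<G>" and min: "\<And>\<H>. Q \<H> \<Longrightarrow> card \<G> \<le> card \<H>"
  proof -
    obtain \<G>0 where "Q \<G>0" using spanned_by_young_orbits[OF assms] unfolding Q_def by blast
    then show thesis using ex_has_least_nat[of Q \<G>0 card] that by blast
  qed
  have fin: "finite \<G>" and ir: "\<And>U. U \<in> \<G> \<Longrightarrow> irreducible U" "\<And>U. U \<in> \<G> \<Longrightarrow> U \<subseteq> P"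
    and sp: "P \<subseteq> span (\<Union>\<G>)" using \<G> by (auto simp: Q_def)
  have iv: "invariant U" if "U \<in> \<G>" for U using ir(1)[OF that] by (simp add: irreducible_def)
  have sub: "subspace U" if "U \<in> \<G>" for U using iv[OF that] by (rule invariantD)
  \<comment> \<open>Two different decompositions of a vector would make \<open>U0\<close> meet the
    span of the other members nontrivially; being irreducible, \<open>U0\<close> would lie in that
    span and could be removed, against minimality.\<close>
  have uniq: "f U0 = g U0"
    if f: "\<forall>U\<in>\<G>. f U \<in> U" and g: "\<forall>U\<in>\<G>. g U \<in> U" and e: "(\<Sum>U\<in>\<G>. f U) = (\<Sum>U\<in>\<G>. g U)" and U0: "U0 \<in> \<G>" for f g U0
  proof (rule ccontr)
    assume ne: "f U0 \<noteq> g U0"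
    let ?S = "span (\<Union>(\<G> - {U0}))"
    have iS: "invariant ?S" using iv by (intro invariant_span_Union) auto
    let ?W = "U0 \<inter> ?S"
    have "invariant ?W" using iS iv[OF U0]
      unfolding invariant_def by (simp add: subspace_inter)
    moreover have "f U0 - g U0 \<in> ?W"
    proof
      show "f U0 - g U0 \<in> U0" using subspace_diff[OF sub[OF U0]] f g U0 by blast
      have "f U0 - g U0 = (\<Sum>U\<in>\<G> - {U0}. g U - f U)"
        using e unfolding sum.remove[OF fin U0] sum_subtractf by (simp add: algebra_simps)
      also have "\<dots> \<in> ?S"
      proof (rule span_sum)
        fix U assume U: "U \<in> \<G> - {U0}"
        then have "g U - f U \<in> U" using subspace_diff[OF sub] f g by blast
        then show "g U - f U \<in> ?S" using U by (intro span_base) blast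
      qed
      finally show "f U0 - g U0 \<in> ?S" .
    qed
    then have "?W \<noteq> {0}" using ne by (metis right_minus_eq singletonD)
    ultimately have "?W = U0" using ir(1)[OF U0] unfolding irreducible_def by blast
    have "U \<subseteq> ?S" if U: "U \<in> \<G>" for U
    proof (cases "U = U0")
      case True
      then show ?thesis using \<open>?W = U0\<close> by blast
    next
      case False
      then show ?thesis using U by (intro subset_trans[OF _ span_superset]) blast
    qed
    then have "\<Union>\<G> \<subseteq> ?S" by (rule Union_least)
    then have "span (\<Union>\<G>) \<subseteq> ?S" by (rule span_minimal) (rule subspace_span)
    then have "P \<subseteq> ?S" using sp by (rule subset_trans[rotated])
    moreover have "finite (\<G> - {U0})" using fin by simp
    moreover have "\<forall>U\<in>\<G> - {U0}. irreducible U \<and> U \<subseteq> P" using ir by simp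
    ultimately have "Q (\<G> - {U0})" unfolding Q_def by blast
    from min[OF this] show False using card_Diff1_less[OF fin U0] by simp
  qed
  obtain h where h: "bij_betw h {0..<card \<G>} \<G>" using ex_bij_betw_nat_finite[OF fin] by blast
  let ?r = "card \<G>"
  have h': "bij_betw h {..<?r} \<G>" using h by (simp add: atLeast0LessThan)
  have hG: "h i \<in> \<G>" if "i < ?r" for i using bij_betwE[OF h'] that by blast
  have "\<exists>!f. f \<in> (\<Pi>\<^sub>E i\<in>{..<?r}. h i) \<and> v = (\<Sum>i<?r. f i)" if v: "v \<in> P" for v
  proof -
    obtain F where F: "\<forall>U\<in>\<G>. F U \<in> U" "v = (\<Sum>U\<in>\<G>. F U)"
      using span_Union_sum[OF fin sub] v sp by blast
    let ?f = "\<lambda>i\<in>{..<?r}. F (h i)"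
    show ?thesis
    proof (rule ex1I[of _ ?f])
      have "v = (\<Sum>i<?r. F (h i))" using F(2) sum.reindex_bij_betw[OF h', of F] by simp
      moreover have "F (h i) \<in> h i" if "i < ?r" for i using F(1) hG[OF that] by blast
      ultimately show "?f \<in> (\<Pi>\<^sub>E i\<in>{..<?r}. h i) \<and> v = (\<Sum>i<?r. ?f i)" by simp
      fix f assume f: "f \<in> (\<Pi>\<^sub>E i\<in>{..<?r}. h i) \<and> v = (\<Sum>i<?r. f i)"
      define G where "G U = f (inv_into {..<?r} h U)" for U
      have Gh: "G (h i) = f i" if "i < ?r" for i
        using that h' by (simp add: G_def bij_betw_inv_into_left)
      have "(\<Sum>U\<in>\<G>. G U) = (\<Sum>i<?r. G (h i))" by (rule sum.reindex_bij_betw[OF h', symmetric])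
      then have "(\<Sum>U\<in>\<G>. G U) = (\<Sum>U\<in>\<G>. F U)" using f F(2) Gh by simp
      moreover have "\<forall>U\<in>\<G>. G U \<in> U"
      proof
        fix U assume "U \<in> \<G>"
        then obtain i where "i < ?r" "U = h i" using h' by (auto simp: bij_betw_def)
        then show "G U \<in> U" using PiE_mem[OF conjunct1[OF f], of i] Gh by simp
      qed
      ultimately have GF: "G U = F U" if "U \<in> \<G>" for U using uniq[of G F U] F(1) that by blast
      have fF: "f i = F (h i)" if "i < ?r" for i
        using GF[OF hG[OF that]] Gh[OF that] by simp
      show "f = ?f"
      proof
        fix i
        show "f i = ?f i"
        proof (cases "i < ?r")
          case False
          then have "f i = undefined" using f by (intro PiE_arb[of f "{..<?r}" h]) auto
          then show ?thesis using False by simp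
        qed (simp add: fF)
      qed
    qed
  qed
  moreover have "\<forall>i<?r. irreducible (h i) \<and> h i \<subseteq> P" using ir hG by blast
  ultimately show ?thesis by blast
qed

end

text \<open>Linearity and equivariance of \<open>T\<close> are assumed only on an invariant
  subspace, because an isomorphism of submodules is controlled only there.\<close>

lemma equivariant_young:
  assumes "Sn_rep sc1 n rho1" "Sn_rep sc2 n rho2" and U: "Sn_rep.invariant sc1 n rho1 U"
    and add: "\<And>u v. u \<in> U \<Longrightarrow> v \<in> U \<Longrightarrow> T (u + v) = T u + T v"
    and scl: "\<And>c u. u \<in> U \<Longrightarrow> T (sc1 c u) = sc2 c (T u)"
    and eqv: "\<And>\<sigma> u. \<sigma> permutes {..<n} \<Longrightarrow> u \<in> U \<Longrightarrow> T (rho1 \<sigma> u) = rho2 \<sigma> (T u)"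
    and lam: "sum_list lam = n" and u: "u \<in> U"
  shows "T (Sn_rep.young sc1 rho1 lam u) = Sn_rep.young sc2 rho2 lam (T u)"
    and "T (Sn_rep.grp sc1 n rho1 x u) = Sn_rep.grp sc2 n rho2 x (T u)"
proof -
  interpret A: Sn_rep sc1 n rho1 by fact
  interpret B: Sn_rep sc2 n rho2 by fact
  have sU: "A.subspace U" using U by (rule A.invariantD)
  have "sc1 0 u \<in> U" using A.subspace_scale[OF sU u] .
  have T0: "T 0 = 0" using scl[OF u, of 0] by simp
  have Tsum: "T (sum f I) = (\<Sum>i\<in>I. T (f i))" if "\<And>i. i \<in> I \<Longrightarrow> f i \<in> U" for f and I :: "(nat \<Rightarrow> nat) set"
    using that
  proof (induction I rule: infinite_finite_induct)
    case (insert i I)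
    then show ?case using A.subspace_sum[OF sU, of I f] by (simp add: add)
  qed (auto simp: T0)
  have rU: "rho1 \<sigma> u \<in> U" if "\<sigma> permutes {..<n}" "u \<in> U" for \<sigma> u using A.invariantD(2)[OF U that] .
  have c: "T (A.colop lam u) = B.colop lam (T u)"
    unfolding A.colop_def B.colop_def
    by (subst Tsum) (auto simp: scl eqv rU u A.stab_perm[OF lam] intro!: A.subspace_scale[OF sU])
  have cu: "A.colop lam u \<in> U" by (rule A.colop_in[OF lam U u])
  show "T (A.young lam u) = B.young lam (T u)"
    unfolding A.young_def B.young_def c[symmetric] A.rowop_def B.rowop_def
    by (subst Tsum) (auto simp: eqv rU cu A.stab_perm[OF lam])
  show "T (A.grp x u) = B.grp x (T u)"
    unfolding A.grp_def B.grp_def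
    by (subst Tsum) (auto simp: scl eqv rU u intro!: A.subspace_scale[OF sU])
qed

section \<open>The modules M(lam)\<close>

lemma bilin_ext_grp:
  fixes p q :: "(nat \<Rightarrow> nat) \<Rightarrow>\<^sub>0 'f::field_char_0"
  assumes "Poly_Mapping.keys p \<subseteq> Sym n"
  shows "bilin_ext (\<circ>) p q = Sn_rep.grp pm_scale n young_action (Poly_Mapping.lookup p) q"
proof -
  interpret Sn_rep "pm_scale :: 'f \<Rightarrow> _" n young_action by (rule regular_rep)
  have sc: "pm_scale c (Poly_Mapping.single k d) = Poly_Mapping.single k (c * d)" for c d :: 'f and k :: "nat \<Rightarrow> nat"
    by (rule poly_mapping_eqI) (simp add: Poly_Mapping.lookup_single when_def)
  have "bilin_ext (\<circ>) p q = (\<Sum>k\<in>Poly_Mapping.keys p. pm_scale (Poly_Mapping.lookup p k) (young_action k q))"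
    unfolding bilin_ext_def young_action_def lin_ext_def scale_sum_right sc ..
  also have "\<dots> = (\<Sum>k\<in>Sym n. pm_scale (Poly_Mapping.lookup p k) (young_action k q))"
    using assms by (intro sum.mono_neutral_left) (auto simp: Poly_Mapping.in_keys_iff)
  finally show ?thesis by (simp add: grp_def)
qed

abbreviation sym_one :: "(nat \<Rightarrow> nat) \<Rightarrow>\<^sub>0 'f::field_char_0" where
  "sym_one \<equiv> Poly_Mapping.single id 1"

lemma young_action_one: "young_action \<sigma> (sym_one :: _ \<Rightarrow>\<^sub>0 'f::field_char_0) = Poly_Mapping.single \<sigma> 1"
  by (simp add: young_action_def lin_ext_def)

text \<open>Links the element that defines \<open>M(lam)\<close> to the operator calculus:
  multiplying by the row symmetrizer from the left is \<open>rowop\<close>, and the column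
  antisymmetrizer is \<open>colop\<close> of the identity.\<close>

lemma young_symmetrizer_eq:
  assumes lam: "sum_list lam = n"
  shows "(young_symmetrizer lam :: _ \<Rightarrow>\<^sub>0 'f::field_char_0) = Sn_rep.young pm_scale young_action lam sym_one"
proof -
  interpret Sn_rep "pm_scale :: 'f \<Rightarrow> _" n young_action by (rule regular_rep)
  have sc: "pm_scale c (Poly_Mapping.single k d) = Poly_Mapping.single k (c * d)" for c d :: 'f and k :: "nat \<Rightarrow> nat"
    by (rule poly_mapping_eqI) (simp add: Poly_Mapping.lookup_single when_def)
  have r: "(row_symmetrizer lam :: _ \<Rightarrow>\<^sub>0 'f) = (\<Sum>\<sigma>\<in>row_stab lam. Poly_Mapping.single \<sigma> 1)"
    unfolding row_symmetrizer_def row_stab_eq ..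
  have c: "(col_antisymmetrizer lam :: _ \<Rightarrow>\<^sub>0 'f) = colop lam sym_one"
    unfolding col_antisymmetrizer_def col_stab_eq[symmetric] colop_def young_action_one sc by simp
  have lk: "Poly_Mapping.lookup (row_symmetrizer lam :: _ \<Rightarrow>\<^sub>0 'f) \<sigma> = of_bool (\<sigma> \<in> row_stab lam)" for \<sigma>
    unfolding r Poly_Mapping.lookup_sum by (simp add: Poly_Mapping.lookup_single when_def of_bool_def)
  have rs: "row_stab lam \<subseteq> Sym n" using stab_perm[OF lam] by auto
  then have k: "Poly_Mapping.keys (row_symmetrizer lam :: _ \<Rightarrow>\<^sub>0 'f) \<subseteq> Sym n"
    by (auto simp: Poly_Mapping.in_keys_iff lk)
  have "young_symmetrizer lam = bilin_ext (\<circ>) (row_symmetrizer lam) (col_antisymmetrizer lam :: _ \<Rightarrow>\<^sub>0 'f)"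
    by (simp add: young_symmetrizer_def free_alg_def)
  also have "\<dots> = (\<Sum>\<sigma>\<in>Sym n. pm_scale (of_bool (\<sigma> \<in> row_stab lam)) (young_action \<sigma> (colop lam sym_one)))"
    unfolding bilin_ext_grp[OF k] c grp_def lk ..
  also have "\<dots> = (\<Sum>\<sigma>\<in>row_stab lam. young_action \<sigma> (colop lam sym_one))"
    using rs by (intro sum.mono_neutral_cong_right) auto
  finally show ?thesis by (simp add: young_def rowop_def)
qed

lemma carrier_young_module:
  assumes lam: "sum_list lam = n"
  shows "carrier (young_module lam :: ('f::field_char_0, _) module) =
    Sn_rep.orbit_span pm_scale n young_action (Sn_rep.young pm_scale young_action lam sym_one)"
proof -
  interpret Sn_rep "pm_scale :: 'f \<Rightarrow> _" n young_action by (rule regular_rep)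
  let ?e = "young lam sym_one"
  have "carrier (young_module lam :: ('f, _) module) = {bilin_ext (\<circ>) a ?e |a. Poly_Mapping.keys a \<subseteq> Sym n}"
    unfolding young_module_def Let_def young_symmetrizer_eq[OF lam] lam by (simp add: free_alg_def)
  also have "\<dots> = orbit_span ?e"
  proof safe
    fix a :: "(nat \<Rightarrow> nat) \<Rightarrow>\<^sub>0 'f" assume "Poly_Mapping.keys a \<subseteq> Sym n"
    then show "bilin_ext (\<circ>) a ?e \<in> orbit_span ?e" by (simp add: bilin_ext_grp orbit_span_def)
  next
    fix u assume "u \<in> orbit_span ?e"
    then obtain x where x: "u = grp x ?e" by (auto simp: orbit_span_def)
    define a where "a = (\<Sum>\<sigma>\<in>Sym n. Poly_Mapping.single \<sigma> (x \<sigma>))"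
    have lk: "Poly_Mapping.lookup a \<sigma> = (if \<sigma> \<in> Sym n then x \<sigma> else 0)" for \<sigma>
      unfolding a_def Poly_Mapping.lookup_sum by (simp add: Poly_Mapping.lookup_single when_def)
    then have k: "Poly_Mapping.keys a \<subseteq> Sym n" by (auto simp: Poly_Mapping.in_keys_iff split: if_splits)
    have "bilin_ext (\<circ>) a ?e = u"
      unfolding bilin_ext_grp[OF k] x grp_def by (intro sum.cong refl) (simp add: lk)
    then show "\<exists>a. u = bilin_ext (\<circ>) a ?e \<and> Poly_Mapping.keys a \<subseteq> Sym n" using k by blast
  qed
  finally show ?thesis .
qed

lemma young_module_simps:
  "add (young_module lam :: ('f::field_char_0, _) module) = (+)"
  "module.smult (young_module lam :: ('f::field_char_0, _) module) = pm_scale"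
  by (simp_all add: young_module_def Let_def free_alg_def)

text \<open>The interface between the two formalisms: it moves multiplicities and dimensions of the carrier-based
  modules of the definitions to subspaces of a vector space on a type.\<close>

locale Sn_model = Sn_rep scale n rho
  for scale :: "'f::field_char_0 \<Rightarrow> 'v::ab_group_add \<Rightarrow> 'v" (infixr "*s" 75) and n rho +
  fixes V :: "('f, 'w) module" and tau :: "(nat \<Rightarrow> nat) \<Rightarrow> 'w \<Rightarrow> 'w" and Th :: "'w \<Rightarrow> 'v" and P :: "'v set"
  assumes module_V: "Module.module class_ring V"
    and Th_bij: "bij_betw Th (carrier V) P"
    and Th_add: "x \<in> carrier V \<Longrightarrow> y \<in> carrier V \<Longrightarrow> Th (x \<oplus>\<^bsub>V\<^esub> y) = Th x + Th y"
    and Th_smult: "x \<in> carrier V \<Longrightarrow> Th (c \<odot>\<^bsub>V\<^esub> x) = c *s Th x"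
    and Th_tau: "\<sigma> permutes {..<n} \<Longrightarrow> x \<in> carrier V \<Longrightarrow> tau \<sigma> x \<in> carrier V \<and> Th (tau \<sigma> x) = rho \<sigma> (Th x)"
    and P_inv: "invariant P"
    and P_fin: "\<exists>B. finite B \<and> B \<subseteq> P \<and> P \<subseteq> span B"
begin

interpretation V: Module.module class_ring V
  rewrites "carrier class_ring = UNIV" by (rule module_V) simp

lemma Th_mem: "x \<in> carrier V \<Longrightarrow> Th x \<in> P" using Th_bij by (auto simp: bij_betw_def)

lemma Th_inj: "x \<in> carrier V \<Longrightarrow> y \<in> carrier V \<Longrightarrow> Th x = Th y \<Longrightarrow> x = y"
  using Th_bij by (auto simp: bij_betw_def inj_on_def)

lemma Th_surj: "v \<in> P \<Longrightarrow> \<exists>x\<in>carrier V. Th x = v" using Th_bij by (auto simp: bij_betw_def)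

lemma Th_zero: "Th \<zero>\<^bsub>V\<^esub> = 0"
  using Th_add[of "\<zero>\<^bsub>V\<^esub>" "\<zero>\<^bsub>V\<^esub>"] by simp

lemma Th_finsum: "(\<And>i. i \<in> I \<Longrightarrow> f i \<in> carrier V) \<Longrightarrow> Th (finsum V f I) = (\<Sum>i\<in>I. Th (f i))"
proof (induction I rule: infinite_finite_induct)
  case (insert i I)
  then have "f \<in> I \<rightarrow> carrier V" by blast
  then have "Th (finsum V f (insert i I)) = Th (f i \<oplus>\<^bsub>V\<^esub> finsum V f I)"
    using insert by (subst V.finsum_insert) auto
  also have "\<dots> = Th (f i) + Th (finsum V f I)"
    using insert.prems by (intro Th_add V.finsum_closed) auto
  finally show ?case using insert by simp
qed (simp_all add: Th_zero)

lemma Th_zero_iff: "x \<in> carrier V \<Longrightarrow> Th x = 0 \<longleftrightarrow> x = \<zero>\<^bsub>V\<^esub>"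
  using Th_inj[of x "\<zero>\<^bsub>V\<^esub>"] Th_zero by auto

lemma Sn_submodule_iff:
  "Sn_submodule n V tau N \<longleftrightarrow> N \<subseteq> carrier V \<and> invariant (Th ` N)"
proof
  assume s: "Sn_submodule n V tau N"
  then have sm: "submodule class_ring N V" and t: "\<And>\<sigma>. \<sigma> permutes {..<n} \<Longrightarrow> tau \<sigma> ` N \<subseteq> N"
    by (auto simp: Sn_submodule_def)
  interpret N: submodule class_ring N V by (rule sm)
  have sub: "N \<subseteq> carrier V" by (rule N.subset)
  have "subspace (Th ` N)"
  proof (rule subspaceI)
    show "0 \<in> Th ` N" using N.zero_closed Th_zero by (metis imageI)
  next
    fix a b assume "a \<in> Th ` N" "b \<in> Th ` N"
    then obtain x y where xy: "x \<in> N" "y \<in> N" "a = Th x" "b = Th y" by blast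
    then have "a + b = Th (x \<oplus>\<^bsub>V\<^esub> y)" using Th_add sub by (metis subsetD)
    then show "a + b \<in> Th ` N" using N.m_closed xy by blast
  next
    fix c a assume "a \<in> Th ` N"
    then obtain x where x: "x \<in> N" "a = Th x" by blast
    then have "c *s a = Th (c \<odot>\<^bsub>V\<^esub> x)" using Th_smult sub by (metis subsetD)
    then show "c *s a \<in> Th ` N" using N.smult_closed x by simp
  qed
  moreover have "rho \<sigma> u \<in> Th ` N" if "\<sigma> permutes {..<n}" "u \<in> Th ` N" for \<sigma> u
  proof -
    from that obtain x where x: "x \<in> N" "u = Th x" by blast
    then have "rho \<sigma> u = Th (tau \<sigma> x)" using Th_tau that sub by (metis subsetD)
    moreover have "tau \<sigma> x \<in> N" using t[OF that(1)] x(1) by blast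
    ultimately show ?thesis by blast
  qed
  ultimately show "N \<subseteq> carrier V \<and> invariant (Th ` N)" using sub by (simp add: invariant_def)
next
  assume *: "N \<subseteq> carrier V \<and> invariant (Th ` N)"
  then have sub: "N \<subseteq> carrier V" and iv: "invariant (Th ` N)" by auto
  have sp: "subspace (Th ` N)" using iv by (rule invariantD)
  have bck: "x \<in> N" if "x \<in> carrier V" "Th x \<in> Th ` N" for x
    using that sub Th_inj by (metis imageE subsetD)
  show "Sn_submodule n V tau N" unfolding Sn_submodule_def
  proof (intro conjI allI impI)
    show "submodule class_ring N V"
    proof
      show "N \<subseteq> carrier V" by (rule sub)
      show "x \<oplus>\<^bsub>V\<^esub> y \<in> N" if "x \<in> N" "y \<in> N" for x y
        using that sub subspace_add[OF sp, of "Th x" "Th y"] by (intro bck) (auto simp: Th_add subset_iff)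
      show "\<zero>\<^bsub>V\<^esub> \<in> N" using subspace_0[OF sp] by (intro bck) (auto simp: Th_zero)
      show "c \<odot>\<^bsub>V\<^esub> x \<in> N" if "x \<in> N" for c x
        using that sub subspace_scale[OF sp, of "Th x" c] by (intro bck) (auto simp: Th_smult subset_iff)
    qed
    show "tau \<sigma> ` N \<subseteq> N" if s: "\<sigma> permutes {..<n}" for \<sigma>
    proof safe
      fix x assume "x \<in> N"
      then show "tau \<sigma> x \<in> N"
        using sub Th_tau[OF s, of x] invariantD(2)[OF iv s, of "Th x"] by (intro bck) (auto simp: subset_iff)
    qed
  qed
qed

definition pull :: "'v set \<Rightarrow> 'w set" where
  "pull U = {x \<in> carrier V. Th x \<in> U}"

lemma Th_pull: "U \<subseteq> P \<Longrightarrow> Th ` pull U = U"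
  using Th_surj by (fastforce simp: pull_def)

lemma pull_Th: assumes "N \<subseteq> carrier V" shows "pull (Th ` N) = N"
proof (rule equalityI)
  show "pull (Th ` N) \<subseteq> N"
  proof
    fix x assume "x \<in> pull (Th ` N)"
    then obtain y where "x \<in> carrier V" "y \<in> N" "Th x = Th y" by (auto simp: pull_def)
    then show "x \<in> N" using Th_inj[of x y] assms by blast
  qed
  show "N \<subseteq> pull (Th ` N)" using assms by (auto simp: pull_def)
qed

lemma Th_image_zero: "N \<subseteq> carrier V \<Longrightarrow> Th ` N = {0} \<longleftrightarrow> N = {\<zero>\<^bsub>V\<^esub>}"
proof
  assume N: "N \<subseteq> carrier V" "Th ` N = {0}"
  then have "N = pull {0}" using pull_Th by metis
  also have "\<dots> = {\<zero>\<^bsub>V\<^esub>}" using Th_zero_iff by (auto simp: pull_def Th_zero)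
  finally show "N = {\<zero>\<^bsub>V\<^esub>}" .
qed (simp add: Th_zero)

lemma Sn_irreducible_iff:
  "Sn_irreducible n V tau N \<longleftrightarrow> N \<subseteq> carrier V \<and> irreducible (Th ` N)"
proof (cases "N \<subseteq> carrier V \<and> invariant (Th ` N)")
  case False
  then show ?thesis by (auto simp: Sn_irreducible_def Sn_submodule_iff irreducible_def)
next
  case True
  then have NV: "N \<subseteq> carrier V" and iv: "invariant (Th ` N)" by simp_all
  have P: "Th ` N \<subseteq> P" using NV Th_mem by blast
  let ?A = "\<forall>M. Sn_submodule n V tau M \<and> M \<subseteq> N \<longrightarrow> M = {\<zero>\<^bsub>V\<^esub>} \<or> M = N"
  let ?B = "\<forall>W. invariant W \<longrightarrow> W \<subseteq> Th ` N \<longrightarrow> W = {0} \<or> W = Th ` N"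
  have "?B" if a: "?A"
  proof (intro allI impI)
    fix W assume W: "invariant W" "W \<subseteq> Th ` N"
    have e: "Th ` pull W = W" by (rule Th_pull) (rule subset_trans[OF W(2) P])
    have c: "pull W \<subseteq> carrier V" unfolding pull_def by blast
    have "pull W \<subseteq> pull (Th ` N)" using W(2) unfolding pull_def by blast
    then have "pull W \<subseteq> N" unfolding pull_Th[OF NV] .
    moreover have "Sn_submodule n V tau (pull W)" unfolding Sn_submodule_iff e using c W(1) by simp
    ultimately have "pull W = {\<zero>\<^bsub>V\<^esub>} \<or> pull W = N" using a by blast
    then show "W = {0} \<or> W = Th ` N"
    proof
      assume "pull W = {\<zero>\<^bsub>V\<^esub>}"
      then have "W = {0}" using e Th_zero by (metis image_empty image_insert)
      then show ?thesis ..
    next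
      assume "pull W = N"
      then show ?thesis using e by simp
    qed
  qed
  moreover have "?A" if a: "?B"
  proof (intro allI impI)
    fix M assume M: "Sn_submodule n V tau M \<and> M \<subseteq> N"
    then have c: "M \<subseteq> carrier V" "invariant (Th ` M)" by (simp_all add: Sn_submodule_iff)
    have "Th ` M \<subseteq> Th ` N" using M by blast
    then have "Th ` M = {0} \<or> Th ` M = Th ` N" using a c(2) by blast
    then show "M = {\<zero>\<^bsub>V\<^esub>} \<or> M = N"
      using Th_image_zero[OF c(1)] pull_Th[OF c(1)] pull_Th[OF NV] by metis
  qed
  ultimately have "?A \<longleftrightarrow> ?B" by blast
  then show ?thesis unfolding Sn_irreducible_def Sn_submodule_iff irreducible_def Th_image_zero[OF NV]
    using NV iv by simp
qed

text \<open>Guarantees that the choice in \<open>Sn_multiplicity\<close> picks the count of an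
  actual decomposition.\<close>

lemma Sn_decomposition_ex: "\<exists>r N. Sn_decomposition n V tau r N"
proof -
  obtain B where B: "finite B" "B \<subseteq> P" "P \<subseteq> span B" using P_fin by blast
  obtain r :: nat and N where N0: "\<forall>i<r. irreducible (N i) \<and> N i \<subseteq> P"
    and d0: "\<forall>v\<in>P. \<exists>!f. f \<in> (\<Pi>\<^sub>E i\<in>{..<r}. N i) \<and> v = (\<Sum>i<r. f i)"
    using irreducible_decomposition[OF P_inv B] by (elim exE conjE) (rule that)
  have N: "irreducible (N i)" "N i \<subseteq> P" if "i < r" for i using N0 that by simp_all
  note d = bspec[OF d0]
  have c: "pull (N i) \<subseteq> carrier V" for i by (auto simp: pull_def)
  have "Sn_decomposition n V tau r (\<lambda>i. pull (N i))" unfolding Sn_decomposition_def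
  proof (intro conjI allI impI ballI)
    fix i assume "i < r"
    from N[OF this] c[of i] show "Sn_irreducible n V tau (pull (N i))"
      unfolding Sn_irreducible_iff by (simp only: Th_pull)
  next
    fix v assume v: "v \<in> carrier V"
    obtain f where f0: "f \<in> (\<Pi>\<^sub>E i\<in>{..<r}. N i) \<and> Th v = (\<Sum>i<r. f i)"
      and u0: "\<forall>g. g \<in> (\<Pi>\<^sub>E i\<in>{..<r}. N i) \<and> Th v = (\<Sum>i<r. g i) \<longrightarrow> g = f"
      using d[OF Th_mem[OF v]] unfolding Ex1_def by (elim exE) (erule conjE, rule that)
    note f = conjunct1[OF f0] conjunct2[OF f0]
    have u: "g = f" if "g \<in> (\<Pi>\<^sub>E i\<in>{..<r}. N i)" "Th v = (\<Sum>i<r. g i)" for g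
      using u0[rule_format, OF conjI[OF that]] .
    have "\<exists>x\<in>carrier V. Th x = f i" if "i < r" for i
      using Th_surj N(2)[OF that] PiE_mem[OF f(1)] that by blast
    then have "\<forall>i. \<exists>x. i < r \<longrightarrow> x \<in> carrier V \<and> Th x = f i" by blast
    from choice[OF this] obtain F where F: "\<And>i. i < r \<Longrightarrow> F i \<in> carrier V" "\<And>i. i < r \<Longrightarrow> Th (F i) = f i"
      by blast
    let ?F = "restrict F {..<r}"
    have Fi: "?F i \<in> carrier V" if "i < r" for i using F that by simp
    show "\<exists>!f. f \<in> (\<Pi>\<^sub>E i\<in>{..<r}. pull (N i)) \<and> v = (\<Oplus>\<^bsub>V\<^esub>i\<in>{..<r}. f i)"
    proof (rule ex1I[of _ ?F])
      have "Th (\<Oplus>\<^bsub>V\<^esub>i\<in>{..<r}. ?F i) = (\<Sum>i<r. Th (?F i))" by (rule Th_finsum) (use F in simp)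
      also have "\<dots> = Th v" using f(2) F by simp
      finally have e: "(\<Oplus>\<^bsub>V\<^esub>i\<in>{..<r}. ?F i) = v"
        using v F(1) by (intro Th_inj V.finsum_closed) simp_all
      have m: "?F i \<in> pull (N i)" if "i < r" for i
        using F that PiE_mem[OF f(1), of i] by (simp add: pull_def)
      have "?F \<in> (\<Pi>\<^sub>E i\<in>{..<r}. pull (N i))"
        by (rule PiE_I) (use m in auto)
      then show "?F \<in> (\<Pi>\<^sub>E i\<in>{..<r}. pull (N i)) \<and> v = (\<Oplus>\<^bsub>V\<^esub>i\<in>{..<r}. ?F i)" using e by simp
      fix G assume G: "G \<in> (\<Pi>\<^sub>E i\<in>{..<r}. pull (N i)) \<and> v = (\<Oplus>\<^bsub>V\<^esub>i\<in>{..<r}. G i)"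
      have Gi: "G i \<in> carrier V" "Th (G i) \<in> N i" if "i < r" for i
        using PiE_mem[OF conjunct1[OF G], of i] that by (auto simp: pull_def)
      let ?g = "\<lambda>i\<in>{..<r}. Th (G i)"
      have "Th v = Th (\<Oplus>\<^bsub>V\<^esub>i\<in>{..<r}. G i)" using G by simp
      also have "\<dots> = (\<Sum>i<r. Th (G i))" by (rule Th_finsum) (use Gi in auto)
      finally have vg: "Th v = (\<Sum>i<r. ?g i)" by simp
      have "?g \<in> (\<Pi>\<^sub>E i\<in>{..<r}. N i)" by (rule PiE_I) (use Gi in simp_all)
      from u[OF this vg] have gf: "Th (G i) = f i" if "i < r" for i
        using fun_cong[of ?g f i] that unfolding lessThan_iff restrict_def by presburger
      show "G = ?F"
      proof
        fix i
        show "G i = ?F i"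
        proof (cases "i < r")
          case True
          then show ?thesis using Th_inj[OF Gi(1) F(1), of i i] gf F(2) by simp
        next
          case False
          then have "G i = undefined" using G by (intro PiE_arb[of G "{..<r}" "\<lambda>i. pull (N i)"]) auto
          then show ?thesis using False by simp
        qed
      qed
    qed
  qed
  then show ?thesis by blast
qed

abbreviation Reg_young where "Reg_young lam \<equiv> Sn_rep.young (pm_scale :: 'f \<Rightarrow> _) young_action lam"

text \<open>\<open>M(lam)\<close> contains an element not annihilated by \<open>young lam\<close>,
  and equivariant maps commute with \<open>young lam\<close>; so its preimage in \<open>N\<close> is
  not annihilated either.\<close>

lemma young_module_iso_imp:
  assumes lam: "partition_of lam n" and N: "N \<subseteq> carrier V" "invariant (Th ` N)"
    and iso: "Sn_isomorphic n (V\<lparr>carrier := N\<rparr>) tau (young_module lam :: ('f, _) module) young_action"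
  shows "\<exists>v\<in>P. young lam v \<noteq> 0"
proof -
  interpret Reg: Sn_rep "pm_scale :: 'f \<Rightarrow> _" n young_action by (rule regular_rep)
  have l: "sum_list lam = n" using lam by (simp add: partition_of_def)
  let ?e = "Reg.young lam sym_one"
  have cM: "carrier (young_module lam :: ('f, _) module) = Reg.orbit_span ?e" by (rule carrier_young_module[OF l])
  obtain f where hom: "f \<in> module_hom class_ring (V\<lparr>carrier := N\<rparr>) (young_module lam :: ('f, _) module)"
    and bij: "bij_betw f N (Reg.orbit_span ?e)"
    and eq: "\<And>\<sigma> v. \<sigma> permutes {..<n} \<Longrightarrow> v \<in> N \<Longrightarrow> f (tau \<sigma> v) = young_action \<sigma> (f v)"
    using iso unfolding Sn_isomorphic_def cM by auto
  have fadd: "f (x \<oplus>\<^bsub>V\<^esub> y) = f x + f y" if "x \<in> N" "y \<in> N" for x y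
    using module_hom_add[OF hom, of x y] that by (simp add: young_module_simps)
  have fsc: "f (c \<odot>\<^bsub>V\<^esub> x) = pm_scale c (f x)" if "x \<in> N" for x c
    using module_hom_smult[OF hom, of c x] that by (simp add: young_module_simps)
  have "Reg.orbit_span ?e \<noteq> {0}" using Reg.orbit_span_self[of ?e] young_one_nonzero[OF l, where 'f = 'f] by auto
  then obtain u where u: "u \<in> Reg.orbit_span ?e" "Reg.young lam u \<noteq> 0"
    using Reg.young_orbit_nonzero[OF lam Reg.orbit_span_invariant subset_refl] by blast
  have "u \<in> f ` N" using bij u(1) by (simp add: bij_betw_def)
  then obtain x where x: "x \<in> N" "f x = u" by blast
  let ?U = "Th ` N"
  \<comment> \<open>The given isomorphism, read on the image of \<open>N\<close> under
    \<open>Th\<close>.\<close>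
  define T where "T v = f (inv_into N Th v)" for v
  have injN: "inj_on Th N" using N(1) Th_inj by (auto simp: inj_on_def)
  have T: "T (Th x) = f x" if "x \<in> N" for x using that injN by (simp add: T_def inv_into_f_f)
  have sN: "Sn_submodule n V tau N" using N by (simp add: Sn_submodule_iff)
  then interpret N: submodule class_ring N V by (simp add: Sn_submodule_def)
  have tN: "tau \<sigma> x \<in> N" if "\<sigma> permutes {..<n}" "x \<in> N" for \<sigma> x
    using sN that unfolding Sn_submodule_def by blast
  have "T (young lam (Th x)) = Reg.young lam (T (Th x))"
  proof (rule equivariant_young(1)[OF Sn_rep_axioms Reg.Sn_rep_axioms N(2) _ _ _ l])
    show "Th x \<in> ?U" using x by blast
    fix a b assume "a \<in> ?U" "b \<in> ?U"
    then obtain y z where yz: "y \<in> N" "z \<in> N" "a = Th y" "b = Th z" by blast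
    have "a + b = Th (y \<oplus>\<^bsub>V\<^esub> z)" using yz N(1) by (simp add: Th_add subset_iff)
    then show "T (a + b) = T a + T b" using yz N.m_closed[OF yz(1,2)] by (simp add: T fadd)
  next
    fix c a assume "a \<in> ?U"
    then obtain y where y: "y \<in> N" "a = Th y" by blast
    have "c *s a = Th (c \<odot>\<^bsub>V\<^esub> y)" using y N(1) by (simp add: Th_smult subset_iff)
    moreover have "c \<odot>\<^bsub>V\<^esub> y \<in> N" using y by simp
    ultimately show "T (c *s a) = pm_scale c (T a)" using y by (simp add: T fsc)
  next
    fix \<sigma> a assume s: "\<sigma> permutes {..<n}" and "a \<in> ?U"
    then obtain y where y: "y \<in> N" "a = Th y" by blast
    have "rho \<sigma> a = Th (tau \<sigma> y)" using y N(1) Th_tau[OF s, of y] by (simp add: subset_iff)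
    then show "T (rho \<sigma> a) = young_action \<sigma> (T a)" using y tN[OF s y(1)] by (simp add: T eq s)
  qed
  then have "T (young lam (Th x)) \<noteq> 0" using u x by (simp add: T)
  moreover have "T 0 = 0"
  proof -
    have "f \<zero>\<^bsub>V\<^esub> = 0" using fadd[OF N.zero_closed N.zero_closed] by simp
    then show ?thesis using T[OF N.zero_closed] by (simp add: Th_zero)
  qed
  ultimately have "young lam (Th x) \<noteq> 0" by metis
  then show ?thesis using x N(1) Th_mem by blast
qed

text \<open>Evaluation at \<open>w\<close> maps the left ideal \<open>M(lam)\<close> onto the
  submodule generated by \<open>young lam w\<close>, which by irreducibility is the whole image of
  \<open>N\<close>. Its kernel on the left ideal is a submodule missing the generator, hence
  zero.\<close>

lemma young_module_isoI:
  assumes lam: "partition_of lam n" and N: "N \<subseteq> carrier V" "irreducible (Th ` N)"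
    and w: "w \<in> Th ` N" "young lam w \<noteq> 0"
  shows "Sn_isomorphic n (V\<lparr>carrier := N\<rparr>) tau (young_module lam :: ('f, _) module) young_action"
proof -
  interpret Reg: Sn_rep "pm_scale :: 'f \<Rightarrow> _" n young_action by (rule regular_rep)
  have l: "sum_list lam = n" using lam by (simp add: partition_of_def)
  have invN: "invariant (Th ` N)" using N(2) by (simp add: irreducible_def)
  let ?e = "Reg.young lam sym_one"
  let ?M = "Reg.orbit_span ?e"
  have cM: "carrier (young_module lam :: ('f, _) module) = ?M" by (rule carrier_young_module[OF l])
  define ev where "ev q = grp (Poly_Mapping.lookup q) w" for q
  have ev_add: "ev (p + q) = ev p + ev q" for p q
    by (simp add: ev_def grp_def Poly_Mapping.lookup_add scale_left_distrib sum.distrib)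
  have ev_sc: "ev (pm_scale c q) = c *s ev q" for c q
    by (simp add: ev_def grp_def scale_sum_right)
  have ev_act: "ev (young_action \<sigma> q) = rho \<sigma> (ev q)" if "\<sigma> permutes {..<n}" for \<sigma> q
    by (simp only: ev_def rho_grp[OF that]) (simp add: grp_def lookup_young_action[OF that])
  have ev_one: "ev sym_one = w"
  proof -
    have "ev sym_one = grp (\<lambda>\<sigma>. of_bool (\<sigma> = id)) w"
      unfolding ev_def grp_def by (intro sum.cong refl) (auto simp: Poly_Mapping.lookup_single when_def)
    then show ?thesis by (simp add: grp_delta)
  qed
  have invU: "Reg.invariant UNIV" by (simp add: Reg.invariant_def)
  have ev_e: "ev ?e = young lam w"
    using equivariant_young(1)[OF Reg.Sn_rep_axioms Sn_rep_axioms invU, of ev lam sym_one]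
    by (simp add: ev_add ev_sc ev_act l ev_one)
  have ev_grp: "ev (Reg.grp x ?e) = grp x (young lam w)" for x
    using equivariant_young(2)[OF Reg.Sn_rep_axioms Sn_rep_axioms invU, of ev lam ?e x]
    by (simp add: ev_add ev_sc ev_act l ev_e)
  have ev_0: "ev 0 = 0" using ev_sc[of 0 0] by simp
  have img: "ev ` ?M = Th ` N"
  proof -
    have 1: "ev ` ?M = orbit_span (young lam w)"
      by (auto simp: Reg.orbit_span_def orbit_span_def ev_grp image_iff)
    have 2: "orbit_span (young lam w) \<subseteq> Th ` N"
      using orbit_span_le[OF invN] young_in[OF l invN w(1)] by blast
    have "orbit_span (young lam w) \<noteq> {0}" using orbit_span_self[of "young lam w"] w(2) by auto
    then have "orbit_span (young lam w) = Th ` N"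
      using N(2) 2 orbit_span_invariant unfolding irreducible_def by blast
    then show ?thesis using 1 by simp
  qed
  have kerz: "q = 0" if "q \<in> ?M" "ev q = 0" for q
  proof -
    let ?K = "?M \<inter> {q. ev q = 0}"
    have "Reg.subspace {q. ev q = 0}" by (rule Reg.subspaceI) (auto simp: ev_0 ev_add ev_sc)
    then have "Reg.subspace ?K"
      using Reg.invariantD(1)[OF Reg.orbit_span_invariant] by (intro Reg.subspace_inter)
    then have iK: "Reg.invariant ?K"
      using Reg.invariantD(2)[OF Reg.orbit_span_invariant] unfolding Reg.invariant_def
      by (simp add: ev_act rho_zero)
    have "?e \<notin> ?K" using ev_e w(2) by simp
    then have "?K \<noteq> ?M" using Reg.orbit_span_self by blast
    then have "?K = {0}" using Reg.young_orbit_irreducible[OF lam iK Int_lower1] by blast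
    then show ?thesis using that by blast
  qed
  have sM: "Reg.subspace ?M" using Reg.orbit_span_invariant by (rule Reg.invariantD)
  have inj: "inj_on ev ?M"
  proof (rule inj_onI)
    fix p q assume pq: "p \<in> ?M" "q \<in> ?M" "ev p = ev q"
    have "ev (p - q) = 0" using ev_add[of "p - q" q] pq(3) by simp
    then have "p - q = 0" using kerz Reg.subspace_diff[OF sM pq(1,2)] by blast
    then show "p = q" by simp
  qed
  define f where "f x = inv_into ?M ev (Th x)" for x
  have fM: "f x \<in> ?M" "ev (f x) = Th x" if "x \<in> N" for x
  proof -
    have "Th x \<in> ev ` ?M" using img that by blast
    then show "f x \<in> ?M" "ev (f x) = Th x" by (simp_all add: f_def inv_into_into f_inv_into_f)
  qed
  have funi: "f x = q" if "x \<in> N" "q \<in> ?M" "ev q = Th x" for x q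
    using inj fM[OF that(1)] that(2,3) by (metis inj_onD)
  have "Sn_submodule n V tau N" using N(1) invN by (simp add: Sn_submodule_iff)
  then interpret N: submodule class_ring N V by (simp add: Sn_submodule_def)
  have tN: "tau \<sigma> x \<in> N" if "\<sigma> permutes {..<n}" "x \<in> N" for \<sigma> x
    using \<open>Sn_submodule n V tau N\<close> that unfolding Sn_submodule_def by blast
  have cV: "x \<in> carrier V" if "x \<in> N" for x using N(1) that by blast
  have "f \<in> module_hom class_ring (V\<lparr>carrier := N\<rparr>) (young_module lam :: ('f, _) module)"
    unfolding module_hom_def mem_Collect_eq cM young_module_simps
  proof (intro conjI allI impI)
    show "f \<in> carrier (V\<lparr>carrier := N\<rparr>) \<rightarrow> ?M" using fM by simp
  next
    fix x y assume "x \<in> carrier (V\<lparr>carrier := N\<rparr>) \<and> y \<in> carrier (V\<lparr>carrier := N\<rparr>)"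
    then have xy: "x \<in> N" "y \<in> N" by auto
    have "f (x \<oplus>\<^bsub>V\<^esub> y) = f x + f y"
      using N.m_closed[OF xy] Reg.subspace_add[OF sM fM(1)[OF xy(1)] fM(1)[OF xy(2)]] fM(2)[OF xy(1)] fM(2)[OF xy(2)]
      by (intro funi) (simp_all add: ev_add Th_add cV xy)
    then show "f (x \<oplus>\<^bsub>V\<lparr>carrier := N\<rparr>\<^esub> y) = f x + f y" by simp
  next
    fix c :: 'f and x assume "c \<in> carrier class_ring \<and> x \<in> carrier (V\<lparr>carrier := N\<rparr>)"
    then have x: "x \<in> N" by auto
    have "f (c \<odot>\<^bsub>V\<^esub> x) = pm_scale c (f x)"
    proof (rule funi)
      show "c \<odot>\<^bsub>V\<^esub> x \<in> N" using x by simp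
      show "pm_scale c (f x) \<in> ?M" by (rule Reg.subspace_scale[OF sM fM(1)[OF x]])
      show "ev (pm_scale c (f x)) = Th (c \<odot>\<^bsub>V\<^esub> x)" by (simp add: ev_sc fM(2)[OF x] Th_smult cV[OF x])
    qed
    then show "f (c \<odot>\<^bsub>V\<lparr>carrier := N\<rparr>\<^esub> x) = pm_scale c (f x)" by simp
  qed
  moreover have "bij_betw f (carrier (V\<lparr>carrier := N\<rparr>)) (carrier (young_module lam :: ('f, _) module))"
    unfolding cM
  proof (rule bij_betw_imageI)
    show "inj_on f (carrier (V\<lparr>carrier := N\<rparr>))"
    proof (rule inj_onI)
      fix x y assume "x \<in> carrier (V\<lparr>carrier := N\<rparr>)" "y \<in> carrier (V\<lparr>carrier := N\<rparr>)" and e: "f x = f y"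
      then have xy: "x \<in> N" "y \<in> N" by simp_all
      have "Th x = Th y" unfolding fM(2)[OF xy(1), symmetric] fM(2)[OF xy(2), symmetric] e ..
      then show "x = y" by (rule Th_inj[OF cV[OF xy(1)] cV[OF xy(2)]])
    qed
    have "?M \<subseteq> f ` N"
    proof
      fix q assume q: "q \<in> ?M"
      then have "ev q \<in> Th ` N" using img by blast
      then obtain x where x: "x \<in> N" "ev q = Th x" by blast
      have "f x = q" by (rule funi[OF x(1) q x(2)])
      then show "q \<in> f ` N" using x(1) by blast
    qed
    moreover have "f ` N \<subseteq> ?M" using fM(1) by blast
    ultimately show "f ` carrier (V\<lparr>carrier := N\<rparr>) = ?M" by simp
  qed
  moreover have "f (tau \<sigma> x) = young_action \<sigma> (f x)" if s: "\<sigma> permutes {..<n}" and x: "x \<in> N" for \<sigma> x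
  proof (rule funi)
    show "tau \<sigma> x \<in> N" by (rule tN[OF s x])
    show "young_action \<sigma> (f x) \<in> ?M" by (rule Reg.invariantD(2)[OF Reg.orbit_span_invariant s fM(1)[OF x]])
    show "ev (young_action \<sigma> (f x)) = Th (tau \<sigma> x)"
      using Th_tau[OF s cV[OF x]] by (simp add: ev_act[OF s] fM(2)[OF x])
  qed
  ultimately show ?thesis unfolding Sn_isomorphic_def by (intro bexI[of _ f]) simp_all
qed

text \<open>The argument applies to whichever decomposition \<open>SOME\<close> picks: a vector not
  annihilated by \<open>young lam\<close> has a component with the same property, and the summand of
  that component is isomorphic to \<open>M(lam)\<close>.\<close>

lemma Sn_multiplicity_nonzero:
  assumes lam: "partition_of lam n"
  shows "Sn_multiplicity n V tau (young_module lam :: ('f, _) module) young_action \<noteq> 0 \<longleftrightarrow>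
    (\<exists>v\<in>P. young lam v \<noteq> 0)"
proof -
  have l: "sum_list lam = n" using lam by (simp add: partition_of_def)
  let ?iso = "\<lambda>N. Sn_isomorphic n (V\<lparr>carrier := N\<rparr>) tau (young_module lam :: ('f, _) module) young_action"
  let ?m = "Sn_multiplicity n V tau (young_module lam :: ('f, _) module) young_action"
  obtain r0 N0 where dec: "Sn_decomposition n V tau r0 N0" using Sn_decomposition_ex by blast
  define Q where "Q m \<longleftrightarrow> (\<exists>r N. Sn_decomposition n V tau r N \<and> m = card {i. i < r \<and> ?iso (N i)})" for m
  have "Q (card {i. i < r0 \<and> ?iso (N0 i)})"
    unfolding Q_def by (rule exI[of _ r0], rule exI[of _ N0], rule conjI, rule dec, rule refl)
  then have "Q (SOME m. Q m)" by (rule someI)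
  moreover have "?m = (SOME m. Q m)" unfolding Sn_multiplicity_def Q_def ..
  ultimately have "Q ?m" by simp
  then obtain r N where d: "Sn_decomposition n V tau r N" and m: "?m = card {i. i < r \<and> ?iso (N i)}"
    unfolding Q_def
    by (elim exE) (erule conjE, rule that)
  have card_nz: "card {i. i < r \<and> Q i} \<noteq> 0 \<longleftrightarrow> (\<exists>i<r. Q i)" for Q
    by (auto simp: card_eq_0_iff)
  have ir: "N i \<subseteq> carrier V" "irreducible (Th ` N i)" if "i < r" for i
    using d[unfolded Sn_decomposition_def, THEN conjunct1, rule_format, OF that]
    unfolding Sn_irreducible_iff by simp_all
  have "?m \<noteq> 0 \<longleftrightarrow> (\<exists>i<r. ?iso (N i))" unfolding m by (rule card_nz)
  also have "\<dots> \<longleftrightarrow> (\<exists>v\<in>P. young lam v \<noteq> 0)"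
  proof
    assume "\<exists>i<r. ?iso (N i)"
    then obtain i where i: "i < r" "?iso (N i)" by blast
    have "invariant (Th ` N i)" using ir(2)[OF i(1)] by (simp add: irreducible_def)
    then show "\<exists>v\<in>P. young lam v \<noteq> 0" by (rule young_module_iso_imp[OF lam ir(1)[OF i(1)] _ i(2)])
  next
    assume "\<exists>v\<in>P. young lam v \<noteq> 0"
    then obtain v where v: "v \<in> P" "young lam v \<noteq> 0" by blast
    then obtain x where x: "x \<in> carrier V" "Th x = v" using Th_surj by blast
    obtain f where f0: "f \<in> (\<Pi>\<^sub>E i\<in>{..<r}. N i) \<and> x = (\<Oplus>\<^bsub>V\<^esub>i\<in>{..<r}. f i)"
      using bspec[OF conjunct2[OF d[unfolded Sn_decomposition_def]] x(1)]
      unfolding Ex1_def by (elim exE) (erule conjE, rule that)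
    note f = conjunct1[OF f0] conjunct2[OF f0]
    have fi: "f i \<in> N i" if "i < r" for i using PiE_mem[OF f(1), of i] that by simp
    have "Th (\<Oplus>\<^bsub>V\<^esub>i\<in>{..<r}. f i) = (\<Sum>i<r. Th (f i))"
      by (rule Th_finsum) (use fi ir(1) in blast)
    then have "v = (\<Sum>i<r. Th (f i))" using x(2) f(2) by simp
    then have e: "young lam v = (\<Sum>i<r. young lam (Th (f i)))" by (simp only: young_sum[OF l])
    have "\<exists>i<r. young lam (Th (f i)) \<noteq> 0"
    proof (rule ccontr)
      assume "\<not> ?thesis"
      then have "(\<Sum>i<r. young lam (Th (f i))) = 0" by (intro sum.neutral) simp
      then show False using e v(2) by simp
    qed
    then obtain i where i: "i < r" "young lam (Th (f i)) \<noteq> 0" by blast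
    then show "\<exists>i<r. ?iso (N i)" using young_module_isoI[OF lam ir[OF i(1)] imageI[OF fi[OF i(1)]]] by blast
  qed
  finally show ?thesis .
qed

lemma Th_lincomb:
  "A \<subseteq> carrier V \<Longrightarrow> Th (module.lincomb V a A) = (\<Sum>x\<in>A. a x *s Th x)"
  unfolding V.lincomb_def by (subst Th_finsum) (auto simp: Th_smult subset_iff)

lemma Th_span:
  assumes "A \<subseteq> carrier V" "finite A"
  shows "Th ` module.span class_ring V A = span (Th ` A)"
proof -
  have inj: "inj_on Th A" using assms(1) Th_inj by (auto simp: inj_on_def)
  have "Th ` module.span class_ring V A = range (\<lambda>a. \<Sum>x\<in>A. a x *s Th x)"
  proof -
    have "Th ` module.span class_ring V A = range (\<lambda>a. Th (module.lincomb V a A))"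
      unfolding V.finite_span[OF assms(2,1)] by auto
    then show ?thesis by (simp only: Th_lincomb[OF assms(1)])
  qed
  also have "\<dots> = range (\<lambda>u. \<Sum>v\<in>Th ` A. u v *s v)"
  proof safe
    fix a
    have "(\<Sum>x\<in>A. a x *s Th x) = (\<Sum>v\<in>Th ` A. a (inv_into A Th v) *s v)"
      by (simp add: sum.reindex[OF inj] inv_into_f_f[OF inj])
    then show "(\<Sum>x\<in>A. a x *s Th x) \<in> range (\<lambda>u. \<Sum>v\<in>Th ` A. u v *s v)"
      by (rule image_eqI[where x = "\<lambda>v. a (inv_into A Th v)", OF _ UNIV_I])
  next
    fix u
    have "(\<Sum>v\<in>Th ` A. u v *s v) = (\<Sum>x\<in>A. u (Th x) *s Th x)" by (simp add: sum.reindex[OF inj])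
    then show "(\<Sum>v\<in>Th ` A. u v *s v) \<in> range (\<lambda>a. \<Sum>x\<in>A. a x *s Th x)"
      by (rule image_eqI[where x = "\<lambda>x. u (Th x)", OF _ UNIV_I])
  qed
  also have "\<dots> = span (Th ` A)" using assms(2) by (simp add: span_finite)
  finally show ?thesis .
qed

text \<open>\<open>vectorspace.dim\<close> is the least size of a finite generating set. Generating
  sets of the carrier correspond to those of \<open>P\<close>, where no generating set is smaller
  than an independent one.\<close>

lemma dim_basis_P:
  "\<exists>B. finite B \<and> B \<subseteq> P \<and> P \<subseteq> span B \<and> independent B \<and> card B = vectorspace.dim class_ring V"
proof -
  have vs: "vectorspace class_ring V" by (rule vectorspace.intro[OF module_V class_field])
  have PS: "subspace P" using P_inv by (rule invariantD)
  obtain B0 where B0: "finite B0" "B0 \<subseteq> P" "P \<subseteq> span B0" using P_fin by blast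
  obtain B where B: "B \<subseteq> P" "independent B" "P \<subseteq> span B" using maximal_independent_subset[of P] by blast
  have finB: "finite B"
    using independent_span_bound[OF B0(1) B(2)] B(1) B0(3) by blast
  define A where "A = inv_into (carrier V) Th ` B"
  have ThA: "Th ` A = B" and cA: "A \<subseteq> carrier V"
    using Th_bij B(1) by (auto simp: A_def bij_betw_def image_image f_inv_into_f subset_iff inv_into_into)
  have finA: "finite A" using finB by (simp add: A_def)
  have spP: "span B = P" using B PS by (simp add: span_minimal subset_antisym)
  have "card A \<le> card B" using finB by (simp add: A_def card_image_le)
  moreover have "card B \<le> card A" using card_image_le[OF finA, of Th] by (simp add: ThA)
  ultimately have cAB: "card A = card B" by simp
  have sub: "module.span class_ring V X \<subseteq> carrier V" if "X \<subseteq> carrier V" for X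
    using V.span_is_subset2[OF that] .
  have gen: "module.span class_ring V X = carrier V \<longleftrightarrow> span (Th ` X) = P" if "X \<subseteq> carrier V" "finite X" for X
  proof -
    have "module.span class_ring V X = carrier V \<longleftrightarrow> Th ` module.span class_ring V X = Th ` carrier V"
      using Th_bij sub[OF that(1)] by (metis bij_betw_def inj_on_image_eq_iff subset_refl)
    then show ?thesis using Th_span[OF that] Th_bij by (simp add: bij_betw_def)
  qed
  have "vectorspace.dim class_ring V = card B"
    unfolding vectorspace.dim_def[OF vs]
  proof (rule Least_equality)
    show "\<exists>X. finite X \<and> card X = card B \<and> X \<subseteq> carrier V \<and> module.span class_ring V X = carrier V"
      using finA cAB cA gen[OF cA finA] ThA spP by blast
    fix m assume "\<exists>X. finite X \<and> card X = m \<and> X \<subseteq> carrier V \<and> module.span class_ring V X = carrier V"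
    then obtain X where X: "finite X" "card X = m" "X \<subseteq> carrier V" "span (Th ` X) = P" using gen by blast
    have "card B \<le> card (Th ` X)"
      using independent_span_bound[OF finite_imageI[OF X(1)] B(2)] B(1) X(4) by blast
    also have "\<dots> \<le> m" using card_image_le[OF X(1)] X(2) by blast
    finally show "card B \<le> m" .
  qed
  then show ?thesis using finB B by metis
qed

end

section \<open>Multilinear functions on a finite dimensional H-algebra\<close>

definition fscale :: "('f \<Rightarrow> 'a \<Rightarrow> 'a) \<Rightarrow> 'f \<Rightarrow> ('p \<Rightarrow> 'a) \<Rightarrow> 'p \<Rightarrow> 'a" where
  "fscale sc c F = (\<lambda>\<psi>. sc c (F \<psi>))"

text \<open>Precomposition of the argument gives a left action: both
  \<open>frho (\<sigma> \<circ> \<tau>) F\<close> and \<open>frho \<sigma> (frho \<tau> F)\<close>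
  evaluate \<open>F\<close> at \<open>\<psi> \<circ> \<sigma> \<circ> \<tau>\<close>.\<close>

definition frho :: "(nat \<Rightarrow> nat) \<Rightarrow> ((nat \<Rightarrow> 'a) \<Rightarrow> 'b) \<Rightarrow> (nat \<Rightarrow> 'a) \<Rightarrow> 'b" where
  "frho \<sigma> F = (\<lambda>\<psi>. F (\<psi> \<circ> \<sigma>))"

lemma sum_fun_apply: "(\<Sum>i\<in>I. f i) x = (\<Sum>i\<in>I. f i x)"
  for f :: "'i \<Rightarrow> 'p \<Rightarrow> 'b::comm_monoid_add"
  by (induction I rule: infinite_finite_induct) auto

lemma vector_space_fscale: "vector_space sc \<Longrightarrow> vector_space (fscale sc :: _ \<Rightarrow> ('p \<Rightarrow> _) \<Rightarrow> _)"
  unfolding vector_space_def fscale_def by (auto simp: fun_eq_iff)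

lemma fun_rep: "vector_space sc \<Longrightarrow> Sn_rep (fscale sc) n (frho :: _ \<Rightarrow> ((nat \<Rightarrow> 'a) \<Rightarrow> _) \<Rightarrow> _)"
  unfolding Sn_rep_def Sn_rep_axioms_def
  by (intro conjI vector_space_fscale) (auto simp: frho_def fscale_def fun_eq_iff o_assoc)

locale fd_H_algebra = generalized_H_action scaleH scaleA mulA act
  for scaleH :: "'f::field_char_0 \<Rightarrow> 'h::ring_1 \<Rightarrow> 'h"
    and scaleA :: "'f \<Rightarrow> 'a::ab_group_add \<Rightarrow> 'a"
    and mulA :: "'a \<Rightarrow> 'a \<Rightarrow> 'a" and act :: "'h \<Rightarrow> 'a \<Rightarrow> 'a" +
  fixes Bs :: "'a set"
  assumes Bs_finite: "finite Bs" and Bs_indep: "\<not> A.dependent Bs" and Bs_span: "A.span Bs = UNIV"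
begin

abbreviation fsc :: "'f \<Rightarrow> ((nat \<Rightarrow> 'a) \<Rightarrow> 'a) \<Rightarrow> (nat \<Rightarrow> 'a) \<Rightarrow> 'a" where
  "fsc \<equiv> fscale scaleA"

sublocale FS: vector_space fsc
  by (rule vector_space_fscale) (rule A.vector_space_axioms)

definition mf :: "monom \<Rightarrow> 'h list \<Rightarrow> (nat \<Rightarrow> 'a) \<Rightarrow> 'a" where
  "mf w hs = (\<lambda>\<psi>. eval_monom mulA act \<psi> w hs)"

text \<open>The functions defined by H-polynomials in which each variable of \<open>S\<close> occurs
  exactly once. General sets of variables are needed because gluing multiplies functions of disjoint
  variables.\<close>

definition PS :: "nat set \<Rightarrow> ((nat \<Rightarrow> 'a) \<Rightarrow> 'a) set" where
  "PS S = FS.span {mf w hs |w hs. length hs = deg w \<and> distinct (vars w) \<and> set (vars w) = S}"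

lemma mf_in_PS: "length hs = deg w \<Longrightarrow> distinct (vars w) \<Longrightarrow> mf w hs \<in> PS (set (vars w))"
  unfolding PS_def by (rule FS.span_base) blast

lemma PS_subspace: "FS.subspace (PS S)" by (simp add: PS_def)

lemma PS_induct [consumes 1, case_names zero step]:
  assumes "F \<in> PS S" "Q (\<lambda>\<psi>. 0)"
    and "\<And>c w hs G. length hs = deg w \<Longrightarrow> distinct (vars w) \<Longrightarrow> set (vars w) = S \<Longrightarrow> Q G \<Longrightarrow>
      Q (\<lambda>\<psi>. scaleA c (mf w hs \<psi>) + G \<psi>)"
  shows "Q F"
  using assms(1) unfolding PS_def
proof (induction rule: FS.span_induct_alt)
  case base
  then show ?case using assms(2) by (simp add: zero_fun_def)
next
  case (step c x y)
  then obtain w hs where x: "x = mf w hs" "length hs = deg w" "distinct (vars w)" "set (vars w) = S" by blast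
  have "Q (\<lambda>\<psi>. scaleA c (mf w hs \<psi>) + y \<psi>)" using assms(3) x step.IH by blast
  then show ?case by (simp add: x fscale_def plus_fun_def)
qed

lemma PS_zero: "(\<lambda>\<psi>. 0) \<in> PS S"
  using FS.subspace_0[OF PS_subspace] by (simp add: zero_fun_def)

lemma PS_add: "F \<in> PS S \<Longrightarrow> G \<in> PS S \<Longrightarrow> (\<lambda>\<psi>. F \<psi> + G \<psi>) \<in> PS S"
  using FS.subspace_add[OF PS_subspace] by (simp add: plus_fun_def)

lemma PS_scale: "F \<in> PS S \<Longrightarrow> (\<lambda>\<psi>. scaleA c (F \<psi>)) \<in> PS S"
  using FS.subspace_scale[OF PS_subspace] by (simp add: fscale_def)

lemma PS_sum: "(\<And>i. i \<in> I \<Longrightarrow> F i \<in> PS S) \<Longrightarrow> (\<lambda>\<psi>. \<Sum>i\<in>I. F i \<psi>) \<in> PS S"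
  by (induction I rule: infinite_finite_induct) (auto simp: PS_zero PS_add)

lemma mulA_zero_left: "mulA 0 x = 0"
proof -
  have "mulA (0 + 0) x = mulA 0 x + mulA 0 x" by (rule A.mulA_add_left)
  then show ?thesis by simp
qed

lemma mulA_zero_right: "mulA x 0 = 0"
proof -
  have "mulA x (0 + 0) = mulA x 0 + mulA x 0" by (rule A.mulA_add_right)
  then show ?thesis by simp
qed

lemma act_zero: "act h 0 = 0"
proof -
  have "act h (0 + 0) = act h 0 + act h 0" by (rule act_add_right)
  then show ?thesis by simp
qed

lemma mf_Prod:
  assumes "length hs = deg u"
  shows "mf (Prod u v) (hs @ ks) \<psi> = mulA (mf u hs \<psi>) (mf v ks \<psi>)"
  using assms by (simp add: mf_def)

lemma PS_mult:
  assumes "F \<in> PS S" "G \<in> PS S'" "S \<inter> S' = {}"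
  shows "(\<lambda>\<psi>. mulA (F \<psi>) (G \<psi>)) \<in> PS (S \<union> S')"
  using assms(1)
proof (induction rule: PS_induct)
  case zero
  then show ?case by (simp add: mulA_zero_left PS_zero)
next
  case (step c w hs F)
  have "(\<lambda>\<psi>. mulA (mf w hs \<psi>) (G \<psi>)) \<in> PS (S \<union> S')"
    using assms(2)
  proof (induction rule: PS_induct)
    case zero
    then show ?case by (simp add: mulA_zero_right PS_zero)
  next
    case (step d v ks G)
    have "mf (Prod w v) (hs @ ks) \<in> PS (set (vars (Prod w v)))"
      using step.hyps \<open>length hs = deg w\<close> \<open>distinct (vars w)\<close> \<open>set (vars w) = S\<close> assms(3)
      by (intro mf_in_PS) auto
    moreover have "mf (Prod w v) (hs @ ks) = (\<lambda>\<psi>. mulA (mf w hs \<psi>) (mf v ks \<psi>))"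
      using mf_Prod[OF \<open>length hs = deg w\<close>] by blast
    ultimately have "(\<lambda>\<psi>. mulA (mf w hs \<psi>) (mf v ks \<psi>)) \<in> PS (S \<union> S')"
      using step.hyps \<open>set (vars w) = S\<close> by simp
    then have "(\<lambda>\<psi>. scaleA d (mulA (mf w hs \<psi>) (mf v ks \<psi>)) + mulA (mf w hs \<psi>) (G \<psi>)) \<in> PS (S \<union> S')"
      using step.IH by (intro PS_add PS_scale)
    then show ?case by (simp only: A.mulA_add_right A.mulA_scale_right)
  qed
  then have "(\<lambda>\<psi>. scaleA c (mulA (mf w hs \<psi>) (G \<psi>)) + mulA (F \<psi>) (G \<psi>)) \<in> PS (S \<union> S')"
    using step.IH by (intro PS_add PS_scale)
  then show ?case by (simp only: A.mulA_add_left A.mulA_scale_left)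
qed

text \<open>The axiom of the generalized action enters here: it pushes \<open>h\<close> through a
  product. The terms with exchanged factors stay in the space because \<open>PS\<close> admits the
  variables in every order.\<close>

lemma mf_act: "length hs = deg w \<Longrightarrow> distinct (vars w) \<Longrightarrow> (\<lambda>\<psi>. act h (mf w hs \<psi>)) \<in> PS (set (vars w))"
proof (induction w arbitrary: hs h)
  case (Var i)
  then obtain k where hs: "hs = [k]" by (cases hs) auto
  have "(\<lambda>\<psi>. act h (mf (Var i) hs \<psi>)) = mf (Var i) [h * k]"
    by (auto simp: mf_def hs act_mult)
  then show ?case using mf_in_PS[of "[h * k]" "Var i"] by simp
next
  case (Prod u v)
  define hs1 hs2 where hh: "hs1 = take (deg u) hs" "hs2 = drop (deg u) hs"
  have l: "length hs1 = deg u" "length hs2 = deg v" using Prod.prems(1) by (auto simp: hh)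
  have e: "mf (Prod u v) hs \<psi> = mulA (mf u hs1 \<psi>) (mf v hs2 \<psi>)" for \<psi>
    by (simp add: mf_def hh)
  obtain k :: nat and h1 h2 h3 h4 where a: "\<And>x y. act h (mulA x y) =
      (\<Sum>i=1..k. mulA (act (h1 i) x) (act (h2 i) y) + mulA (act (h3 i) y) (act (h4 i) x))"
    using act_mulA[of h] by blast
  have d: "distinct (vars u)" "distinct (vars v)" "set (vars u) \<inter> set (vars v) = {}"
    using Prod.prems(2) by auto
  have "(\<lambda>\<psi>. \<Sum>i=1..k. mulA (act (h1 i) (mf u hs1 \<psi>)) (act (h2 i) (mf v hs2 \<psi>)) +
      mulA (act (h3 i) (mf v hs2 \<psi>)) (act (h4 i) (mf u hs1 \<psi>))) \<in> PS (set (vars u) \<union> set (vars v))"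
  proof (intro PS_sum PS_add)
    fix i
    show "(\<lambda>\<psi>. mulA (act (h1 i) (mf u hs1 \<psi>)) (act (h2 i) (mf v hs2 \<psi>))) \<in> PS (set (vars u) \<union> set (vars v))"
      by (intro PS_mult Prod.IH l d)
    have "(\<lambda>\<psi>. mulA (act (h3 i) (mf v hs2 \<psi>)) (act (h4 i) (mf u hs1 \<psi>))) \<in> PS (set (vars v) \<union> set (vars u))"
      using d(3) by (intro PS_mult Prod.IH l d) blast
    then show "(\<lambda>\<psi>. mulA (act (h3 i) (mf v hs2 \<psi>)) (act (h4 i) (mf u hs1 \<psi>))) \<in> PS (set (vars u) \<union> set (vars v))"
      by (simp only: Un_commute)
  qed
  then show ?case by (simp add: e a)
qed

lemma PS_act:
  assumes "F \<in> PS S" shows "(\<lambda>\<psi>. act h (F \<psi>)) \<in> PS S"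
  using assms
proof (induction rule: PS_induct)
  case zero
  then show ?case by (simp add: act_zero PS_zero)
next
  case (step c w hs F)
  then have "(\<lambda>\<psi>. act h (mf w hs \<psi>)) \<in> PS S" using mf_act by blast
  then have "(\<lambda>\<psi>. scaleA c (act h (mf w hs \<psi>)) + act h (F \<psi>)) \<in> PS S"
    using step.IH by (intro PS_add PS_scale)
  then show ?case by (simp only: act_add_right act_scale_right)
qed

lemma vars_rename: "vars (rename \<sigma> w) = map \<sigma> (vars w)"
  by (induction w) auto

lemma mf_rename: "mf (rename \<sigma> w) hs \<psi> = mf w hs (\<psi> \<circ> \<sigma>)"
  by (induction w arbitrary: hs) (auto simp: mf_def vars_rename)

lemma PS_rename:
  assumes "F \<in> PS S" "inj_on \<sigma> S" shows "(\<lambda>\<psi>. F (\<psi> \<circ> \<sigma>)) \<in> PS (\<sigma> ` S)"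
  using assms(1)
proof (induction rule: PS_induct)
  case zero
  then show ?case by (simp add: PS_zero)
next
  case (step c w hs F)
  have "mf (rename \<sigma> w) hs \<in> PS (\<sigma> ` S)"
    using mf_in_PS[of hs "rename \<sigma> w"] step.hyps assms(2) by (simp add: vars_rename distinct_map)
  moreover have "mf (rename \<sigma> w) hs = (\<lambda>\<psi>. mf w hs (\<psi> \<circ> \<sigma>))" by (rule ext) (rule mf_rename)
  ultimately have "(\<lambda>\<psi>. mf w hs (\<psi> \<circ> \<sigma>)) \<in> PS (\<sigma> ` S)" by simp
  then show ?case using step.IH by (intro PS_add PS_scale)
qed

lemma PS_var: "(\<lambda>\<psi>. \<psi> i) \<in> PS {i}"
  using mf_in_PS[of "[1]" "Var i"] by (simp add: mf_def act_one)

section \<open>Multilinearity\<close>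

text \<open>The first clause makes arguments outside \<open>S\<close> irrelevant, so that total
  assignments can be used for functions of finitely many variables.\<close>

definition multilin :: "nat set \<Rightarrow> ((nat \<Rightarrow> 'a) \<Rightarrow> 'a) \<Rightarrow> bool" where
  "multilin S F \<longleftrightarrow> (\<forall>\<psi> \<psi>'. (\<forall>x\<in>S. \<psi> x = \<psi>' x) \<longrightarrow> F \<psi> = F \<psi>') \<and>
    (\<forall>x\<in>S. \<forall>\<psi> u v. F (\<psi>(x := u + v)) = F (\<psi>(x := u)) + F (\<psi>(x := v))) \<and>
    (\<forall>x\<in>S. \<forall>\<psi> c u. F (\<psi>(x := scaleA c u)) = scaleA c (F (\<psi>(x := u))))"

lemma multilin_dep: "multilin S F \<Longrightarrow> (\<And>x. x \<in> S \<Longrightarrow> \<psi> x = \<psi>' x) \<Longrightarrow> F \<psi> = F \<psi>'"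
  unfolding multilin_def by blast

lemma multilin_add: "multilin S F \<Longrightarrow> x \<in> S \<Longrightarrow> F (\<psi>(x := u + v)) = F (\<psi>(x := u)) + F (\<psi>(x := v))"
  unfolding multilin_def by blast

lemma multilin_scale: "multilin S F \<Longrightarrow> x \<in> S \<Longrightarrow> F (\<psi>(x := scaleA c u)) = scaleA c (F (\<psi>(x := u)))"
  unfolding multilin_def by blast

lemma multilin_zero:
  assumes "multilin S F" "x \<in> S" "\<psi> x = 0" shows "F \<psi> = 0"
proof -
  have "F (\<psi>(x := scaleA 0 0)) = scaleA 0 (F (\<psi>(x := 0)))" by (rule multilin_scale[OF assms(1,2)])
  moreover have "\<psi>(x := 0) = \<psi>" using assms(3) by auto
  ultimately show ?thesis by simp
qed

lemma multilin_mf: "distinct (vars w) \<Longrightarrow> multilin (set (vars w)) (mf w hs)"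
proof (induction w arbitrary: hs)
  case (Var i)
  show ?case by (simp add: multilin_def mf_def act_add_right act_scale_right)
next
  case (Prod u v)
  define hs1 hs2 where hh: "hs1 = take (deg u) hs" "hs2 = drop (deg u) hs"
  have e: "mf (Prod u v) hs = (\<lambda>\<psi>. mulA (mf u hs1 \<psi>) (mf v hs2 \<psi>))"
    by (simp add: mf_def hh)
  have d: "distinct (vars u)" "distinct (vars v)" "set (vars u) \<inter> set (vars v) = {}"
    using Prod.prems by auto
  note u = Prod.IH(1)[OF d(1), of hs1] and v = Prod.IH(2)[OF d(2), of hs2]
  show ?case unfolding multilin_def e
  proof (intro conjI allI impI ballI)
    fix \<psi> \<psi>' :: "nat \<Rightarrow> 'a" assume "\<forall>x\<in>set (vars (Prod u v)). \<psi> x = \<psi>' x"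
    then show "mulA (mf u hs1 \<psi>) (mf v hs2 \<psi>) = mulA (mf u hs1 \<psi>') (mf v hs2 \<psi>')"
      using multilin_dep[OF u, of \<psi> \<psi>'] multilin_dep[OF v, of \<psi> \<psi>'] by simp
  next
    fix x and \<psi> :: "nat \<Rightarrow> 'a" and a b assume x: "x \<in> set (vars (Prod u v))"
    show "mulA (mf u hs1 (\<psi>(x := a + b))) (mf v hs2 (\<psi>(x := a + b))) =
      mulA (mf u hs1 (\<psi>(x := a))) (mf v hs2 (\<psi>(x := a))) + mulA (mf u hs1 (\<psi>(x := b))) (mf v hs2 (\<psi>(x := b)))"
    proof (cases "x \<in> set (vars u)")
      case True
      have "mf v hs2 (\<psi>(x := c)) = mf v hs2 \<psi>" for c
        using True d(3) by (intro multilin_dep[OF v]) auto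
      then show ?thesis by (simp only: multilin_add[OF u True] A.mulA_add_left)
    next
      case False
      then have xv: "x \<in> set (vars v)" using x by simp
      have "mf u hs1 (\<psi>(x := c)) = mf u hs1 \<psi>" for c
        using False by (intro multilin_dep[OF u]) auto
      then show ?thesis by (simp only: multilin_add[OF v xv] A.mulA_add_right)
    qed
  next
    fix x and \<psi> :: "nat \<Rightarrow> 'a" and c a assume x: "x \<in> set (vars (Prod u v))"
    show "mulA (mf u hs1 (\<psi>(x := scaleA c a))) (mf v hs2 (\<psi>(x := scaleA c a))) =
      scaleA c (mulA (mf u hs1 (\<psi>(x := a))) (mf v hs2 (\<psi>(x := a))))"
    proof (cases "x \<in> set (vars u)")
      case True
      have "mf v hs2 (\<psi>(x := c)) = mf v hs2 \<psi>" for c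
        using True d(3) by (intro multilin_dep[OF v]) auto
      then show ?thesis by (simp only: multilin_scale[OF u True] A.mulA_scale_left)
    next
      case False
      then have xv: "x \<in> set (vars v)" using x by simp
      have "mf u hs1 (\<psi>(x := c)) = mf u hs1 \<psi>" for c
        using False by (intro multilin_dep[OF u]) auto
      then show ?thesis by (simp only: multilin_scale[OF v xv] A.mulA_scale_right)
    qed
  qed
qed

lemma PS_multilin: assumes "F \<in> PS S" shows "multilin S F"
  using assms
proof (induction rule: PS_induct)
  case zero
  show ?case by (simp add: multilin_def)
next
  case (step c w hs G)
  have m: "multilin S (mf w hs)" using multilin_mf step.hyps by blast
  show ?case unfolding multilin_def
  proof (intro conjI allI impI ballI)
    fix \<psi> \<psi>' :: "nat \<Rightarrow> 'a" assume "\<forall>x\<in>S. \<psi> x = \<psi>' x"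
    then show "scaleA c (mf w hs \<psi>) + G \<psi> = scaleA c (mf w hs \<psi>') + G \<psi>'"
      using multilin_dep[OF m, of \<psi> \<psi>'] multilin_dep[OF step.IH, of \<psi> \<psi>'] by simp
  next
    fix x and \<psi> :: "nat \<Rightarrow> 'a" and a b assume x: "x \<in> S"
    show "scaleA c (mf w hs (\<psi>(x := a + b))) + G (\<psi>(x := a + b)) =
      scaleA c (mf w hs (\<psi>(x := a))) + G (\<psi>(x := a)) + (scaleA c (mf w hs (\<psi>(x := b))) + G (\<psi>(x := b)))"
      by (simp only: multilin_add[OF m x] multilin_add[OF step.IH x] A.scale_right_distrib ac_simps)
  next
    fix x and \<psi> :: "nat \<Rightarrow> 'a" and d a assume x: "x \<in> S"
    show "scaleA c (mf w hs (\<psi>(x := scaleA d a))) + G (\<psi>(x := scaleA d a)) =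
      scaleA d (scaleA c (mf w hs (\<psi>(x := a))) + G (\<psi>(x := a)))"
      by (simp only: multilin_scale[OF m x] multilin_scale[OF step.IH x] A.scale_right_distrib A.scale_scale
          mult.commute)
  qed
qed

text \<open>Induction on the set of arguments that are still arbitrary; each is expanded in the
  basis.\<close>

lemma multilin_zeroI:
  assumes m: "multilin S F" and S: "finite S"
    and z: "\<And>\<psi>. (\<And>x. x \<in> S \<Longrightarrow> \<psi> x \<in> Bs) \<Longrightarrow> F \<psi> = 0"
  shows "F \<psi> = 0"
proof -
  have "F \<psi> = 0" if "finite T" "T \<subseteq> S" "\<And>x. x \<in> S - T \<Longrightarrow> \<psi> x \<in> Bs" for T \<psi>
    using that
  proof (induction T arbitrary: \<psi> rule: finite_induct)
    case empty
    then show ?case by (intro z) simp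
  next
    case (insert x T)
    have x: "x \<in> S" using insert.prems(1) by simp
    have "\<psi> x \<in> A.span Bs" by (simp add: Bs_span)
    then have "F (\<psi>(x := \<psi> x)) = 0"
    proof (induction rule: A.span_induct_alt)
      case base
      show ?case by (rule multilin_zero[OF m x]) simp
    next
      case (step c b y)
      have "F (\<psi>(x := b)) = 0"
        by (rule insert.IH) (use insert.prems step.hyps in auto)
      then show ?case
        by (simp only: multilin_add[OF m x] multilin_scale[OF m x] step.IH A.scale_zero_right add_0)
    qed
    then show ?case by simp
  qed
  from this[of S \<psi>] S show ?thesis by simp
qed

definition coord :: "'a \<Rightarrow> 'a \<Rightarrow> 'f" where
  "coord b v = A.representation Bs v b"

lemma coord_add: "coord b (u + v) = coord b u + coord b v"
  by (simp add: coord_def A.representation_add[OF Bs_indep] Bs_span)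

lemma coord_scale: "coord b (scaleA c v) = c * coord b v"
  by (simp add: coord_def A.representation_scale[OF Bs_indep] Bs_span)

lemma coord_zeroI: assumes "\<And>b. b \<in> Bs \<Longrightarrow> coord b v = 0" shows "v = 0"
proof -
  have "(\<Sum>b\<in>Bs. scaleA (coord b v) b) = v"
    unfolding coord_def using A.sum_representation_eq[OF Bs_indep _ Bs_finite order_refl] Bs_span by auto
  then show ?thesis using assms by simp
qed

text \<open>The coordinates of the values at the words of \<open>W\<close> are separating
  functionals, \<open>card Bs\<close> of them for each word.\<close>

lemma separated_span_words:
  fixes W :: "(nat \<Rightarrow> 'a) set"
  assumes "finite W" "FS.subspace U"
    and sep: "\<And>F. F \<in> U \<Longrightarrow> (\<And>\<psi>. \<psi> \<in> W \<Longrightarrow> F \<psi> = 0) \<Longrightarrow> F = 0"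
  shows "\<exists>B\<subseteq>U. finite B \<and> card B \<le> card W * card Bs \<and> U \<subseteq> FS.span B"
proof -
  have "\<exists>B\<subseteq>U. finite B \<and> card B \<le> card (W \<times> Bs) \<and> U \<subseteq> FS.span B"
  proof (rule FS.separated_span[where \<phi> = "\<lambda>(\<psi>, b) F. coord b (F \<psi>)"])
    show "finite (W \<times> Bs)" using assms(1) Bs_finite by simp
    fix F assume F: "F \<in> U" and z: "\<And>p. p \<in> W \<times> Bs \<Longrightarrow> (case p of (\<psi>, b) \<Rightarrow> \<lambda>F. coord b (F \<psi>)) F = 0"
    show "F = 0"
    proof (rule sep[OF F])
      fix \<psi> assume "\<psi> \<in> W"
      then have "coord b (F \<psi>) = 0" if "b \<in> Bs" for b using z[of "(\<psi>, b)"] that by simp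
      then show "F \<psi> = 0" by (rule coord_zeroI)
    qed
  qed (auto simp: coord_add coord_scale fscale_def assms(2) split: prod.splits)
  then show ?thesis by (simp add: card_cartesian_product)
qed

lemma PS_finite:
  assumes "finite S" shows "\<exists>B. finite B \<and> B \<subseteq> PS S \<and> PS S \<subseteq> FS.span B"
proof -
  let ?W = "S \<rightarrow>\<^sub>E Bs"
  have "\<exists>B\<subseteq>PS S. finite B \<and> card B \<le> card ?W * card Bs \<and> PS S \<subseteq> FS.span B"
  proof (rule separated_span_words)
    show "finite ?W" using assms Bs_finite by (simp add: finite_PiE)
    fix F assume F: "F \<in> PS S" and z: "\<And>\<psi>. \<psi> \<in> ?W \<Longrightarrow> F \<psi> = 0"
    have m: "multilin S F" using F by (rule PS_multilin)
    have "F \<psi> = 0" for \<psi>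
    proof (rule multilin_zeroI[OF m assms])
      fix \<psi> assume p: "\<And>x. x \<in> S \<Longrightarrow> \<psi> x \<in> Bs"
      have "F \<psi> = F (restrict \<psi> S)" by (rule multilin_dep[OF m]) simp
      also have "\<dots> = 0" by (rule z) (use p in auto)
      finally show "F \<psi> = 0" .
    qed
    then show "F = 0" by (simp add: fun_eq_iff)
  qed (rule PS_subspace)
  then show ?thesis by blast
qed

abbreviation PN :: "nat \<Rightarrow> ((nat \<Rightarrow> 'a) \<Rightarrow> 'a) set" where
  "PN n \<equiv> PS {..<n}"

lemma rep: "Sn_rep fsc n frho"
  by (rule fun_rep) (rule A.vector_space_axioms)

lemma PN_invariant: "Sn_rep.invariant fsc n frho (PN n)"
proof -
  interpret Sn_rep fsc n frho by (rule rep)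
  show ?thesis unfolding invariant_def
  proof (intro conjI ballI PS_subspace)
    fix \<sigma> F assume s: "\<sigma> \<in> Sym n" and F: "F \<in> PN n"
    have "(\<lambda>\<psi>. F (\<psi> \<circ> \<sigma>)) \<in> PS (\<sigma> ` {..<n})"
      using s by (intro PS_rename[OF F]) (auto intro: permutes_inj_on)
    then show "frho \<sigma> F \<in> PN n" using s by (simp add: frho_def permutes_image)
  qed
qed

end

section \<open>Quotient spaces\<close>

locale quotient_space =
  fixes V :: "('f::field, 'v) module" and N :: "'v set"
  assumes module_V: "Module.module class_ring V" and submodule_N: "submodule class_ring N V"
begin

sublocale V: Module.module "class_ring :: 'f ring" V by (rule module_V)
sublocale N: submodule "class_ring :: 'f ring" N V by (rule submodule_N)

abbreviation coset :: "'v \<Rightarrow> 'v set" where "coset v \<equiv> N +>\<^bsub>V\<^esub> v"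

lemma coset_def: "coset v = {m \<oplus>\<^bsub>V\<^esub> v |m. m \<in> N}"
  by (auto simp: a_r_coset_def')

lemma N_carrier: "m \<in> N \<Longrightarrow> m \<in> carrier V" using N.subset by blast

lemma N_neg: "m \<in> N \<Longrightarrow> \<ominus>\<^bsub>V\<^esub> m \<in> N"
proof -
  assume m: "m \<in> N"
  have "- 1 \<odot>\<^bsub>V\<^esub> m \<in> N" using N.smult_closed[OF _ m, of "- 1"] by simp
  moreover have "- 1 \<odot>\<^bsub>V\<^esub> m = \<ominus>\<^bsub>V\<^esub> m"
    using V.smult_minus_1[OF N_carrier[OF m]] by (simp add: class_ring_simps)
  ultimately show ?thesis by simp
qed

lemma coset_self: "v \<in> carrier V \<Longrightarrow> v \<in> coset v"
  unfolding coset_def mem_Collect_eq by (rule exI[of _ "\<zero>\<^bsub>V\<^esub>"]) simp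

lemma coset_eqI:
  assumes "v \<in> carrier V" "w \<in> carrier V" "m \<in> N" "v = m \<oplus>\<^bsub>V\<^esub> w"
  shows "coset v = coset w"
proof -
  have "k \<oplus>\<^bsub>V\<^esub> v \<in> coset w" if k: "k \<in> N" for k
  proof -
    have "k \<oplus>\<^bsub>V\<^esub> v = (k \<oplus>\<^bsub>V\<^esub> m) \<oplus>\<^bsub>V\<^esub> w"
      using assms k N_carrier by (simp add: V.M.a_assoc)
    then show ?thesis using N.m_closed[OF k assms(3)] unfolding coset_def by blast
  qed
  moreover have "k \<oplus>\<^bsub>V\<^esub> w \<in> coset v" if k: "k \<in> N" for k
  proof -
    have "k \<oplus>\<^bsub>V\<^esub> w = (k \<oplus>\<^bsub>V\<^esub> \<ominus>\<^bsub>V\<^esub> m) \<oplus>\<^bsub>V\<^esub> v"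
      unfolding assms(4) using assms(2,3) k N_carrier N_neg[OF assms(3)]
      by (simp add: V.M.a_assoc V.M.r_neg1)
    then show ?thesis using N.m_closed[OF k N_neg[OF assms(3)]] unfolding coset_def by blast
  qed
  ultimately show ?thesis using coset_def by (intro equalityI subsetI) (auto simp: coset_def)
qed

lemma carrier_quot: "carrier (quot_space V N) = coset ` carrier V"
  by (auto simp: quot_space_def A_RCOSETS_def')

lemma zero_quot: "\<zero>\<^bsub>quot_space V N\<^esub> = coset \<zero>\<^bsub>V\<^esub>"
proof -
  have "coset \<zero>\<^bsub>V\<^esub> = N" using N_carrier by (auto simp: coset_def) (metis V.M.r_zero)
  then show ?thesis by (simp add: quot_space_def)
qed

lemma add_quot:
  assumes "v \<in> carrier V" "w \<in> carrier V"
  shows "coset v \<oplus>\<^bsub>quot_space V N\<^esub> coset w = coset (v \<oplus>\<^bsub>V\<^esub> w)"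
proof -
  have "coset v \<oplus>\<^bsub>quot_space V N\<^esub> coset w = {x \<oplus>\<^bsub>V\<^esub> y |x y. x \<in> coset v \<and> y \<in> coset w}"
    by (auto simp: quot_space_def set_add_def')
  also have "\<dots> = coset (v \<oplus>\<^bsub>V\<^esub> w)"
  proof (intro equalityI subsetI)
    fix z assume "z \<in> {x \<oplus>\<^bsub>V\<^esub> y |x y. x \<in> coset v \<and> y \<in> coset w}"
    then obtain m k where mk: "m \<in> N" "k \<in> N" "z = (m \<oplus>\<^bsub>V\<^esub> v) \<oplus>\<^bsub>V\<^esub> (k \<oplus>\<^bsub>V\<^esub> w)"
      unfolding coset_def by blast
    then have "z = (m \<oplus>\<^bsub>V\<^esub> k) \<oplus>\<^bsub>V\<^esub> (v \<oplus>\<^bsub>V\<^esub> w)"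
      using assms N_carrier by (simp add: V.M.a_ac)
    then show "z \<in> coset (v \<oplus>\<^bsub>V\<^esub> w)" using N.m_closed[OF mk(1,2)] unfolding coset_def by blast
  next
    fix z assume "z \<in> coset (v \<oplus>\<^bsub>V\<^esub> w)"
    then obtain m where m: "m \<in> N" "z = m \<oplus>\<^bsub>V\<^esub> (v \<oplus>\<^bsub>V\<^esub> w)" unfolding coset_def by blast
    then have z: "z = (m \<oplus>\<^bsub>V\<^esub> v) \<oplus>\<^bsub>V\<^esub> w" using assms N_carrier by (simp add: V.M.a_assoc)
    have "m \<oplus>\<^bsub>V\<^esub> v \<in> coset v" using m(1) unfolding coset_def by blast
    then show "z \<in> {x \<oplus>\<^bsub>V\<^esub> y |x y. x \<in> coset v \<and> y \<in> coset w}" using z coset_self[OF assms(2)] by blast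
  qed
  finally show ?thesis .
qed

text \<open>\<open>quot_space\<close> takes a union over all representatives of the coset; they all
  contribute the same coset.\<close>

lemma smult_quot:
  assumes "v \<in> carrier V"
  shows "c \<odot>\<^bsub>quot_space V N\<^esub> coset v = coset (c \<odot>\<^bsub>V\<^esub> v)"
proof -
  have "coset (c \<odot>\<^bsub>V\<^esub> x) = coset (c \<odot>\<^bsub>V\<^esub> v)" if x: "x \<in> coset v" for x
  proof -
    obtain m where m: "m \<in> N" "x = m \<oplus>\<^bsub>V\<^esub> v" using x unfolding coset_def by blast
    then have "c \<odot>\<^bsub>V\<^esub> x = (c \<odot>\<^bsub>V\<^esub> m) \<oplus>\<^bsub>V\<^esub> (c \<odot>\<^bsub>V\<^esub> v)"
      using assms N_carrier by (simp add: V.smult_r_distr)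
    then show ?thesis using m assms N_carrier by (intro coset_eqI[of _ _ "c \<odot>\<^bsub>V\<^esub> m"]) auto
  qed
  moreover have "v \<in> coset v" using assms by (rule coset_self)
  ultimately have "(\<Union>x\<in>coset v. coset (c \<odot>\<^bsub>V\<^esub> x)) = coset (c \<odot>\<^bsub>V\<^esub> v)" by blast
  then show ?thesis by (simp add: quot_space_def)
qed

lemma quot_module: "Module.module class_ring (quot_space V N)"
proof (rule module_criteria)
  show "cring (class_ring :: 'f ring)" by (rule class_cring.is_cring)
  show "\<forall>v\<in>carrier (quot_space V N). \<exists>neg_v\<in>carrier (quot_space V N). v \<oplus>\<^bsub>quot_space V N\<^esub> neg_v = \<zero>\<^bsub>quot_space V N\<^esub>"
  proof
    fix X assume "X \<in> carrier (quot_space V N)"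
    then obtain v where v: "v \<in> carrier V" "X = coset v" unfolding carrier_quot by blast
    then show "\<exists>neg_v\<in>carrier (quot_space V N). X \<oplus>\<^bsub>quot_space V N\<^esub> neg_v = \<zero>\<^bsub>quot_space V N\<^esub>"
      unfolding carrier_quot by (intro bexI[of _ "coset (\<ominus>\<^bsub>V\<^esub> v)"]) (simp_all add: add_quot zero_quot V.M.r_neg)
  qed
qed (auto simp: carrier_quot add_quot zero_quot smult_quot V.M.a_ac V.smult_assoc1[simplified] V.smult_l_distr[simplified]
      V.smult_r_distr V.smult_one[simplified] class_ring_simps)

end

section \<open>The algebra of \<open>H\<close>-polynomials\<close>

lemma free_alg_simps:
  "carrier (free_alg S g) = {p. Poly_Mapping.keys p \<subseteq> S}" "add (free_alg S g) = (+)"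
  "zero (free_alg S g) = 0" "module.smult (free_alg S g) = pm_scale"
  by (simp_all add: free_alg_def)

lemma keys_subset_iff: "Poly_Mapping.keys p \<subseteq> S \<longleftrightarrow> (\<forall>k. k \<notin> S \<longrightarrow> Poly_Mapping.lookup p k = 0)"
  by (auto simp: Poly_Mapping.in_keys_iff)

lemma free_alg_module: "Module.module class_ring (free_alg S g :: ('f::field, 'k \<Rightarrow>\<^sub>0 'f) module)"
proof -
  interpret vector_space "pm_scale :: 'f \<Rightarrow> ('k \<Rightarrow>\<^sub>0 'f) \<Rightarrow> _" by (rule vector_space_pm)
  show ?thesis
  proof (rule module_criteria)
    show "cring (class_ring :: 'f ring)" by (rule class_cring.is_cring)
    show "\<forall>v\<in>carrier (free_alg S g :: ('f, 'k \<Rightarrow>\<^sub>0 'f) module). \<exists>w\<in>carrier (free_alg S g).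
      v \<oplus>\<^bsub>free_alg S g\<^esub> w = \<zero>\<^bsub>free_alg S g\<^esub>"
    proof
      fix v :: "'k \<Rightarrow>\<^sub>0 'f" assume "v \<in> carrier (free_alg S g)"
      then show "\<exists>w\<in>carrier (free_alg S g). v \<oplus>\<^bsub>free_alg S g\<^esub> w = \<zero>\<^bsub>free_alg S g\<^esub>"
        by (intro bexI[of _ "- v"]) (auto simp: free_alg_simps)
    qed
  qed (simp_all add: free_alg_simps keys_subset_iff Poly_Mapping.lookup_add scale_left_distrib
      scale_right_distrib ac_simps)
qed

context fd_H_algebra
begin

abbreviation pre :: "('f, ('h list \<times> monom) \<Rightarrow>\<^sub>0 'f) module" where "pre \<equiv> pre_Hpolys"
abbreviation TZ :: "(('h list \<times> monom) \<Rightarrow>\<^sub>0 'f) set" where "TZ \<equiv> tensor_zero scaleH"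
abbreviation HP :: "('f, (('h list \<times> monom) \<Rightarrow>\<^sub>0 'f) set) module" where "HP \<equiv> Hpolys scaleH"

definition ev1 :: "(('h list \<times> monom) \<Rightarrow>\<^sub>0 'f) \<Rightarrow> (nat \<Rightarrow> 'a) \<Rightarrow> 'a" where
  "ev1 p = (\<lambda>\<psi>. eval_pre scaleA mulA act \<psi> p)"

lemma ev1_eq:
  assumes "finite K" "Poly_Mapping.keys p \<subseteq> K"
  shows "ev1 p \<psi> = (\<Sum>(hs, w)\<in>K. scaleA (Poly_Mapping.lookup p (hs, w)) (mf w hs \<psi>))"
  unfolding ev1_def eval_pre_def mf_def using assms
  by (intro sum.mono_neutral_left) (auto simp: Poly_Mapping.in_keys_iff)

lemma ev1_add: "ev1 (p + q) = ev1 p + ev1 q"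
proof
  fix \<psi>
  let ?K = "Poly_Mapping.keys p \<union> Poly_Mapping.keys q"
  have "Poly_Mapping.keys (p + q) \<subseteq> ?K" by (rule Poly_Mapping.keys_add)
  then have "ev1 (p + q) \<psi> = (\<Sum>(hs, w)\<in>?K. scaleA (Poly_Mapping.lookup (p + q) (hs, w)) (mf w hs \<psi>))"
    by (intro ev1_eq) auto
  also have "\<dots> = (\<Sum>(hs, w)\<in>?K. scaleA (Poly_Mapping.lookup p (hs, w)) (mf w hs \<psi>)) +
      (\<Sum>(hs, w)\<in>?K. scaleA (Poly_Mapping.lookup q (hs, w)) (mf w hs \<psi>))"
    by (simp add: Poly_Mapping.lookup_add A.scale_left_distrib sum.distrib case_prod_unfold)
  also have "\<dots> = ev1 p \<psi> + ev1 q \<psi>" by (subst (1 2) ev1_eq[of ?K]) auto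
  finally show "ev1 (p + q) \<psi> = (ev1 p + ev1 q) \<psi>" by simp
qed

lemma ev1_scale: "ev1 (pm_scale c p) = fsc c (ev1 p)"
proof
  fix \<psi>
  have "Poly_Mapping.keys (pm_scale c p) \<subseteq> Poly_Mapping.keys p" by (auto simp: Poly_Mapping.in_keys_iff)
  then have "ev1 (pm_scale c p) \<psi> = (\<Sum>(hs, w)\<in>Poly_Mapping.keys p. scaleA (c * Poly_Mapping.lookup p (hs, w)) (mf w hs \<psi>))"
    by (subst ev1_eq[of "Poly_Mapping.keys p"]) auto
  also have "\<dots> = scaleA c (ev1 p \<psi>)"
    by (subst ev1_eq[of "Poly_Mapping.keys p"]) (auto simp: A.scale_sum_right case_prod_unfold)
  finally show "ev1 (pm_scale c p) \<psi> = fsc c (ev1 p) \<psi>" by (simp add: fscale_def)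
qed

lemma ev1_zero: "ev1 0 = 0"
  using ev1_add[of 0 0] by simp

lemma ev1_minus: "ev1 (p - q) = ev1 p - ev1 q"
  using ev1_add[of "p - q" q] by (simp add: algebra_simps)

lemma ev1_single: "ev1 (Poly_Mapping.single (hs, w) c) = fsc c (mf w hs)"
  by (rule ext, subst ev1_eq[of "{(hs, w)}"]) (auto simp: fscale_def)

text \<open>Together with the scalar version, this is what lets evaluation respect the tensor
  relations.\<close>

lemma mf_update_add:
  "k < length hs \<Longrightarrow> length hs = deg w \<Longrightarrow>
    mf w (hs[k := g + h]) \<psi> = mf w (hs[k := g]) \<psi> + mf w (hs[k := h]) \<psi>"
proof (induction w arbitrary: hs k)
  case (Var i)
  then obtain x where "hs = [x]" "k = 0" by (cases hs) auto
  then show ?case by (simp add: mf_def act_add_left)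
next
  case (Prod u v)
  show ?case
  proof (cases "k < deg u")
    case True
    have "mf u ((take (deg u) hs)[k := g + h]) \<psi> = mf u ((take (deg u) hs)[k := g]) \<psi> + mf u ((take (deg u) hs)[k := h]) \<psi>"
      using Prod.prems True by (intro Prod.IH(1)) auto
    then show ?thesis using True by (simp add: mf_def take_update_swap drop_update_cancel A.mulA_add_left)
  next
    case False
    have "mf v ((drop (deg u) hs)[k - deg u := g + h]) \<psi> =
        mf v ((drop (deg u) hs)[k - deg u := g]) \<psi> + mf v ((drop (deg u) hs)[k - deg u := h]) \<psi>"
      using Prod.prems False by (intro Prod.IH(2)) auto
    then show ?thesis using False by (simp add: mf_def drop_update_swap take_update_cancel A.mulA_add_right)
  qed
qed

lemma mf_update_scale:
  "k < length hs \<Longrightarrow> length hs = deg w \<Longrightarrow>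
    mf w (hs[k := scaleH c h]) \<psi> = scaleA c (mf w (hs[k := h]) \<psi>)"
proof (induction w arbitrary: hs k)
  case (Var i)
  then obtain x where "hs = [x]" "k = 0" by (cases hs) auto
  then show ?case by (simp add: mf_def act_scale_left)
next
  case (Prod u v)
  show ?case
  proof (cases "k < deg u")
    case True
    have "mf u ((take (deg u) hs)[k := scaleH c h]) \<psi> = scaleA c (mf u ((take (deg u) hs)[k := h]) \<psi>)"
      using Prod.prems True by (intro Prod.IH(1)) auto
    then show ?thesis using True by (simp add: mf_def take_update_swap drop_update_cancel A.mulA_scale_left)
  next
    case False
    have "mf v ((drop (deg u) hs)[k - deg u := scaleH c h]) \<psi> = scaleA c (mf v ((drop (deg u) hs)[k - deg u := h]) \<psi>)"
      using Prod.prems False by (intro Prod.IH(2)) auto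
    then show ?thesis using False by (simp add: mf_def drop_update_swap take_update_cancel A.mulA_scale_right)
  qed
qed

interpretation pre: Module.module "class_ring :: 'f ring" pre by (rule free_alg_module)

lemma single_in_pre: "(hs, w) \<in> Hmonoms \<Longrightarrow> Poly_Mapping.single (hs, w) c \<in> carrier pre"
  by (auto simp: free_alg_simps)

lemma relations_carrier: "tensor_relations scaleH \<subseteq> carrier pre"
proof -
  have d: "p - q \<in> carrier pre" if "p \<in> carrier pre" "q \<in> carrier pre" for p q
    using that by (simp add: free_alg_simps keys_subset_iff lookup_minus)
  have m: "(hs[k := x], w) \<in> Hmonoms" if "(hs, w) \<in> Hmonoms" for hs w k x
    using that by (simp add: Hmonoms_def)
  show ?thesis unfolding tensor_relations_def by (auto intro!: d single_in_pre m)
qed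

lemma TZ_submodule: "submodule class_ring TZ pre"
  unfolding tensor_zero_def by (rule pre.span_is_submodule[OF relations_carrier])

sublocale T: quotient_space pre TZ
  by (intro quotient_space.intro free_alg_module TZ_submodule)

lemma TZ_le:
  assumes "tensor_relations scaleH \<subseteq> N" "submodule class_ring N pre" shows "TZ \<subseteq> N"
  unfolding tensor_zero_def by (rule pre.span_is_subset[OF assms])

text \<open>The elements with zero evaluation form a submodule containing the tensor relations,
  hence everything that they span.\<close>

lemma ev1_TZ: assumes "p \<in> TZ" shows "ev1 p = 0"
proof -
  have "submodule class_ring {p \<in> carrier pre. ev1 p = 0} pre"
    unfolding submodule_def using free_alg_module
    by (auto simp: ev1_add ev1_zero ev1_scale free_alg_simps(2-4) fscale_def fun_eq_iff)
      (auto simp: free_alg_simps keys_subset_iff Poly_Mapping.lookup_add)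
  moreover have "tensor_relations scaleH \<subseteq> {p \<in> carrier pre. ev1 p = 0}"
  proof
    fix p assume p: "p \<in> tensor_relations scaleH"
    then have "ev1 p = 0"
      unfolding tensor_relations_def
      by (auto simp: ev1_minus ev1_single fscale_def fun_eq_iff mf_update_add mf_update_scale Hmonoms_def)
    then show "p \<in> {p \<in> carrier pre. ev1 p = 0}" using p relations_carrier by blast
  qed
  ultimately show ?thesis using TZ_le assms by blast
qed

definition ev2 :: "(('h list \<times> monom) \<Rightarrow>\<^sub>0 'f) set \<Rightarrow> (nat \<Rightarrow> 'a) \<Rightarrow> 'a" where
  "ev2 f = (\<lambda>\<psi>. eval_Hpoly scaleA mulA act \<psi> f)"

abbreviation co :: "(('h list \<times> monom) \<Rightarrow>\<^sub>0 'f) \<Rightarrow> (('h list \<times> monom) \<Rightarrow>\<^sub>0 'f) set" where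
  "co p \<equiv> TZ +>\<^bsub>pre\<^esub> p"

lemma co_def: "co p = {t + p |t. t \<in> TZ}" unfolding T.coset_def by (simp add: free_alg_simps)

lemma HP_eq: "HP = quot_space pre TZ" by (simp add: Hpolys_def)

text \<open>By \<open>ev1_TZ\<close> evaluation is constant on a coset, so \<open>the_elem\<close>
  returns its only value.\<close>

lemma ev2_co: assumes "p \<in> carrier pre" shows "ev2 (co p) = ev1 p"
proof
  fix \<psi>
  have e: "ev1 q \<psi> = ev1 p \<psi>" if q: "q \<in> co p" for q
  proof -
    obtain t where "t \<in> TZ" "q = t + p" using q unfolding co_def by blast
    then show ?thesis using ev1_TZ[of t] by (simp add: ev1_add)
  qed
  have "(\<lambda>q. ev1 q \<psi>) ` co p = {ev1 p \<psi>}"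
  proof
    show "(\<lambda>q. ev1 q \<psi>) ` co p \<subseteq> {ev1 p \<psi>}" using e by blast
    show "{ev1 p \<psi>} \<subseteq> (\<lambda>q. ev1 q \<psi>) ` co p" using T.coset_self[OF assms] by blast
  qed
  then show "ev2 (co p) \<psi> = ev1 p \<psi>"
    unfolding ev2_def eval_Hpoly_def by (simp add: ev1_def)
qed

lemma HP_module: "Module.module class_ring HP" unfolding HP_eq by (rule T.quot_module)

lemma HP_carrier: "carrier HP = co ` carrier pre" unfolding HP_eq by (rule T.carrier_quot)

lemma HP_add: "p \<in> carrier pre \<Longrightarrow> q \<in> carrier pre \<Longrightarrow> co p \<oplus>\<^bsub>HP\<^esub> co q = co (p + q)"
  unfolding HP_eq using T.add_quot by (simp add: free_alg_simps)

lemma HP_smult: "p \<in> carrier pre \<Longrightarrow> c \<odot>\<^bsub>HP\<^esub> co p = co (pm_scale c p)"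
  unfolding HP_eq using T.smult_quot by (simp add: free_alg_simps)

lemma HP_zero: "\<zero>\<^bsub>HP\<^esub> = co 0"
  unfolding HP_eq using T.zero_quot by (simp add: free_alg_simps)

lemma pre_closed:
  "p \<in> carrier pre \<Longrightarrow> q \<in> carrier pre \<Longrightarrow> p + q \<in> carrier pre"
  "p \<in> carrier pre \<Longrightarrow> pm_scale c p \<in> carrier pre" "0 \<in> carrier pre"
  by (auto simp: free_alg_simps keys_subset_iff Poly_Mapping.lookup_add)

lemma ev2_add: "f \<in> carrier HP \<Longrightarrow> g \<in> carrier HP \<Longrightarrow> ev2 (f \<oplus>\<^bsub>HP\<^esub> g) = ev2 f + ev2 g"
  unfolding HP_carrier by (elim imageE) (simp add: HP_add ev2_co pre_closed ev1_add)

lemma ev2_smult: "f \<in> carrier HP \<Longrightarrow> ev2 (c \<odot>\<^bsub>HP\<^esub> f) = fsc c (ev2 f)"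
  unfolding HP_carrier by (elim imageE) (simp add: HP_smult ev2_co pre_closed ev1_scale)

lemma ev2_zero: "ev2 \<zero>\<^bsub>HP\<^esub> = 0" by (simp add: HP_zero ev2_co pre_closed ev1_zero)


section \<open>Multilinear \<open>H\<close>-polynomials as multilinear functions\<close>

abbreviation gens :: "nat \<Rightarrow> (('h list \<times> monom) \<Rightarrow>\<^sub>0 'f) set set" where
  "gens n \<equiv> {Hmonom scaleH hs w |hs w \<sigma>. length hs = n \<and> \<sigma> permutes {..<n} \<and> vars w = map \<sigma> [0..<n]}"

abbreviation MLP :: "nat \<Rightarrow> (('h list \<times> monom) \<Rightarrow>\<^sub>0 'f) set set" where
  "MLP n \<equiv> multilinear_Hpolys scaleH n"

lemma vars_perm_iff:
  "(\<exists>\<sigma>. \<sigma> permutes {..<n} \<and> vars w = map \<sigma> [0..<n]) \<longleftrightarrow> distinct (vars w) \<and> set (vars w) = {..<n}"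
proof
  assume "\<exists>\<sigma>. \<sigma> permutes {..<n} \<and> vars w = map \<sigma> [0..<n]"
  then obtain \<sigma> where s: "\<sigma> permutes {..<n}" "vars w = map \<sigma> [0..<n]" by blast
  then show "distinct (vars w) \<and> set (vars w) = {..<n}"
    using permutes_image[OF s(1)] permutes_inj_on[OF s(1)]
    by (simp add: distinct_map atLeast0LessThan)
next
  assume d: "distinct (vars w) \<and> set (vars w) = {..<n}"
  then have l: "deg w = n" using distinct_card[of "vars w"] by simp
  define \<sigma> where "\<sigma> i = (if i < n then vars w ! i else i)" for i
  have "bij_betw ((!) (vars w)) {..<n} {..<n}" by (rule bij_betw_nth) (use d l in auto)
  then have "bij_betw \<sigma> {..<n} {..<n}" by (rule bij_betw_cong[THEN iffD1, rotated]) (simp add: \<sigma>_def)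
  then have "\<sigma> permutes {..<n}" by (rule bij_imp_permutes) (simp add: \<sigma>_def)
  moreover have "vars w = map \<sigma> [0..<n]" by (rule nth_equalityI) (simp_all add: l \<sigma>_def)
  ultimately show "\<exists>\<sigma>. \<sigma> permutes {..<n} \<and> vars w = map \<sigma> [0..<n]" by blast
qed

lemma gens_eq: "gens n = {co (Poly_Mapping.single (hs, w) 1) |hs w.
    length hs = deg w \<and> distinct (vars w) \<and> set (vars w) = {..<n}}" (is "_ = ?R")
proof (intro equalityI subsetI)
  fix f assume "f \<in> gens n"
  then obtain hs w \<sigma> where f: "f = Hmonom scaleH hs w" "length hs = n" "\<sigma> permutes {..<n}" "vars w = map \<sigma> [0..<n]"
    by blast
  then have "distinct (vars w)" "set (vars w) = {..<n}" using vars_perm_iff[of n w] by blast+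
  moreover have "length hs = deg w" using f by simp
  ultimately show "f \<in> ?R" using f(1) unfolding Hmonom_def by blast
next
  fix f assume "f \<in> ?R"
  then obtain hs w where f: "f = Hmonom scaleH hs w" "length hs = deg w" "distinct (vars w)" "set (vars w) = {..<n}"
    unfolding Hmonom_def by blast
  then obtain \<sigma> where "\<sigma> permutes {..<n}" "vars w = map \<sigma> [0..<n]" using vars_perm_iff[of n w] by blast
  moreover have "deg w = n" using f distinct_card[of "vars w"] by simp
  ultimately show "f \<in> gens n" using f by auto
qed

lemma gens_carrier: "gens n \<subseteq> carrier HP"
  unfolding gens_eq HP_carrier by (auto simp: free_alg_simps Hmonoms_def)

interpretation HP: Module.module "class_ring :: 'f ring" HP by (rule HP_module)

lemma MLP_submodule: "submodule class_ring (MLP n) HP"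
  unfolding multilinear_Hpolys_def by (rule HP.span_is_submodule[OF gens_carrier])

lemma MLP_le: "gens n \<subseteq> N \<Longrightarrow> submodule class_ring N HP \<Longrightarrow> MLP n \<subseteq> N"
  unfolding multilinear_Hpolys_def by (rule HP.span_is_subset)

lemma gens_MLP: "gens n \<subseteq> MLP n"
  unfolding multilinear_Hpolys_def by (rule HP.in_own_span[OF gens_carrier])

lemma MLP_carrier: "f \<in> MLP n \<Longrightarrow> f \<in> carrier HP"
  using MLP_submodule unfolding submodule_def by blast

lemma MLP_closed:
  "f \<in> MLP n \<Longrightarrow> g \<in> MLP n \<Longrightarrow> f \<oplus>\<^bsub>HP\<^esub> g \<in> MLP n" "\<zero>\<^bsub>HP\<^esub> \<in> MLP n" "f \<in> MLP n \<Longrightarrow> c \<odot>\<^bsub>HP\<^esub> f \<in> MLP n"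
  using MLP_submodule[of n] unfolding submodule_def by auto

lemma submoduleI_HP:
  assumes "N \<subseteq> carrier HP" "\<zero>\<^bsub>HP\<^esub> \<in> N" "\<And>f g. f \<in> N \<Longrightarrow> g \<in> N \<Longrightarrow> f \<oplus>\<^bsub>HP\<^esub> g \<in> N"
    "\<And>c f. f \<in> N \<Longrightarrow> c \<odot>\<^bsub>HP\<^esub> f \<in> N"
  shows "submodule class_ring N HP"
  unfolding submodule_def using HP_module assms by simp

lemma ev2_gen:
  assumes "length hs = deg w" shows "ev2 (co (Poly_Mapping.single (hs, w) 1)) = mf w hs"
proof -
  have "(hs, w) \<in> Hmonoms" using assms by (simp add: Hmonoms_def)
  then show ?thesis by (simp only: ev2_co[OF single_in_pre] ev1_single fscale_def A.scale_one)
qed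

text \<open>With \<open>N2_iff\<close>, which identifies the kernel, this makes the space of
  multilinear H-polynomials modulo identities a copy of \<open>PN n\<close>.\<close>

lemma ev2_MLP: "ev2 ` MLP n = PN n"
proof
  let ?N = "{f \<in> carrier HP. ev2 f \<in> PN n}"
  have "submodule class_ring ?N HP"
    by (rule submoduleI_HP) (auto simp: ev2_add ev2_smult ev2_zero FS.subspace_0[OF PS_subspace]
        FS.subspace_add[OF PS_subspace] FS.subspace_scale[OF PS_subspace])
  moreover have "gens n \<subseteq> ?N"
  proof
    fix f assume f: "f \<in> gens n"
    then obtain hs w where "f = co (Poly_Mapping.single (hs, w) 1)" "length hs = deg w" "distinct (vars w)"
      "set (vars w) = {..<n}" unfolding gens_eq by blast
    then have "ev2 f \<in> PN n" using ev2_gen mf_in_PS by metis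
    then show "f \<in> ?N" using f gens_carrier by blast
  qed
  ultimately have "MLP n \<subseteq> ?N" by (intro MLP_le)
  then show "ev2 ` MLP n \<subseteq> PN n" by blast
  have "FS.subspace (ev2 ` MLP n)"
  proof (rule FS.subspaceI)
    show "0 \<in> ev2 ` MLP n" using ev2_zero MLP_closed(2)[of n] by (metis imageI)
    fix F G assume "F \<in> ev2 ` MLP n" "G \<in> ev2 ` MLP n"
    then obtain f g where fg: "f \<in> MLP n" "g \<in> MLP n" "F = ev2 f" "G = ev2 g" by blast
    have "F + G = ev2 (f \<oplus>\<^bsub>HP\<^esub> g)" using fg by (simp add: ev2_add MLP_carrier[of _ n])
    then show "F + G \<in> ev2 ` MLP n" using MLP_closed(1)[OF fg(1,2)] by blast
  next
    fix c F assume "F \<in> ev2 ` MLP n"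
    then obtain f where f: "f \<in> MLP n" "F = ev2 f" by blast
    have "fsc c F = ev2 (c \<odot>\<^bsub>HP\<^esub> f)" using f by (simp add: ev2_smult MLP_carrier[of _ n])
    then show "fsc c F \<in> ev2 ` MLP n" using MLP_closed(3)[OF f(1)] by blast
  qed
  moreover have "{mf w hs |w hs. length hs = deg w \<and> distinct (vars w) \<and> set (vars w) = {..<n}} \<subseteq> ev2 ` MLP n"
  proof
    fix F assume "F \<in> {mf w hs |w hs. length hs = deg w \<and> distinct (vars w) \<and> set (vars w) = {..<n}}"
    then obtain w hs where F: "F = mf w hs" "length hs = deg w" "distinct (vars w)" "set (vars w) = {..<n}" by blast
    have "co (Poly_Mapping.single (hs, w) 1) \<in> MLP n" using F gens_MLP[of n] unfolding gens_eq by blast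
    then show "F \<in> ev2 ` MLP n" using ev2_gen[OF F(2)] F(1) by (metis imageI)
  qed
  ultimately show "PN n \<subseteq> ev2 ` MLP n" unfolding PS_def by (intro FS.span_minimal) auto
qed

abbreviation V2 :: "nat \<Rightarrow> ('f, (('h list \<times> monom) \<Rightarrow>\<^sub>0 'f) set) module" where
  "V2 n \<equiv> HP\<lparr>carrier := MLP n\<rparr>"

abbreviation N2 :: "nat \<Rightarrow> (('h list \<times> monom) \<Rightarrow>\<^sub>0 'f) set set" where
  "N2 n \<equiv> MLP n \<inter> H_identities scaleH scaleA mulA act"

lemma N2_iff: "f \<in> N2 n \<longleftrightarrow> f \<in> MLP n \<and> ev2 f = 0"
  using MLP_carrier[of f n] by (auto simp: H_identities_def ev2_def fun_eq_iff)

lemma V2_quotient: "quotient_space (V2 n) (N2 n)"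
proof (rule quotient_space.intro)
  show m: "Module.module class_ring (V2 n)" by (rule HP.submodule_is_module[OF MLP_submodule])
  show "submodule class_ring (N2 n) (V2 n)"
  proof (rule submodule.intro)
    show "Module.module class_ring (V2 n)" by (rule m)
    show "N2 n \<subseteq> carrier (V2 n)" by simp
    show "f \<oplus>\<^bsub>V2 n\<^esub> g \<in> N2 n" if "f \<in> N2 n" "g \<in> N2 n" for f g
      using that unfolding N2_iff by (simp add: MLP_closed ev2_add MLP_carrier[of _ n])
    show "\<zero>\<^bsub>V2 n\<^esub> \<in> N2 n" unfolding N2_iff by (simp add: MLP_closed ev2_zero)
    show "c \<odot>\<^bsub>V2 n\<^esub> f \<in> N2 n" if "f \<in> N2 n" for c f
      using that unfolding N2_iff by (simp add: MLP_closed ev2_smult MLP_carrier[of _ n])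
  qed
qed

abbreviation MQ where "MQ n \<equiv> multilinear_quot scaleH scaleA mulA act n"

text \<open>Any representative may be evaluated, since two of them differ by an identity; see
  \<open>Th_cq\<close>.\<close>

definition Th :: "(('h list \<times> monom) \<Rightarrow>\<^sub>0 'f) set set \<Rightarrow> (nat \<Rightarrow> 'a) \<Rightarrow> 'a" where
  "Th C = ev2 (SOME f. f \<in> C)"

abbreviation cq :: "nat \<Rightarrow> (('h list \<times> monom) \<Rightarrow>\<^sub>0 'f) set \<Rightarrow> (('h list \<times> monom) \<Rightarrow>\<^sub>0 'f) set set" where
  "cq n f \<equiv> N2 n +>\<^bsub>V2 n\<^esub> f"

lemma cq_def: "cq n f = {m \<oplus>\<^bsub>HP\<^esub> f |m. m \<in> N2 n}"
proof -
  interpret quotient_space "V2 n" "N2 n" by (rule V2_quotient)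
  show ?thesis unfolding coset_def by simp
qed

lemma Th_cq: assumes "f \<in> MLP n" shows "Th (cq n f) = ev2 f"
proof -
  interpret quotient_space "V2 n" "N2 n" by (rule V2_quotient)
  have "f \<in> cq n f" using coset_self[of f] assms by simp
  then have "(SOME g. g \<in> cq n f) \<in> cq n f" by (rule someI)
  then obtain m where m: "m \<in> N2 n" "(SOME g. g \<in> cq n f) = m \<oplus>\<^bsub>HP\<^esub> f" unfolding cq_def by blast
  have "ev2 (m \<oplus>\<^bsub>HP\<^esub> f) = ev2 f"
    using m(1) assms unfolding N2_iff by (simp add: ev2_add MLP_carrier[of _ n])
  then show ?thesis by (simp add: Th_def m(2))
qed

lemma MQ_eq: "MQ n = quot_space (V2 n) (N2 n)" by (simp add: multilinear_quot_def)

lemma MQ_carrier: "carrier (MQ n) = cq n ` MLP n"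
  unfolding MQ_eq using quotient_space.carrier_quot[OF V2_quotient] by simp

lemma Th_bij: "bij_betw Th (carrier (MQ n)) (PN n)"
proof (rule bij_betw_imageI)
  interpret quotient_space "V2 n" "N2 n" by (rule V2_quotient)
  show "Th ` carrier (MQ n) = PN n"
    unfolding MQ_carrier ev2_MLP[symmetric] image_image by (rule image_cong[OF refl]) (rule Th_cq)
  show "inj_on Th (carrier (MQ n))"
  proof (rule inj_onI)
    fix C D assume "C \<in> carrier (MQ n)" "D \<in> carrier (MQ n)" and e: "Th C = Th D"
    then obtain f g where fg: "f \<in> MLP n" "g \<in> MLP n" "C = cq n f" "D = cq n g" unfolding MQ_carrier by blast
    have fg': "f \<in> carrier HP" "g \<in> carrier HP" using fg MLP_carrier by auto
    have "ev2 f = ev2 g" using e fg by (simp add: Th_cq)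
    let ?m = "f \<oplus>\<^bsub>HP\<^esub> (- 1 \<odot>\<^bsub>HP\<^esub> g)"
    have mML: "?m \<in> MLP n" using fg by (simp add: MLP_closed)
    have "ev2 ?m = ev2 f + fsc (- 1) (ev2 g)" using fg' by (simp add: ev2_add ev2_smult)
    also have "\<dots> = 0" using \<open>ev2 f = ev2 g\<close> by (simp add: FS.scale_minus_left)
    finally have m: "?m \<in> N2 n" using mML unfolding N2_iff by simp
    have "- 1 \<odot>\<^bsub>HP\<^esub> g = \<ominus>\<^bsub>HP\<^esub> g" using HP.smult_minus_1[OF fg'(2)] by (simp add: class_ring_simps)
    then have "?m \<oplus>\<^bsub>HP\<^esub> g = f" using fg' by (simp add: HP.M.a_assoc HP.M.l_neg)
    then have "f = ?m \<oplus>\<^bsub>V2 n\<^esub> g" by simp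
    then have "cq n f = cq n g" using fg(1,2) m by (intro coset_eqI[of f g ?m]) simp_all
    then show "C = D" using fg by simp
  qed
qed

lemma Th_add': "C \<in> carrier (MQ n) \<Longrightarrow> D \<in> carrier (MQ n) \<Longrightarrow> Th (C \<oplus>\<^bsub>MQ n\<^esub> D) = Th C + Th D"
proof -
  interpret quotient_space "V2 n" "N2 n" by (rule V2_quotient)
  assume "C \<in> carrier (MQ n)" "D \<in> carrier (MQ n)"
  then obtain f g where fg: "f \<in> MLP n" "g \<in> MLP n" "C = cq n f" "D = cq n g" unfolding MQ_carrier by blast
  have "C \<oplus>\<^bsub>MQ n\<^esub> D = cq n (f \<oplus>\<^bsub>HP\<^esub> g)" unfolding MQ_eq fg(3,4) using add_quot[of f g] fg(1,2) by simp
  then show ?thesis using fg by (simp add: Th_cq MLP_closed ev2_add MLP_carrier[of _ n])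
qed

lemma Th_smult': "C \<in> carrier (MQ n) \<Longrightarrow> Th (c \<odot>\<^bsub>MQ n\<^esub> C) = fsc c (Th C)"
proof -
  interpret quotient_space "V2 n" "N2 n" by (rule V2_quotient)
  assume "C \<in> carrier (MQ n)"
  then obtain f where f: "f \<in> MLP n" "C = cq n f" unfolding MQ_carrier by blast
  have "c \<odot>\<^bsub>MQ n\<^esub> C = cq n (c \<odot>\<^bsub>HP\<^esub> f)" unfolding MQ_eq f(2) using smult_quot[of f c] f(1) by simp
  then show ?thesis using f by (simp add: Th_cq MLP_closed ev2_smult MLP_carrier[of _ n])
qed

end

section \<open>Renaming of variables\<close>

lemma lin_ext_eq:
  assumes "finite K" "Poly_Mapping.keys p \<subseteq> K"
  shows "lin_ext g p = (\<Sum>k\<in>K. Poly_Mapping.single (g k) (Poly_Mapping.lookup p k))"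
  unfolding lin_ext_def using assms
  by (intro sum.mono_neutral_left) (auto simp: Poly_Mapping.in_keys_iff)

lemma lin_ext_add: "lin_ext g (p + q) = lin_ext g p + lin_ext g q"
proof -
  let ?K = "Poly_Mapping.keys p \<union> Poly_Mapping.keys q"
  have "Poly_Mapping.keys (p + q) \<subseteq> ?K" by (rule Poly_Mapping.keys_add)
  then have "lin_ext g (p + q) = (\<Sum>k\<in>?K. Poly_Mapping.single (g k) (Poly_Mapping.lookup (p + q) k))"
    by (intro lin_ext_eq) auto
  also have "\<dots> = (\<Sum>k\<in>?K. Poly_Mapping.single (g k) (Poly_Mapping.lookup p k)) +
     (\<Sum>k\<in>?K. Poly_Mapping.single (g k) (Poly_Mapping.lookup q k))"
    by (simp add: Poly_Mapping.lookup_add single_add sum.distrib)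
  also have "\<dots> = lin_ext g p + lin_ext g q" by (subst (1 2) lin_ext_eq[of ?K]) auto
  finally show ?thesis .
qed

lemma lin_ext_zero: "lin_ext g 0 = 0" by (simp add: lin_ext_def)

lemma lin_ext_minus: "lin_ext g (p - q) = lin_ext g p - lin_ext g q"
  using lin_ext_add[of g "p - q" q] by (simp add: algebra_simps)

lemma lin_ext_sum: "lin_ext g (sum f I) = (\<Sum>i\<in>I. lin_ext g (f i))"
  by (induction I rule: infinite_finite_induct) (auto simp: lin_ext_add lin_ext_zero)

lemma lin_ext_single: "lin_ext g (Poly_Mapping.single k c) = Poly_Mapping.single (g k) c"
  by (simp add: lin_ext_def)

lemma pm_scale_single: "pm_scale c (Poly_Mapping.single k d) = Poly_Mapping.single k (c * d)"
  by (rule poly_mapping_eqI) (simp add: Poly_Mapping.lookup_single when_def)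

lemma lin_ext_scale:
  fixes p :: "'k \<Rightarrow>\<^sub>0 'f::field" and g :: "'k \<Rightarrow> 'l"
  shows "lin_ext g (pm_scale c p) = pm_scale c (lin_ext g p)"
proof -
  interpret vector_space "pm_scale :: 'f \<Rightarrow> ('l \<Rightarrow>\<^sub>0 'f) \<Rightarrow> _" by (rule vector_space_pm)
  have "Poly_Mapping.keys (pm_scale c p) \<subseteq> Poly_Mapping.keys p" by (auto simp: Poly_Mapping.in_keys_iff)
  then have "lin_ext g (pm_scale c p) = (\<Sum>k\<in>Poly_Mapping.keys p. pm_scale c (Poly_Mapping.single (g k) (Poly_Mapping.lookup p k)))"
    by (subst lin_ext_eq[of "Poly_Mapping.keys p"]) (auto simp: pm_scale_single)
  then show ?thesis by (simp add: lin_ext_def scale_sum_right)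
qed

lemma lin_ext_comp: "lin_ext g (lin_ext h p) = lin_ext (g \<circ> h) p"
  unfolding lin_ext_def[of h] lin_ext_sum lin_ext_single by (simp add: lin_ext_def)

lemma lin_ext_id: "lin_ext (\<lambda>x. x) p = p"
  by (rule poly_mapping_eqI) (use lookup_lin_ext[of "\<lambda>x. x" p] in simp)

lemma rename_comp: "rename \<sigma> (rename \<tau> w) = rename (\<sigma> \<circ> \<tau>) w" by (induction w) auto

lemma rename_id: "rename id w = w" by (induction w) auto

lemma perm_pre_comp: "perm_pre \<sigma> (perm_pre \<tau> p) = perm_pre (\<sigma> \<circ> \<tau>) p"
  unfolding perm_pre_def lin_ext_comp by (rule arg_cong[of _ _ "\<lambda>g. lin_ext g p"]) (auto simp: rename_comp)

lemma perm_pre_id: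
  fixes p :: "('h list \<times> monom) \<Rightarrow>\<^sub>0 'f::field"
  shows "perm_pre id p = p"
proof -
  have "(\<lambda>(hs :: 'h list, w). (hs, rename id w)) = (\<lambda>x. x)" by (auto simp: rename_id)
  then show ?thesis unfolding perm_pre_def by (simp only: lin_ext_id)
qed

lemma perm_pre_single: "perm_pre \<sigma> (Poly_Mapping.single (hs, w) c) = Poly_Mapping.single (hs, rename \<sigma> w) c"
  by (simp add: perm_pre_def lin_ext_single)

lemma perm_pre_add: "perm_pre \<sigma> (p + q) = perm_pre \<sigma> p + perm_pre \<sigma> q"
  by (simp add: perm_pre_def lin_ext_add)

context fd_H_algebra
begin

interpretation pre: Module.module "class_ring :: 'f ring" pre by (rule free_alg_module)

interpretation HP: Module.module "class_ring :: 'f ring" HP by (rule HP_module)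

lemma ev1_sum: "ev1 (sum f I) = (\<Sum>i\<in>I. ev1 (f i))"
  by (induction I rule: infinite_finite_induct) (auto simp: ev1_add ev1_zero)

lemma ev1_perm: "ev1 (perm_pre \<sigma> p) = frho \<sigma> (ev1 p)"
proof
  fix \<psi>
  have "ev1 (perm_pre \<sigma> p) \<psi> = (\<Sum>(hs, w)\<in>Poly_Mapping.keys p. scaleA (Poly_Mapping.lookup p (hs, w)) (mf w hs (\<psi> \<circ> \<sigma>)))"
    unfolding perm_pre_def lin_ext_def ev1_sum sum_fun_apply
    by (intro sum.cong refl) (auto simp: ev1_single fscale_def mf_rename)
  also have "\<dots> = frho \<sigma> (ev1 p) \<psi>"
    unfolding frho_def by (subst ev1_eq[of "Poly_Mapping.keys p"]) auto
  finally show "ev1 (perm_pre \<sigma> p) \<psi> = frho \<sigma> (ev1 p) \<psi>" .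
qed

lemma perm_pre_carrier: assumes "p \<in> carrier pre" shows "perm_pre \<sigma> p \<in> carrier pre"
proof -
  have 1: "Poly_Mapping.single (hs, rename \<sigma> w) c \<in> carrier pre" if "(hs, w) \<in> Hmonoms" for hs w c
    using that by (intro single_in_pre) (simp add: Hmonoms_def vars_rename)
  have 2: "sum f I \<in> carrier pre" if "\<And>i. i \<in> I \<Longrightarrow> f i \<in> carrier pre" for f and I :: "('h list \<times> monom) set"
    using that by (induction I rule: infinite_finite_induct) (simp_all add: pre_closed)
  show ?thesis unfolding perm_pre_def lin_ext_def
  proof (rule 2)
    fix k assume "k \<in> Poly_Mapping.keys p"
    then have "k \<in> Hmonoms" using assms by (auto simp: free_alg_simps(1))
    then show "Poly_Mapping.single (case k of (hs, w) \<Rightarrow> (hs, rename \<sigma> w)) (Poly_Mapping.lookup p k) \<in> carrier pre"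
      using 1 by (cases k) simp
  qed
qed

text \<open>Renaming leaves the list of exponents alone and so maps each tensor relation to a tensor
  relation.\<close>

lemma perm_pre_TZ: assumes "p \<in> TZ" shows "perm_pre \<sigma> p \<in> TZ"
proof -
  let ?N = "{p \<in> carrier pre. perm_pre \<sigma> p \<in> TZ}"
  have "submodule class_ring ?N pre"
    using TZ_submodule free_alg_module pre_closed
    unfolding submodule_def perm_pre_def
    by (simp add: free_alg_simps(2-4) lin_ext_add lin_ext_zero lin_ext_scale)
  moreover have "tensor_relations scaleH \<subseteq> ?N"
  proof
    fix p assume p: "p \<in> tensor_relations scaleH"
    have m: "(hs, rename \<sigma> w) \<in> Hmonoms" if "(hs, w) \<in> Hmonoms" for hs :: "'h list" and w
      using that by (simp add: Hmonoms_def vars_rename)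
    have "perm_pre \<sigma> p \<in> tensor_relations scaleH"
      using p unfolding tensor_relations_def
    proof (elim UnE CollectE exE conjE)
      fix hs w k g h
      assume "p = Poly_Mapping.single (hs[k := g + h], w) 1 - Poly_Mapping.single (hs[k := g], w) 1
         - Poly_Mapping.single (hs[k := h], w) 1" "(hs, w) \<in> Hmonoms" "k < length hs"
      then show "perm_pre \<sigma> p \<in> {Poly_Mapping.single (hs[k := g + h], w) 1 - Poly_Mapping.single (hs[k := g], w) 1
         - Poly_Mapping.single (hs[k := h], w) 1 |hs w k g h. (hs, w) \<in> Hmonoms \<and> k < length hs} \<union>
        {Poly_Mapping.single (hs[k := scaleH c h], w) 1 - Poly_Mapping.single (hs[k := h], w) c
         |hs w k c h. (hs, w) \<in> Hmonoms \<and> k < length hs}"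
        using m by (intro UnI1) (simp add: perm_pre_def lin_ext_minus lin_ext_single, blast)
    next
      fix hs w k c h
      assume "p = Poly_Mapping.single (hs[k := scaleH c h], w) 1 - Poly_Mapping.single (hs[k := h], w) c"
        "(hs, w) \<in> Hmonoms" "k < length hs"
      then show "perm_pre \<sigma> p \<in> {Poly_Mapping.single (hs[k := g + h], w) 1 - Poly_Mapping.single (hs[k := g], w) 1
         - Poly_Mapping.single (hs[k := h], w) 1 |hs w k g h. (hs, w) \<in> Hmonoms \<and> k < length hs} \<union>
        {Poly_Mapping.single (hs[k := scaleH c h], w) 1 - Poly_Mapping.single (hs[k := h], w) c
         |hs w k c h. (hs, w) \<in> Hmonoms \<and> k < length hs}"
        using m by (intro UnI2) (simp add: perm_pre_def lin_ext_minus lin_ext_single, blast)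
    qed
    then have "perm_pre \<sigma> p \<in> TZ"
      unfolding tensor_zero_def using T.V.in_own_span[OF relations_carrier] by blast
    then show "p \<in> ?N" using p relations_carrier by blast
  qed
  ultimately show ?thesis using TZ_le assms by blast
qed

text \<open>The image is the full coset because renaming by the inverse permutation also preserves
  \<open>TZ\<close>.\<close>

lemma perm_co:
  assumes "\<sigma> permutes {..<n}" shows "perm_pre \<sigma> ` co p = co (perm_pre \<sigma> p)"
proof
  show "perm_pre \<sigma> ` co p \<subseteq> co (perm_pre \<sigma> p)"
    unfolding co_def using perm_pre_TZ by (auto simp: perm_pre_add)
  show "co (perm_pre \<sigma> p) \<subseteq> perm_pre \<sigma> ` co p"
  proof
    fix q assume "q \<in> co (perm_pre \<sigma> p)"
    then obtain t where t: "t \<in> TZ" "q = t + perm_pre \<sigma> p" unfolding co_def by blast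
    have "perm_pre \<sigma> (perm_pre (pinv \<sigma>) t) = t"
      by (simp add: perm_pre_comp permutes_inv_o[OF assms] perm_pre_id)
    then have "q = perm_pre \<sigma> (perm_pre (pinv \<sigma>) t + p)" by (simp add: t(2) perm_pre_add)
    moreover have "perm_pre (pinv \<sigma>) t + p \<in> co p" unfolding co_def using perm_pre_TZ[OF t(1)] by blast
    ultimately show "q \<in> perm_pre \<sigma> ` co p" by blast
  qed
qed

lemma P1_HP:
  assumes s: "\<sigma> permutes {..<n}" and "f \<in> carrier HP"
  shows "perm_pre \<sigma> ` f \<in> carrier HP" "ev2 (perm_pre \<sigma> ` f) = frho \<sigma> (ev2 f)"
proof -
  obtain p where p: "p \<in> carrier pre" "f = co p" using assms(2) unfolding HP_carrier by blast
  show "perm_pre \<sigma> ` f \<in> carrier HP"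
    unfolding p(2) perm_co[OF s] HP_carrier using perm_pre_carrier[OF p(1)] by blast
  show "ev2 (perm_pre \<sigma> ` f) = frho \<sigma> (ev2 f)"
    unfolding p(2) perm_co[OF s] by (simp add: ev2_co p(1) perm_pre_carrier ev1_perm)
qed

lemma P1_add:
  assumes s: "\<sigma> permutes {..<n}" and "f \<in> carrier HP" "g \<in> carrier HP"
  shows "perm_pre \<sigma> ` (f \<oplus>\<^bsub>HP\<^esub> g) = perm_pre \<sigma> ` f \<oplus>\<^bsub>HP\<^esub> perm_pre \<sigma> ` g"
proof -
  obtain p q where p: "p \<in> carrier pre" "f = co p" "q \<in> carrier pre" "g = co q"
    using assms(2,3) unfolding HP_carrier by blast
  then show ?thesis
    by (simp add: HP_add perm_co[OF s] perm_pre_add perm_pre_carrier pre_closed)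
qed

lemma P1_smult:
  assumes s: "\<sigma> permutes {..<n}" and "f \<in> carrier HP"
  shows "perm_pre \<sigma> ` (c \<odot>\<^bsub>HP\<^esub> f) = c \<odot>\<^bsub>HP\<^esub> (perm_pre \<sigma> ` f)"
proof -
  obtain p where p: "p \<in> carrier pre" "f = co p" using assms(2) unfolding HP_carrier by blast
  then have "perm_pre \<sigma> (pm_scale c p) = pm_scale c (perm_pre \<sigma> p)" by (simp add: perm_pre_def lin_ext_scale)
  then show ?thesis using p by (simp add: HP_smult perm_co[OF s] perm_pre_carrier pre_closed)
qed

lemma P1_MLP: assumes s: "\<sigma> permutes {..<n}" and "f \<in> MLP n" shows "perm_pre \<sigma> ` f \<in> MLP n"
proof -
  let ?N = "{f \<in> carrier HP. perm_pre \<sigma> ` f \<in> MLP n}"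
  have z: "perm_pre \<sigma> ` \<zero>\<^bsub>HP\<^esub> = \<zero>\<^bsub>HP\<^esub>"
    unfolding HP_zero perm_co[OF s] by (simp add: perm_pre_def lin_ext_zero)
  have "submodule class_ring ?N HP"
    by (rule submoduleI_HP) (auto simp: z MLP_closed P1_add[OF s] P1_smult[OF s])
  moreover have "gens n \<subseteq> ?N"
  proof
    fix f assume f: "f \<in> gens n"
    then obtain hs w where w: "f = co (Poly_Mapping.single (hs, w) 1)" "length hs = deg w" "distinct (vars w)"
      "set (vars w) = {..<n}" unfolding gens_eq by blast
    have "length hs = deg (rename \<sigma> w)" "distinct (vars (rename \<sigma> w))" "set (vars (rename \<sigma> w)) = {..<n}"
      using w permutes_inj_on[OF s] permutes_image[OF s] by (simp_all add: vars_rename distinct_map)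
    then have "co (Poly_Mapping.single (hs, rename \<sigma> w) 1) \<in> gens n" unfolding gens_eq by blast
    then have "perm_pre \<sigma> ` f \<in> MLP n"
      unfolding w(1) perm_co[OF s] perm_pre_single using gens_MLP by blast
    then show "f \<in> ?N" using f gens_carrier by blast
  qed
  ultimately show ?thesis using MLP_le assms(2) by blast
qed

lemma P1_inv:
  assumes s: "\<sigma> permutes {..<n}" shows "perm_pre \<sigma> ` perm_pre (pinv \<sigma>) ` f = f"
  by (simp add: image_image perm_pre_comp permutes_inv_o[OF s] perm_pre_id)

lemma perm_cq:
  assumes s: "\<sigma> permutes {..<n}" and f: "f \<in> MLP n"
  shows "perm_quot \<sigma> (cq n f) = cq n (perm_pre \<sigma> ` f)"
proof -
  have N: "perm_pre \<sigma> ` m \<in> N2 n" if "m \<in> N2 n" "\<sigma> permutes {..<n}" for m \<sigma>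
  proof -
    have m: "m \<in> MLP n" "ev2 m = 0" using that(1) unfolding N2_iff by simp_all
    have "ev2 (perm_pre \<sigma> ` m) = frho \<sigma> 0" unfolding P1_HP(2)[OF that(2) MLP_carrier[OF m(1)]] m(2) ..
    also have "frho \<sigma> 0 = (0 :: (nat \<Rightarrow> 'a) \<Rightarrow> 'a)" by (simp add: frho_def fun_eq_iff)
    finally show ?thesis using P1_MLP[OF that(2) m(1)] unfolding N2_iff by simp
  qed
  have cf: "f \<in> carrier HP" by (rule MLP_carrier[OF f])
  have cm: "m \<in> carrier HP" if "m \<in> N2 n" for m using that MLP_carrier by blast
  show ?thesis
  proof
    show "perm_quot \<sigma> (cq n f) \<subseteq> cq n (perm_pre \<sigma> ` f)"
    proof
      fix x assume "x \<in> perm_quot \<sigma> (cq n f)"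
      then obtain m where m: "m \<in> N2 n" "x = perm_pre \<sigma> ` (m \<oplus>\<^bsub>HP\<^esub> f)"
        unfolding perm_quot_def cq_def by blast
      then show "x \<in> cq n (perm_pre \<sigma> ` f)" unfolding cq_def P1_add[OF s cm[OF m(1)] cf] using N[OF m(1) s] 
        m(2) P1_add[OF s cm[OF m(1)] cf] by blast
    qed
    show "cq n (perm_pre \<sigma> ` f) \<subseteq> perm_quot \<sigma> (cq n f)"
    proof
      fix x assume "x \<in> cq n (perm_pre \<sigma> ` f)"
      then obtain m where m: "m \<in> N2 n" "x = m \<oplus>\<^bsub>HP\<^esub> perm_pre \<sigma> ` f" unfolding cq_def by blast
      let ?m = "perm_pre (pinv \<sigma>) ` m"
      have mm: "?m \<in> N2 n" using N[OF m(1) permutes_inv[OF s]] .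
      have "perm_pre \<sigma> ` (?m \<oplus>\<^bsub>HP\<^esub> f) = x"
        unfolding P1_add[OF s cm[OF mm] cf] P1_inv[OF s] m(2) ..
      then show "x \<in> perm_quot \<sigma> (cq n f)" unfolding perm_quot_def cq_def using mm by blast
    qed
  qed
qed

lemma model: "Sn_model fsc n frho (MQ n) perm_quot Th (PN n)"
proof -
  interpret Sn_rep fsc n frho by (rule rep)
  show ?thesis
  proof (intro Sn_model.intro Sn_model_axioms.intro)
    show "Sn_rep fsc n frho" by (rule rep)
    show "Module.module class_ring (MQ n)" unfolding MQ_eq by (rule quotient_space.quot_module[OF V2_quotient])
    show "bij_betw Th (carrier (MQ n)) (PN n)" by (rule Th_bij)
    show "invariant (PN n)" by (rule PN_invariant)
    show "\<exists>B. finite B \<and> B \<subseteq> PN n \<and> PN n \<subseteq> FS.span B" by (rule PS_finite) simp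
    fix C D assume C: "C \<in> carrier (MQ n)"
    show "Th (c \<odot>\<^bsub>MQ n\<^esub> C) = fsc c (Th C)" for c by (rule Th_smult'[OF C])
    show "Th (C \<oplus>\<^bsub>MQ n\<^esub> D) = Th C + Th D" if "D \<in> carrier (MQ n)" by (rule Th_add'[OF C that])
    fix \<sigma> :: "nat \<Rightarrow> nat" assume s: "\<sigma> permutes {..<n}"
    obtain f where f: "f \<in> MLP n" "C = cq n f" using C unfolding MQ_carrier by blast
    show "perm_quot \<sigma> C \<in> carrier (MQ n) \<and> Th (perm_quot \<sigma> C) = frho \<sigma> (Th C)"
      unfolding f(2) perm_cq[OF s f(1)] MQ_carrier
      using P1_MLP[OF s f(1)] P1_HP(2)[OF s MLP_carrier[OF f(1)]] by (simp add: Th_cq f(1))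
  qed
qed

text \<open>From here on, occurrence of a shape is tested by letting the Young symmetrizer act on
  functions.\<close>

lemma H_multiplicity_iff:
  assumes "partition_of lam n"
  shows "H_multiplicity scaleH scaleA mulA act lam \<noteq> 0 \<longleftrightarrow>
    (\<exists>F\<in>PN n. Sn_rep.young fsc frho lam F \<noteq> 0)"
  using Sn_model.Sn_multiplicity_nonzero[OF model assms] assms
  unfolding H_multiplicity_def partition_of_def by simp

lemma H_codim_basis:
  "\<exists>B. finite B \<and> B \<subseteq> PN n \<and> PN n \<subseteq> FS.span B \<and> \<not> FS.dependent B \<and>
    card B = H_codim scaleH scaleA mulA act n"
  unfolding H_codim_def by (rule Sn_model.dim_basis_P[OF model])

end

section \<open>Words of a given content\<close>

text \<open>The words in which the letter \<open>i\<close> occurs \<open>part lam i\<close> times,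
  produced by permuting the word \<open>rowf lam\<close>; their number is a multinomial coefficient.
  Restriction makes equality of words a question about the positions below
  \<open>sum_list lam\<close>.\<close>

definition row_words :: "nat list \<Rightarrow> (nat \<Rightarrow> nat) set" where
  "row_words lam = (\<lambda>\<sigma>. restrict (rowf lam \<circ> \<sigma>) {..<sum_list lam}) ` Sym (sum_list lam)"

lemma finite_row_words: "finite (row_words lam)" by (simp add: row_words_def)

lemma row_words_nonempty: "row_words lam \<noteq> {}"
  unfolding row_words_def using permutes_id by blast

lemma row_words_PiE: "row_words lam \<subseteq> {..<sum_list lam} \<rightarrow>\<^sub>E {..<length lam}"
proof
  fix w assume "w \<in> row_words lam"
  then obtain \<sigma> where s: "\<sigma> permutes {..<sum_list lam}" and w: "w = restrict (rowf lam \<circ> \<sigma>) {..<sum_list lam}"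
    unfolding row_words_def by blast
  have "rowf lam (\<sigma> p) < length lam" if "p < sum_list lam" for p
    using permutes_in_image[OF s, of p] that by (intro rowf_less_length) simp
  then show "w \<in> {..<sum_list lam} \<rightarrow>\<^sub>E {..<length lam}" unfolding w by auto
qed

lemma prod_rowf:
  fixes x :: "nat \<Rightarrow> real"
  shows "(\<Prod>p<sum_list lam. x (rowf lam p)) = (\<Prod>i<length lam. x i ^ part lam i)"
proof -
  have "(\<Prod>p<sum_list lam. x (rowf lam p)) = (\<Prod>i<length lam. \<Prod>p\<in>{p\<in>{..<sum_list lam}. rowf lam p = i}. x (rowf lam p))"
    by (rule prod.group[symmetric]) (auto simp: rowf_less_length)
  also have "\<dots> = (\<Prod>i<length lam. x i ^ part lam i)"
  proof (intro prod.cong refl)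
    fix i
    have "(\<Prod>p\<in>{p\<in>{..<sum_list lam}. rowf lam p = i}. x (rowf lam p)) = (\<Prod>p\<in>{p\<in>{..<sum_list lam}. rowf lam p = i}. x i)"
      by (intro prod.cong) auto
    also have "\<dots> = x i ^ part lam i" using card_rowf[of lam i] by simp
    finally show "(\<Prod>p\<in>{p\<in>{..<sum_list lam}. rowf lam p = i}. x (rowf lam p)) = x i ^ part lam i" .
  qed
  finally show ?thesis .
qed

text \<open>Each word contributes the same monomial to the expansion of the power of a sum of probabilities.\<close>

lemma card_row_words_le:
  fixes x :: "nat \<Rightarrow> real"
  assumes "\<And>i. x i \<ge> 0" "(\<Sum>i<length lam. x i) = 1"
  shows "real (card (row_words lam)) * (\<Prod>i<length lam. x i ^ part lam i) \<le> 1"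
proof -
  let ?n = "sum_list lam"
  have c: "(\<Prod>p<?n. x (w p)) = (\<Prod>i<length lam. x i ^ part lam i)" if wW: "w \<in> row_words lam" for w
  proof -
    obtain \<sigma> where s: "\<sigma> permutes {..<?n}" and w: "w = restrict (rowf lam \<circ> \<sigma>) {..<?n}"
      using wW unfolding row_words_def by blast
    have "(\<Prod>p<?n. x (w p)) = (\<Prod>p<?n. x (rowf lam (\<sigma> p)))" by (intro prod.cong refl) (simp add: w)
    also have "\<dots> = (\<Prod>p<?n. x (rowf lam p))"
      using prod.permute[OF s, of "\<lambda>p. x (rowf lam p)"] by (simp add: o_def)
    finally show ?thesis by (simp add: prod_rowf)
  qed
  have "real (card (row_words lam)) * (\<Prod>i<length lam. x i ^ part lam i) = (\<Sum>w\<in>row_words lam. \<Prod>p<?n. x (w p))"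
    by (simp add: c)
  also have "\<dots> \<le> (\<Sum>w\<in>{..<?n} \<rightarrow>\<^sub>E {..<length lam}. \<Prod>p<?n. x (w p))"
    using row_words_PiE assms(1) by (intro sum_mono2) (auto intro!: finite_PiE prod_nonneg)
  also have "\<dots> = (\<Prod>p<?n. \<Sum>i<length lam. x i)" by (rule prod_sum_PiE[symmetric]) auto
  also have "\<dots> = 1" using assms(2) by simp
  finally show ?thesis .
qed

text \<open>Permutations that give the same word differ by a row permutation on the left.\<close>

lemma row_words_fiber:
  assumes "\<sigma> permutes {..<sum_list lam}" "\<tau> permutes {..<sum_list lam}"
    "restrict (rowf lam \<circ> \<sigma>) {..<sum_list lam} = restrict (rowf lam \<circ> \<tau>) {..<sum_list lam}"
  shows "\<sigma> \<circ> pinv \<tau> \<in> row_stab lam"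
proof -
  have "rowf lam (\<sigma> (pinv \<tau> p)) = rowf lam p" if "p < sum_list lam" for p
  proof -
    have l: "pinv \<tau> p < sum_list lam"
      using permutes_in_image[OF permutes_inv[OF assms(2)], of p] that by simp
    have "rowf lam (\<sigma> (pinv \<tau> p)) = rowf lam (\<tau> (pinv \<tau> p))"
      using fun_cong[OF assms(3), of "pinv \<tau> p"] l by simp
    then show ?thesis by (simp add: permutes_inverses(1)[OF assms(2)])
  qed
  then show ?thesis using permutes_compose[OF permutes_inv[OF assms(2)] assms(1)] by (simp add: row_stab_def)
qed

text \<open>A row permutation is determined by its restrictions to the rows, which are permutations
  of sets of sizes \<open>part lam i\<close>.\<close>

lemma card_row_stab_le: "card (row_stab lam) \<le> (\<Prod>i<length lam. fact (part lam i))"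
proof -
  let ?n = "sum_list lam"
  let ?R = "\<lambda>i. {p. p < ?n \<and> rowf lam p = i}"
  let ?f = "\<lambda>\<sigma>. \<lambda>i\<in>{..<length lam}. \<lambda>p. if p \<in> ?R i then \<sigma> p else p"
  have "inj_on ?f (row_stab lam)"
  proof (rule inj_onI, rule ext)
    fix \<sigma> \<tau> p assume s: "\<sigma> \<in> row_stab lam" "\<tau> \<in> row_stab lam" and e: "?f \<sigma> = ?f \<tau>"
    show "\<sigma> p = \<tau> p"
    proof (cases "p < ?n")
      case True
      then have "rowf lam p < length lam" by (rule rowf_less_length)
      then show ?thesis using fun_cong[OF fun_cong[OF e, of "rowf lam p"], of p] True by simp
    next
      case False
      then show ?thesis using row_stab_permutes[OF s(1)] row_stab_permutes[OF s(2)] by (simp add: permutes_not_in)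
    qed
  qed
  moreover have "?f ` row_stab lam \<subseteq> (\<Pi>\<^sub>E i\<in>{..<length lam}. {q. q permutes ?R i})"
  proof
    fix g assume "g \<in> ?f ` row_stab lam"
    then obtain \<sigma> where s: "\<sigma> \<in> row_stab lam" and g: "g = ?f \<sigma>" by blast
    have sp: "\<sigma> permutes {..<?n}" using s by (rule row_stab_permutes)
    have "(\<lambda>p. if p \<in> ?R i then \<sigma> p else p) permutes ?R i" for i
    proof (rule bij_imp_permutes)
      have "\<sigma> ` ?R i = ?R i" using s unfolding row_stab_eq tableau_row_eq by simp
      then have "bij_betw \<sigma> (?R i) (?R i)" using permutes_inj_on[OF sp] by (simp add: bij_betw_def)
      then show "bij_betw (\<lambda>p. if p \<in> ?R i then \<sigma> p else p) (?R i) (?R i)"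
        by (rule bij_betw_cong[THEN iffD1, rotated]) simp
    qed (rule if_not_P)
    then show "g \<in> (\<Pi>\<^sub>E i\<in>{..<length lam}. {q. q permutes ?R i})" unfolding g by (intro restrict_PiE_iff[THEN iffD2]) simp
  qed
  moreover have "finite (\<Pi>\<^sub>E i\<in>{..<length lam}. {q. q permutes ?R i})"
    by (intro finite_PiE finite_permutations) auto
  ultimately have "card (row_stab lam) \<le> card (\<Pi>\<^sub>E i\<in>{..<length lam}. {q. q permutes ?R i})"
    by (intro card_inj_on_le)
  also have "\<dots> = (\<Prod>i<length lam. fact (part lam i))"
    unfolding card_PiE[OF finite_lessThan]
  proof (intro prod.cong refl)
    fix i show "card {q. q permutes ?R i} = fact (part lam i)"
      by (rule card_permutations[OF card_rowf]) simp
  qed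
  finally show ?thesis .
qed

text \<open>Each fiber of the map from permutations to words embeds into the row group, whose order
  is bounded by the product of factorials.\<close>

lemma card_row_words_ge:
  "fact (sum_list lam) \<le> card (row_words lam) * (\<Prod>i<length lam. fact (part lam i))"
proof -
  let ?n = "sum_list lam"
  let ?g = "\<lambda>\<sigma>. restrict (rowf lam \<circ> \<sigma>) {..<?n}"
  have fib: "card {\<sigma> \<in> Sym ?n. ?g \<sigma> = w} \<le> card (row_stab lam)" if "w \<in> row_words lam" for w
  proof -
    obtain \<tau> where t: "\<tau> permutes {..<?n}" "w = ?g \<tau>" using \<open>w \<in> row_words lam\<close> unfolding row_words_def by blast
    have "inj_on (\<lambda>\<sigma>. \<sigma> \<circ> pinv \<tau>) {\<sigma> \<in> Sym ?n. ?g \<sigma> = w}"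
    proof (rule inj_onI)
      fix a b assume "a \<circ> pinv \<tau> = b \<circ> pinv \<tau>"
      then have "a \<circ> pinv \<tau> \<circ> \<tau> = b \<circ> pinv \<tau> \<circ> \<tau>" by simp
      then show "a = b" by (simp add: o_assoc[symmetric] permutes_inv_o[OF t(1)])
    qed
    moreover have "(\<lambda>\<sigma>. \<sigma> \<circ> pinv \<tau>) ` {\<sigma> \<in> Sym ?n. ?g \<sigma> = w} \<subseteq> row_stab lam"
      using row_words_fiber[OF _ t(1)] t(2) by blast
    ultimately show ?thesis by (rule card_inj_on_le) simp
  qed
  have "fact ?n = card (Sym ?n)" by (simp add: card_permutations[of "{..<?n}", OF refl])
  also have "Sym ?n = (\<Union>w\<in>row_words lam. {\<sigma> \<in> Sym ?n. ?g \<sigma> = w})" by (auto simp: row_words_def)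
  also have "card \<dots> \<le> (\<Sum>w\<in>row_words lam. card {\<sigma> \<in> Sym ?n. ?g \<sigma> = w})"
    by (rule card_UN_le[OF finite_row_words])
  also have "\<dots> \<le> (\<Sum>w\<in>row_words lam. card (row_stab lam))" by (rule sum_mono) (rule fib)
  also have "\<dots> \<le> card (row_words lam) * (\<Prod>i<length lam. fact (part lam i))"
    using card_row_stab_le[of lam] by simp
  finally show ?thesis .
qed

section \<open>The upper bound\<close>

lemma count_image_mset_set:
  "finite A \<Longrightarrow> count (image_mset f (mset_set A)) y = card {x \<in> A. f x = y}"
proof (induction A rule: finite_induct)
  case (insert a A)
  have "{x \<in> insert a A. f x = y} = (if f a = y then insert a {x \<in> A. f x = y} else {x \<in> A. f x = y})"
    by auto
  then show ?case using insert by simp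
qed simp

context fd_H_algebra
begin

text \<open>The transposition of \<open>p\<close> and \<open>q\<close> changes the sign of the
  function but fixes the argument.\<close>

lemma colop_alt:
  assumes F: "F \<in> PN n" and lam: "sum_list lam = n"
    and pq: "p < n" "q < n" "p \<noteq> q" "colf lam p = colf lam q" "\<psi> p = \<psi> q"
  shows "Sn_rep.colop fsc frho lam F \<psi> = 0"
proof -
  interpret Sn_rep fsc n frho by (rule rep)
  let ?h = "colop lam F" and ?t = "Transposition.transpose p q"
  have t: "?t \<in> col_stab lam"
    using pq by (auto simp: col_stab_def lam Transposition.transpose_def intro!: permutes_swap_id)
  have "frho ?t ?h = fsc (of_int (sign ?t)) ?h" by (rule rho_colop[OF lam t])
  then have "frho ?t ?h \<psi> = fsc (of_int (sign ?t)) ?h \<psi>" by simp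
  moreover have "\<psi> \<circ> ?t = \<psi>" using pq(5) by (auto simp: fun_eq_iff Transposition.transpose_def)
  ultimately have e: "?h \<psi> = - ?h \<psi>" using pq(3) by (simp add: frho_def fscale_def sign_swap_id)
  have "?h \<psi> + ?h \<psi> = 0" by (subst (2) e) simp
  then have "scaleA 2 (?h \<psi>) = 0"
    using A.scale_left_distrib[of 1 1 "?h \<psi>"] by simp
  then show ?thesis by simp
qed

text \<open>The first column has \<open>length lam\<close> cells. If these outnumber the basis
  vectors, every word in the basis repeats a vector there, and the column antisymmetrization
  vanishes on it.\<close>

lemma young_nonzero_length:
  assumes F: "F \<in> PN n" and lam: "partition_of lam n" and nz: "Sn_rep.young fsc frho lam F \<noteq> 0"
  shows "length lam \<le> card Bs"
proof (rule ccontr)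
  interpret Sn_rep fsc n frho by (rule rep)
  have l: "sum_list lam = n" using lam by (simp add: partition_of_def)
  assume len: "\<not> length lam \<le> card Bs"
  have c: "colop lam F \<in> PN n" by (rule colop_in[OF l PN_invariant F])
  have "colop lam F \<psi> = 0" for \<psi>
  proof (rule multilin_zeroI[OF PS_multilin[OF c] finite_lessThan])
    fix \<psi> assume w: "\<And>x. x \<in> {..<n} \<Longrightarrow> \<psi> x \<in> Bs"
    have p0: "0 < part lam i" if "i < length lam" for i
    proof -
      have "lam ! i \<in> set lam" using that by simp
      then have "lam ! i \<noteq> 0" using lam unfolding partition_of_def by metis
      then show ?thesis using that by (simp add: part_def)
    qed
    have cl: "cell lam i 0 < n" if "i < length lam" for i using cell_less[OF p0[OF that]] l by simp
    have "(\<lambda>i. \<psi> (cell lam i 0)) ` {..<length lam} \<subseteq> Bs" using cl w by auto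
    then have "card ((\<lambda>i. \<psi> (cell lam i 0)) ` {..<length lam}) < card {..<length lam}"
      using card_mono[OF Bs_finite, of "(\<lambda>i. \<psi> (cell lam i 0)) ` {..<length lam}"] len by simp
    then have "\<not> inj_on (\<lambda>i. \<psi> (cell lam i 0)) {..<length lam}" by (rule pigeonhole)
    then obtain i j where ij: "i < length lam" "j < length lam" "i \<noteq> j" "\<psi> (cell lam i 0) = \<psi> (cell lam j 0)"
      unfolding inj_on_def by blast
    show "colop lam F \<psi> = 0"
    proof (rule colop_alt[OF F l cl[OF ij(1)] cl[OF ij(2)] _ _ ij(4)])
      show "cell lam i 0 \<noteq> cell lam j 0" using ij(3) rowf_cell[OF p0[OF ij(1)]] rowf_cell[OF p0[OF ij(2)]] by metis
      show "colf lam (cell lam i 0) = colf lam (cell lam j 0)"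
        using colf_cell[OF p0[OF ij(1)]] colf_cell[OF p0[OF ij(2)]] by simp
    qed
  qed
  then have "colop lam F = 0" by (simp add: fun_eq_iff)
  then have "young lam F = 0" using rowop_scale[OF l, of 0 0] by (simp add: young_def)
  then show False using nz by simp
qed

definition row_invariants :: "nat list \<Rightarrow> ((nat \<Rightarrow> 'a) \<Rightarrow> 'a) set" where
  "row_invariants lam = {F \<in> PN (sum_list lam). \<forall>r\<in>row_stab lam. frho r F = F}"

text \<open>A complete invariant of words in the basis up to the row group. With at most
  \<open>card Bs\<close> rows it takes at most \<open>(n + 1) ^ (card Bs * card Bs)\<close>
  values.\<close>

definition content :: "nat list \<Rightarrow> (nat \<Rightarrow> 'a) \<Rightarrow> nat \<times> 'a \<Rightarrow> nat" where
  "content lam \<psi> = (\<lambda>(i, b)\<in>{..<length lam} \<times> Bs. card {p\<in>{..<sum_list lam}. (rowf lam p, \<psi> p) = (i, b)})"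

text \<open>Equal contents mean that the pairs of row and basis vector form the same multiset. A
  permutation matching them preserves rows, so \<open>F\<close> is unaffected by it.\<close>

lemma row_invariants_content:
  assumes F: "F \<in> row_invariants lam"
    and w: "\<psi> \<in> {..<sum_list lam} \<rightarrow>\<^sub>E Bs" "\<psi>' \<in> {..<sum_list lam} \<rightarrow>\<^sub>E Bs"
    and c: "content lam \<psi> = content lam \<psi>'"
  shows "F \<psi> = F \<psi>'"
proof -
  let ?n = "sum_list lam"
  let ?f = "\<lambda>\<psi> p. (rowf lam p, \<psi> p)"
  have cnt: "card {p\<in>{..<?n}. ?f \<psi> p = y} = card {p\<in>{..<?n}. ?f \<psi>' p = y}" for y
  proof (cases "y \<in> {..<length lam} \<times> Bs")
    case True
    obtain i b where y: "y = (i, b)" by (cases y)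
    show ?thesis using fun_cong[OF c, of y] True unfolding y content_def by simp
  next
    case False
    have "?f \<phi> p \<noteq> y" if "\<phi> \<in> {..<?n} \<rightarrow>\<^sub>E Bs" "p < ?n" for \<phi> p
      using False rowf_less_length[OF that(2)] PiE_mem[OF that(1), of p] that(2) by auto
    then show ?thesis using w by (metis (mono_tags, lifting) Collect_cong lessThan_iff)
  qed
  have "image_mset (?f \<psi>) (mset_set {..<?n}) = image_mset (?f \<psi>') (mset_set {..<?n})"
    by (rule multiset_eqI) (simp only: count_image_mset_set[OF finite_lessThan] cnt)
  then obtain r where r: "r permutes {..<?n}" "\<forall>p\<in>{..<?n}. ?f \<psi> p = ?f \<psi>' (r p)"
    by (rule image_mset_eq_implies_permutes[OF finite_lessThan])
  have "r \<in> row_stab lam" using r by (auto simp: row_stab_def)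
  then have "frho r F = F" using F by (simp add: row_invariants_def)
  then have "F \<psi>' = F (\<psi>' \<circ> r)" by (metis frho_def)
  also have "\<dots> = F \<psi>"
    by (rule multilin_dep[OF PS_multilin[of F "{..<?n}"]]) (use F r in \<open>auto simp: row_invariants_def\<close>)
  finally show ?thesis ..
qed

text \<open>A row invariant function is determined by its values at one word per content, each value
  having \<open>card Bs\<close> coordinates.\<close>

lemma row_invariants_span:
  assumes len: "length lam \<le> card Bs"
  shows "\<exists>B\<subseteq>row_invariants lam. finite B \<and> card B \<le> (sum_list lam + 1) ^ (card Bs * card Bs) * card Bs \<and>
    row_invariants lam \<subseteq> FS.span B"
proof -
  let ?n = "sum_list lam" and ?s = "card Bs"
  let ?W = "{..<?n} \<rightarrow>\<^sub>E Bs"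
  have finW: "finite ?W" using Bs_finite by (simp add: finite_PiE)
  define rp where "rp k = (SOME \<psi>. \<psi> \<in> ?W \<and> content lam \<psi> = k)" for k
  define Z where "Z = rp ` content lam ` ?W"
  have rp: "rp (content lam \<psi>) \<in> ?W \<and> content lam (rp (content lam \<psi>)) = content lam \<psi>" if "\<psi> \<in> ?W" for \<psi>
    unfolding rp_def by (rule someI[of _ \<psi>]) (use that in simp)
  have finZ: "finite Z" using finW by (simp add: Z_def)
  have sub: "FS.subspace (row_invariants lam)"
  proof (rule FS.subspaceI)
    interpret Sn_rep fsc ?n frho by (rule rep)
    have rp: "r permutes {..<?n}" if "r \<in> row_stab lam" for r by (rule row_stab_permutes[OF that])
    show "0 \<in> row_invariants lam" by (simp add: row_invariants_def FS.subspace_0[OF PS_subspace] rho_zero rp)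
    show "F + G \<in> row_invariants lam" if "F \<in> row_invariants lam" "G \<in> row_invariants lam" for F G
      using that by (simp add: row_invariants_def FS.subspace_add[OF PS_subspace] rho_add rp)
    show "fsc c F \<in> row_invariants lam" if "F \<in> row_invariants lam" for c F
      using that by (simp add: row_invariants_def FS.subspace_scale[OF PS_subspace] rho_scale rp)
  qed
  have "\<exists>B\<subseteq>row_invariants lam. finite B \<and> card B \<le> card Z * card Bs \<and> row_invariants lam \<subseteq> FS.span B"
  proof (rule separated_span_words[OF finZ sub])
    fix F assume F: "F \<in> row_invariants lam" and z: "\<And>\<psi>. \<psi> \<in> Z \<Longrightarrow> F \<psi> = 0"
    have m: "multilin {..<?n} F" using F by (auto simp: row_invariants_def intro: PS_multilin)
    have "F \<psi> = 0" for \<psi>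
    proof (rule multilin_zeroI[OF m finite_lessThan])
      fix \<psi> assume p: "\<And>x. x \<in> {..<?n} \<Longrightarrow> \<psi> x \<in> Bs"
      let ?\<phi> = "restrict \<psi> {..<?n}"
      have phi: "?\<phi> \<in> ?W" using p by auto
      have "F \<psi> = F ?\<phi>" by (rule multilin_dep[OF m]) simp
      also have "\<dots> = F (rp (content lam ?\<phi>))"
        using rp[OF phi] by (intro row_invariants_content[OF F phi]) simp_all
      also have "\<dots> = 0" using phi by (intro z) (simp add: Z_def)
      finally show "F \<psi> = 0" .
    qed
    then show "F = 0" by (simp add: fun_eq_iff)
  qed
  moreover have "card Z * card Bs \<le> (?n + 1) ^ (?s * ?s) * card Bs"
  proof -
    let ?K = "({..<length lam} \<times> Bs) \<rightarrow>\<^sub>E {..?n}"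
    have "content lam ` ?W \<subseteq> ?K"
    proof
      fix k assume "k \<in> content lam ` ?W"
      then obtain \<psi> where k: "k = content lam \<psi>" by blast
      have "card {p\<in>{..<?n}. Q p} \<le> ?n" for Q
        using card_mono[of "{..<?n}" "{p\<in>{..<?n}. Q p}"] by auto
      then show "k \<in> ?K" unfolding k content_def by auto
    qed
    moreover have "finite ?K" using Bs_finite by (intro finite_PiE) auto
    ultimately have "card (content lam ` ?W) \<le> card ?K" by (rule card_mono[rotated])
    also have "card ?K = (?n + 1) ^ (length lam * ?s)"
      using Bs_finite by (simp add: card_PiE card_cartesian_product)
    also have "\<dots> \<le> (?n + 1) ^ (?s * ?s)" using len by (intro power_increasing) auto
    finally have "card (content lam ` ?W) \<le> (?n + 1) ^ (?s * ?s)" .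
    moreover have "card Z \<le> card (content lam ` ?W)" unfolding Z_def using finW by (intro card_image_le) simp
    ultimately show ?thesis by (intro mult_right_mono) auto
  qed
  ultimately show ?thesis by (meson le_trans)
qed

definition supp :: "nat \<Rightarrow> nat list set" where
  "supp n = {lam. partition_of lam n \<and> H_multiplicity scaleH scaleA mulA act lam \<noteq> 0}"

lemma supp_iff: "lam \<in> supp n \<longleftrightarrow> partition_of lam n \<and> (\<exists>F\<in>PN n. Sn_rep.young fsc frho lam F \<noteq> 0)"
  using H_multiplicity_iff by (auto simp: supp_def)

lemma finite_supp: "finite (supp n)"
  by (rule finite_subset[OF _ finite_Par[of n]]) (auto simp: supp_def)

lemma supp_length: "lam \<in> supp n \<Longrightarrow> length lam \<le> card Bs"
  using young_nonzero_length supp_iff by blast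

text \<open>By \<open>sum_central\<close> the space is spanned by translates
  \<open>frho \<sigma> (young lam G)\<close>. Here \<open>young lam G\<close> is row invariant, so
  it lies in a space of polynomial dimension, and its translate depends on \<open>\<sigma>\<close>
  only modulo the row group, that is, on a word of content \<open>lam\<close>.\<close>

lemma codim_upper:
  "H_codim scaleH scaleA mulA act n \<le>
    (\<Sum>lam\<in>supp n. card (row_words lam) * ((n + 1) ^ (card Bs * card Bs) * card Bs))"
proof -
  interpret Sn_rep fsc n frho by (rule rep)
  let ?D = "(n + 1) ^ (card Bs * card Bs) * card Bs"
  have "\<forall>lam\<in>supp n. \<exists>B. B \<subseteq> row_invariants lam \<and> finite B \<and> card B \<le> ?D \<and> row_invariants lam \<subseteq> FS.span B"
  proof
    fix lam assume lam: "lam \<in> supp n"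
    then have "sum_list lam = n" by (simp add: supp_def partition_of_def)
    then show "\<exists>B. B \<subseteq> row_invariants lam \<and> finite B \<and> card B \<le> ?D \<and> row_invariants lam \<subseteq> FS.span B"
      using row_invariants_span[OF supp_length[OF lam]] by simp
  qed
  from bchoice[OF this] obtain B where B: "\<And>lam. lam \<in> supp n \<Longrightarrow> B lam \<subseteq> row_invariants lam"
    "\<And>lam. lam \<in> supp n \<Longrightarrow> finite (B lam)" "\<And>lam. lam \<in> supp n \<Longrightarrow> card (B lam) \<le> ?D"
    "\<And>lam. lam \<in> supp n \<Longrightarrow> row_invariants lam \<subseteq> FS.span (B lam)" by blast
  \<comment> \<open>The inverse is taken because \<open>\<sigma>\<close> matters up to row
    permutations on the right: \<open>\<sigma>\<close> and \<open>\<sigma> \<circ> r\<close> give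
    the same word.\<close>
  define wd where "wd lam \<sigma> = restrict (rowf lam \<circ> pinv \<sigma>) {..<n}" for lam and \<sigma> :: "nat \<Rightarrow> nat"
  define ch where "ch lam w = (SOME \<sigma>. \<sigma> permutes {..<n} \<and> wd lam \<sigma> = w)" for lam w
  define T where "T lam = (\<lambda>(w, g). frho (ch lam w) g) ` (row_words lam \<times> B lam)" for lam
  have finT: "finite (T lam)" if "lam \<in> supp n" for lam
    using B(2)[OF that] finite_row_words by (simp add: T_def)
  have cardT: "card (T lam) \<le> card (row_words lam) * ?D" if "lam \<in> supp n" for lam
  proof -
    have "card (T lam) \<le> card (row_words lam \<times> B lam)"
      unfolding T_def using B(2)[OF that] finite_row_words by (intro card_image_le) simp
    also have "\<dots> \<le> card (row_words lam) * ?D" using B(3)[OF that] by (simp add: card_cartesian_product)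
    finally show ?thesis .
  qed
  have inT: "frho \<sigma> g \<in> T lam" if lam: "lam \<in> supp n" and s: "\<sigma> permutes {..<n}" and g: "g \<in> B lam" for lam \<sigma> g
  proof -
    have l: "sum_list lam = n" using lam by (simp add: supp_def partition_of_def)
    let ?t = "ch lam (wd lam \<sigma>)"
    have t: "?t permutes {..<n} \<and> wd lam ?t = wd lam \<sigma>"
      unfolding ch_def by (rule someI[of _ \<sigma>]) (use s in simp)
    have "pinv ?t \<circ> pinv (pinv \<sigma>) \<in> row_stab lam"
      using t permutes_inv[OF s] permutes_inv[of ?t "{..<n}"] unfolding wd_def l[symmetric]
      by (intro row_words_fiber) auto
    then have r: "pinv ?t \<circ> \<sigma> \<in> row_stab lam" by (simp add: permutes_inv_inv[OF s])
    have gi: "frho r g = g" if "r \<in> row_stab lam" for r using B(1)[OF lam] g that by (auto simp: row_invariants_def)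
    have "\<sigma> = ?t \<circ> (pinv ?t \<circ> \<sigma>)" using permutes_inv_o(1)[OF conjunct1[OF t]] by (simp add: o_assoc)
    then have "frho \<sigma> g = frho ?t (frho (pinv ?t \<circ> \<sigma>) g)"
      using rho_comp[of ?t "pinv ?t \<circ> \<sigma>" g] t s by (metis permutes_compose permutes_inv)
    also have "\<dots> = frho ?t g" by (simp only: gi[OF r])
    finally have e: "frho \<sigma> g = frho ?t g" .
    have "wd lam \<sigma> \<in> row_words lam" unfolding wd_def row_words_def l using permutes_inv[OF s] by blast
    then have "(wd lam \<sigma>, g) \<in> row_words lam \<times> B lam" using g by simp
    then show ?thesis unfolding e T_def by (rule rev_image_eqI) simp
  qed
  let ?T = "\<Union>lam\<in>supp n. T lam"
  have finU: "finite ?T" using finite_supp finT by blast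
  obtain k where k: "\<And>v. v = (\<Sum>lam\<in>Par n. fsc (k lam) (central lam v))" using sum_central by blast
  have "PN n \<subseteq> FS.span ?T"
  proof
    fix F assume F: "F \<in> PN n"
    have "fsc (k lam) (central lam F) \<in> FS.span ?T" if lam: "lam \<in> Par n" for lam
    proof (intro FS.span_scale)
      have l: "sum_list lam = n" using lam by (simp add: partition_of_def)
      show "central lam F \<in> FS.span ?T" unfolding central_def
      proof (rule FS.span_sum)
        fix \<sigma> assume "\<sigma> \<in> Sym n"
        then have s: "\<sigma> permutes {..<n}" by simp
        let ?G = "frho (pinv \<sigma>) F"
        have G: "?G \<in> PN n" using invariantD(2)[OF PN_invariant permutes_inv[OF s] F] .
        show "frho \<sigma> (young lam ?G) \<in> FS.span ?T"
        proof (cases "lam \<in> supp n")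
          case False
          then have "young lam ?G = 0" using lam G supp_iff by blast
          then show ?thesis using rho_zero[OF s] FS.span_zero by simp
        next
          case True
          have yi: "young lam ?G \<in> row_invariants lam"
            unfolding row_invariants_def l young_def
            using rowop_in[OF l PN_invariant colop_in[OF l PN_invariant G]] rho_rowop[OF l] by simp
          then have "young lam ?G \<in> FS.span (B lam)" using B(4)[OF True] by blast
          then show ?thesis
          proof (induction rule: FS.span_induct_alt)
            case base
            show ?case by (simp only: rho_zero[OF s] FS.span_zero)
          next
            case (step c x y)
            have "frho \<sigma> x \<in> FS.span ?T" using inT[OF True s step.hyps] True by (intro FS.span_base) blast
            then have "fsc c (frho \<sigma> x) + frho \<sigma> y \<in> FS.span ?T"
              using step.IH by (intro FS.span_add FS.span_scale)
            then show ?case by (simp only: rho_add[OF s] rho_scale[OF s])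
          qed
        qed
      qed
    qed
    then have "(\<Sum>lam\<in>Par n. fsc (k lam) (central lam F)) \<in> FS.span ?T" by (rule FS.span_sum)
    then show "F \<in> FS.span ?T" using k[of F] by simp
  qed
  moreover obtain C where C: "finite C" "C \<subseteq> PN n" "\<not> FS.dependent C" "card C = H_codim scaleH scaleA mulA act n"
    using H_codim_basis by blast
  ultimately have "card C \<le> card ?T" using FS.independent_span_bound[OF finU C(3)] by blast
  also have "\<dots> \<le> (\<Sum>lam\<in>supp n. card (T lam))" by (rule card_UN_le[OF finite_supp])
  also have "\<dots> \<le> (\<Sum>lam\<in>supp n. card (row_words lam) * ?D)" by (rule sum_mono) (rule cardT)
  finally show ?thesis using C(4) by simp
qed

end

section \<open>Polarization\<close>

text \<open>An element \<open>x\<close> of \<open>N\<close> outside \<open>A\<close> pairs each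
  \<open>T\<close> without \<open>x\<close> with the set enlarged by \<open>x\<close>, and the two
  terms have opposite signs.\<close>

lemma sum_alternating_supersets:
  assumes "finite N" "A \<subset> N"
  shows "(\<Sum>T\<in>Pow N. if A \<subseteq> T then (- 1) ^ card T else (0::int)) = 0"
proof -
  obtain x where x: "x \<in> N" "x \<notin> A" using assms(2) by blast
  let ?f = "\<lambda>T. if A \<subseteq> T then (- 1) ^ card T else (0::int)"
  let ?M = "Pow (N - {x})"
  have f: "?f (insert x T) = - ?f T" if T: "T \<in> ?M" for T
  proof -
    have "x \<notin> T" "finite T" using T assms(1) by (auto intro: finite_subset)
    moreover have "A \<subseteq> insert x T \<longleftrightarrow> A \<subseteq> T" using x(2) by blast
    ultimately show ?thesis by simp
  qed
  have inj: "inj_on (insert x) ?M" by (intro inj_onI) blast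
  have "Pow N = ?M \<union> insert x ` ?M" using Pow_insert[of x "N - {x}"] x(1) by (simp only: insert_Diff)
  moreover have "?M \<inter> insert x ` ?M = {}" by blast
  ultimately have "sum ?f (Pow N) = sum ?f ?M + sum ?f (insert x ` ?M)"
    using assms(1) by (simp only:) (intro sum.union_disjoint, simp_all)
  also have "sum ?f (insert x ` ?M) = sum (\<lambda>T. ?f (insert x T)) ?M"
    using sum.reindex[OF inj, of ?f] by (simp only: o_def)
  also have "\<dots> = sum (\<lambda>T. - ?f T) ?M" by (rule sum.cong[OF refl f])
  also have "\<dots> = - sum ?f ?M" by (rule sum_negf)
  finally show ?thesis by (simp only: add.right_inverse)
qed

context fd_H_algebra
begin

lemma multilin_sum:
  assumes "multilin S F" "x \<in> S"
  shows "F (\<psi>(x := \<Sum>t\<in>B. g t)) = (\<Sum>t\<in>B. F (\<psi>(x := g t)))"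
proof (induction B rule: infinite_finite_induct)
  case (insert t B)
  then show ?case by (simp only: sum.insert[OF insert.hyps] multilin_add[OF assms])
qed (simp_all add: multilin_zero[OF assms])

text \<open>A choice function \<open>\<pi>\<close> picks one summand for each argument in
  \<open>T\<close>; the arguments outside \<open>T\<close> stay as in \<open>\<psi>\<close>.\<close>

lemma multilin_expand:
  assumes m: "multilin S F" and "finite T" "T \<subseteq> S"
  shows "F (override_on \<psi> (\<lambda>p. \<Sum>t\<in>B p. g p t) T) = (\<Sum>\<pi>\<in>Pi\<^sub>E T B. F (override_on \<psi> (\<lambda>p. g p (\<pi> p)) T))"
  using assms(2,3)
proof (induction T arbitrary: \<psi> rule: finite_induct)
  case empty
  show ?case by simp
next
  case (insert x T)
  let ?G = "\<lambda>p. \<Sum>t\<in>B p. g p t"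
  have x: "x \<in> S" using insert.prems by simp
  have ov: "override_on \<psi> f (insert x T) = (override_on \<psi> f T)(x := f x)" for f
    by (auto simp: override_on_def fun_eq_iff)
  have ov2: "(override_on \<psi> f T)(x := y) = override_on (\<psi>(x := y)) f T" for f y
    using insert.hyps(2) by (auto simp: override_on_def fun_eq_iff)
  have "F (override_on \<psi> ?G (insert x T)) = (\<Sum>y\<in>B x. F ((override_on \<psi> ?G T)(x := g x y)))"
    unfolding ov by (rule multilin_sum[OF m x])
  also have "\<dots> = (\<Sum>y\<in>B x. \<Sum>\<pi>\<in>Pi\<^sub>E T B. F (override_on (\<psi>(x := g x y)) (\<lambda>p. g p (\<pi> p)) T))"
    unfolding ov2 using insert.IH insert.prems by simp
  also have "\<dots> = (\<Sum>(y, \<pi>)\<in>B x \<times> Pi\<^sub>E T B. F (override_on \<psi> (\<lambda>p. g p ((\<pi>(x := y)) p)) (insert x T)))"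
    unfolding sum.cartesian_product
  proof (rule sum.cong[OF refl], clarsimp)
    fix y \<pi>
    have "override_on (\<psi>(x := g x y)) (\<lambda>p. g p (\<pi> p)) T = override_on \<psi> (\<lambda>p. g p (if p = x then y else \<pi> p)) (insert x T)"
      using insert.hyps(2) by (auto simp: override_on_def fun_eq_iff)
    then show "F (override_on (\<psi>(x := g x y)) (\<lambda>p. g p (\<pi> p)) T) =
      F (override_on \<psi> (\<lambda>p. g p (if p = x then y else \<pi> p)) (insert x T))" by simp
  qed
  also have "\<dots> = (\<Sum>\<pi>\<in>Pi\<^sub>E (insert x T) B. F (override_on \<psi> (\<lambda>p. g p (\<pi> p)) (insert x T)))"
    unfolding PiE_insert_eq
    by (subst sum.reindex[OF inj_combinator[OF insert.hyps(2)]]) (simp add: case_prod_unfold)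
  finally show ?case .
qed

text \<open>Inclusion-exclusion over the subsets of the positions expresses the row symmetrization by values
  at arguments that are constant on the rows.\<close>

lemma row_constant_nonzero:
  assumes h: "h \<in> PN n" and lam: "sum_list lam = n" and nz: "Sn_rep.rowop frho lam h \<noteq> 0"
  shows "\<exists>\<xi>. h (\<lambda>p. \<xi> (rowf lam p)) \<noteq> 0"
proof (rule ccontr)
  interpret Sn_rep fsc n frho by (rule rep)
  assume no: "\<not> ?thesis"
  have m: "multilin {..<n} h" using h by (rule PS_multilin)
  let ?R = "\<lambda>p. {t \<in> {..<n}. rowf lam t = rowf lam p}"
  have "rowop lam h \<psi> = 0" for \<psi>
  proof -
    let ?v = "\<lambda>\<pi>. h (\<lambda>p. \<psi> (\<pi> p))"
    \<comment> \<open>The argument \<open>?y p\<close> depends on \<open>p\<close> only through its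
      row, so the assumption makes \<open>h\<close> vanish there. Expanding gives the sum over the
      maps that preserve rows and take values in \<open>T\<close>.\<close>
    have expand: "0 = (\<Sum>\<pi>\<in>Pi\<^sub>E {..<n} ?R. if \<pi> ` {..<n} \<subseteq> T then ?v \<pi> else 0)" if T: "T \<subseteq> {..<n}" for T
    proof -
      let ?B = "\<lambda>p. {t \<in> T. rowf lam t = rowf lam p}"
      let ?y = "\<lambda>p. \<Sum>t\<in>?B p. \<psi> t"
      have "h ?y = 0" using no by (simp only: not_ex not_not) (erule allE[of _ "\<lambda>i. \<Sum>t\<in>{t \<in> T. rowf lam t = i}. \<psi> t"])
      moreover have "h ?y = h (override_on \<psi> ?y {..<n})"
        by (rule multilin_dep[OF m]) (simp add: override_on_def)
      moreover have "h (override_on \<psi> ?y {..<n}) = (\<Sum>\<pi>\<in>Pi\<^sub>E {..<n} ?B. h (override_on \<psi> (\<lambda>p. \<psi> (\<pi> p)) {..<n}))"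
        by (rule multilin_expand[OF m]) auto
      moreover have "h (override_on \<psi> (\<lambda>p. \<psi> (\<pi> p)) {..<n}) = ?v \<pi>" for \<pi>
        by (rule multilin_dep[OF m]) (simp add: override_on_def)
      ultimately have "0 = (\<Sum>\<pi>\<in>Pi\<^sub>E {..<n} ?B. ?v \<pi>)" by simp
      also have "Pi\<^sub>E {..<n} ?B = {\<pi> \<in> Pi\<^sub>E {..<n} ?R. \<pi> ` {..<n} \<subseteq> T}"
        using T by (auto simp: PiE_def Pi_def)
      also have "(\<Sum>\<pi>\<in>{\<pi> \<in> Pi\<^sub>E {..<n} ?R. \<pi> ` {..<n} \<subseteq> T}. ?v \<pi>) =
          (\<Sum>\<pi>\<in>Pi\<^sub>E {..<n} ?R. if \<pi> ` {..<n} \<subseteq> T then ?v \<pi> else 0)"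
        by (rule sum.inter_filter) (intro finite_PiE, auto)
      finally show ?thesis .
    qed
    have sgn_if: "scaleA (of_int s) (if P then x else 0) = scaleA (of_int (if P then s else 0)) x" for s P x
      by simp
    have "0 = (\<Sum>T\<in>Pow {..<n}. scaleA (of_int ((- 1) ^ card T)) (\<Sum>\<pi>\<in>Pi\<^sub>E {..<n} ?R. if \<pi> ` {..<n} \<subseteq> T then ?v \<pi> else 0))"
    proof (rule sum.neutral[symmetric], rule ballI)
      fix T assume "T \<in> Pow {..<n}"
      then have "T \<subseteq> {..<n}" by blast
      from expand[OF this]
      show "scaleA (of_int ((- 1) ^ card T)) (\<Sum>\<pi>\<in>Pi\<^sub>E {..<n} ?R. if \<pi> ` {..<n} \<subseteq> T then ?v \<pi> else 0) = 0"
        by (simp only: A.scale_zero_right)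
    qed
    also have "\<dots> = (\<Sum>\<pi>\<in>Pi\<^sub>E {..<n} ?R. \<Sum>T\<in>Pow {..<n}. scaleA (of_int (if \<pi> ` {..<n} \<subseteq> T then (- 1) ^ card T else 0)) (?v \<pi>))"
      unfolding A.scale_sum_right sgn_if by (rule sum.swap)
    also have "\<dots> = (\<Sum>\<pi>\<in>Pi\<^sub>E {..<n} ?R. scaleA (of_int (\<Sum>T\<in>Pow {..<n}. if \<pi> ` {..<n} \<subseteq> T then (- 1) ^ card T else 0)) (?v \<pi>))"
      unfolding of_int_sum A.scale_sum_left ..
    \<comment> \<open>The alternating sum over \<open>T\<close> retains only the maps onto
      \<open>{..<n}\<close>, which are the row permutations.\<close>
    also have "\<dots> = (\<Sum>\<pi>\<in>Pi\<^sub>E {..<n} ?R. if \<pi> ` {..<n} = {..<n} then scaleA (of_int ((- 1) ^ n)) (?v \<pi>) else 0)"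
    proof (rule sum.cong[OF refl])
      fix \<pi> assume "\<pi> \<in> Pi\<^sub>E {..<n} ?R"
      then have sub: "\<pi> ` {..<n} \<subseteq> {..<n}" by (auto simp: PiE_def Pi_def)
      show "scaleA (of_int (\<Sum>T\<in>Pow {..<n}. if \<pi> ` {..<n} \<subseteq> T then (- 1) ^ card T else 0)) (?v \<pi>) =
        (if \<pi> ` {..<n} = {..<n} then scaleA (of_int ((- 1) ^ n)) (?v \<pi>) else 0)"
      proof (cases "\<pi> ` {..<n} = {..<n}")
        case True
        have "(\<Sum>T\<in>Pow {..<n}. if {..<n} \<subseteq> T then (- 1) ^ card T else (0::int)) =
          (\<Sum>T\<in>Pow {..<n}. if T = {..<n} then (- 1) ^ n else 0)"
          by (rule sum.cong[OF refl]) auto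
        also have "\<dots> = (- 1) ^ n" by simp
        finally show ?thesis using True by simp
      next
        case False
        then have "(\<Sum>T\<in>Pow {..<n}. if \<pi> ` {..<n} \<subseteq> T then (- 1) ^ card T else (0::int)) = 0"
          using sub by (intro sum_alternating_supersets) auto
        then show ?thesis using False by simp
      qed
    qed
    also have "\<dots> = (\<Sum>\<pi>\<in>{\<pi> \<in> Pi\<^sub>E {..<n} ?R. \<pi> ` {..<n} = {..<n}}. scaleA (of_int ((- 1) ^ n)) (?v \<pi>))"
      by (rule sum.inter_filter[symmetric]) (intro finite_PiE, auto)
    also have "\<dots> = (\<Sum>r\<in>row_stab lam. scaleA (of_int ((- 1) ^ n)) (h (\<psi> \<circ> r)))"
    proof (rule sum.reindex_bij_witness[of _ "\<lambda>r. restrict r {..<n}" "\<lambda>\<pi> p. if p < n then \<pi> p else p"])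
      fix \<pi> assume p: "\<pi> \<in> {\<pi> \<in> Pi\<^sub>E {..<n} ?R. \<pi> ` {..<n} = {..<n}}"
      let ?r = "\<lambda>p. if p < n then \<pi> p else p"
      have pe: "\<pi> \<in> Pi\<^sub>E {..<n} ?R" and im: "\<pi> ` {..<n} = {..<n}" using p by auto
      show "restrict ?r {..<n} = \<pi>" using pe by (auto simp: fun_eq_iff restrict_def PiE_def extensional_def)
      have "inj_on \<pi> {..<n}" by (rule eq_card_imp_inj_on) (simp_all add: im)
      then have "bij_betw \<pi> {..<n} {..<n}" using im by (simp add: bij_betw_def)
      then have "bij_betw ?r {..<n} {..<n}" by (rule bij_betw_cong[THEN iffD1, rotated]) simp
      then have "?r permutes {..<n}" by (rule bij_imp_permutes) simp
      then show "?r \<in> row_stab lam" using pe by (auto simp: row_stab_def lam PiE_def Pi_def)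
      have "h (\<psi> \<circ> ?r) = ?v \<pi>" by (rule multilin_dep[OF m]) simp
      then show "scaleA (of_int ((- 1) ^ n)) (h (\<psi> \<circ> ?r)) = scaleA (of_int ((- 1) ^ n)) (?v \<pi>)" by simp
    next
      fix r assume r: "r \<in> row_stab lam"
      have rp: "r permutes {..<n}" using r by (rule stab_perm(1)[OF lam])
      show "(\<lambda>p. if p < n then restrict r {..<n} p else p) = r"
        using rp by (auto simp: fun_eq_iff permutes_not_in)
      have "r p < n" if "p < n" for p using permutes_in_image[OF rp, of p] that by simp
      moreover have "restrict r {..<n} ` {..<n} = {..<n}" using permutes_image[OF rp] by simp
      ultimately show "restrict r {..<n} \<in> {\<pi> \<in> Pi\<^sub>E {..<n} ?R. \<pi> ` {..<n} = {..<n}}"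
        using r by (auto simp: row_stab_def lam)
    qed
    also have "\<dots> = scaleA (of_int ((- 1) ^ n)) (rowop lam h \<psi>)"
      unfolding rowop_def sum_fun_apply A.scale_sum_right by (simp add: frho_def)
    finally have "scaleA (of_int ((- 1) ^ n)) (rowop lam h \<psi>) = 0" by simp
    then show ?thesis by simp
  qed
  then show False using nz by (simp add: fun_eq_iff)
qed

end

section \<open>Gluing\<close>

locale simple_H_algebra = fd_H_algebra scaleH scaleA mulA act Bs
  for scaleH :: "'f::field_char_0 \<Rightarrow> 'h::ring_1 \<Rightarrow> 'h"
    and scaleA :: "'f \<Rightarrow> 'a::ab_group_add \<Rightarrow> 'a"
    and mulA :: "'a \<Rightarrow> 'a \<Rightarrow> 'a"
    and act :: "'h \<Rightarrow> 'a \<Rightarrow> 'a"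
    and Bs :: "'a set" +
  assumes simple: "H_simple scaleA mulA act"
begin

text \<open>The elements obtained from \<open>a\<close> by \<open>j\<close> multiplications, from
  either side, by elements of \<open>A\<close>. An outermost \<open>act\<close> in every rule makes
  each level stable under the action.\<close>

inductive reach :: "'a \<Rightarrow> nat \<Rightarrow> 'a \<Rightarrow> bool" for a where
  start: "reach a 0 (act h a)"
| right: "reach a j c \<Longrightarrow> reach a (Suc j) (act h (mulA c y))"
| left: "reach a j c \<Longrightarrow> reach a (Suc j) (act h (mulA y c))"

lemma reach_act: "reach a j c \<Longrightarrow> reach a j (act g c)"
  by (induction rule: reach.induct) (auto simp: act_mult[symmetric] intro: reach.intros)

definition RS :: "'a \<Rightarrow> nat \<Rightarrow> 'a set" where
  "RS a j = A.span {c. \<exists>i\<le>j. reach a i c}"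

lemma RS_mono: "RS a j \<subseteq> RS a (Suc j)"
  unfolding RS_def by (rule A.span_mono) (auto intro: le_SucI)

lemma RS_self: "a \<in> RS a j"
  unfolding RS_def using reach.start[of a 1] by (intro A.span_base) (auto simp: act_one)

text \<open>When one more multiplication yields nothing new, the span is closed under multiplication
  and hence an H-ideal; it contains \<open>a\<close>.\<close>

lemma RS_ideal:
  assumes e: "RS a (Suc j) \<subseteq> RS a j" and a: "a \<noteq> 0"
  shows "RS a j = UNIV"
proof -
  have sub: "A.subspace (RS a j)" by (simp add: RS_def)
  have act: "act h b \<in> RS a j" if "b \<in> RS a j" for h b
    using that unfolding RS_def
  proof (induction rule: A.span_induct_alt)
    case base
    show ?case by (simp add: act_zero A.span_zero)
  next
    case (step c x y)
    then have "act h x \<in> A.span {c. \<exists>i\<le>j. reach a i c}" by (intro A.span_base) (auto intro: reach_act)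
    then show ?case using step.IH by (simp add: act_add_right act_scale_right A.span_add A.span_scale)
  qed
  have mul: "mulA x b \<in> RS a j \<and> mulA b x \<in> RS a j" if "b \<in> RS a j" for x b
    using that unfolding RS_def[of a j]
  proof (induction rule: A.span_induct_alt)
    case base
    show ?case by (simp add: mulA_zero_left mulA_zero_right A.span_zero)
  next
    case (step c y z)
    then obtain i where i: "i \<le> j" "reach a i y" by blast
    have "mulA x y \<in> RS a (Suc j)" "mulA y x \<in> RS a (Suc j)"
      using reach.left[OF i(2), of 1 x] reach.right[OF i(2), of 1 x] i(1)
      unfolding RS_def by (auto simp: act_one intro!: A.span_base exI[of _ "Suc i"])
    then have "mulA x y \<in> RS a j" "mulA y x \<in> RS a j" using e by auto
    then have "mulA x y \<in> A.span {c. \<exists>i\<le>j. reach a i c}" "mulA y x \<in> A.span {c. \<exists>i\<le>j. reach a i c}"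
      by (simp_all add: RS_def)
    then show ?case using step.IH
      by (simp add: A.mulA_add_left A.mulA_add_right A.mulA_scale_left A.mulA_scale_right A.span_add A.span_scale)
  qed
  have "H_ideal scaleA mulA act (RS a j)" unfolding H_ideal_def using sub mul act by blast
  then have "RS a j = {0} \<or> RS a j = UNIV" using simple unfolding H_simple_def by blast
  then show ?thesis using RS_self[of a j] a by auto
qed

text \<open>As long as the chain has not reached \<open>A\<close> its dimension grows at every step,
  starting from at least 1. This is the origin of the constant \<open>card Bs\<close> in the
  gluing.\<close>

lemma RS_UNIV:
  assumes a: "a \<noteq> 0" shows "RS a (card Bs) = UNIV"
proof (rule ccontr)
  assume ne: "RS a (card Bs) \<noteq> UNIV"
  have "RS a j = UNIV \<or> (\<exists>D. D \<subseteq> RS a j \<and> finite D \<and> \<not> A.dependent D \<and> Suc j \<le> card D)" for j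
  proof (induction j)
    case 0
    have "\<not> A.dependent {a}" using a by simp
    then show ?case using RS_self[of a 0] by (intro disjI2 exI[of _ "{a}"]) simp
  next
    case (Suc j)
    show ?case
    proof (cases "RS a (Suc j) = UNIV")
      case False
      then have nj: "RS a j \<noteq> UNIV" using RS_mono[of a j] by auto
      then have "\<not> RS a (Suc j) \<subseteq> RS a j" using RS_ideal[OF _ a] by blast
      then obtain v where v: "v \<in> RS a (Suc j)" "v \<notin> RS a j" by blast
      obtain D where D: "D \<subseteq> RS a j" "finite D" "\<not> A.dependent D" "Suc j \<le> card D" using Suc nj by blast
      have "A.span D \<subseteq> RS a j" by (rule A.span_minimal[OF D(1)]) (simp add: RS_def)
      then have vs: "v \<notin> A.span D" using v(2) by blast
      then have "v \<notin> D" using A.span_base by blast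
      moreover have "\<not> A.dependent (insert v D)" by (rule A.independent_insertI[OF vs D(3)])
      moreover have "insert v D \<subseteq> RS a (Suc j)" using v(1) D(1) RS_mono[of a j] by blast
      ultimately show ?thesis using D by (intro disjI2 exI[of _ "insert v D"]) simp
    qed simp
  qed
  from this[of "card Bs"] ne obtain D where D: "finite D" "\<not> A.dependent D" "Suc (card Bs) \<le> card D" by blast
  have "card D \<le> card Bs" using A.independent_span_bound[OF Bs_finite D(2)] Bs_span by simp
  then show False using D(3) by simp
qed

lemma mulA_nonzero: "\<exists>u v. mulA u v \<noteq> 0"
proof (rule ccontr)
  assume "\<not> ?thesis"
  then have "{mulA a b |a b. True} = {0}" by auto
  then have "A.span {mulA a b |a b. True} = {0}" by (simp add: A.span_zero)
  then show False using simple unfolding H_simple_def by blast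
qed

lemma mulA_span_zero:
  assumes "\<And>c d. c \<in> C \<Longrightarrow> d \<in> D \<Longrightarrow> mulA c d = 0" "u \<in> A.span C" "v \<in> A.span D"
  shows "mulA u v = 0"
  using assms(2)
proof (induction rule: A.span_induct_alt)
  case base
  show ?case by (rule mulA_zero_left)
next
  case (step k c w)
  have "mulA c v = 0" using assms(3)
  proof (induction rule: A.span_induct_alt)
    case base
    show ?case by (rule mulA_zero_right)
  next
    case (step l d w)
    then show ?case using assms(1)[OF \<open>c \<in> C\<close>] by (simp add: A.mulA_add_right A.mulA_scale_right)
  qed
  then show ?case using step.IH by (simp add: A.mulA_add_left A.mulA_scale_left)
qed

text \<open>The elements reachable from \<open>a\<close> span \<open>A\<close>, and so do those
  reachable from \<open>b\<close>; if all their products vanished, multiplication would be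
  zero.\<close>

lemma glue_elements:
  assumes "a \<noteq> 0" "b \<noteq> 0"
  shows "\<exists>i j c d. i \<le> card Bs \<and> j \<le> card Bs \<and> reach a i c \<and> reach b j d \<and> mulA c d \<noteq> 0"
proof (rule ccontr)
  assume no: "\<not> ?thesis"
  obtain u v where uv: "mulA u v \<noteq> 0" using mulA_nonzero by blast
  have "mulA u v = 0"
    by (rule mulA_span_zero[of "{c. \<exists>i\<le>card Bs. reach a i c}" "{d. \<exists>j\<le>card Bs. reach b j d}"])
      (use no RS_UNIV[OF assms(1)] RS_UNIV[OF assms(2)] in \<open>auto simp: RS_def\<close>)
  then show False using uv by simp
qed

text \<open>Provides a step that adds exactly one factor. If none worked, \<open>RS a 0\<close>
  would already be stable, hence all of \<open>A\<close>, and every product would vanish.\<close>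

lemma extend_element:
  assumes "a \<noteq> 0" shows "\<exists>h y. mulA (act h a) y \<noteq> 0 \<or> mulA y (act h a) \<noteq> 0"
proof (rule ccontr)
  assume no: "\<not> ?thesis"
  have "RS a (Suc 0) \<subseteq> RS a 0" unfolding RS_def
  proof (rule A.span_minimal)
    show "{c. \<exists>i\<le>Suc 0. reach a i c} \<subseteq> A.span {c. \<exists>i\<le>0. reach a i c}"
    proof
      fix c assume "c \<in> {c. \<exists>i\<le>Suc 0. reach a i c}"
      then obtain i where i: "i \<le> Suc 0" "reach a i c" by blast
      show "c \<in> A.span {c. \<exists>i\<le>0. reach a i c}"
      proof (cases "i = 0")
        case True
        then show ?thesis using i by (intro A.span_base) auto
      next
        case False
        then have "reach a (Suc 0) c" using i by (metis le_SucE le_zero_eq)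
        then have "c = 0"
        proof (cases rule: reach.cases)
          case (right c' h y)
          from right(2) obtain h' where "c' = act h' a" by (cases rule: reach.cases) auto
          then show ?thesis using no right(1) by (simp add: act_zero)
        next
          case (left c' h y)
          from left(2) obtain h' where "c' = act h' a" by (cases rule: reach.cases) auto
          then show ?thesis using no left(1) by (simp add: act_zero)
        qed
        then show ?thesis by (simp add: A.span_zero)
      qed
    qed
  qed (rule A.subspace_span)
  then have U: "RS a 0 = UNIV" by (rule RS_ideal[OF _ assms])
  have B: "A.span {act h a |h. True} = UNIV"
  proof -
    have "{c. \<exists>i\<le>0. reach a i c} = {act h a |h. True}"
      by (auto intro: reach.start elim: reach.cases)
    then show ?thesis using U by (simp add: RS_def)
  qed
  obtain u v where uv: "mulA u v \<noteq> 0" using mulA_nonzero by blast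
  have "mulA u v = 0"
    by (rule mulA_span_zero[of "{act h a |h. True}" UNIV]) (use no B in auto)
  then show False using uv by simp
qed

text \<open>The factors used to reach \<open>c\<close> become fresh variables
  \<open>t, ..., t + j - 1\<close>, and \<open>\<psi>'\<close> assigns these factors to them. The
  last clause, that zeros of \<open>G\<close> persist, later carries the alternation of each copy
  through the gluing.\<close>

lemma reach_lift:
  assumes "reach a j c" "G \<in> PS S" "S \<inter> {t..<t + j} = {}" "G \<psi>0 = a"
  shows "\<exists>G' \<psi>'. G' \<in> PS (S \<union> {t..<t + j}) \<and> G' \<psi>' = c \<and> (\<forall>x. x \<notin> {t..<t + j} \<longrightarrow> \<psi>' x = \<psi>0 x) \<and>
    (\<forall>\<psi>. G \<psi> = 0 \<longrightarrow> G' \<psi> = 0)"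
  using assms(1,3)
proof (induction rule: reach.induct)
  case (start h)
  show ?case using PS_act[OF assms(2), of h] assms(4)
    by (intro exI[of _ "\<lambda>\<psi>. act h (G \<psi>)"] exI[of _ \<psi>0]) (simp add: act_zero)
next
  case (right j c h y)
  have "S \<inter> {t..<t + j} = {}" using right.prems by auto
  from right.IH[OF this] obtain G' \<psi>' where G': "G' \<in> PS (S \<union> {t..<t + j})" "G' \<psi>' = c"
    "\<forall>x. x \<notin> {t..<t + j} \<longrightarrow> \<psi>' x = \<psi>0 x" "\<forall>\<psi>. G \<psi> = 0 \<longrightarrow> G' \<psi> = 0" by blast
  have tS: "t + j \<notin> S \<union> {t..<t + j}" using right.prems by auto
  have S: "S \<union> {t..<t + j} \<union> {t + j} = S \<union> {t..<t + Suc j}" by auto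
  have "(\<lambda>\<psi>. act h (mulA (G' \<psi>) (\<psi> (t + j)))) \<in> PS (S \<union> {t..<t + j} \<union> {t + j})"
    by (intro PS_act PS_mult G'(1) PS_var) (use tS in blast)
  moreover have "G' (\<psi>'(t + j := y)) = c"
    unfolding G'(2)[symmetric] by (rule multilin_dep[OF PS_multilin[OF G'(1)]]) (use tS in auto)
  then have "act h (mulA (G' (\<psi>'(t + j := y))) ((\<psi>'(t + j := y)) (t + j))) = act h (mulA c y)" by (simp only: fun_upd_same)
  moreover have "\<forall>x. x \<notin> {t..<t + Suc j} \<longrightarrow> (\<psi>'(t + j := y)) x = \<psi>0 x" using G'(3) by auto
  moreover have "\<forall>\<psi>. G \<psi> = 0 \<longrightarrow> act h (mulA (G' \<psi>) (\<psi> (t + j))) = 0" using G'(4) by (simp add: act_zero mulA_zero_left)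
  ultimately show ?case unfolding S
    by (intro exI[of _ "\<lambda>\<psi>. act h (mulA (G' \<psi>) (\<psi> (t + j)))"] exI[of _ "\<psi>'(t + j := y)"] conjI) (assumption | simp)+
next
  case (left j c h y)
  have "S \<inter> {t..<t + j} = {}" using left.prems by auto
  from left.IH[OF this] obtain G' \<psi>' where G': "G' \<in> PS (S \<union> {t..<t + j})" "G' \<psi>' = c"
    "\<forall>x. x \<notin> {t..<t + j} \<longrightarrow> \<psi>' x = \<psi>0 x" "\<forall>\<psi>. G \<psi> = 0 \<longrightarrow> G' \<psi> = 0" by blast
  have tS: "t + j \<notin> S \<union> {t..<t + j}" using left.prems by auto
  have S: "{t + j} \<union> (S \<union> {t..<t + j}) = S \<union> {t..<t + Suc j}" by auto
  have "(\<lambda>\<psi>. act h (mulA (\<psi> (t + j)) (G' \<psi>))) \<in> PS ({t + j} \<union> (S \<union> {t..<t + j}))"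
    by (intro PS_act PS_mult G'(1) PS_var) (use tS in blast)
  moreover have "G' (\<psi>'(t + j := y)) = c"
    unfolding G'(2)[symmetric] by (rule multilin_dep[OF PS_multilin[OF G'(1)]]) (use tS in auto)
  then have "act h (mulA ((\<psi>'(t + j := y)) (t + j)) (G' (\<psi>'(t + j := y)))) = act h (mulA y c)" by (simp only: fun_upd_same)
  moreover have "\<forall>x. x \<notin> {t..<t + Suc j} \<longrightarrow> (\<psi>'(t + j := y)) x = \<psi>0 x" using G'(3) by auto
  moreover have "\<forall>\<psi>. G \<psi> = 0 \<longrightarrow> act h (mulA (\<psi> (t + j)) (G' \<psi>)) = 0" using G'(4) by (simp add: act_zero mulA_zero_right)
  ultimately show ?case unfolding S
    by (intro exI[of _ "\<lambda>\<psi>. act h (mulA (\<psi> (t + j)) (G' \<psi>))"] exI[of _ "\<psi>'(t + j := y)"] conjI) (assumption | simp)+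
qed

text \<open>Each further copy is joined by \<open>glue_elements\<close>, at the cost of at most
  \<open>card Bs\<close> new variables on either side; hence the factor \<open>2 * card Bs\<close>.
  Copy \<open>b'\<close> owns the \<open>n\<close> variables from \<open>b' * n\<close> on, and the
  auxiliary variables start at \<open>m\<close>, behind all \<open>q\<close> copies.\<close>

lemma glue_copies:
  assumes g: "g \<in> PN n" and nz: "g \<eta> \<noteq> 0" and m: "q * n \<le> m"
  shows "1 \<le> b \<Longrightarrow> b \<le> q \<Longrightarrow> \<exists>k G \<psi>. k \<le> 2 * card Bs * b \<and> G \<in> PS ({..<b * n} \<union> {m..<m + k}) \<and>
    (\<forall>x<b * n. \<psi> x = \<eta> (x mod n)) \<and> G \<psi> \<noteq> 0 \<and>
    (\<forall>\<psi>. (\<exists>b'<b. g (\<lambda>p. \<psi> (b' * n + p)) = 0) \<longrightarrow> G \<psi> = 0)"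
proof (induction b rule: nat_induct_at_least[of 1, consumes 1])
  case base
  have "g (\<lambda>x. \<eta> (x mod n)) = g \<eta>"
    by (rule multilin_dep[OF PS_multilin[OF g]]) simp
  then show ?case using g nz
    by (intro exI[of _ 0] exI[of _ g] exI[of _ "\<lambda>x. \<eta> (x mod n)"]) simp
next
  case (Suc b)
  have "b \<le> q" using Suc.prems by simp
  from Suc.IH[OF this]
  obtain k G \<psi> where k: "k \<le> 2 * card Bs * b" and G: "G \<in> PS ({..<b * n} \<union> {m..<m + k})"
    and psi: "\<forall>x<b * n. \<psi> x = \<eta> (x mod n)" and Gnz: "G \<psi> \<noteq> 0"
    and Gz: "\<forall>\<psi>. (\<exists>b'<b. g (\<lambda>p. \<psi> (b' * n + p)) = 0) \<longrightarrow> G \<psi> = 0" by (elim exE conjE)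
  obtain i j c d where ij: "i \<le> card Bs" "j \<le> card Bs" "reach (G \<psi>) i c" "reach (g \<eta>) j d" "mulA c d \<noteq> 0"
    using glue_elements[OF Gnz nz] by blast
  have bq: "b * n + n \<le> m" using Suc.prems m mult_le_mono1[of "Suc b" q n] by simp
  have d1: "({..<b * n} \<union> {m..<m + k}) \<inter> {m + k..<m + k + i} = {}" using bq by auto
  obtain G1 \<psi>1 where G1: "G1 \<in> PS ({..<b * n} \<union> {m..<m + k} \<union> {m + k..<m + k + i})" "G1 \<psi>1 = c"
    "\<forall>x. x \<notin> {m + k..<m + k + i} \<longrightarrow> \<psi>1 x = \<psi> x" "\<forall>\<psi>. G \<psi> = 0 \<longrightarrow> G1 \<psi> = 0"
    using reach_lift[OF ij(3) G d1 refl] by blast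
  let ?sh = "\<lambda>p. b * n + p"
  let ?g = "\<lambda>\<psi>. g (\<lambda>p. \<psi> (b * n + p))"
  have "(\<lambda>\<psi>. g (\<psi> \<circ> ?sh)) \<in> PS (?sh ` {..<n})" by (rule PS_rename[OF g]) (simp add: inj_on_def)
  moreover have "?sh ` {..<n} = {b * n..<b * n + n}"
    by (metis add.commute atLeast0LessThan image_add_atLeastLessThan add_0)
  ultimately have g1: "?g \<in> PS {b * n..<b * n + n}" by (simp add: o_def)
  have "?g (\<lambda>x. \<eta> (x mod n)) = g \<eta>"
    by (rule multilin_dep[OF PS_multilin[OF g]]) simp
  note d2 = this
  have d3: "{b * n..<b * n + n} \<inter> {m + k + i..<m + k + i + j} = {}" using bq by auto
  obtain G2 \<psi>2 where G2: "G2 \<in> PS ({b * n..<b * n + n} \<union> {m + k + i..<m + k + i + j})" "G2 \<psi>2 = d"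
    "\<forall>x. x \<notin> {m + k + i..<m + k + i + j} \<longrightarrow> \<psi>2 x = \<eta> (x mod n)" "\<forall>\<psi>. ?g \<psi> = 0 \<longrightarrow> G2 \<psi> = 0"
    using reach_lift[OF ij(4) g1 d3 d2] by blast
  let ?S1 = "{..<b * n} \<union> {m..<m + k} \<union> {m + k..<m + k + i}"
  let ?S2 = "{b * n..<b * n + n} \<union> {m + k + i..<m + k + i + j}"
  \<comment> \<open>The two factors have disjoint variables, so the assignments can be
    merged.\<close>
  let ?\<psi> = "\<lambda>x. if x \<in> ?S1 then \<psi>1 x else \<psi>2 x"
  have dis: "?S1 \<inter> ?S2 = {}" using bq by auto
  have un: "?S1 \<union> ?S2 = {..<Suc b * n} \<union> {m..<m + (k + i + j)}" by auto
  have P: "(\<lambda>\<psi>. mulA (G1 \<psi>) (G2 \<psi>)) \<in> PS ({..<Suc b * n} \<union> {m..<m + (k + i + j)})"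
    using PS_mult[OF G1(1) G2(1) dis] unfolding un .
  have G1c: "G1 ?\<psi> = c" unfolding G1(2)[symmetric]
    by (rule multilin_dep[OF PS_multilin[OF G1(1)]]) (simp only: if_True)
  have S2: "x \<notin> ?S1" if "x \<in> ?S2" for x using dis that by (simp only: disjoint_iff) blast
  have G2d: "G2 ?\<psi> = d" unfolding G2(2)[symmetric]
    by (rule multilin_dep[OF PS_multilin[OF G2(1)]]) (simp only: S2 if_False)
  have nz': "mulA (G1 ?\<psi>) (G2 ?\<psi>) \<noteq> 0" unfolding G1c G2d by (rule ij(5))
  have v: "?\<psi> x = \<eta> (x mod n)" if "x < Suc b * n" for x
  proof (cases "x < b * n")
    case True
    then have "x \<notin> {m + k..<m + k + i}" using bq by auto
    then show ?thesis using True G1(3) psi by simp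
  next
    case False
    then have "x \<notin> ?S1" "x \<notin> {m + k + i..<m + k + i + j}" using bq that by auto
    then show ?thesis by (simp only: if_False G2(3)[rule_format] simp_thms)
  qed
  have z: "mulA (G1 \<psi>) (G2 \<psi>) = 0" if ex: "\<exists>b'<Suc b. g (\<lambda>p. \<psi> (b' * n + p)) = 0" for \<psi>
  proof -
    obtain b' where b': "b' < Suc b" "g (\<lambda>p. \<psi> (b' * n + p)) = 0" using ex by blast
    show ?thesis
    proof (cases "b' = b")
      case True
      then have "G2 \<psi> = 0" using b' G2(4) by blast
      then show ?thesis by (simp add: mulA_zero_right)
    next
      case False
      then have "b' < b" using b' by simp
      then have "G1 \<psi> = 0" using b' Gz G1(4) by blast
      then show ?thesis by (simp add: mulA_zero_left)
    qed
  qed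
  have kk: "k + i + j \<le> 2 * card Bs * Suc b" using k ij(1,2) by simp
  show ?case
    by (rule exI[of _ "k + i + j"], rule exI[of _ "\<lambda>\<psi>. mulA (G1 \<psi>) (G2 \<psi>)"], rule exI[of _ ?\<psi>])
      (intro conjI allI impI kk P v nz' z)
qed

text \<open>\<open>glue_copies\<close> only bounds the number of auxiliary variables;
  \<open>extend_element\<close> then adds single variables until there are exactly
  \<open>N\<close>.\<close>

lemma glue_copies_fill:
  assumes g: "g \<in> PN n" and nz: "g \<eta> \<noteq> 0" and q: "1 \<le> q" and N: "q * n + 2 * card Bs * q \<le> N"
  shows "\<exists>G \<psi>. G \<in> PN N \<and> (\<forall>x<q * n. \<psi> x = \<eta> (x mod n)) \<and> G \<psi> \<noteq> 0 \<and>
    (\<forall>\<psi>. (\<exists>b<q. g (\<lambda>p. \<psi> (b * n + p)) = 0) \<longrightarrow> G \<psi> = 0)"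
proof -
  let ?P = "\<lambda>N. \<exists>G \<psi>. G \<in> PN N \<and> (\<forall>x<q * n. \<psi> x = \<eta> (x mod n)) \<and> G \<psi> \<noteq> 0 \<and>
    (\<forall>\<psi>. (\<exists>b<q. g (\<lambda>p. \<psi> (b * n + p)) = 0) \<longrightarrow> G \<psi> = 0)"
  obtain k G \<psi> where k: "k \<le> 2 * card Bs * q" and G: "G \<in> PS ({..<q * n} \<union> {q * n..<q * n + k})"
    "\<forall>x<q * n. \<psi> x = \<eta> (x mod n)" "G \<psi> \<noteq> 0"
    "\<forall>\<psi>. (\<exists>b'<q. g (\<lambda>p. \<psi> (b' * n + p)) = 0) \<longrightarrow> G \<psi> = 0"
    using glue_copies[OF g nz order_refl q order_refl] by blast
  have "{..<q * n} \<union> {q * n..<q * n + k} = {..<q * n + k}" by auto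
  then have base: "?P (q * n + k)" using G by auto
  have step: "?P (Suc t)" if t: "q * n \<le> t" and Pt: "?P t" for t
  proof -
    obtain G \<psi> where G: "G \<in> PN t" "\<forall>x<q * n. \<psi> x = \<eta> (x mod n)" "G \<psi> \<noteq> 0"
      "\<forall>\<psi>. (\<exists>b<q. g (\<lambda>p. \<psi> (b * n + p)) = 0) \<longrightarrow> G \<psi> = 0" using Pt by blast
    obtain h y where hy: "mulA (act h (G \<psi>)) y \<noteq> 0 \<or> mulA y (act h (G \<psi>)) \<noteq> 0"
      using extend_element[OF G(3)] by blast
    let ?\<psi> = "\<psi>(t := y)"
    have Ge: "G ?\<psi> = G \<psi>" by (rule multilin_dep[OF PS_multilin[OF G(1)]]) simp
    have ps: "\<forall>x<q * n. ?\<psi> x = \<eta> (x mod n)" using G(2) t by simp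
    have S: "{..<t} \<union> {t} = {..<Suc t}" "{t} \<union> {..<t} = {..<Suc t}" by auto
    show ?thesis
    proof (cases "mulA (act h (G \<psi>)) y \<noteq> 0")
      case True
      have "(\<lambda>\<psi>. mulA (act h (G \<psi>)) (\<psi> t)) \<in> PS ({..<t} \<union> {t})"
        by (intro PS_mult PS_act G(1) PS_var) simp
      then show ?thesis using True Ge ps G(4) unfolding S
        by (intro exI[of _ "\<lambda>\<psi>. mulA (act h (G \<psi>)) (\<psi> t)"] exI[of _ ?\<psi>]) (simp add: act_zero mulA_zero_left)
    next
      case False
      have "(\<lambda>\<psi>. mulA (\<psi> t) (act h (G \<psi>))) \<in> PS ({t} \<union> {..<t})"
        by (intro PS_mult PS_act G(1) PS_var) simp
      then show ?thesis using False hy Ge ps G(4) unfolding S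
        by (intro exI[of _ "\<lambda>\<psi>. mulA (\<psi> t) (act h (G \<psi>))"] exI[of _ ?\<psi>]) (simp add: act_zero mulA_zero_right)
    qed
  qed
  have "q * n + k \<le> N" using k N by simp
  then show "?P N"
    by (induction N rule: dec_induct) (use base step in auto)
qed

end

section \<open>Diagonals of glued tableaux\<close>

text \<open>Position \<open>x\<close> lies in copy \<open>x div n\<close> of the tableau. Row \<open>i\<close> of copy \<open>b\<close> belongs to diagonal
  \<open>b + i\<close>; a complete diagonal meets the rows \<open>0, \<dots>, length lam - 1\<close> in different copies, hence its
  positions are not alternated with one another.\<close>

locale glued_tableaux =
  fixes lam :: "nat list" and n q :: nat
  assumes lam: "partition_of lam n" and n_pos: "n > 0"
begin

definition diag :: "nat \<Rightarrow> nat" where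
  "diag x = x div n + rowf lam (x mod n)"

text \<open>The position on diagonal \<open>c\<close> with index \<open>p\<close> in its copy. A
  complete diagonal takes row \<open>i\<close> from copy \<open>c - i\<close> and so contains every
  index below \<open>n\<close> once; through \<open>x mod n\<close> it looks like one whole
  tableau.\<close>

definition pos :: "nat \<Rightarrow> nat \<Rightarrow> nat" where
  "pos c p = (c - rowf lam p) * n + p"

text \<open>The bound by \<open>length lam\<close> keeps \<open>c - rowf lam p\<close> from being
  truncated at 0, the bound by \<open>q\<close> keeps the copy in range.\<close>

definition complete :: "nat \<Rightarrow> bool" where
  "complete x \<longleftrightarrow> x < q * n \<and> length lam \<le> diag x \<and> diag x < q"

definition shuffle :: "(nat \<Rightarrow> nat \<Rightarrow> nat) \<Rightarrow> nat \<Rightarrow> nat" where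
  "shuffle s x = (if complete x then pos (diag x) (s (diag x) (x mod n)) else x)"

text \<open>Outside the complete diagonals the letter is frozen at the row index; there the
  induction over diagonals has nothing to prove.\<close>

definition letter :: "(nat \<Rightarrow> nat \<Rightarrow> nat) \<Rightarrow> nat \<Rightarrow> nat" where
  "letter v x = (if complete x then v (diag x) (x mod n) else rowf lam (x mod n))"

lemma sum_lam: "sum_list lam = n" using lam by (simp add: partition_of_def)

lemma pos_props:
  assumes "length lam \<le> c" "c < q" "p < n"
  shows "diag (pos c p) = c" "pos c p mod n = p" "pos c p div n = c - rowf lam p" "pos c p < q * n" "complete (pos c p)"
proof -
  have r: "rowf lam p < length lam" using assms(3) by (intro rowf_less_length) (simp add: sum_lam)
  show m: "pos c p mod n = p" using assms(3) by (simp add: pos_def)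
  show d: "pos c p div n = c - rowf lam p" using assms(3) n_pos by (simp add: pos_def)
  show g: "diag (pos c p) = c" using r assms(1) by (simp add: diag_def m d)
  have "pos c p < (c - rowf lam p + 1) * n" using assms(3) by (simp add: pos_def)
  also have "\<dots> \<le> q * n" using assms(2) by (intro mult_le_mono1) simp
  finally show "pos c p < q * n" .
  then show "complete (pos c p)" using assms(1,2) by (simp add: complete_def g)
qed

lemma pos_diag: "pos (diag x) (x mod n) = x"
  by (simp add: pos_def diag_def)

lemma mod_less: "x mod n < n" using n_pos by simp

lemma shuffle_pos:
  assumes "length lam \<le> c" "c < q" "p < n"
  shows "shuffle s (pos c p) = pos c (s c p)"
  using pos_props[OF assms] by (simp add: shuffle_def)

lemma letter_pos:
  assumes "length lam \<le> c" "c < q" "p < n"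
  shows "letter v (pos c p) = v c p"
  using pos_props[OF assms] by (simp add: letter_def)

lemma shuffle_complete:
  assumes "\<And>c. s c permutes {..<n}" "complete x"
  shows "shuffle s x = pos (diag x) (s (diag x) (x mod n))" "s (diag x) (x mod n) < n"
  using assms(2) permutes_in_image[OF assms(1)[of "diag x"], of "x mod n"] mod_less[of x]
  by (simp_all add: shuffle_def)

lemma shuffle_inverse:
  assumes s: "\<And>c. s c permutes {..<n}" and t: "\<And>c. t c permutes {..<n}" and ts: "\<And>c p. t c (s c p) = p"
  shows "shuffle t (shuffle s x) = x"
proof (cases "complete x")
  case True
  then have c: "length lam \<le> diag x" "diag x < q" by (simp_all add: complete_def)
  show ?thesis
    unfolding shuffle_complete(1)[of s, OF s True] shuffle_pos[OF c shuffle_complete(2)[of s, OF s True]] ts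
    by (rule pos_diag)
qed (simp add: shuffle_def)

lemma shuffle_less:
  assumes s: "\<And>c. s c permutes {..<n}" and x: "x < q * n"
  shows "shuffle s x < q * n"
proof (cases "complete x")
  case True
  then have c: "length lam \<le> diag x" "diag x < q" by (simp_all add: complete_def)
  show ?thesis
    unfolding shuffle_complete(1)[of s, OF s True] by (rule pos_props(4)[OF c shuffle_complete(2)[of s, OF s True]])
qed (simp add: shuffle_def x)

lemma shuffle_permutes:
  assumes s: "\<And>c. s c permutes {..<n}"
  shows "shuffle s permutes {..<q * n}"
proof (rule bij_imp_permutes)
  let ?t = "\<lambda>c. pinv (s c)"
  have t: "?t c permutes {..<n}" for c by (rule permutes_inv[OF s])
  show "bij_betw (shuffle s) {..<q * n} {..<q * n}"
    by (rule bij_betwI[where g = "shuffle ?t"])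
      (auto simp: shuffle_less[of s, OF s] shuffle_less[of ?t, OF t] shuffle_inverse[of s ?t, OF s t] shuffle_inverse[of ?t s, OF t s] permutes_inverses[OF s])
  show "shuffle s x = x" if "x \<notin> {..<q * n}" for x using that by (simp add: shuffle_def complete_def)
qed

text \<open>Reading a word through the inverse of the permutation that produced it gives back the
  row indices.\<close>

lemma letter_shuffle:
  assumes s: "\<And>c. s c permutes {..<n}"
  shows "letter (\<lambda>c. restrict (rowf lam \<circ> s c) {..<n}) (shuffle (\<lambda>c. pinv (s c)) x) = rowf lam (x mod n)"
proof (cases "complete x")
  case True
  let ?t = "\<lambda>c. pinv (s c)"
  have t: "?t c permutes {..<n}" for c by (rule permutes_inv[OF s])
  have c: "length lam \<le> diag x" "diag x < q" using True by (simp_all add: complete_def)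
  show ?thesis unfolding shuffle_complete(1)[of ?t, OF t True] letter_pos[OF c shuffle_complete(2)[of ?t, OF t True]]
    using shuffle_complete(2)[of ?t, OF t True] by (simp add: permutes_inverses[OF s])
qed (simp add: shuffle_def letter_def)

text \<open>By induction on the diagonal: the smaller letters are already used up in each column, so the
  letter at \<open>x\<close> is at least the row of \<open>x\<close>, and the sums over the diagonal agree.\<close>

lemma letters_rigid:
  assumes s: "\<And>c. s c permutes {..<n}" and v: "\<And>c. length lam \<le> c \<Longrightarrow> c < q \<Longrightarrow> v c \<in> row_words lam"
    and dist: "\<And>b p p'. b < q \<Longrightarrow> p < n \<Longrightarrow> p' < n \<Longrightarrow> p \<noteq> p' \<Longrightarrow> colf lam p = colf lam p' \<Longrightarrow>
      letter v (shuffle s (b * n + p)) \<noteq> letter v (shuffle s (b * n + p'))"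
  shows "x < q * n \<Longrightarrow> letter v (shuffle s x) = rowf lam (x mod n)"
proof (induction "diag x" arbitrary: x rule: less_induct)
  case less
  show ?case
  proof (cases "complete x")
    case True
    define c where "c = diag x"
    have c: "length lam \<le> c" "c < q" using True by (simp_all add: complete_def c_def)
    let ?u = "\<lambda>p. letter v (shuffle s (pos c p))"
    have ge: "rowf lam p \<le> ?u p" if p: "p < n" for p
    proof (rule ccontr)
      assume "\<not> ?thesis"
      then have lt: "?u p < rowf lam p" by simp
      \<comment> \<open>The cell in the same column whose row is the letter found at
        \<open>p\<close>. It exists because the parts decrease, and it lies on a smaller diagonal of
        complete or frozen positions, so by induction it already carries this letter.\<close>
      define p' where "p' = cell lam (?u p) (colf lam p)"
      have "colf lam p < part lam (rowf lam p)" using cell_rowf_colf(1)[of p lam] p by (simp add: sum_lam)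
      also have "\<dots> \<le> part lam (?u p)" using lt by (intro partition_of_antimono[OF lam]) simp
      finally have cp: "colf lam p < part lam (?u p)" .
      have rp: "rowf lam p' = ?u p" "colf lam p' = colf lam p" "p' < n"
        using rowf_cell[OF cp] colf_cell[OF cp] cell_less[OF cp] by (simp_all add: p'_def sum_lam)
      have rl: "rowf lam p < length lam" using p by (intro rowf_less_length) (simp add: sum_lam)
      define b where "b = c - rowf lam p"
      have bq: "b < q" using c by (simp add: b_def)
      have xe: "pos c p = b * n + p" by (simp add: pos_def b_def)
      have "b * n + p' < (b + 1) * n" using rp(3) by simp
      also have "\<dots> \<le> q * n" using bq by (intro mult_le_mono1) simp
      finally have l': "b * n + p' < q * n" .
      have "diag (b * n + p') = b + ?u p" using rp n_pos by (simp add: diag_def)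
      also have "\<dots> < diag x" using lt rl c by (simp add: b_def c_def[symmetric])
      finally have "letter v (shuffle s (b * n + p')) = rowf lam ((b * n + p') mod n)" using l' by (rule less.hyps)
      then have "letter v (shuffle s (b * n + p')) = ?u p" using rp by simp
      moreover have "p \<noteq> p'" using rp(1) lt by auto
      ultimately show False using dist[OF bq p rp(3)] rp(2) xe by simp
    qed
    obtain \<tau> where t: "\<tau> permutes {..<n}" "v c = restrict (rowf lam \<circ> \<tau>) {..<n}"
      using v[OF c] unfolding row_words_def sum_lam by blast
    have sc: "s c p < n" if "p < n" for p using permutes_in_image[OF s, of c p] that by simp
    \<comment> \<open>The word \<open>v c\<close> rearranges the row indices and \<open>s c\<close>
      rearranges the diagonal, so the letters have the same sum as the row indices; together with
      the inequality this gives equality everywhere.\<close>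
    have "(\<Sum>p<n. ?u p) = (\<Sum>p<n. v c (s c p))"
      by (intro sum.cong refl) (simp add: shuffle_pos[OF c] letter_pos[OF c] sc)
    also have "\<dots> = (\<Sum>p<n. v c p)" using sum.permute[OF s, of "v c" c] by (simp add: o_def)
    also have "\<dots> = (\<Sum>p<n. rowf lam (\<tau> p))" by (intro sum.cong refl) (simp add: t(2))
    also have "\<dots> = (\<Sum>p<n. rowf lam p)" using sum.permute[OF t(1), of "rowf lam"] by (simp add: o_def)
    finally have e: "(\<Sum>p<n. rowf lam p) = (\<Sum>p<n. ?u p)" ..
    have "rowf lam p = ?u p" if "p < n" for p
      by (rule sum_mono_inv[OF e]) (use ge that in auto)
    from this[OF mod_less[of x]] show ?thesis unfolding c_def pos_diag ..
  qed (simp add: shuffle_def letter_def)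
qed

end

context fd_H_algebra
begin

text \<open>The matrix of values at the test points \<open>y j\<close> is diagonal with nonzero
  entries.\<close>

lemma independent_separated:
  assumes "finite I" "\<And>i. i \<in> I \<Longrightarrow> f i (y i) \<noteq> 0" "\<And>i j. i \<in> I \<Longrightarrow> j \<in> I \<Longrightarrow> f i (y j) \<noteq> 0 \<Longrightarrow> i = j"
  shows "inj_on f I" "\<not> FS.dependent (f ` I)"
proof -
  have *: "\<forall>i\<in>I. k i = 0" if z: "(\<Sum>i\<in>I. fsc (k i) (f i)) = 0" for k
  proof
    fix j assume j: "j \<in> I"
    have "0 = (\<Sum>i\<in>I. fsc (k i) (f i)) (y j)" by (simp add: z)
    also have "\<dots> = (\<Sum>i\<in>I. if i = j then scaleA (k j) (f j (y j)) else 0)"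
      unfolding sum_fun_apply
    proof (intro sum.cong refl)
      fix i assume i: "i \<in> I"
      show "fsc (k i) (f i) (y j) = (if i = j then scaleA (k j) (f j (y j)) else 0)"
        using assms(3)[OF i j] by (cases "f i (y j) = 0") (auto simp: fscale_def assms(2))
    qed
    also have "\<dots> = scaleA (k j) (f j (y j))" using assms(1) j by simp
    finally show "k j = 0" using assms(2)[OF j] by simp
  qed
  show "inj_on f I" "\<not> FS.dependent (f ` I)"
    by (rule FS.independent_family[OF assms(1) *]; assumption)+
qed

end

context simple_H_algebra
begin

text \<open>For a tuple \<open>v\<close> of words on the diagonals
  \<open>length lam, ..., q - 1\<close>, the assignment \<open>y v\<close> writes \<open>v\<close>
  there and \<open>f v\<close> undoes the corresponding permutation, so \<open>f v (y v)\<close> is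
  the nonzero value of the glued function. If \<open>f v (y v')\<close> is nonzero, no column of any
  copy receives a letter twice, and \<open>letters_rigid\<close> forces
  \<open>v' = v\<close>.\<close>

lemma codim_lower:
  assumes lam: "lam \<in> supp n" and n: "n > 0" and q: "1 \<le> q" and N: "q * n + 2 * card Bs * q \<le> N"
  shows "card (row_words lam) ^ (q - length lam) \<le> H_codim scaleH scaleA mulA act N"
proof -
  interpret Sn_rep fsc n frho by (rule rep)
  have part: "partition_of lam n" and exF: "\<exists>F\<in>PN n. young lam F \<noteq> 0"
    using supp_iff[THEN iffD1, OF lam] by (rule conjunct1, rule conjunct2)
  interpret glued_tableaux lam n q by unfold_locales (fact part, fact n)
  obtain F where F: "F \<in> PN n" "young lam F \<noteq> 0" using exF by (elim bexE)
  define h where "h = colop lam F"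
  have h: "h \<in> PN n" unfolding h_def by (rule colop_in[OF sum_lam PN_invariant F(1)])
  have "rowop lam h \<noteq> 0" using F(2) unfolding young_def h_def .
  \<comment> \<open>An argument that is constant on rows can be encoded by letters, since only the
    row index of a position matters.\<close>
  from row_constant_nonzero[OF h sum_lam this] obtain \<xi> where "h (\<lambda>p. \<xi> (rowf lam p)) \<noteq> 0" by (elim exE)
  from glue_copies_fill[OF h this q N] obtain G \<psi>0 where G: "G \<in> PN N"
    and psi0: "\<forall>x<q * n. \<psi>0 x = \<xi> (rowf lam (x mod n))" and nz: "G \<psi>0 \<noteq> 0"
    and zero: "\<forall>\<psi>. (\<exists>b<q. h (\<lambda>p. \<psi> (b * n + p)) = 0) \<longrightarrow> G \<psi> = 0" by (elim exE conjE)
  define I where "I = (\<Pi>\<^sub>E c\<in>{length lam..<q}. row_words lam)"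
  have finI: "finite I" unfolding I_def by (intro finite_PiE finite_row_words) simp
  have cardI: "card I = card (row_words lam) ^ (q - length lam)" by (simp add: I_def card_PiE)
  \<comment> \<open>The default \<open>id\<close> makes \<open>pm w\<close> a permutation even when
    \<open>w\<close> is not a word of content \<open>lam\<close>.\<close>
  have "\<forall>w. \<exists>\<sigma>. \<sigma> permutes {..<n} \<and> (w \<in> row_words lam \<longrightarrow> w = restrict (rowf lam \<circ> \<sigma>) {..<n})"
  proof
    fix w show "\<exists>\<sigma>. \<sigma> permutes {..<n} \<and> (w \<in> row_words lam \<longrightarrow> w = restrict (rowf lam \<circ> \<sigma>) {..<n})"
    proof (cases "w \<in> row_words lam")
      case True
      then show ?thesis unfolding row_words_def sum_lam by auto
    next
      case False
      then show ?thesis using permutes_id[of "{..<n}"] by (intro exI[of _ id]) simp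
    qed
  qed
  from choice[OF this] obtain pm where "\<forall>w. pm w permutes {..<n} \<and>
    (w \<in> row_words lam \<longrightarrow> w = restrict (rowf lam \<circ> pm w) {..<n})" by (elim exE)
  then have pm: "\<And>w. pm w permutes {..<n}"
    "\<And>w. w \<in> row_words lam \<Longrightarrow> w = restrict (rowf lam \<circ> pm w) {..<n}" by simp_all
  define s where "s v c = pm (v c)" for v :: "nat \<Rightarrow> nat \<Rightarrow> nat" and c :: nat
  define t where "t v c = pinv (s v c)" for v c
  have s: "s v c permutes {..<n}" and t: "t v c permutes {..<n}" for v c
    by (simp_all add: s_def t_def pm permutes_inv)
  have vs: "v c = restrict (rowf lam \<circ> s v c) {..<n}" if "v \<in> I" "length lam \<le> c" "c < q" for v c
  proof -
    have "v c \<in> row_words lam" using that by (auto simp: I_def)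
    then show ?thesis unfolding s_def by (rule pm(2))
  qed
  have letter_cong: "letter v x = letter (\<lambda>c. restrict (rowf lam \<circ> s v c) {..<n}) x" if "v \<in> I" for v x
    using vs[OF that, of "diag x"] unfolding letter_def complete_def by simp
  define f where "f v = frho (shuffle (t v)) G" for v
  define y where "y v x = (if x < q * n then \<xi> (letter v x) else \<psi>0 x)" for v x
  have fin: "f v \<in> PN N" for v
  proof -
    have "shuffle (t v) permutes {..<N}"
      by (rule permutes_subset[OF shuffle_permutes[of "t v"]]) (use t N in auto)
    then show ?thesis unfolding f_def
      using Sn_rep.invariantD(2)[OF rep PN_invariant _ G] by simp
  qed
  have "f v (y v) \<noteq> 0" if v: "v \<in> I" for v
  proof -
    have "G (y v \<circ> shuffle (t v)) = G \<psi>0"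
    proof (rule multilin_dep[OF PS_multilin[OF G]])
      fix x
      show "(y v \<circ> shuffle (t v)) x = \<psi>0 x"
      proof (cases "x < q * n")
        case True
        have "letter v (shuffle (t v) x) = rowf lam (x mod n)"
          unfolding letter_cong[OF v] t_def by (rule letter_shuffle[of "s v"]) (rule s)
        then show ?thesis using True shuffle_less[of "t v" x] t psi0 by (simp add: y_def)
      qed (simp add: y_def shuffle_def complete_def)
    qed
    then show ?thesis using nz by (simp add: f_def frho_def)
  qed
  moreover have "v = v'" if v: "v \<in> I" and v': "v' \<in> I" and ne: "f v (y v') \<noteq> 0" for v v'
  proof (rule PiE_ext)
    show "v \<in> (\<Pi>\<^sub>E c\<in>{length lam..<q}. row_words lam)" "v' \<in> (\<Pi>\<^sub>E c\<in>{length lam..<q}. row_words lam)"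
      using v v' by (simp_all add: I_def)
    fix c assume "c \<in> {length lam..<q}"
    then have c: "length lam \<le> c" "c < q" by simp_all
    have Gne: "G (y v' \<circ> shuffle (t v)) \<noteq> 0" using ne by (simp add: f_def frho_def)
    have rigid: "letter v' (shuffle (t v) x) = rowf lam (x mod n)" if "x < q * n" for x
    proof (rule letters_rigid[of "t v", OF t _ _ that])
      show "v' c \<in> row_words lam" if "length lam \<le> c" "c < q" for c using v' that by (auto simp: I_def)
      fix b p p' assume a: "b < q" "p < n" "p' < n" "p \<noteq> p'" "colf lam p = colf lam p'"
      have l: "b * n + r < q * n" if "r < n" for r
      proof -
        have "b * n + r < (b + 1) * n" using that by simp
        also have "\<dots> \<le> q * n" using a(1) by (intro mult_le_mono1) simp
        finally show ?thesis .
      qed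
      have yl: "(y v' \<circ> shuffle (t v)) (b * n + r) = \<xi> (letter v' (shuffle (t v) (b * n + r)))" if "r < n" for r
        using shuffle_less[of "t v", OF t l[OF that]] by (simp add: y_def)
      show "letter v' (shuffle (t v) (b * n + p)) \<noteq> letter v' (shuffle (t v) (b * n + p'))"
      proof
        assume e: "letter v' (shuffle (t v) (b * n + p)) = letter v' (shuffle (t v) (b * n + p'))"
        \<comment> \<open>Equal letters in one column are equal arguments of a function alternating
          in that column, so copy \<open>b\<close> contributes 0 and \<open>G\<close>
          vanishes.\<close>
        have "h (\<lambda>r. (y v' \<circ> shuffle (t v)) (b * n + r)) = 0" unfolding h_def
          by (rule colop_alt[OF F(1) sum_lam a(2,3,4,5)]) (simp only: yl[OF a(2)] yl[OF a(3)] e)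
        then show False using zero a(1) Gne by blast
      qed
    qed
    show "v c = v' c"
    proof
      fix p
      show "v c p = v' c p"
      proof (cases "p < n")
        case True
        have sp: "s v c p < n" using permutes_in_image[OF s, of v c p] True by simp
        have "rowf lam (s v c p) = letter v' (shuffle (t v) (pos c (s v c p)))"
          using rigid[OF pos_props(4)[OF c sp]] pos_props(2)[OF c sp] by simp
        also have "\<dots> = letter v' (pos c p)"
          by (simp add: shuffle_pos[OF c sp] t_def permutes_inverses[OF s])
        also have "\<dots> = v' c p" by (rule letter_pos[OF c True])
        finally show ?thesis using fun_cong[OF vs[OF v c], of p] True by simp
      next
        case False
        then show ?thesis using fun_cong[OF vs[OF v c], of p] fun_cong[OF vs[OF v' c], of p] by simp
      qed
    qed
  qed
  ultimately have ind: "inj_on f I" "\<not> FS.dependent (f ` I)"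
    using independent_separated[OF finI, of f y] by blast+
  obtain B where B: "finite B" "PN N \<subseteq> FS.span B" "card B = H_codim scaleH scaleA mulA act N"
    using H_codim_basis by blast
  have "f ` I \<subseteq> FS.span B" using fin B(2) by blast
  then have "card (f ` I) \<le> card B" using FS.independent_span_bound[OF B(1) ind(2)] by blast
  then show ?thesis using card_image[OF ind(1)] cardI B(3) by simp
qed

text \<open>A single variable serves as the one copy, with \<open>n = 1\<close> and
  \<open>q = 1\<close>, and is filled up to \<open>N\<close> arguments.\<close>

lemma PN_nonzero:
  assumes N: "1 + 2 * card Bs \<le> N"
  shows "\<exists>G\<in>PN N. G \<noteq> 0"
proof -
  obtain a :: 'a where a: "a \<noteq> 0" using mulA_nonzero by blast
  have g: "(\<lambda>\<psi>. \<psi> 0) \<in> PN 1" using PS_var[of 0] by (simp add: lessThan_Suc)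
  from glue_copies_fill[OF g, of "\<lambda>_. a" 1 N] a N obtain G \<psi> where "G \<in> PN N" "G \<psi> \<noteq> 0" by auto
  then show ?thesis by (intro bexI[of _ G]) auto
qed

lemma codim_pos:
  assumes N: "1 + 2 * card Bs \<le> N"
  shows "H_codim scaleH scaleA mulA act N > 0"
proof (rule ccontr)
  assume "\<not> ?thesis"
  moreover obtain B where B: "finite B" "PN N \<subseteq> FS.span B" "card B = H_codim scaleH scaleA mulA act N"
    using H_codim_basis by blast
  ultimately have "B = {}" by simp
  then show False using B(2) PN_nonzero[OF N] by auto
qed

lemma supp_nonempty: "1 + 2 * card Bs \<le> N \<Longrightarrow> supp N \<noteq> {}"
  using codim_upper[of N] codim_pos[of N] by auto

end

section \<open>Asymptotics\<close>

text \<open>One term of the exponential series; at \<open>x = n\<close> it is the lower Stirling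
  bound.\<close>

lemma power_le_fact_exp:
  fixes x :: real assumes "x \<ge> 0"
  shows "x ^ n \<le> fact n * exp x"
proof -
  have "(\<Sum>k\<in>{n}. x ^ k /\<^sub>R fact k) \<le> suminf (\<lambda>k. x ^ k /\<^sub>R fact k)"
    by (rule sum_le_suminf[OF summable_exp_generic]) (use assms in auto)
  then have "x ^ n / fact n \<le> exp x" by (simp add: exp_def field_simps)
  then show ?thesis by (simp add: field_simps)
qed

text \<open>The upper Stirling bound. The induction step amounts to e \<le> (1 + 1/x)^(x+1) for x =
  k + 1, which follows from 1 - y \<le> exp (-y) at y = 1/(x+1).\<close>

lemma fact_le_power_div_exp: "(fact (Suc k) :: real) \<le> exp 1 * real (Suc k) * (real (Suc k) / exp 1) ^ Suc k"
proof (induction k)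
  case (Suc k)
  let ?x = "real (Suc k)"
  have "exp 1 \<le> ((?x + 1) / ?x) ^ (k + 2)"
  proof -
    have "real (k + 2) * (1 / (?x + 1)) = 1" by (simp add: field_simps)
    then have "exp 1 = exp (1 / (?x + 1)) ^ (k + 2)" using exp_of_nat_mult[of "k + 2" "1 / (?x + 1)"] by (simp only:)
    also have "exp (1 / (?x + 1)) \<le> (?x + 1) / ?x"
    proof -
      have "1 + (- (1 / (?x + 1))) \<le> exp (- (1 / (?x + 1)))" by (rule exp_ge_add_one_self)
      moreover have "1 + (- (1 / (?x + 1))) = ?x / (?x + 1)" by (simp add: field_simps)
      ultimately have "?x / (?x + 1) \<le> inverse (exp (1 / (?x + 1)))" by (simp add: exp_minus)
      then show ?thesis by (simp add: field_simps)
    qed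
    then have "exp (1 / (?x + 1)) ^ (k + 2) \<le> ((?x + 1) / ?x) ^ (k + 2)" by (rule power_mono) simp
    finally show ?thesis .
  qed
  moreover have "?x ^ (k + 2) > 0" by simp
  ultimately have e: "exp 1 * ?x ^ (k + 2) \<le> (?x + 1) ^ (k + 2)" by (simp only: power_divide pos_le_divide_eq)
  have "fact (Suc (Suc k)) = (?x + 1) * (fact (Suc k) :: real)" by simp
  also have "\<dots> \<le> (?x + 1) * (exp 1 * ?x * (?x / exp 1) ^ Suc k)"
    by (rule mult_left_mono[OF Suc.IH]) simp
  also have "\<dots> = (?x + 1) * (exp 1 * ?x ^ (k + 2)) / exp 1 ^ Suc k" by (simp add: power_divide)
  also have "\<dots> \<le> (?x + 1) * (?x + 1) ^ (k + 2) / exp 1 ^ Suc k"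
    by (intro divide_right_mono mult_left_mono e) auto
  also have "\<dots> = exp 1 * real (Suc (Suc k)) * (real (Suc (Suc k)) / exp 1) ^ Suc (Suc k)"
    by (simp add: power_divide)
  finally show ?case .
qed simp

section \<open>Entropy estimates for the number of words\<close>

definition profile :: "nat \<Rightarrow> nat list \<Rightarrow> nat \<Rightarrow> real" where
  "profile n lam i = real (part lam i) / real n"

text \<open>The inverse of the n-th power of \<Phi> at the profile, written with integer exponents;
  see \<open>Phi_power\<close>.\<close>

definition entropy_prod :: "nat \<Rightarrow> nat list \<Rightarrow> real" where
  "entropy_prod n lam = (\<Prod>i<length lam. profile n lam i ^ part lam i)"

lemma sum_part: "(\<Sum>i<length lam. part lam i) = sum_list lam"
  by (simp add: part_def sum_list_sum_nth atLeast0LessThan)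

lemma part_pos: "partition_of lam n \<Longrightarrow> i < length lam \<Longrightarrow> part lam i > 0"
  unfolding partition_of_def part_def by (metis gr0I nth_mem)

lemma profile_bounds:
  assumes "partition_of lam n"
  shows "0 \<le> profile n lam i" "profile n lam i \<le> 1"
proof -
  have "part lam i \<le> n" using part_le_sum_list[of lam i] assms by (simp add: partition_of_def)
  then show "0 \<le> profile n lam i" "profile n lam i \<le> 1" by (auto simp: profile_def divide_le_eq)
qed

lemma Phi_power:
  assumes lam: "partition_of lam n" and n: "n > 0" and len: "length lam \<le> s"
  shows "Phi s (profile n lam) ^ n = 1 / entropy_prod n lam"
proof -
  let ?f = "\<lambda>i. if profile n lam i = 0 then 1 else profile n lam i powr profile n lam i"
  have "(\<Prod>i<s. ?f i) = (\<Prod>i<length lam. ?f i)"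
    using len by (intro prod.mono_neutral_right) (auto simp: profile_def part_def)
  moreover have "?f i ^ n = profile n lam i ^ part lam i" if "i < length lam" for i
  proof -
    have p: "profile n lam i > 0" using part_pos[OF lam that] n by (simp add: profile_def)
    have "?f i ^ n = profile n lam i powr (profile n lam i * real n)"
      using p by (simp add: powr_powr[symmetric] powr_realpow)
    also have "profile n lam i * real n = real (part lam i)" using n by (simp add: profile_def)
    finally show ?thesis using p by (simp add: powr_realpow)
  qed
  ultimately show ?thesis
    by (simp add: Phi_def power_divide entropy_prod_def prod_power_distrib)
qed

lemma Phi_ge_1:
  assumes "partition_of lam n"
  shows "1 \<le> Phi s (profile n lam)"
proof -
  let ?f = "\<lambda>i. if profile n lam i = 0 then 1 else profile n lam i powr profile n lam i"
  have "0 < (\<Prod>i<s. ?f i)" by (intro prod_pos) simp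
  moreover have "?f i \<le> 1" for i
    using powr_mono2[of "profile n lam i" "profile n lam i" 1] profile_bounds[OF assms, of i] by auto
  then have "(\<Prod>i<s. ?f i) \<le> 1" by (intro prod_le_1) auto
  ultimately show ?thesis by (simp add: Phi_def)
qed

text \<open>From ln (1/x) \<le> 1/x - 1 follows x ln x \<ge> x - 1 \<ge> -1, so each of the
  \<open>s\<close> factors in the denominator is at least 1/e. What matters is that the bound is
  independent of \<open>n\<close>.\<close>

lemma Phi_le_exp:
  assumes "partition_of lam n"
  shows "Phi s (profile n lam) \<le> exp (real s)"
proof -
  let ?f = "\<lambda>i. if profile n lam i = 0 then 1 else profile n lam i powr profile n lam i"
  have f: "exp (- 1) \<le> ?f i" for i
  proof (cases "profile n lam i = 0")
    case False
    define x where "x = profile n lam i"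
    have x: "x > 0" using False profile_bounds(1)[OF assms, of i] by (simp add: x_def)
    have "ln (inverse x) \<le> inverse x - 1" using x by (intro ln_le_minus_one) simp
    then have "x * (1 - inverse x) \<le> x * ln x" using x by (intro mult_left_mono) (simp_all add: ln_inverse)
    then have "- 1 \<le> x * ln x" using x by (simp add: right_diff_distrib)
    then have "exp (- 1) \<le> x powr x" using x by (simp add: powr_def)
    then show ?thesis using False by (simp add: x_def)
  qed simp
  have "exp (- real s) = (\<Prod>i<s. exp (- 1 :: real))" by (simp add: exp_of_nat_mult[symmetric])
  also have "\<dots> \<le> (\<Prod>i<s. ?f i)" using f by (intro prod_mono) auto
  finally have "Phi s (profile n lam) \<le> 1 / exp (- real s)" unfolding Phi_def by (intro divide_left_mono mult_pos_pos prod_pos) auto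
  then show ?thesis by (simp add: exp_minus field_simps)
qed

text \<open>The bound \<open>card_row_words_le\<close> is used at the profile itself, the
  probability vector that maximizes the monomial.\<close>

lemma row_words_le_Phi:
  assumes lam: "partition_of lam n" and n: "n > 0" and len: "length lam \<le> s"
  shows "real (card (row_words lam)) \<le> Phi s (profile n lam) ^ n"
proof -
  have s: "sum_list lam = n" using lam by (simp add: partition_of_def)
  have "(\<Sum>i<length lam. profile n lam i) = real (\<Sum>i<length lam. part lam i) / real n"
    by (simp add: profile_def sum_divide_distrib)
  then have "(\<Sum>i<length lam. profile n lam i) = 1" using n by (simp only: sum_part s) simp
  then have "real (card (row_words lam)) * entropy_prod n lam \<le> 1" unfolding entropy_prod_def
    by (intro card_row_words_le profile_bounds(1)[OF lam])
  moreover have "entropy_prod n lam > 0" unfolding entropy_prod_def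
    using n part_pos[OF lam] by (intro prod_pos) (auto simp: profile_def)
  ultimately show ?thesis unfolding Phi_power[OF assms] by (simp add: field_simps)
qed

text \<open>Both Stirling bounds are inserted into \<open>card_row_words_ge\<close>: the powers of
  n/e cancel, and each of the at most \<open>s\<close> rows costs a factor
  \<open>exp 1 * real n\<close>.\<close>

lemma row_words_ge_Phi:
  assumes lam: "partition_of lam n" and n: "n > 0" and len: "length lam \<le> s"
  shows "Phi s (profile n lam) ^ n \<le> (exp 1 * real n) ^ s * real (card (row_words lam))"
proof -
  have s: "sum_list lam = n" using lam by (simp add: partition_of_def)
  let ?l = "\<lambda>i. real (part lam i)" and ?W = "real (card (row_words lam))"
  have P: "entropy_prod n lam > 0" unfolding entropy_prod_def
    using n part_pos[OF lam] by (intro prod_pos) (auto simp: profile_def)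
  have pw: "(\<Prod>i<length lam. x ^ part lam i) = x ^ n" for x :: real
    by (simp add: power_sum[symmetric] sum_part s)
  have f: "fact (part lam i) \<le> exp 1 * real n * (?l i / exp 1) ^ part lam i" if i: "i < length lam" for i
  proof -
    obtain k where k: "part lam i = Suc k" using part_pos[OF lam i] gr0_implies_Suc by blast
    have "?l i \<le> real n" using part_le_sum_list[of lam i] by (simp add: s)
    then have "exp 1 * ?l i * (?l i / exp 1) ^ part lam i \<le> exp 1 * real n * (?l i / exp 1) ^ part lam i"
      by (intro mult_right_mono mult_left_mono) auto
    then show ?thesis using fact_le_power_div_exp[of k] unfolding k by linarith
  qed
  have "real n ^ n / exp 1 ^ n \<le> fact n"
    using power_le_fact_exp[of "real n" n] by (simp add: field_simps exp_of_nat_mult[symmetric])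
  also have "\<dots> \<le> ?W * (\<Prod>i<length lam. fact (part lam i))"
    using card_row_words_ge[of lam] unfolding s of_nat_le_iff[symmetric, where 'a = real]
    by (simp only: of_nat_mult of_nat_prod of_nat_fact)
  also have "\<dots> \<le> ?W * (\<Prod>i<length lam. exp 1 * real n * (?l i / exp 1) ^ part lam i)"
    using f by (intro mult_left_mono prod_mono) auto
  also have "(\<Prod>i<length lam. exp 1 * real n * (?l i / exp 1) ^ part lam i) =
      (exp 1 * real n) ^ length lam * (\<Prod>i<length lam. profile n lam i ^ part lam i * (real n / exp 1) ^ part lam i)"
  proof -
    have "(?l i / exp 1) ^ part lam i = profile n lam i ^ part lam i * (real n / exp 1) ^ part lam i" for i
      using n by (simp add: profile_def power_mult_distrib[symmetric])
    then show ?thesis by (simp only: prod.distrib[of "\<lambda>_. exp 1 * real n"] prod_constant card_lessThan)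
  qed
  also have "(\<Prod>i<length lam. profile n lam i ^ part lam i * (real n / exp 1) ^ part lam i) =
      entropy_prod n lam * (real n / exp 1) ^ n"
    unfolding prod.distrib pw entropy_prod_def ..
  finally have "(real n / exp 1) ^ n * 1 \<le> (real n / exp 1) ^ n * (?W * (exp 1 * real n) ^ length lam * entropy_prod n lam)"
    by (simp add: power_divide mult_ac)
  then have "1 \<le> ?W * (exp 1 * real n) ^ length lam * entropy_prod n lam"
    using n by (simp only: mult_le_cancel_left_pos zero_less_power zero_less_divide_iff exp_gt_zero of_nat_0_less_iff simp_thms)
  then have "1 / entropy_prod n lam \<le> ?W * (exp 1 * real n) ^ length lam" using P by (simp add: field_simps)
  also have "\<dots> \<le> ?W * (exp 1 * real n) ^ s"
  proof (intro mult_left_mono power_increasing len)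
    have "1 * 1 \<le> exp 1 * real n" by (intro mult_mono) (use n in auto)
    then show "1 \<le> exp 1 * real n" by simp
  qed simp
  finally show ?thesis unfolding Phi_power[OF assms] by (simp add: mult.commute)
qed

text \<open>The hypotheses force \<open>u\<close> and \<open>m\<close> to converge to the supremum of the sequence \<open>m - \<epsilon>\<close>.\<close>

lemma squeeze_to_supremum:
  fixes u m \<delta> \<epsilon> :: "nat \<Rightarrow> real"
  assumes upper: "\<forall>\<^sub>F n in sequentially. u n \<le> m n + \<delta> n"
    and lower: "\<forall>\<^sub>F n in sequentially. \<forall>e>0. \<forall>\<^sub>F N in sequentially. m n - \<epsilon> n - e \<le> u N"
    and bounded: "\<forall>\<^sub>F n in sequentially. m n - \<epsilon> n \<le> C"
    and lim: "\<delta> \<longlonglongrightarrow> 0" "\<epsilon> \<longlonglongrightarrow> 0"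
  shows "\<exists>L. u \<longlonglongrightarrow> L \<and> m \<longlonglongrightarrow> L"
proof -
  from eventually_conj[OF upper eventually_conj[OF lower bounded]] obtain n1 where
    n1: "\<And>n. n \<ge> n1 \<Longrightarrow> u n \<le> m n + \<delta> n" "\<And>n e. n \<ge> n1 \<Longrightarrow> e > 0 \<Longrightarrow> \<forall>\<^sub>F N in sequentially. m n - \<epsilon> n - e \<le> u N"
    "\<And>n. n \<ge> n1 \<Longrightarrow> m n - \<epsilon> n \<le> C"
    unfolding eventually_sequentially by blast
  \<comment> \<open>A supremum over a tail on which all hypotheses hold. It bounds
    \<open>m - \<epsilon>\<close> and thereby \<open>u\<close> from above up to vanishing errors,
    while a single term close to \<open>L\<close> bounds \<open>u\<close> from below at all large
    \<open>N\<close>.\<close>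
  define L where "L = (SUP n\<in>{n1..}. m n - \<epsilon> n)"
  have bdd: "bdd_above ((\<lambda>n. m n - \<epsilon> n) ` {n1..})" using n1(3) by (intro bdd_aboveI[of _ C]) auto
  have le: "m n - \<epsilon> n \<le> L" if "n \<ge> n1" for n
    unfolding L_def by (rule cSUP_upper[OF _ bdd]) (use that in simp)
  have ge: "\<forall>\<^sub>F N in sequentially. L - e \<le> u N" if "e > 0" for e
  proof -
    have "\<exists>n\<in>{n1..}. L - e / 2 < m n - \<epsilon> n"
      unfolding L_def using that by (intro less_cSUP_iff[THEN iffD1, OF _ bdd]) auto
    then obtain n where n: "n \<ge> n1" "L - e / 2 < m n - \<epsilon> n" by auto
    show ?thesis using n1(2)[OF n(1), of "e / 2"] that n(2) by (auto elim!: eventually_mono)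
  qed
  have ev: "\<forall>\<^sub>F n in sequentially. n \<ge> n1" by (rule eventually_ge_at_top)
  have small: "\<forall>\<^sub>F n in sequentially. \<bar>\<delta> n\<bar> < e \<and> \<bar>\<epsilon> n\<bar> < e" if "e > 0" for e
    using eventually_conj[OF lim(1)[THEN tendstoD, OF that] lim(2)[THEN tendstoD, OF that]] by simp
  have "u \<longlonglongrightarrow> L"
  proof (rule tendstoI)
    fix e :: real assume e: "e > 0"
    have "\<forall>\<^sub>F n in sequentially. n \<ge> n1 \<and> (\<bar>\<delta> n\<bar> < e / 3 \<and> \<bar>\<epsilon> n\<bar> < e / 3) \<and> L - e / 2 \<le> u n"
      using e by (intro eventually_conj[OF ev] eventually_conj[OF small ge]) simp_all
    then show "\<forall>\<^sub>F n in sequentially. dist (u n) L < e"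
    proof eventually_elim
      case (elim n)
      then have "u n < L + e" "L - e < u n" using le[of n] n1(1)[of n] e by (auto simp: abs_if split: if_splits)
      then show ?case by (simp add: dist_real_def abs_less_iff)
    qed
  qed
  moreover have "m \<longlonglongrightarrow> L"
  proof (rule tendsto_sandwich[of "\<lambda>n. u n - \<delta> n" _ _ "\<lambda>n. L + \<epsilon> n"])
    show "\<forall>\<^sub>F n in sequentially. u n - \<delta> n \<le> m n" using ev by eventually_elim (use n1(1) in fastforce)
    show "\<forall>\<^sub>F n in sequentially. m n \<le> L + \<epsilon> n" using ev by eventually_elim (use le in fastforce)
    show "(\<lambda>n. u n - \<delta> n) \<longlonglongrightarrow> L" using tendsto_diff[OF \<open>u \<longlonglongrightarrow> L\<close> lim(1)] by simp
    show "(\<lambda>n. L + \<epsilon> n) \<longlonglongrightarrow> L" using tendsto_add[OF tendsto_const lim(2)] by simp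
  qed
  ultimately show ?thesis by blast
qed

lemma div_over_tendsto:
  assumes "p > 0"
  shows "(\<lambda>N. real (N div p) / real N) \<longlonglongrightarrow> 1 / real p"
proof (rule tendsto_sandwich[of "\<lambda>N. 1 / real p - 1 / real N" _ _ "\<lambda>N. 1 / real p"])
  have *: "N < p * (N div p) + p \<and> p * (N div p) \<le> N" for N
    using mult_div_mod_eq[of p N] mod_less_divisor[of p N] assms by linarith
  have r: "real N < real p * real (N div p) + real p \<and> real p * real (N div p) \<le> real N" for N
    using *[of N] unfolding of_nat_mult[symmetric] of_nat_add[symmetric] of_nat_less_iff of_nat_le_iff .
  show "\<forall>\<^sub>F N in sequentially. 1 / real p - 1 / real N \<le> real (N div p) / real N"
    using eventually_gt_at_top[of 0]
  proof eventually_elim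
    case (elim N)
    have "(real N - real p) / (real p * real N) \<le> real p * real (N div p) / (real p * real N)"
      using r[of N] by (intro divide_right_mono) auto
    then show ?case using elim assms by (simp add: diff_divide_distrib)
  qed
  show "\<forall>\<^sub>F N in sequentially. real (N div p) / real N \<le> 1 / real p"
    using eventually_gt_at_top[of 0]
  proof eventually_elim
    case (elim N)
    then show ?case using r[of N] assms by (simp add: field_simps)
  qed
  show "(\<lambda>N. 1 / real p - 1 / real N) \<longlonglongrightarrow> 1 / real p"
    using tendsto_diff[OF tendsto_const lim_1_over_n] by simp
qed simp

section \<open>Comparison of the codimensions with the maximum of \<Phi>\<close>

context simple_H_algebra
begin

abbreviation codim where "codim \<equiv> H_codim scaleH scaleA mulA act"

text \<open>For small \<open>n\<close> the set of shapes may be empty and the value unspecified;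
  from \<open>1 + 2 * card Bs\<close> on, \<open>supp_nonempty\<close> applies.\<close>

definition max_Phi :: "nat \<Rightarrow> real" where
  "max_Phi n = Max ((\<lambda>lam. Phi (card Bs) (profile n lam)) ` supp n)"

lemma supp_partition: "lam \<in> supp n \<Longrightarrow> partition_of lam n" by (simp add: supp_def)

lemma max_Phi_attained:
  assumes "1 + 2 * card Bs \<le> n"
  shows "\<exists>lam\<in>supp n. max_Phi n = Phi (card Bs) (profile n lam)"
proof -
  have "max_Phi n \<in> (\<lambda>lam. Phi (card Bs) (profile n lam)) ` supp n"
    unfolding max_Phi_def using supp_nonempty[OF assms] finite_supp by (intro Max_in) auto
  then show ?thesis by blast
qed

lemma max_Phi_ge: "lam \<in> supp n \<Longrightarrow> Phi (card Bs) (profile n lam) \<le> max_Phi n"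
  unfolding max_Phi_def using finite_supp by (intro Max_ge) auto

text \<open>A shape that occurs has at most \<open>card Bs\<close> rows, each of length at most
  \<open>n\<close>.\<close>

lemma card_supp_le:
  assumes "n > 0"
  shows "card (supp n) \<le> (n + 1) ^ card Bs"
proof -
  let ?f = "\<lambda>lam. \<lambda>i\<in>{..<card Bs}. part lam i"
  have "inj_on ?f (supp n)"
  proof (rule inj_onI)
    fix a b assume ab: "a \<in> supp n" "b \<in> supp n" and e: "?f a = ?f b"
    have "part a i = part b i" for i
    proof (cases "i < card Bs")
      case True
      then show ?thesis using fun_cong[OF e, of i] by simp
    next
      case False
      then show ?thesis using supp_length[OF ab(1)] supp_length[OF ab(2)] by (simp add: part_def)
    qed
    then show "a = b" using partition_of_eqI supp_partition[OF ab(1)] supp_partition[OF ab(2)] by blast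
  qed
  moreover have "?f ` supp n \<subseteq> {..<card Bs} \<rightarrow>\<^sub>E {..<n + 1}"
  proof
    fix g assume "g \<in> ?f ` supp n"
    then obtain lam where lam: "lam \<in> supp n" "g = ?f lam" by blast
    have "part lam i < n + 1" for i
      using part_le_sum_list[of lam i] supp_partition[OF lam(1)] by (simp add: partition_of_def)
    then show "g \<in> {..<card Bs} \<rightarrow>\<^sub>E {..<n + 1}" unfolding lam(2) by auto
  qed
  ultimately have "card (supp n) \<le> card ({..<card Bs} \<rightarrow>\<^sub>E {..<n + 1})"
    by (rule card_inj_on_le) (intro finite_PiE, auto)
  then show ?thesis by (simp add: card_PiE)
qed

text \<open>In the exponent of \<open>n + 1\<close>, the summand \<open>card Bs\<close> comes from
  the number of shapes and \<open>card Bs * card Bs\<close> from the number of contents.\<close>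

lemma codim_upper_Phi:
  assumes n: "1 + 2 * card Bs \<le> n"
  shows "real (codim n) \<le> real ((n + 1) ^ (card Bs + card Bs * card Bs) * card Bs) * max_Phi n ^ n"
proof -
  have n0: "n > 0" using n by simp
  let ?D = "(n + 1) ^ (card Bs * card Bs) * card Bs"
  have W: "real (card (row_words lam)) \<le> max_Phi n ^ n" if lam: "lam \<in> supp n" for lam
  proof -
    have "real (card (row_words lam)) \<le> Phi (card Bs) (profile n lam) ^ n"
      by (rule row_words_le_Phi[OF supp_partition[OF lam] n0 supp_length[OF lam]])
    also have "\<dots> \<le> max_Phi n ^ n"
      using Phi_ge_1[OF supp_partition[OF lam], of "card Bs"] by (intro power_mono max_Phi_ge[OF lam]) simp
    finally show ?thesis .
  qed
  have "real (codim n) \<le> (\<Sum>lam\<in>supp n. real (card (row_words lam)) * real ?D)"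
    using codim_upper[of n] unfolding of_nat_le_iff[symmetric, where 'a = real] of_nat_sum of_nat_mult .
  also have "\<dots> \<le> (\<Sum>lam\<in>supp n. max_Phi n ^ n * real ?D)"
    by (intro sum_mono mult_right_mono W) auto
  also have "\<dots> = real (card (supp n)) * (max_Phi n ^ n * real ?D)" by simp
  also have "\<dots> \<le> real ((n + 1) ^ card Bs) * (max_Phi n ^ n * real ?D)"
  proof (rule mult_right_mono)
    show "real (card (supp n)) \<le> real ((n + 1) ^ card Bs)"
      using card_supp_le[OF n0] unfolding of_nat_le_iff .
    show "0 \<le> max_Phi n ^ n * real ?D"
      using W supp_nonempty[OF n] by (meson all_not_in_conv mult_nonneg_nonneg of_nat_0_le_iff order_trans)
  qed
  finally show ?thesis by (simp add: power_add mult_ac)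
qed

lemma ln_max_Phi:
  assumes "1 + 2 * card Bs \<le> n"
  shows "1 \<le> max_Phi n" "ln (max_Phi n) \<le> real (card Bs)"
proof -
  obtain lam where lam: "lam \<in> supp n" "max_Phi n = Phi (card Bs) (profile n lam)"
    using max_Phi_attained[OF assms] by blast
  show M: "1 \<le> max_Phi n" unfolding lam(2) by (rule Phi_ge_1[OF supp_partition[OF lam(1)]])
  have "max_Phi n \<le> exp (real (card Bs))" unfolding lam(2) by (rule Phi_le_exp[OF supp_partition[OF lam(1)]])
  then have "ln (max_Phi n) \<le> ln (exp (real (card Bs)))" using M by (subst ln_le_cancel_iff) auto
  then show "ln (max_Phi n) \<le> real (card Bs)" by simp
qed

lemma ln_codim_upper:
  assumes n: "1 + 2 * card Bs \<le> n"
  shows "ln (real (codim n)) / real n \<le> ln (max_Phi n) +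
    (real (card Bs + card Bs * card Bs) * (ln 2 + ln (real n)) + ln (real (card Bs))) / real n"
proof -
  let ?k = "card Bs + card Bs * card Bs"
  have c: "real (codim n) > 0" using codim_pos[OF n] by simp
  have M: "max_Phi n > 0" using ln_max_Phi(1)[OF n] by simp
  have "real (codim n) \<le> (real n + 1) ^ ?k * real (card Bs) * max_Phi n ^ n"
    using codim_upper_Phi[OF n] by (simp only: of_nat_mult of_nat_power of_nat_add of_nat_1)
  also have "\<dots> \<le> (2 * real n) ^ ?k * real (card Bs) * max_Phi n ^ n"
    using M n by (intro mult_right_mono power_mono) auto
  finally have up: "real (codim n) \<le> (2 * real n) ^ ?k * real (card Bs) * max_Phi n ^ n" .
  then have b: "card Bs > 0" using c by (intro gr0I) simp
  have "ln (real (codim n)) \<le> ln ((2 * real n) ^ ?k * real (card Bs) * max_Phi n ^ n)"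
    using up c by (subst ln_le_cancel_iff) (auto intro: order_less_le_trans)
  also have "\<dots> = real ?k * (ln 2 + ln (real n)) + ln (real (card Bs)) + real n * ln (max_Phi n)"
    using b M n by (simp add: ln_mult ln_realpow distrib_left)
  finally have "ln (real (codim n)) / real n \<le>
      (real ?k * (ln 2 + ln (real n)) + ln (real (card Bs)) + real n * ln (max_Phi n)) / real n"
    by (rule divide_right_mono) simp
  then show ?thesis using n by (simp add: add_divide_distrib)
qed

text \<open>Take \<open>N div p\<close> copies, where \<open>p = n + 2 * card Bs\<close> pays for a
  copy and for gluing it. The term with \<open>ln (real n)\<close> is the Stirling loss;
  \<open>2 * real (card Bs) * real (card Bs)\<close> is the price of replacing \<open>n\<close> by
  \<open>p\<close>, as \<open>ln (max_Phi n)\<close> is at most \<open>card Bs\<close>. The rounding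
  and the lost diagonals disappear in \<open>e\<close> as \<open>N\<close> grows.\<close>

lemma ln_codim_lower:
  assumes n: "1 + 2 * card Bs \<le> n" and e: "e > 0"
  shows "\<forall>\<^sub>F N in sequentially. ln (max_Phi n) -
    (2 * real (card Bs) * real (card Bs) + real (card Bs) * (1 + ln (real n))) / real n - e
    \<le> ln (real (codim N)) / real N"
proof -
  let ?b = "card Bs" and ?m = "ln (max_Phi n)"
  obtain lam where lam: "lam \<in> supp n" and max: "max_Phi n = Phi ?b (profile n lam)"
    using max_Phi_attained[OF n] by blast
  define p where "p = n + 2 * ?b"
  have p: "p > 0" and n0: "n > 0" using n by (simp_all add: p_def)
  define W where "W = real (card (row_words lam))"
  have W: "W \<ge> 1" using finite_row_words row_words_nonempty unfolding W_def by (simp add: Suc_le_eq card_gt_0_iff)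
  have "real n * ?m = ln (max_Phi n ^ n)" using ln_max_Phi(1)[OF n] by (simp add: ln_realpow)
  also have "\<dots> \<le> ln ((exp 1 * real n) ^ ?b * W)"
    using row_words_ge_Phi[OF supp_partition[OF lam] n0 supp_length[OF lam]] ln_max_Phi(1)[OF n] W n0
    unfolding max W_def by (subst ln_le_cancel_iff) auto
  also have "\<dots> = real ?b * (1 + ln (real n)) + ln W" using n0 W by (simp add: ln_mult ln_realpow)
  finally have w1: "real n * ?m - real ?b * (1 + ln (real n)) \<le> ln W" by simp
  have w2: "?m - (2 * real ?b * real ?b + real ?b * (1 + ln (real n))) / real n \<le> ln W / real p"
  proof -
    have "real ?b * ?m \<le> real ?b * real ?b" by (rule mult_left_mono[OF ln_max_Phi(2)[OF n]]) simp
    then have "real p * ?m - (2 * real ?b * real ?b + real ?b * (1 + ln (real n))) \<le> ln W"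
      using w1 by (simp add: p_def algebra_simps)
    then have "(real p * ?m - (2 * real ?b * real ?b + real ?b * (1 + ln (real n)))) / real p \<le> ln W / real p"
      by (rule divide_right_mono) simp
    moreover have "(2 * real ?b * real ?b + real ?b * (1 + ln (real n))) / real p \<le>
        (2 * real ?b * real ?b + real ?b * (1 + ln (real n))) / real n"
      using n0 by (intro divide_left_mono mult_pos_pos add_nonneg_nonneg mult_nonneg_nonneg) (auto simp: p_def)
    ultimately show ?thesis using p by (simp add: diff_divide_distrib)
  qed
  have low: "(real (N div p) - real ?b) * ln W \<le> ln (real (codim N))" if N: "N \<ge> p" for N
  proof -
    let ?q = "N div p"
    have q: "1 \<le> ?q" using N p by (simp add: Suc_le_eq div_greater_zero_iff)
    have "?q * n + 2 * ?b * ?q = ?q * p" by (simp add: p_def algebra_simps)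
    also have "\<dots> \<le> N" by simp
    finally have "card (row_words lam) ^ (?q - length lam) \<le> codim N" by (rule codim_lower[OF lam n0 q])
    then have c: "W ^ (?q - length lam) \<le> real (codim N)"
      unfolding W_def of_nat_power[symmetric] of_nat_le_iff .
    have "(real ?q - real ?b) * ln W \<le> real (?q - length lam) * ln W"
      using supp_length[OF lam] W by (intro mult_right_mono) auto
    also have "\<dots> = ln (W ^ (?q - length lam))" using W by (simp add: ln_realpow)
    also have "\<dots> \<le> ln (real (codim N))" using c one_le_power[OF W, of "?q - length lam"]
      by (subst ln_le_cancel_iff) linarith+
    finally show ?thesis .
  qed
  have "(\<lambda>N. (real (N div p) / real N - real ?b / real N) * ln W) \<longlonglongrightarrow> (1 / real p - 0) * ln W"
    by (intro tendsto_mult tendsto_diff div_over_tendsto[OF p] tendsto_const lim_const_over_n)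
  then have "\<forall>\<^sub>F N in sequentially. ln W / real p - e < (real (N div p) / real N - real ?b / real N) * ln W"
    by (rule order_tendstoD(1)) (use e in simp)
  then show ?thesis using eventually_ge_at_top[of p]
  proof eventually_elim
    case (elim N)
    have "(real (N div p) / real N - real ?b / real N) * ln W \<le> ln (real (codim N)) / real N"
      using divide_right_mono[OF low[OF elim(2)], of "real N"]
      by (simp add: diff_divide_distrib left_diff_distrib)
    then show ?case using elim(1) w2 by linarith
  qed
qed

text \<open>\<open>squeeze_to_supremum\<close> is applied to logarithms, where polynomial factors
  become errors of order ln n / n; exponentials restore the n-th root.\<close>

lemma codim_growth:
  "\<exists>L. (\<lambda>n. root n (real (codim n))) \<longlonglongrightarrow> L \<and> max_Phi \<longlonglongrightarrow> L"
proof -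
  let ?b = "real (card Bs)" and ?k = "real (card Bs + card Bs * card Bs)"
  let ?u = "\<lambda>n. ln (real (codim n)) / real n" and ?m = "\<lambda>n. ln (max_Phi n)"
  let ?d = "\<lambda>n. (?k * (ln 2 + ln (real n)) + ln ?b) / real n"
  let ?e = "\<lambda>n. (2 * ?b * ?b + ?b * (1 + ln (real n))) / real n"
  have ev: "\<forall>\<^sub>F n in sequentially. 1 + 2 * card Bs \<le> n" by (rule eventually_ge_at_top)
  have "\<exists>L. ?u \<longlonglongrightarrow> L \<and> ?m \<longlonglongrightarrow> L"
  proof (rule squeeze_to_supremum[of ?u ?m ?d ?e ?b])
    show "\<forall>\<^sub>F n in sequentially. ?u n \<le> ?m n + ?d n" using ev ln_codim_upper by (rule eventually_mono)
    show "\<forall>\<^sub>F n in sequentially. \<forall>e>0. \<forall>\<^sub>F N in sequentially. ?m n - ?e n - e \<le> ?u N"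
      using ev by (rule eventually_mono) (intro allI impI ln_codim_lower)
    show "\<forall>\<^sub>F n in sequentially. ?m n - ?e n \<le> ?b"
      using ev
    proof (rule eventually_mono)
      fix n assume n: "1 + 2 * card Bs \<le> n"
      then have "0 \<le> ?e n" by (intro divide_nonneg_nonneg add_nonneg_nonneg mult_nonneg_nonneg) auto
      then show "?m n - ?e n \<le> ?b" using ln_max_Phi(2)[OF n] by linarith
    qed
    have lim: "(\<lambda>n. (x + y * ln (real n)) / real n) \<longlonglongrightarrow> 0" for x y :: real
    proof -
      have "(\<lambda>n. x / real n + y * (ln (real n) / real n)) \<longlonglongrightarrow> 0 + y * 0"
        by (intro tendsto_add tendsto_mult tendsto_const lim_const_over_n
          filterlim_compose[OF ln_x_over_x_tendsto_0 filterlim_real_sequentially])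
      then show ?thesis by (simp add: add_divide_distrib)
    qed
    show "?d \<longlonglongrightarrow> 0" using lim[of "?k * ln 2 + ln ?b" ?k] by (simp add: algebra_simps)
    show "?e \<longlonglongrightarrow> 0" using lim[of "2 * ?b * ?b + ?b" ?b] by (simp add: algebra_simps)
  qed
  then obtain L where L: "?u \<longlonglongrightarrow> L" "?m \<longlonglongrightarrow> L" by blast
  have "(\<lambda>n. root n (real (codim n))) \<longlonglongrightarrow> exp L"
  proof (rule Lim_transform_eventually[OF tendsto_exp[OF L(1)]])
    show "\<forall>\<^sub>F n in sequentially. exp (?u n) = root n (real (codim n))"
      using ev
    proof (rule eventually_mono)
      fix n assume n: "1 + 2 * card Bs \<le> n"
      then show "exp (?u n) = root n (real (codim n))"
        using codim_pos[OF n] by (simp add: root_powr_inverse powr_def)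
    qed
  qed
  moreover have "max_Phi \<longlonglongrightarrow> exp L"
  proof (rule Lim_transform_eventually[OF tendsto_exp[OF L(2)]])
    show "\<forall>\<^sub>F n in sequentially. exp (?m n) = max_Phi n"
      using ev by (rule eventually_mono) (use ln_max_Phi(1) in fastforce)
  qed
  ultimately show ?thesis by blast
qed

end

theorem theorem6p1:
  fixes scaleH :: "'f::field_char_0 \<Rightarrow> 'h::ring_1 \<Rightarrow> 'h"
    and scaleA :: "'f \<Rightarrow> 'a::ab_group_add \<Rightarrow> 'a"
    and mulA :: "'a \<Rightarrow> 'a \<Rightarrow> 'a"
    and act :: "'h \<Rightarrow> 'a \<Rightarrow> 'a"
    and s :: nat
  assumes "generalized_H_action scaleH scaleA mulA act"
    and "\<exists>B. finite_dimensional_vector_space scaleA B"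
    and "vector_space.dim scaleA UNIV = s"
    and "H_simple scaleA mulA act"
  shows "convergent (\<lambda>n. root n (real (H_codim scaleH scaleA mulA act n))) \<and>
    ereal (PIexp scaleH scaleA mulA act) = d_exponent scaleH scaleA mulA act s"
proof -
  obtain B where B: "finite_dimensional_vector_space scaleA B" using assms(2) by blast
  interpret fd: finite_dimensional_vector_space scaleA B by (rule B)
  interpret simple_H_algebra scaleH scaleA mulA act B
    by (intro simple_H_algebra.intro fd_H_algebra.intro assms(1) fd_H_algebra_axioms.intro
      simple_H_algebra_axioms.intro assms(4) fd.finite_Basis fd.independent_Basis fd.span_Basis)
  have s: "s = card B" using assms(3) fd.dim_UNIV by simp
  obtain L where L: "(\<lambda>n. root n (real (codim n))) \<longlonglongrightarrow> L" "max_Phi \<longlonglongrightarrow> L"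
    using codim_growth by blast
  \<comment> \<open>The maximum in the definition of the exponent is \<open>max_Phi n\<close>, and a
    convergent sequence has its limit as upper limit.\<close>
  have "d_exponent scaleH scaleA mulA act s = limsup (\<lambda>n. ereal (max_Phi n))"
    unfolding d_exponent_def max_Phi_def s supp_def profile_def by (simp add: setcompr_eq_image)
  also have "\<dots> = ereal L" using L(2) by (intro lim_imp_Limsup tendsto_ereal) simp_all
  finally show ?thesis using L(1) by (auto simp: PIexp_def convergent_def limI)
qed

end
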